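(* Let $s\in(-1,1)$, $t_0>0$ and $k\ge 1$. Then $$\frac{\bar\mu_k}{1+\frac{t_0^{2/3}}{3\pi^2}\,\bar\mu_k}\;\le\;\mu_k^t\;\le\;\hat\mu_k^{t_0}\qquad\text{for any } t\in(0,t_0].$$
   Context: Fix $s\in(-1,1)$. For $t>0$, $T^t$ is the triangular domain with vertices $(-1,0)$, $(1,0)$, $(s,t)$. Its upper boundary is the graph of $h:[-1,1]\to\mathbb{R}$, $h(x)=\frac{t}{1+s}(x+1)$ for $x\in[-1,s]$ and $h(x)=-\frac{t}{1-s}(x-1)$ for $x\in[s,1]$ ($h$ depends on $t$; $h'$ denotes its weak derivative). Let $I^t=[-t^{-2/3}(1+s),\,t^{-2/3}(1-s)]$. Eigenvalues are listed in nondecreasing order, counted with multiplicity; $(\cdot,\cdot)_{T^t}$ is the $L^2(T^t)$ inner product. (1) $\mu_k^t$ is the $k$-th eigenvalue of: find $u\in H^1_0(T^t)\setminus\{0\}$ and $\mu>0$ with $t^{4/3}\left[(\nabla u,\nabla v)_{T^t}-\frac{\pi^2}{t^2}(u,v)_{T^t}\right]=\mu\,(u,v)_{T^t}$ for all $v\in H^1_0(T^t)$. Equivalently $\mu_k^t=t^{4/3}(\lambda_k^t-\pi^2/t^2)$ where $\lambda_k^t$ is the $k$-th Dirichlet eigenvalue of the Laplacian on $T^t$. (2) $\hat\mu_k^t$ is the $k$-th eigenvalue of: find $\hat u\in H^1_0(I^t)\setminus\{0\}$ and $\hat\mu>0$ with $\int_{I^t}\hat u'\hat v'\,dx+\int_{I^t}V(t,x)\hat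 u\hat v\,dx=\hat\mu\int_{I^t}\hat u\hat v\,dx$ for all $\hat v\in H^1_0(I^t)$, where $$V(t,x)=t^{4/3}\left(\frac{\pi^2}{h(t^{2/3}x+s)^2}+\frac{(3+4\pi^2)\,h'(t^{2/3}x+s)^2}{12\,h(t^{2/3}x+s)^2}-\frac{\pi^2}{t^2}\right).$$ (3) $\bar\mu_k$ is the $k$-th eigenvalue of: find $\bar u\in H^1(\mathbb{R})\setminus\{0\}$ and $\bar\mu>0$ with $\int_{\mathbb{R}}\bar u'\bar v'\,dx+\int_{\mathbb{R}}V(x)\bar u\bar v\,dx=\bar\mu\int_{\mathbb{R}}\bar u\bar v\,dx$ for all $\bar v\in H^1(\mathbb{R})$ (in the form domain, i.e. functions with $\int V|\cdot|^2<\infty$), where $V(x)=\frac{2\pi^2}{1-s}|x|$ for $x>0$ and $V(x)=\frac{2\pi^2}{1+s}|x|$ for $x\le 0$. *)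

theory Defs
  imports "HOL-Analysis.Analysis"
begin

section \<open>Sobolev spaces\<close>

text \<open>Real-valued functions live on the whole type; elements of the function spaces on an open
  set \<open>U\<close> are representatives, to be identified when equal almost everywhere on \<open>U\<close>.\<close>

definition partial_deriv :: "('a::euclidean_space \<Rightarrow> real) \<Rightarrow> 'a \<Rightarrow> 'a \<Rightarrow> real" where
  "partial_deriv f i x = frechet_derivative f (at x) i"

primrec C_k :: "nat \<Rightarrow> ('a::euclidean_space \<Rightarrow> real) \<Rightarrow> bool" where
  "C_k 0 f \<longleftrightarrow> continuous_on UNIV f"
| "C_k (Suc n) f \<longleftrightarrow> f differentiable_on UNIV \<and> (\<forall>i\<in>Basis. C_k n (partial_deriv f i))"

definition test_function :: "'a::euclidean_space set \<Rightarrow> ('a \<Rightarrow> real) \<Rightarrow> bool" where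
  "test_function U \<phi> \<longleftrightarrow>
     (\<forall>n. C_k n \<phi>) \<and> compact (closure {x. \<phi> x \<noteq> 0}) \<and> closure {x. \<phi> x \<noteq> 0} \<subseteq> U"

definition locally_integrable :: "'a::euclidean_space set \<Rightarrow> ('a \<Rightarrow> real) \<Rightarrow> bool" where
  "locally_integrable U f \<longleftrightarrow> (\<forall>K. compact K \<and> K \<subseteq> U \<longrightarrow> set_integrable lebesgue K f)"

definition has_weak_deriv ::
    "'a::euclidean_space set \<Rightarrow> ('a \<Rightarrow> real) \<Rightarrow> 'a \<Rightarrow> ('a \<Rightarrow> real) \<Rightarrow> bool" where
  "has_weak_deriv U f i g \<longleftrightarrow> locally_integrable U f \<and> locally_integrable U g \<and>
     (\<forall>\<phi>. test_function U \<phi> \<longrightarrow>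
        (LINT x|lebesgue_on U. f x * partial_deriv \<phi> i x) = - (LINT x|lebesgue_on U. g x * \<phi> x))"

text \<open>A representative; weak derivatives are unique up to a null set of \<open>U\<close>.\<close>

definition weak_deriv :: "'a::euclidean_space set \<Rightarrow> ('a \<Rightarrow> real) \<Rightarrow> 'a \<Rightarrow> 'a \<Rightarrow> real" where
  "weak_deriv U f i = (SOME g. has_weak_deriv U f i g)"

definition L2 :: "'a::euclidean_space set \<Rightarrow> ('a \<Rightarrow> real) set" where
  "L2 U = {f. f \<in> borel_measurable (lebesgue_on U) \<and> integrable (lebesgue_on U) (\<lambda>x. (f x)\<^sup>2)}"

definition L2_inner :: "'a::euclidean_space set \<Rightarrow> ('a \<Rightarrow> real) \<Rightarrow> ('a \<Rightarrow> real) \<Rightarrow> real" where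
  "L2_inner U u v = (LINT x|lebesgue_on U. u x * v x)"

definition grad_inner :: "'a::euclidean_space set \<Rightarrow> ('a \<Rightarrow> real) \<Rightarrow> ('a \<Rightarrow> real) \<Rightarrow> real" where
  "grad_inner U u v = (\<Sum>i\<in>Basis. L2_inner U (weak_deriv U u i) (weak_deriv U v i))"

definition H1 :: "'a::euclidean_space set \<Rightarrow> ('a \<Rightarrow> real) set" where
  "H1 U = {u \<in> L2 U. \<forall>i\<in>Basis. \<exists>g\<in>L2 U. has_weak_deriv U u i g}"

definition H1_norm :: "'a::euclidean_space set \<Rightarrow> ('a \<Rightarrow> real) \<Rightarrow> real" where
  "H1_norm U u = sqrt (L2_inner U u u + grad_inner U u u)"

definition H10 :: "'a::euclidean_space set \<Rightarrow> ('a \<Rightarrow> real) set" where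
  "H10 U = {u \<in> H1 U. \<exists>\<phi>. (\<forall>n::nat. test_function U (\<phi> n)) \<and>
              (\<lambda>n. H1_norm U (\<lambda>x. u x - \<phi> n x)) \<longlonglongrightarrow> 0}"


section \<open>Variational eigenvalue problems\<close>

text \<open>Problems of the form: find \<open>u \<in> D\<close>, \<open>u \<noteq> 0\<close>, and \<open>\<mu> > 0\<close> such that
  \<open>a u v = \<mu> (u, v)\<close> for all \<open>v \<in> D\<close>, with the inner product of \<open>L\<^sup>2(U)\<close>.\<close>

definition eigenspace :: "'a::euclidean_space set \<Rightarrow> ('a \<Rightarrow> real) set \<Rightarrow>
    (('a \<Rightarrow> real) \<Rightarrow> ('a \<Rightarrow> real) \<Rightarrow> real) \<Rightarrow> real \<Rightarrow> ('a \<Rightarrow> real) set" where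
  "eigenspace U D a \<mu> = {u \<in> D. \<forall>v\<in>D. a u v = \<mu> * L2_inner U u v}"

definition is_eigenvalue :: "'a::euclidean_space set \<Rightarrow> ('a \<Rightarrow> real) set \<Rightarrow>
    (('a \<Rightarrow> real) \<Rightarrow> ('a \<Rightarrow> real) \<Rightarrow> real) \<Rightarrow> real \<Rightarrow> bool" where
  "is_eigenvalue U D a \<mu> \<longleftrightarrow>
     \<mu> > 0 \<and> (\<exists>u\<in>eigenspace U D a \<mu>. \<not> (AE x in lebesgue_on U. u x = 0))"

text \<open>Dimension \<open>n\<close> after identifying functions that agree almost everywhere on \<open>U\<close>.\<close>

definition has_dim_ae :: "'a::euclidean_space set \<Rightarrow> ('a \<Rightarrow> real) set \<Rightarrow> nat \<Rightarrow> bool" where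
  "has_dim_ae U E n \<longleftrightarrow> (\<exists>b :: nat \<Rightarrow> 'a \<Rightarrow> real. (\<forall>i<n. b i \<in> E) \<and>
     (\<forall>c. (AE x in lebesgue_on U. (\<Sum>i<n. c i * b i x) = 0) \<longrightarrow> (\<forall>i<n. c i = 0)) \<and>
     (\<forall>u\<in>E. \<exists>c. AE x in lebesgue_on U. u x = (\<Sum>i<n. c i * b i x)))"

definition eigenvalue_listing :: "'a::euclidean_space set \<Rightarrow> ('a \<Rightarrow> real) set \<Rightarrow>
    (('a \<Rightarrow> real) \<Rightarrow> ('a \<Rightarrow> real) \<Rightarrow> real) \<Rightarrow> (nat \<Rightarrow> real) \<Rightarrow> bool" where
  "eigenvalue_listing U D a \<mu> \<longleftrightarrow> mono \<mu> \<and> range \<mu> = {\<nu>. is_eigenvalue U D a \<nu>} \<and>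
     (\<forall>\<nu>\<in>range \<mu>. finite {j. \<mu> j = \<nu>} \<and> has_dim_ae U (eigenspace U D a \<nu>) (card {j. \<mu> j = \<nu>}))"

text \<open>There is at most one listing. Listings start at index \<open>0\<close>, whereas eigenvalues are numbered
  from \<open>k = 1\<close>.\<close>

definition kth_eigenvalue :: "'a::euclidean_space set \<Rightarrow> ('a \<Rightarrow> real) set \<Rightarrow>
    (('a \<Rightarrow> real) \<Rightarrow> ('a \<Rightarrow> real) \<Rightarrow> real) \<Rightarrow> nat \<Rightarrow> real" where
  "kth_eigenvalue U D a k = (THE \<mu>. eigenvalue_listing U D a \<mu>) (k - 1)"


section \<open>The triangle and the three eigenvalue problems\<close>

definition triangle :: "real \<Rightarrow> real \<Rightarrow> (real \<times> real) set" where
  "triangle s t = interior (convex hull {(-1, 0), (1, 0), (s, t)})"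

definition height :: "real \<Rightarrow> real \<Rightarrow> real \<Rightarrow> real" where
  "height s t x = (if x \<le> s then t / (1 + s) * (x + 1) else - t / (1 - s) * (x - 1))"

definition height' :: "real \<Rightarrow> real \<Rightarrow> real \<Rightarrow> real" where
  "height' s t = weak_deriv {-1<..<1} (height s t) 1"

text \<open>The Sobolev space on a compact interval is that of its interior.\<close>

definition I_int :: "real \<Rightarrow> real \<Rightarrow> real set" where
  "I_int s t = interior {- (t powr (-2/3)) * (1 + s) .. t powr (-2/3) * (1 - s)}"

definition V_hat :: "real \<Rightarrow> real \<Rightarrow> real \<Rightarrow> real" where
  "V_hat s t x = t powr (4/3) *
     (pi\<^sup>2 / (height s t (t powr (2/3) * x + s))\<^sup>2
      + (3 + 4 * pi\<^sup>2) * (height' s t (t powr (2/3) * x + s))\<^sup>2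
          / (12 * (height s t (t powr (2/3) * x + s))\<^sup>2)
      - pi\<^sup>2 / t\<^sup>2)"

definition V_bar :: "real \<Rightarrow> real \<Rightarrow> real" where
  "V_bar s x = (if x > 0 then 2 * pi\<^sup>2 / (1 - s) * \<bar>x\<bar> else 2 * pi\<^sup>2 / (1 + s) * \<bar>x\<bar>)"

definition mu :: "real \<Rightarrow> real \<Rightarrow> nat \<Rightarrow> real" where
  "mu s t = kth_eigenvalue (triangle s t) (H10 (triangle s t))
     (\<lambda>u v. t powr (4/3) *
        (grad_inner (triangle s t) u v - pi\<^sup>2 / t\<^sup>2 * L2_inner (triangle s t) u v))"

definition mu_hat :: "real \<Rightarrow> real \<Rightarrow> nat \<Rightarrow> real" where
  "mu_hat s t = kth_eigenvalue (I_int s t) (H10 (I_int s t))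
     (\<lambda>u v. grad_inner (I_int s t) u v
        + (LINT x|lebesgue_on (I_int s t). V_hat s t x * u x * v x))"

definition mu_bar :: "real \<Rightarrow> nat \<Rightarrow> real" where
  "mu_bar s = kth_eigenvalue UNIV
     {u \<in> H1 UNIV. integrable lebesgue (\<lambda>x. V_bar s x * (u x)\<^sup>2)}
     (\<lambda>u v. grad_inner UNIV u v + (LINT x|lebesgue. V_bar s x * u x * v x))"

end

theory Submission
 imports Defs "HOL-Complex_Analysis.Great_Picard" "HOL-Computational_Algebra.Polynomial"
begin

text \<open>Both bounds compare Rayleigh quotients. Integrating a test function of the triangle against the first
Dirichlet mode of \<open>(0,t)\<close> on each fibre loses little mass, because the gap to the second mode is \<open>3 pi^2 / t^2\<close>,
and the form dominates the one with potential \<open>V\<close>, as \<open>1 / (1 - x)^2 >= 1 + 2 x\<close>: this is the lower bound.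
For the upper bound, the trial functions \<open>u(x) H(x)^(-1/2) S(y / H(x))\<close>, with \<open>S\<close> close to the first mode of
\<open>(0,1)\<close> and \<open>H\<close> a smoothing of the height from below, reproduce the potential at \<open>t\<close>, which is monotone in \<open>t\<close>.
Ehrling-type inequalities replace the compact embeddings in the spectral theory.\<close>

text \<open>The lower bound loses only mass. If \<open>M\<close> bounds the Rayleigh quotient on a
  trial space and \<open>C = ta / (3 * pi^2)\<close> with \<open>C * M < 1\<close>, projection to
  the first mode keeps at least the fraction \<open>1 - C * M\<close> of the mass, so
  \<open>mu_bar <= M / (1 - C * M)\<close>; solved for \<open>M\<close>, this is the claim. In the
  upper bound \<open>(3 + 4 * pi^2) / 12\<close> equals \<open>pi^2 / 3 + 1 / 2 - 1 / 4\<close>: the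
  second moment of \<open>S'\<close> for \<open>S = sqrt 2 * sin (pi * y)\<close>, less what the
  factor \<open>H powr (-1/2)\<close> gives back. Two obstacles shape the rest. \<open>H10\<close>
  is a closure of test functions, while the natural trial functions have a kink above
  \<open>s\<close> and reach the boundary; genuine test functions replace them at arbitrarily small
  cost, and the comparison inequalities, proved for test functions only, reach the eigenvalues
  through finite-dimensional trial spaces. Moreover, eigenvalues are defined through a unique
  listing with multiplicities, so each of the three forms needs a full spectral theorem. Sine
  expansions on the fibres are avoided by completing squares.\<close>

abbreviation quad :: "('a => 'a => real) => 'a => real" where
 "quad B u == B u u"

abbreviation L2_sq :: "'a::euclidean_space set => ('a => real) => real" where
 "L2_sq U u == L2_inner U u u"

abbreviation pd :: "('a::euclidean_space => real) => 'a => 'a => real" where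
 "pd == partial_deriv"

notation LIMSEQ ("((_)/ ----> (_))" [60, 60] 60)

lemmas lebesgue_nonneg = Bochner_Integration.integral_nonneg
lemmas lebesgue_cong = Bochner_Integration.integral_cong
lemmas lebesgue_bound = Bochner_Integration.integrable_bound

subsection \<open>Symmetric forms and the min-max principle\<close>

text \<open>Elimination: a pivot \<open>p\<close> in the last equation expresses \<open>c p\<close>
  through the other unknowns, and \<open>A'\<close> is the system left after the substitution. This
  dimension count underlies the uniqueness of dimensions and every later choice of a vector
  orthogonal to given ones.\<close>

lemma homogeneous_system_nontrivial:
 fixes A :: "nat => nat => real"
 assumes "n < m"
 shows "EX c. (EX i<m. c i ~= 0) & (ALL j<n. (\<Sum>i<m. c i * A i j) = 0)"
 using assms
proof (induction n arbitrary: m A)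
 case 0
 then show ?case by (intro exI[of _ "%_. 1"]) auto
next
 case (Suc n)
 show ?case
 proof (cases "ALL i<m. A i n = 0")
  case True
  from Suc.IH[of m A] Suc.prems obtain c where c: "EX i<m. c i ~= 0" "ALL j<n. (\<Sum>i<m. c i * A i j) = 0"
   by auto
  with True show ?thesis
   by (intro exI[of _ c]) (auto simp: less_Suc_eq)
 next
  case False
  then obtain p where p: "p < m" "A p n ~= 0" by auto
  obtain m' where m': "m = Suc m'" using p by (cases m) auto
  \<comment> \<open>\<open>s\<close> enumerates the unknowns other than \<open>p\<close> by jumping
    over it, so that the induction hypothesis applies to \<open>m'\<close> consecutive
    indices.\<close>
  define s where "s i = (if i < p then i else Suc i)" for i
  have s_bij: "bij_betw s {..<m'} ({..<m} - {p})"
  proof (rule bij_betw_byWitness[where f' = "%i. if i < p then i else i - 1"])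
   show "ALL a:{..<m'}. (if s a < p then s a else s a - 1) = a" by (auto simp: s_def)
   show "ALL a:{..<m} - {p}. s (if a < p then a else a - 1) = a" by (auto simp: s_def)
   show "s ` {..<m'} <= {..<m} - {p}" using m' p by (auto simp: s_def)
   show "(%i. if i < p then i else i - 1) ` ({..<m} - {p}) <= {..<m'}" using m' p by auto
  qed
  define A' where "A' i j = A (s i) j - A (s i) n / A p n * A p j" for i j
  from Suc.IH[of m' A'] Suc.prems m' obtain d where
   d: "EX i<m'. d i ~= 0" "ALL j<n. (\<Sum>i<m'. d i * A' i j) = 0" by auto
  define sinv where "sinv = inv_into {..<m'} s"
  have sinv: "sinv (s i) = i" if "i < m'" for i
   unfolding sinv_def using s_bij that by (simp add: bij_betw_def)
  have snp: "s i ~= p" for i by (auto simp: s_def)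
  define c where "c i = (if i = p then - (\<Sum>i<m'. d i * A (s i) n / A p n) else d (sinv i))" for i
  have cs: "c (s i) = d i" if "i < m'" for i
   using sinv[OF that] snp by (simp add: c_def)
  have split: "(\<Sum>i<m. c i * A i j) = c p * A p j + (\<Sum>i<m'. d i * A (s i) j)" for j
  proof -
   have "(\<Sum>i<m. c i * A i j) = c p * A p j + (\<Sum>i\<in>{..<m} - {p}. c i * A i j)"
    using p by (subst sum.remove[of _ p]) auto
   also have "(\<Sum>i\<in>{..<m} - {p}. c i * A i j) = (\<Sum>i<m'. c (s i) * A (s i) j)"
    by (rule sum.reindex_bij_betw[OF s_bij, symmetric])
   also have "... = (\<Sum>i<m'. d i * A (s i) j)"
    by (rule sum.cong) (auto simp: cs)
   finally show ?thesis .
  qed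
  have "(\<Sum>i<m. c i * A i j) = 0" if "j < Suc n" for j
  proof (cases "j = n")
   case True
   have "c p * A p n = - (\<Sum>i<m'. d i * A (s i) n)"
    using p by (simp add: c_def sum_divide_distrib[symmetric])
   then show ?thesis using True split by simp
  next
   case False
   then have "(\<Sum>i<m'. d i * A' i j) = 0" using d that by auto
   moreover have "(\<Sum>i<m'. d i * A' i j) = (\<Sum>i<m'. d i * A (s i) j) + c p * A p j"
    by (simp add: A'_def c_def algebra_simps sum_subtractf sum_distrib_left sum_distrib_right)
   ultimately show ?thesis using split by simp
  qed
  moreover obtain i where "i < m'" "d i ~= 0" using d by auto
  then have "s i < m & c (s i) ~= 0" using cs s_bij by (auto simp: bij_betw_def)
  ultimately show ?thesis by (intro exI[of _ c]) auto
 qed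
qed

abbreviation lincomb :: "nat => (nat => real) => (nat => 'a => real) => 'a => real" where
 "lincomb n c e == (%x. \<Sum>i<n. c i * e i x)"

text \<open>Functions are not identified almost everywhere, so the forms are only semidefinite.
  Linearity is demanded on \<open>D\<close> alone because \<open>weak_deriv\<close> is a choice, and
  \<open>grad_inner\<close> is bilinear only where weak derivatives exist.\<close>

locale semi_inner =
 fixes D :: "('a => real) set" and B :: "('a => real) => ('a => real) => real"
 assumes zero: "(%x. 0) : D"
  and lin: "u : D ==> v : D ==> (%x. c * u x + d * v x) : D"
  and sym: "u : D ==> v : D ==> B u v = B v u"
  and bilin: "u : D ==> v : D ==> w : D ==> B (%x. c * u x + d * v x) w = c * B u w + d * B v w"
  and nonneg: "u : D ==> B u u >= 0"
begin

lemma bilin2: "u : D ==> v : D ==> w : D ==> B w (%x. c * u x + d * v x) = c * B w u + d * B w v"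
 using bilin[of u v w c d] sym[of w "%x. c * u x + d * v x"] sym[of w u] sym[of w v] lin[of u v c d] by simp

lemma add: "u : D ==> v : D ==> (%x. u x + v x) : D"
 using lin[of u v 1 1] by simp

lemma diff: "u : D ==> v : D ==> (%x. u x - v x) : D"
 using lin[of u v 1 "-1"] by simp

lemma scale: "u : D ==> (%x. c * u x) : D"
 using lin[of u u c 0] by simp

lemma B_diff: "u : D ==> v : D ==> w : D ==> B (%x. u x - v x) w = B u w - B v w"
 using bilin[of u v w 1 "-1"] by simp

lemma B_scale: "u : D ==> w : D ==> B (%x. c * u x) w = c * B u w"
 using bilin[of u u w c 0] by simp

lemma B_zero: "w : D ==> B (%x. 0) w = 0"
 using B_scale[of w w 0] by simp

lemma lincomb_in: "(!!i. i < n ==> e i : D) ==> lincomb n c e : D"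
proof (induction n)
 case 0
 then show ?case by (simp add: zero)
next
 case (Suc n)
 then show ?case using lin[of "lincomb n c e" "e n" 1 "c n"] by simp
qed

lemma B_lincomb: "(!!i. i < n ==> e i : D) ==> w : D ==> B (lincomb n c e) w = (\<Sum>i<n. c i * B (e i) w)"
proof (induction n)
 case 0
 then show ?case by (simp add: B_zero)
next
 case (Suc n)
 then show ?case using bilin[of "lincomb n c e" "e n" w 1 "c n"] by (simp add: lincomb_in)
qed

lemma B_lincomb2: "(!!i. i < n ==> e i : D) ==>
  B (lincomb n c e) (lincomb n d e) = (\<Sum>i<n. \<Sum>j<n. c i * d j * B (e i) (e j))"
proof -
 assume e: "!!i. i < n ==> e i : D"
 have "B (lincomb n c e) (lincomb n d e) = (\<Sum>i<n. c i * B (lincomb n d e) (e i))"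
  using e by (subst B_lincomb) (auto simp: lincomb_in sym intro!: sum.cong)
 also have "... = (\<Sum>i<n. \<Sum>j<n. c i * d j * B (e i) (e j))"
  using e by (intro sum.cong) (auto simp: B_lincomb sum_distrib_left sym mult_ac intro!: sum.cong)
 finally show ?thesis .
qed

lemma B_sq_comb:
 assumes "u : D" "v : D"
 shows "quad B (%x. c * u x + d * v x) = c^2 * B u u + 2 * c * d * B u v + d^2 * B v v"
 using assms sym[of v u]
 by (simp add: bilin bilin2 lin power2_eq_square algebra_simps)

lemma B_sq_diff:
 assumes "u : D" "v : D"
 shows "quad B (%x. u x - v x) = B u u - 2 * B u v + B v v"
 using B_sq_comb[OF assms, of 1 "-1"] by simp

lemma B_sq_add:
 assumes "u : D" "v : D"
 shows "quad B (%x. u x + v x) = B u u + 2 * B u v + B v v"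
 using B_sq_comb[OF assms, of 1 1] by simp

lemma Cauchy_Schwarz:
 assumes "u : D" "v : D"
 shows "(B u v)^2 <= B u u * B v v"
proof -
 have "0 <= c^2 * B u u + 2 * c * d * B u v + d^2 * B v v" for c d
  using nonneg[OF lin[OF assms, of c d]] B_sq_comb[OF assms, of c d] by simp
 note q = this
 show ?thesis
 proof (cases "B v v = 0")
  case True
  have "B u v = 0"
  proof (rule ccontr)
   assume "B u v ~= 0"
   \<comment> \<open>For \<open>B v v = 0\<close> this coefficient of \<open>v\<close> turns the
     quadratic expression into \<open>-1\<close>.\<close>
   with q[of 1 "- (B u u + 1) / (2 * B u v)"] True show False by (simp add: field_simps)
  qed
  then show ?thesis using True by simp
 next
  case False
  then have "B v v > 0" using nonneg[OF assms(2)] by simp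
  have "0 <= B v v * (B u u * B v v - (B u v)^2)"
   using q[of "B v v" "- B u v"] by (simp add: power2_eq_square algebra_simps)
  then show ?thesis using \<open>B v v > 0\<close> by (simp add: zero_le_mult_iff)
 qed
qed

lemma abs_le_sqrt: "u : D ==> v : D ==> \<bar>B u v\<bar> <= sqrt (B u u) * sqrt (B v v)"
 using Cauchy_Schwarz[of u v] by (metis real_sqrt_abs real_sqrt_le_iff real_sqrt_mult)

lemma le_twice:
 assumes "u : D" "v : D"
 shows "quad B (%x. u x + v x) <= 2 * B u u + 2 * B v v"
 using nonneg[OF diff[OF assms]] B_sq_diff[OF assms] B_sq_add[OF assms] by simp

lemma le_twice_diff:
 assumes "u : D" "v : D"
 shows "quad B (%x. u x - v x) <= 2 * B u u + 2 * B v v"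
 using nonneg[OF add[OF assms]] B_sq_diff[OF assms] B_sq_add[OF assms] by simp

lemma le_twice_via:
 assumes "u : D" "v : D" "w : D"
 shows "quad B (%x. u x - v x) <= 2 * quad B (%x. u x - w x) + 2 * quad B (%x. v x - w x)"
 using le_twice_diff[OF diff[OF assms(1,3)] diff[OF assms(2,3)]] by simp

lemma null_orth: "u : D ==> v : D ==> B u u = 0 ==> B u v = 0"
 using Cauchy_Schwarz[of u v] by simp

lemma sq_diff_commute:
 assumes "u : D" "v : D"
 shows "quad B (%x. u x - v x) = quad B (%x. v x - u x)"
 using B_sq_diff[OF assms] B_sq_diff[OF assms(2,1)] sym[OF assms] by simp

lemma tendsto_B:
 assumes "!!n. v n : D" "u : D" "(%n. quad B (%x. v n x - u x)) ----> 0" "w : D"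
 shows "(%n. B (v n) w) ----> B u w"
proof -
 have "(%n. sqrt (quad B (%x. v n x - u x)) * sqrt (B w w)) ----> sqrt 0 * sqrt (B w w)"
  by (intro tendsto_intros assms)
 then have "(%n. sqrt (quad B (%x. v n x - u x)) * sqrt (B w w)) ----> 0" by simp
 then have "(%n. B (v n) w - B u w) ----> 0"
 proof (rule Lim_null_comparison[rotated], intro always_eventually allI)
  fix n
  show "norm (B (v n) w - B u w) <= sqrt (quad B (%x. v n x - u x)) * sqrt (B w w)"
   using abs_le_sqrt[OF diff[OF assms(1)[of n] assms(2)] assms(4)] assms
   by (simp add: B_diff)
 qed
 then show ?thesis by (simp add: LIM_zero_iff)
qed

lemma tendsto_B_sq:
 assumes "!!n. v n : D" "u : D" "(%n. quad B (%x. v n x - u x)) ----> 0"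
 shows "(%n. quad B (v n)) ----> B u u"
proof -
 have "(%n. quad B (%x. v n x - u x) + 2 * B (v n) u - B u u) ----> 0 + 2 * B u u - B u u"
  by (intro tendsto_intros tendsto_B assms)
 then show ?thesis using assms B_sq_diff by simp
qed

end

section \<open>Uniqueness of the listing of eigenvalues\<close>

lemma eigenvalue_listing_le_aux:
 assumes "eigenvalue_listing U D a \<mu>" "eigenvalue_listing U D a nu"
  and dim: "!!E m n. has_dim_ae U E m ==> has_dim_ae U E n ==> m = n"
  and eq: "!!j. j < n ==> \<mu> j = nu j"
 shows "nu n <= \<mu> n"
proof (rule ccontr)
 assume less: "~ nu n <= \<mu> n"
 \<comment> \<open>If \<open>nu n\<close> exceeded \<open>x\<close>, monotonicity would leave
   \<open>nu\<close> no index from \<open>n\<close> on with value \<open>x\<close>, while below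
   \<open>n\<close> both listings agree. Then \<open>x\<close> would occur less often in
   \<open>nu\<close> than in \<open>\<mu>\<close>, although both counts are the dimension of the
   same eigenspace.\<close>
 define x where "x = \<mu> n"
 have r: "range \<mu> = range nu" using assms(1,2) by (auto simp: eigenvalue_listing_def)
 have x: "x : range \<mu>" "x : range nu" using r by (auto simp: x_def)
 have card: "card {j. \<mu> j = x} = card {j. nu j = x}"
  using assms(1,2) x dim[of "eigenspace U D a x"] unfolding eigenvalue_listing_def by metis
 have fin: "finite {j. \<mu> j = x}" using assms(1) x(1) unfolding eigenvalue_listing_def by blast
 have "mono nu" using assms by (simp add: eigenvalue_listing_def)
 then have "nu j ~= x" if "n <= j" for j
  using monoD[of nu n j] that less by (auto simp: x_def)
 then have "{j. nu j = x} <= {j. \<mu> j = x} - {n}"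
  using eq by (auto simp: x_def) (metis leI)+
 then have "card {j. nu j = x} <= card ({j. \<mu> j = x} - {n})"
  using fin by (intro card_mono) auto
 also have "... < card {j. \<mu> j = x}"
  using fin by (intro card_Diff1_less) (auto simp: x_def)
 finally show False using card by simp
qed

text \<open>Expanding \<open>m\<close> independent functions in \<open>n < m\<close> spanning ones
  leaves more unknowns than equations, hence a nontrivial relation almost everywhere.\<close>

lemma has_dim_ae_le:
 assumes "has_dim_ae U E m" "has_dim_ae U E n"
 shows "m <= n"
proof (rule ccontr)
 assume "~ m <= n"
 then have "n < m" by simp
 obtain b where b: "!!i. i < m ==> b i : E"
  "!!c. AE x in lebesgue_on U. (\<Sum>i<m. c i * b i x) = 0 ==> ALL i<m. c i = (0::real)"
  using assms(1) unfolding has_dim_ae_def by metis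
 obtain d where d: "!!u. u : E ==> EX c. AE x in lebesgue_on U. u x = (\<Sum>i<n. c i * d i x)"
  using assms(2) unfolding has_dim_ae_def by metis
 have "ALL i. EX c. i < m --> (AE x in lebesgue_on U. b i x = (\<Sum>j<n. c j * d j x))"
  using d b(1) by blast
 then obtain A where A: "!!i. i < m ==> AE x in lebesgue_on U. b i x = (\<Sum>j<n. A i j * d j x)"
  by metis
 obtain c where c: "EX i<m. c i ~= 0" "ALL j<n. (\<Sum>i<m. c i * A i j) = 0"
  using homogeneous_system_nontrivial[OF \<open>n < m\<close>, of A] by auto
 have "AE x in lebesgue_on U. ALL i:{..<m}. b i x = (\<Sum>j<n. A i j * d j x)"
  by (rule AE_finite_allI) (auto intro: A)
 then have "AE x in lebesgue_on U. (\<Sum>i<m. c i * b i x) = 0"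
 proof eventually_elim
  case (elim x)
  then have "(\<Sum>i<m. c i * b i x) = (\<Sum>i<m. \<Sum>j<n. c i * A i j * d j x)"
   by (intro sum.cong) (auto simp: sum_distrib_left mult_ac)
  also have "... = (\<Sum>j<n. (\<Sum>i<m. c i * A i j) * d j x)"
   by (subst sum.swap) (simp add: sum_distrib_right)
  also have "... = 0" using c by simp
  finally show ?case .
 qed
 then show False using b(2) c(1) by blast
qed

lemma eigenvalue_listing_unique:
 assumes "eigenvalue_listing U D a \<mu>" "eigenvalue_listing U D a nu"
 shows "\<mu> = nu"
proof
 fix n
 have dim: "has_dim_ae U E m ==> has_dim_ae U E n ==> m = n" for E m n
  using has_dim_ae_le by (metis le_antisym)
 show "\<mu> n = nu n"
 proof (induction n rule: less_induct)
  case (less n)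
  show ?case
   using eigenvalue_listing_le_aux[OF assms, of n] eigenvalue_listing_le_aux[OF assms(2,1), of n] less dim
   by (metis antisym)
 qed
qed

lemma kth_eigenvalue_eq:
 assumes "eigenvalue_listing U D a \<mu>"
 shows "kth_eigenvalue U D a k = \<mu> (k - 1)"
proof -
 have "(THE \<mu>. eigenvalue_listing U D a \<mu>) = \<mu>"
  using assms eigenvalue_listing_unique by blast
 then show ?thesis by (simp add: kth_eigenvalue_def)
qed

text \<open>The hypotheses describe a closed positive form whose domain embeds compactly into
  \<open>L2\<close>. Completeness and compactness are worded with Cauchy sequences, so that no
  quotient by null functions has to be formed; \<open>infinite_dim\<close> makes the sequence of
  eigenvalues infinite.\<close>

locale spectral =
 A: semi_inner D a + b: semi_inner D "L2_inner U"
 for U :: "'a::euclidean_space set" and D a +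
 assumes null_iff: "u : D ==> L2_inner U u u = 0 \<longleftrightarrow> (AE x in lebesgue_on U. u x = 0)"
  and pos: "u : D ==> L2_inner U u u > 0 ==> a u u > 0"
  and complete: "(!!n. v n : D) ==>
   (!!ep. ep > 0 ==> EX N. ALL m>=N. ALL n>=N.
     quad a (%x. v m x - v n x) + L2_sq U (%x. v m x - v n x) < ep) ==>
   EX u:D. (%n. quad a (%x. v n x - u x) + L2_sq U (%x. v n x - u x)) ----> 0"
  and compact: "(!!n. v n : D) ==> (!!n. quad a (v n) + L2_sq U (v n) <= M) ==>
   EX r::nat => nat. strict_mono r & (ALL ep>0. EX N. ALL m>=N. ALL n>=N.
     L2_sq U (%x. v (r m) x - v (r n) x) < ep)"
  and infinite_dim: "EX v. (ALL i<n. v i : D) & (ALL c. L2_sq U (lincomb n c v) = 0 --> (ALL i<n. c i = 0))"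
begin

abbreviation B where "B == L2_inner U"

text \<open>A normalised minimiser of the Rayleigh quotient under orthogonality to the first
  \<open>k\<close> members of \<open>e\<close>: the usual inductive description of the next
  eigenfunction.\<close>

definition minimizer :: "nat => (nat => 'a => real) => ('a => real) => bool" where
 "minimizer k e r \<longleftrightarrow> r : D & B r r = 1 & (ALL i<k. B r (e i) = 0) &
   (ALL u:D. (ALL i<k. B u (e i) = 0) --> a u u >= a r r * B u u)"

lemma nonnull_combination:
 assumes "!!i. i < n ==> e i : D" "!!i. i < m ==> v i : D" "n < m"
  "!!c. quad B (lincomb m c v) = 0 ==> ALL i<m. c i = 0"
 shows "EX c. quad B (lincomb m c v) > 0 & (ALL j<n. B (lincomb m c v) (e j) = 0)"
proof -
 obtain c where c: "EX i<m. c i ~= 0" "ALL j<n. (\<Sum>i<m. c i * B (v i) (e j)) = 0"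
  using homogeneous_system_nontrivial[OF assms(3), of "%i j. B (v i) (e j)"] by auto
 have "lincomb m c v : D" by (rule b.lincomb_in) (use assms in auto)
 then have ge: "quad B (lincomb m c v) >= 0" by (rule b.nonneg)
 have ne: "quad B (lincomb m c v) ~= 0"
 proof
  assume "quad B (lincomb m c v) = 0"
  from assms(4)[OF this] c(1) show False by blast
 qed
 from ge ne have "quad B (lincomb m c v) > 0" by linarith
 then show ?thesis using c assms by (intro exI[of _ c]) (auto simp: b.B_lincomb)
qed

text \<open>Direct method: compactness makes a subsequence of a minimising sequence Cauchy in
  \<open>L2\<close>, the parallelogram law upgrades this to the form norm, and completeness then
  yields an exact minimiser.\<close>

lemma minimizer_exists:
 assumes e: "!!i. i < k ==> e i : D"
 shows "EX r. minimizer k e r"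
proof -
 define X where "X = {u:D. ALL i<k. B u (e i) = 0}"
 define m where "m = (INF u\<in>{u:X. B u u = 1}. a u u)"
 have bdd: "bdd_below ((%u. a u u) ` {u:X. B u u = 1})"
  by (rule bdd_belowI[of _ 0]) (auto simp: X_def A.nonneg)
 have Xlin: "(%x. c * u x + d * v x) : X" if "u : X" "v : X" for u v c d
  using that e by (auto simp: X_def b.lin b.bilin)
 obtain w where w: "w : X" "B w w > 0"
 proof -
  obtain v where v: "ALL i<Suc k. v i : D" "!!c. quad B (lincomb (Suc k) c v) = 0 ==> (ALL i<Suc k. c i = 0)"
   using infinite_dim[of "Suc k"] by blast
  from nonnull_combination[of k e "Suc k" v] e v obtain c where
   "quad B (lincomb (Suc k) c v) > 0" "ALL j<k. B (lincomb (Suc k) c v) (e j) = 0"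
   by auto
  moreover have "lincomb (Suc k) c v : D" by (rule b.lincomb_in) (use v(1) in blast)
  ultimately show ?thesis using that[of "lincomb (Suc k) c v"] by (simp add: X_def)
 qed
 have normalize: "(%x. (1 / sqrt (B u u)) * u x) : {u:X. B u u = 1}
   & quad a (%x. (1 / sqrt (B u u)) * u x) = a u u / B u u"
  if u: "u : X" "B u u > 0" for u
 proof -
  have "u : D" using u by (simp add: X_def)
  have s: "(1 / sqrt (B u u))^2 = 1 / B u u" using u by (simp add: power_divide)
  have "(%x. (1 / sqrt (B u u)) * u x) : X" using Xlin[OF u(1) u(1), of "1 / sqrt (B u u)" 0] by simp
  moreover have "quad B (%x. (1 / sqrt (B u u)) * u x) = 1"
   using b.B_sq_comb[OF \<open>u : D\<close> \<open>u : D\<close>, of "1 / sqrt (B u u)" 0] u s by simp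
  moreover have "quad a (%x. (1 / sqrt (B u u)) * u x) = a u u / B u u"
   using A.B_sq_comb[OF \<open>u : D\<close> \<open>u : D\<close>, of "1 / sqrt (B u u)" 0] s by simp
  ultimately show ?thesis by blast
 qed
 have ne: "{u:X. B u u = 1} ~= {}" using normalize[OF w] by blast
 have m_le: "m * B u u <= a u u" if "u : X" for u
 proof (cases "B u u > 0")
  case True
  have "m <= quad a (%x. (1 / sqrt (B u u)) * u x)"
   unfolding m_def by (rule cINF_lower[OF bdd]) (use normalize[OF that True] in blast)
  then have "m <= a u u / B u u" using normalize[OF that True] by simp
  then show ?thesis using True by (simp add: field_simps)
 next
  case False
  have "u : D" using that by (simp add: X_def)
  then have "B u u = 0" using False b.nonneg[of u] by linarith
  then show ?thesis using A.nonneg[OF \<open>u : D\<close>] by simp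
 qed
 have m0: "m >= 0" unfolding m_def using ne by (intro cINF_greatest) (auto simp: X_def A.nonneg)
 have "EX u:X. B u u = 1 & a u u < m + 1 / Suc n" for n :: nat
 proof -
  have "m < m + 1 / Suc n" by simp
  then show ?thesis unfolding m_def using cINF_less_iff[OF ne bdd] m_def by blast
 qed
 then obtain v where v: "!!n. v n : X" "!!n. quad B (v n) = 1" "!!n. quad a (v n) < m + 1 / Suc n"
  by metis
 have vD: "v n : D" for n using v by (simp add: X_def)
 have "quad a (v n) + quad B (v n) <= m + 2" for n
 proof -
  have "1 / real (Suc n) <= 1" by simp
  then show ?thesis using v(2,3)[of n] by linarith
 qed
 from compact[of v, OF vD this] obtain r where r1: "strict_mono (r::nat=>nat)" and
  r2: "ALL ep>0. EX N. ALL m>=N. ALL n>=N. quad B (%x. v (r m) x - v (r n) x) < ep"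
  by blast
 note r = r1 r2[rule_format]
 have "EX u:D. (%n. quad a (%x. v (r n) x - u x) + quad B (%x. v (r n) x - u x)) ----> 0"
 proof (rule complete)
  fix ep :: real assume "ep > 0"
  obtain N1 where N1: "!!i j. i >= N1 ==> j >= N1 ==>
     quad B (%x. v (r i) x - v (r j) x) < ep / (4 * (m + 1))"
   using r(2)[of "ep / (4 * (m + 1))"] \<open>ep > 0\<close> m0 by auto
  obtain N2 where N2: "1 / Suc N2 < ep / 8" using \<open>ep > 0\<close> nat_approx_posE[of "ep/8"] by (metis divide_pos_pos zero_less_numeral)
  have *: "quad a (%x. v (r i) x - v (r j) x) + quad B (%x. v (r i) x - v (r j) x) < ep"
   if ij: "i >= max N1 N2" "j >= max N1 N2" for i j
  proof -
   let ?d = "%x. v (r i) x - v (r j) x" let ?s = "%x. v (r i) x + v (r j) x"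
   \<comment> \<open>The sum \<open>?s\<close> satisfies the same constraints, so
     \<open>a ?s ?s\<close> is at least \<open>m * B ?s ?s\<close>. Both values along the sequence
     being close to \<open>m\<close>, the parallelogram law forces \<open>a ?d ?d\<close> to be
     small.\<close>
   have sX: "?s : X" using Xlin[of "v (r i)" "v (r j)" 1 1] v by simp
   have 1: "a ?d ?d = 2 * quad a (v (r i)) + 2 * quad a (v (r j)) - a ?s ?s"
    using A.B_sq_diff[OF vD vD] A.B_sq_add[OF vD vD] by simp
   have 2: "B ?s ?s = 4 - B ?d ?d"
    using b.B_sq_diff[OF vD vD] b.B_sq_add[OF vD vD] v(2) by simp
   have "quad a (v (r l)) < m + ep / 8" if "l >= N2" for l
   proof -
    have "1 / real (Suc (r l)) <= 1 / Suc N2" using seq_suble[OF r(1), of l] that by (intro divide_left_mono) auto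
    then show ?thesis using v(3)[of "r l"] N2 by simp
   qed
   then have "quad a (v (r i)) < m + ep / 8" "quad a (v (r j)) < m + ep / 8"
    using ij by auto
   moreover have "m * (4 - B ?d ?d) <= a ?s ?s" using m_le[OF sX] unfolding 2 .
   then have "m * 4 - m * B ?d ?d <= a ?s ?s" unfolding right_diff_distrib .
   ultimately have "a ?d ?d < m * B ?d ?d + ep / 2" using 1 by linarith
   moreover have "(m + 1) * B ?d ?d < ep / 4" using N1[of i j] ij m0 by (simp add: field_simps)
   ultimately show ?thesis using \<open>ep > 0\<close> by (simp add: algebra_simps)
  qed
  then show "EX N. ALL i>=N. ALL j>=N. quad a (%x. v (r i) x - v (r j) x) + quad B (%x. v (r i) x - v (r j) x) < ep"
   by blast
 qed (rule vD)
 then obtain u where u: "u : D" and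
  lim: "(%n. quad a (%x. v (r n) x - u x) + quad B (%x. v (r n) x - u x)) ----> 0"
  by blast
 have lima: "(%n. quad a (%x. v (r n) x - u x)) ----> 0"
  by (rule Lim_null_comparison[OF _ lim]) (auto simp: A.nonneg b.nonneg A.diff vD u)
 have limb: "(%n. quad B (%x. v (r n) x - u x)) ----> 0"
  by (rule Lim_null_comparison[OF _ lim]) (auto simp: A.nonneg b.nonneg A.diff vD u)
 have "(%n. quad B (v (r n))) ----> B u u"
  by (rule b.tendsto_B_sq[OF vD u limb])
 then have Bu: "B u u = 1" by (simp add: v(2) LIMSEQ_const_iff)
 have "a u u <= m"
 proof (rule LIMSEQ_le)
  show "(%n. quad a (v (r n))) ----> a u u" by (rule A.tendsto_B_sq[OF vD u lima])
  have "(%n. m + 1 / real (Suc n)) ----> m + 0"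
   by (intro tendsto_intros LIMSEQ_Suc[OF lim_1_over_n])
  then have "((%n. m + 1 / real (Suc n)) \<circ> r) ----> m + 0" by (rule LIMSEQ_subseq_LIMSEQ[OF _ r(1)])
  then show "(%n. m + 1 / real (Suc (r n))) ----> m" by (simp add: o_def)
 qed (use v(3) in "auto intro: less_imp_le")
 moreover have "B u (e i) = 0" if "i < k" for i
 proof -
  have "(%n. B (v (r n)) (e i)) ----> B u (e i)"
   by (rule b.tendsto_B[OF vD u limb e[OF that]])
  moreover have "B (v (r n)) (e i) = 0" for n using v(1) that by (auto simp: X_def)
  ultimately show ?thesis by (simp add: LIMSEQ_const_iff)
 qed
 moreover have "a w w >= a u u * B w w" if "w : D" "ALL i<k. B w (e i) = 0" for w
  using m_le[of w] that mult_right_mono[OF \<open>a u u <= m\<close>, of "B w w"] b.nonneg[of w] by (auto simp: X_def)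
 ultimately show ?thesis unfolding minimizer_def using u Bu by blast
qed

definition eigf :: "nat => 'a => real" where
 "eigf = (SOME e. ALL k. minimizer k e (e k))"

definition eigval :: "nat => real" where
 "eigval k = quad a (eigf k)"

text \<open>\<open>minimizer_exists\<close> needs the earlier functions in \<open>D\<close>, so the
  dependent choice runs on the guarded predicate \<open>P\<close>; the guard is then discharged by
  induction.\<close>

lemma eigf: "minimizer k eigf (eigf k)"
proof -
 define P where "P = (%(e::nat => 'a => real) k r. (ALL i<k. e i : D) --> minimizer k e r)"
 have "EX e. ALL k. P e k (e k)"
 proof (rule dependent_wellorder_choice)
  fix r and f g :: "nat => 'a => real" and k :: nat
  assume "!!y. y < k ==> f y = g y"
  then show "P f k r = P g k r" by (auto simp: P_def minimizer_def)
 next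
  fix k :: nat and f
  show "EX r. P f k r" unfolding P_def using minimizer_exists by blast
 qed
 then obtain e where e: "!!k. P e k (e k)" by blast
 have "e k : D" for k
 proof (induction k rule: less_induct)
  case (less k)
  then show ?case using e[of k] by (auto simp: P_def minimizer_def)
 qed
 then have "ALL k. minimizer k e (e k)" using e by (auto simp: P_def)
 then have "ALL k. minimizer k eigf (eigf k)"
  unfolding eigf_def by (rule someI[where P = "%e. ALL k. minimizer k e (e k)"])
 then show ?thesis by blast
qed

lemma eigf_D [simp]: "eigf k : D" and eigf_norm [simp]: "quad B (eigf k) = 1"
 using eigf[of k] by (auto simp: minimizer_def)

lemma eigf_orth: "B (eigf i) (eigf j) = (if i = j then 1 else 0)"
proof -
 have "B (eigf i) (eigf j) = 0" if "j < i" for i j using eigf[of i] that by (auto simp: minimizer_def)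
 then show ?thesis using b.sym[of "eigf i" "eigf j"] by (cases i j rule: linorder_cases) auto
qed

lemma eigval_lower: "u : D ==> (!!i. i < k ==> B u (eigf i) = 0) ==> eigval k * B u u <= a u u"
 using eigf[of k] by (auto simp: minimizer_def eigval_def)

lemma mono_eigval: "mono eigval"
proof (rule mono_iff_le_Suc[THEN iffD2], rule allI)
 fix n show "eigval n <= eigval (Suc n)"
  using eigval_lower[of "eigf (Suc n)" n] by (simp add: eigf_orth eigval_def)
qed

lemma eigval_pos: "eigval k > 0"
 using pos[of "eigf k"] by (simp add: eigval_def)

lemma orth_residual:
 assumes "u : D" "j < k"
 shows "B (%x. u x - lincomb k (%i. B u (eigf i)) eigf x) (eigf j) = 0"
proof -
 have "(\<Sum>i<k. B u (eigf i) * B (eigf i) (eigf j)) = (\<Sum>i<k. if i = j then B u (eigf i) else 0)"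
  by (rule sum.cong) (auto simp: eigf_orth)
 then show ?thesis using assms by (simp add: b.B_diff b.lincomb_in b.B_lincomb)
qed

text \<open>Under the constraints, \<open>a - eigval k * B\<close> is a nonnegative form that
  vanishes at \<open>eigf k\<close>, so by Cauchy-Schwarz \<open>eigf k\<close> is orthogonal to
  everything there with respect to it. The remaining directions are earlier eigenfunctions, for
  which both sides vanish by induction.\<close>

lemma eigf_eq: "v : D ==> a (eigf k) v = eigval k * B (eigf k) v"
proof (induction k arbitrary: v rule: less_induct)
 case (less k)
 have orth: "a (eigf k) v = eigval k * B (eigf k) v" if v: "v : D" "!!i. i < k ==> B v (eigf i) = 0" for v
 proof -
  define X where "X = {u:D. ALL i<k. B u (eigf i) = 0}"
  interpret X: semi_inner X "%u v. a u v - eigval k * B u v"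
  proof
   show "(%x. 0) : X" by (auto simp: X_def b.zero b.B_zero)
   show "(%x. c * u x + d * v x) : X" if "u : X" "v : X" for u v c d
    using that by (auto simp: X_def b.lin b.bilin)
  next
   fix u v assume "u : X" "v : X"
   then show "a u v - eigval k * B u v = a v u - eigval k * B v u"
    by (auto simp: X_def A.sym b.sym)
  next
   fix u v w :: "'a => real" and c d assume "u : X" "v : X" "w : X"
   then show "a (%x. c * u x + d * v x) w - eigval k * B (%x. c * u x + d * v x) w =
     c * (a u w - eigval k * B u w) + d * (a v w - eigval k * B v w)"
    by (auto simp: X_def A.bilin b.bilin algebra_simps)
  next
   fix u assume "u : X"
   then show "0 <= a u u - eigval k * B u u" using eigval_lower[of u k] by (auto simp: X_def)
  qed
  have "eigf k : X" "v : X" using v by (auto simp: X_def eigf_orth)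
  then have "a (eigf k) v - eigval k * B (eigf k) v = 0"
   by (rule X.null_orth) (simp add: eigval_def)
  then show ?thesis by simp
 qed
 let ?p = "lincomb k (%i. B v (eigf i)) eigf"
 have p: "?p : D" by (rule b.lincomb_in) simp
 have 1: "a (eigf k) (%x. v x - ?p x) = eigval k * B (eigf k) (%x. v x - ?p x)"
  by (rule orth) (use less.prems p orth_residual in "auto simp: b.diff")
 have "a (eigf i) (eigf k) = 0" if "i < k" for i
  using less.IH[OF that, of "eigf k"] that by (simp add: eigf_orth)
 then have 2: "a ?p (eigf k) = 0" by (simp add: A.B_lincomb)
 have 3: "B ?p (eigf k) = 0" by (simp add: b.B_lincomb eigf_orth)
 have "a v (eigf k) = eigval k * B v (eigf k)"
  using 1 2 3 p less.prems A.B_diff[of v ?p "eigf k"] b.B_diff[of v ?p "eigf k"]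
   A.sym[OF eigf_D[of k] b.diff[OF less.prems p]] b.sym[OF eigf_D[of k] b.diff[OF less.prems p]]
  by simp
 then show ?case using A.sym b.sym less.prems by simp
qed

text \<open>An orthonormal sequence has squared mutual distances \<open>2\<close>, which compactness
  forbids if the values of the form stay bounded.\<close>

lemma eigval_unbounded: "EX k. eigval k > M"
proof (rule ccontr)
 assume "~ ?thesis"
 then have "quad a (eigf k) + quad B (eigf k) <= M + 1" for k
  by (simp add: eigval_def not_less)
 from compact[of eigf, OF eigf_D this] obtain r where r: "strict_mono (r::nat=>nat)"
  and cau: "ALL ep>0. EX N. ALL m>=N. ALL n>=N.
     quad B (%x. eigf (r m) x - eigf (r n) x) < ep"
  by blast
 from cau[rule_format, of 1] obtain N where N: "ALL m>=N. ALL n>=N.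
     quad B (%x. eigf (r m) x - eigf (r n) x) < 1"
  by auto
 have "quad B (%x. eigf (r N) x - eigf (r (Suc N)) x) < 1"
  by (rule N[rule_format]) auto
 moreover have "r N ~= r (Suc N)" using r by (metis lessI less_irrefl strict_monoD)
 ultimately show False by (simp add: b.B_sq_diff eigf_orth)
qed

text \<open>Only coefficients with \<open>eigval j = nu\<close> survive. What remains after
  subtracting the first \<open>N\<close> components still solves the eigenvalue equation for
  \<open>nu\<close>, yet it is orthogonal to those components, where the form is at least
  \<open>eigval N > nu\<close> times the mass; so it is null.\<close>

lemma eigenspace_expansion:
 assumes "u : eigenspace U D a nu" "eigval N > nu"
 shows "AE x in lebesgue_on U. u x = (\<Sum>j | j < N & eigval j = nu. B u (eigf j) * eigf j x)"
proof -
 have u: "u : D" "!!v. v : D ==> a u v = nu * B u v" using assms by (auto simp: eigenspace_def)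
 have z: "B u (eigf j) = 0" if "eigval j ~= nu" for j
 proof -
  have "eigval j * B u (eigf j) = nu * B u (eigf j)"
   using u eigf_eq[of u j] A.sym b.sym by (metis eigf_D)
  then show ?thesis using that by simp
 qed
 let ?p = "lincomb N (%i. B u (eigf i)) eigf"
 let ?w = "%x. u x - ?p x"
 have p: "?p : D" by (rule b.lincomb_in) simp
 have w: "?w : D" using u p by (simp add: b.diff)
 have "a ?p v = nu * B ?p v" if "v : D" for v
  using that by (simp add: A.B_lincomb b.B_lincomb eigf_eq sum_distrib_left) (intro sum.cong, auto simp: z)
 then have "a ?w v = nu * B ?w v" if "v : D" for v
  using that u p by (simp add: A.B_diff b.B_diff algebra_simps)
 then have "a ?w ?w = nu * B ?w ?w" using w by blast
 moreover have "eigval N * B ?w ?w <= a ?w ?w" by (rule eigval_lower[OF w]) (use orth_residual u in auto)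
 ultimately have "(eigval N - nu) * B ?w ?w <= 0" by (simp add: algebra_simps)
 then have "B ?w ?w = 0" using assms(2) b.nonneg[OF w] by (auto simp: mult_le_0_iff)
 then have "AE x in lebesgue_on U. ?w x = 0" using null_iff[OF w] by simp
 moreover have "?p x = (\<Sum>j | j < N & eigval j = nu. B u (eigf j) * eigf j x)" for x
  by (rule sum.mono_neutral_right) (auto simp: z)
 ultimately show ?thesis by simp
qed

lemma finite_eigval: "finite {j. eigval j = nu}"
proof -
 obtain N where "eigval N > nu" using eigval_unbounded by blast
 then have "{j. eigval j = nu} <= {..<N}"
  using mono_eigval by (auto simp: mono_def) (metis leD leI)
 then show ?thesis using finite_subset by blast
qed

lemma AE_lincomb_0:
 assumes "AE x in lebesgue_on U. lincomb n c (%i. eigf (f i)) x = 0" "inj_on f {..<n}" "i < n"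
 shows "c i = 0"
proof -
 let ?p = "lincomb n c (%i. eigf (f i))"
 have p: "?p : D" by (rule b.lincomb_in) simp
 have "B ?p (eigf (f i)) = 0" using b.null_orth[OF p eigf_D] null_iff[OF p] assms by auto
 moreover have "B ?p (eigf (f i)) = (\<Sum>j<n. if j = i then c j else 0)"
  using assms(2,3) by (subst b.B_lincomb) (simp, simp, rule sum.cong, auto simp: eigf_orth inj_on_def)
 ultimately show ?thesis using assms(3) by simp
qed

text \<open>This ties the variationally built sequence to the listing that
  \<open>kth_eigenvalue\<close> selects. Multiplicities agree because the \<open>eigf j\<close> with
  a given value form a basis of its eigenspace.\<close>

lemma eigval_listing: "eigenvalue_listing U D a eigval"
 unfolding eigenvalue_listing_def
proof (intro conjI ballI)
 show "mono eigval" by (rule mono_eigval)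
 show "range eigval = {nu. is_eigenvalue U D a nu}"
 proof (intro equalityI subsetI)
  fix nu assume "nu : range eigval"
  then obtain k where k: "nu = eigval k" by blast
  have "eigf k : eigenspace U D a nu" using eigf_eq k by (simp add: eigenspace_def)
  moreover have "~ (AE x in lebesgue_on U. eigf k x = 0)" using null_iff[of "eigf k"] by simp
  ultimately show "nu : {nu. is_eigenvalue U D a nu}" using eigval_pos k by (auto simp: is_eigenvalue_def)
 next
  fix nu assume "nu : {nu. is_eigenvalue U D a nu}"
  then obtain u where u: "u : eigenspace U D a nu" "~ (AE x in lebesgue_on U. u x = 0)"
   by (auto simp: is_eigenvalue_def)
  obtain N where N: "eigval N > nu" using eigval_unbounded by blast
  show "nu : range eigval"
  proof (rule ccontr)
   assume "nu ~: range eigval"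
   then have "{j. j < N & eigval j = nu} = {}" by auto
   from eigenspace_expansion[OF u(1) N, unfolded this] u(2) show False by simp
  qed
 qed
 fix nu assume "nu : range eigval"
 show "finite {j. eigval j = nu}" by (rule finite_eigval)
 let ?J = "{j. eigval j = nu}"
 obtain f where f: "bij_betw f {..<card ?J} ?J"
  using ex_bij_betw_nat_finite[OF finite_eigval[of nu]] by (auto simp: atLeast0LessThan)
 show "has_dim_ae U (eigenspace U D a nu) (card ?J)"
  unfolding has_dim_ae_def
 proof (intro exI[of _ "%i. eigf (f i)"] conjI allI impI ballI)
  fix i assume "i < card ?J"
  then have "eigval (f i) = nu" using f by (auto simp: bij_betw_def)
  then show "eigf (f i) : eigenspace U D a nu" using eigf_eq by (auto simp: eigenspace_def)
 next
  fix c i assume "AE x in lebesgue_on U. lincomb (card ?J) c (%i. eigf (f i)) x = 0" "i < card ?J"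
  then show "c i = 0" using AE_lincomb_0 f by (auto simp: bij_betw_def)
 next
  fix u assume u: "u : eigenspace U D a nu"
  obtain N where N: "eigval N > nu" using eigval_unbounded by blast
  have "{j. j < N & eigval j = nu} = ?J"
   using N mono_eigval by (auto simp: mono_def) (metis leD leI)
  then have "AE x in lebesgue_on U. u x = (\<Sum>j\<in>?J. B u (eigf j) * eigf j x)"
   using eigenspace_expansion[OF u N] by simp
  moreover have "(\<Sum>j\<in>?J. B u (eigf j) * eigf j x) = (\<Sum>i<card ?J. B u (eigf (f i)) * eigf (f i) x)" for x
   by (rule sum.reindex_bij_betw[OF f, symmetric])
  ultimately show "EX c. AE x in lebesgue_on U. u x = lincomb (card ?J) c (%i. eigf (f i)) x"
   by (intro exI[of _ "%i. B u (eigf (f i))"]) simp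
 qed
qed

lemma kth_eq: "kth_eigenvalue U D a k = eigval (k - 1)"
 by (rule kth_eigenvalue_eq[OF eigval_listing])

text \<open>By the dimension count, \<open>k\<close> independent functions have a nonnull
  combination orthogonal to the first \<open>k - 1\<close> eigenfunctions; its Rayleigh quotient is
  at least \<open>eigval (k - 1)\<close>, which is the \<open>k\<close>-th eigenvalue since listings
  start at \<open>0\<close>.\<close>

lemma minmax_le:
 assumes v: "!!i. i < k ==> v i : D" and "k >= 1"
  and indep: "!!c. L2_sq U (lincomb k c v) = 0 ==> ALL i<k. c i = 0"
  and le: "!!c. quad a (lincomb k c v) <= M * L2_sq U (lincomb k c v)"
 shows "kth_eigenvalue U D a k <= M"
proof -
 obtain c where c: "quad B (lincomb k c v) > 0" "ALL j<k-1. B (lincomb k c v) (eigf j) = 0"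
  using nonnull_combination[of "k-1" eigf k v] assms by auto
 have "eigval (k-1) * quad B (lincomb k c v) <= quad a (lincomb k c v)"
  by (rule eigval_lower) (use c v in "auto simp: b.lincomb_in")
 also note le[of c]
 finally show ?thesis using c(1) by (simp add: kth_eq)
qed

lemma kth_pos: "kth_eigenvalue U D a k > 0"
 by (simp add: kth_eq eigval_pos)

lemma Rayleigh_eigf:
 shows "quad a (lincomb k c eigf) <= eigval (k-1) * (\<Sum>i<k. (c i)^2)"
  "quad B (lincomb k c eigf) = (\<Sum>i<k. (c i)^2)"
proof -
 have "quad a (lincomb k c eigf) = (\<Sum>i<k. \<Sum>j<k. if j = i then eigval i * (c i)^2 else 0)"
  by (subst A.B_lincomb2) (simp, intro sum.cong refl, auto simp: eigf_eq eigf_orth power2_eq_square)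
 also have "... = (\<Sum>i<k. eigval i * (c i)^2)" by simp
 also have "... <= (\<Sum>i<k. eigval (k-1) * (c i)^2)"
  using mono_eigval by (intro sum_mono mult_right_mono) (auto simp: mono_def)
 finally show "quad a (lincomb k c eigf) <= eigval (k-1) * (\<Sum>i<k. (c i)^2)"
  by (simp add: sum_distrib_left)
 have "quad B (lincomb k c eigf) = (\<Sum>i<k. \<Sum>j<k. if j = i then (c i)^2 else 0)"
  by (subst b.B_lincomb2) (simp, intro sum.cong refl, auto simp: eigf_orth power2_eq_square)
 then show "quad B (lincomb k c eigf) = (\<Sum>i<k. (c i)^2)" by simp
qed

end

text \<open>Meant for the Gram matrices of approximated eigenfunctions; estimating mixed products by
  \<open>2 * \<bar>c i\<bar> * \<bar>c j\<bar> <= (c i)^2 + (c j)^2\<close> costs the factor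
  \<open>k\<close>.\<close>

lemma quadratic_perturbation:
 fixes M N :: "nat => nat => real"
 assumes "!!i j. i < k ==> j < k ==> \<bar>M i j - N i j\<bar> <= et"
 shows "\<bar>(\<Sum>i<k. \<Sum>j<k. c i * c j * M i j) - (\<Sum>i<k. \<Sum>j<k. c i * c j * N i j)\<bar> <= et * k * (\<Sum>i<k. (c i)^2)"
proof -
 have "\<bar>(\<Sum>i<k. \<Sum>j<k. c i * c j * M i j) - (\<Sum>i<k. \<Sum>j<k. c i * c j * N i j)\<bar>
   = \<bar>\<Sum>i<k. \<Sum>j<k. c i * c j * (M i j - N i j)\<bar>"
  by (simp add: sum_subtractf algebra_simps)
 also have "... <= (\<Sum>i<k. \<Sum>j<k. \<bar>c i\<bar> * \<bar>c j\<bar> * et)"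
  by (intro order_trans[OF sum_abs] sum_mono order_trans[OF sum_abs])
   (auto simp: abs_mult intro!: mult_left_mono assms)
 also have "... <= (\<Sum>i<k. \<Sum>j<k. ((c i)^2 + (c j)^2) / 2 * et)"
 proof (intro sum_mono mult_right_mono)
  fix i j assume ij: "i : {..<k}" "j : {..<k}"
  show "\<bar>c i\<bar> * \<bar>c j\<bar> <= ((c i)^2 + (c j)^2) / 2"
   using zero_le_power2[of "\<bar>c i\<bar> - \<bar>c j\<bar>"] by (simp add: power2_diff)
  show "0 <= et" using assms[of i j] ij by auto
 qed
 also have "... = et * k * (\<Sum>i<k. (c i)^2)"
  by (simp add: sum.distrib add_divide_distrib distrib_right sum_distrib_left sum_distrib_right algebra_simps sum_divide_distrib[symmetric])
 finally show ?thesis .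
qed

context spectral
begin

text \<open>The comparison estimates are available only on a core \<open>C\<close> of test
  functions. Approximating the first \<open>k\<close> eigenfunctions there nearly preserves both
  Gram matrices, hence the Rayleigh quotient on the whole span; the last conjunct keeps the
  approximants independent.\<close>

lemma core_approx:
 assumes dense: "!!u ep. u : D ==> ep > 0 ==> EX ph:C. quad a (%x. ph x - u x) + L2_sq U (%x. ph x - u x) < ep"
  and CD: "C <= D" and "ep > 0"
 shows "EX v. (ALL i<k. v i : C) & (ALL c. quad a (lincomb k c v) <=
   (kth_eigenvalue U D a k + ep) * L2_sq U (lincomb k c v)) &
   (ALL c. L2_sq U (lincomb k c v) >= (\<Sum>i<k. (c i)^2) / 2)"
proof -
 define L where "L = eigval (k - 1)"
 have L: "L > 0" by (simp add: L_def eigval_pos)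
 have "EX w. ALL n. w n : C & quad a (%x. w n x - u x) + quad B (%x. w n x - u x) < 1 / Suc n"
  if "u : D" for u
 proof -
  have "EX ph. ph : C & quad a (%x. ph x - u x) + L2_sq U (%x. ph x - u x) < 1 / Suc n" for n :: nat
   using dense[OF that, of "1 / Suc n"] by (auto simp: Bex_def)
  then show ?thesis by (intro choice allI)
 qed
 then have "ALL i. EX w. ALL n. w n : C & quad a (%x. w n x - eigf i x) + quad B (%x. w n x - eigf i x) < 1 / Suc n"
  using eigf_D by blast
 from choice[OF this] obtain w where w': "ALL i. ALL n. w i n : C & quad a (%x. w i n x - eigf i x) + quad B (%x. w i n x - eigf i x) < 1 / Suc n"
  by (elim exE)
 then have w: "w i n : C"
   "quad a (%x. w i n x - eigf i x) + quad B (%x. w i n x - eigf i x) < 1 / Suc n" for i n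
  by blast+
 have wD: "w i n : D" for i n using w CD by auto
 have lim1: "(%n. 1 / real (Suc n)) ----> 0" by (rule LIMSEQ_Suc[OF lim_1_over_n])
 have la: "(%n. quad a (%x. w i n x - eigf i x)) ----> 0" for i
 proof (rule Lim_null_comparison[OF _ lim1], intro always_eventually allI)
  fix n show "norm (quad a (%x. w i n x - eigf i x)) <= 1 / real (Suc n)"
   using w(2)[of i n] A.nonneg[OF A.diff[OF wD[of i n] eigf_D[of i]]] b.nonneg[OF A.diff[OF wD[of i n] eigf_D[of i]]] by simp
 qed
 have lb: "(%n. quad B (%x. w i n x - eigf i x)) ----> 0" for i
 proof (rule Lim_null_comparison[OF _ lim1], intro always_eventually allI)
  fix n show "norm (quad B (%x. w i n x - eigf i x)) <= 1 / real (Suc n)"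
   using w(2)[of i n] A.nonneg[OF A.diff[OF wD[of i n] eigf_D[of i]]] b.nonneg[OF A.diff[OF wD[of i n] eigf_D[of i]]] by simp
 qed
 have bil: "(%n. F (w i n) (w j n)) ----> F (eigf i) (eigf j)"
  if "semi_inner D F" and l: "!!i. (%n. F (%x. w i n x - eigf i x) (%x. w i n x - eigf i x)) ----> 0" for F i j
 proof -
  interpret F: semi_inner D F by fact
  \<comment> \<open>Expansion around the limits: the first two terms are linear in the approximants,
    so only the product of the two errors needs Cauchy-Schwarz.\<close>
  have e: "F (w i n) (w j n) = F (w i n) (eigf j) + F (w j n) (eigf i) - F (eigf i) (eigf j)
    + F (%x. w i n x - eigf i x) (%x. w j n x - eigf j x)" for n
  proof -
   have d: "(%x. w j n x - eigf j x) : D" by (simp add: F.diff wD)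
   have "F (%x. w i n x - eigf i x) (%x. w j n x - eigf j x) = F (w i n) (%x. w j n x - eigf j x) - F (eigf i) (%x. w j n x - eigf j x)"
    by (rule F.B_diff) (simp_all add: d wD)
   also have "... = F (%x. w j n x - eigf j x) (w i n) - F (%x. w j n x - eigf j x) (eigf i)"
    by (simp add: F.sym d wD)
   finally show ?thesis
    using F.sym[OF wD[of i n] wD[of j n]] F.sym[OF wD[of i n] eigf_D[of j]] F.sym[OF eigf_D[of i] eigf_D[of j]] by (simp add: F.B_diff wD)
  qed
  have z: "(%n. F (%x. w i n x - eigf i x) (%x. w j n x - eigf j x)) ----> 0"
  proof (rule Lim_null_comparison)
   show "(%n. sqrt (F (%x. w i n x - eigf i x) (%x. w i n x - eigf i x)) * sqrt (F (%x. w j n x - eigf j x) (%x. w j n x - eigf j x))) ----> 0"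
    using tendsto_mult[OF tendsto_real_sqrt[OF l] tendsto_real_sqrt[OF l]] by simp
   show "\<forall>\<^sub>F n in sequentially. norm (F (%x. w i n x - eigf i x) (%x. w j n x - eigf j x)) <=
     sqrt (F (%x. w i n x - eigf i x) (%x. w i n x - eigf i x)) * sqrt (F (%x. w j n x - eigf j x) (%x. w j n x - eigf j x))"
    by (intro always_eventually allI) (simp add: F.abs_le_sqrt F.diff wD)
  qed
  have "(%n. F (w i n) (w j n)) ----> F (eigf i) (eigf j) + F (eigf j) (eigf i) - F (eigf i) (eigf j) + 0"
   unfolding e by (intro tendsto_intros F.tendsto_B z l wD eigf_D)
  then show ?thesis using F.sym[of "eigf i" "eigf j"] by simp
 qed
 have ba: "(%n. a (w i n) (w j n)) ----> a (eigf i) (eigf j)" for i j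
  by (rule bil[where F = a, OF A.semi_inner_axioms la])
 have bb: "(%n. B (w i n) (w j n)) ----> B (eigf i) (eigf j)" for i j
  by (rule bil[where F = B, OF b.semi_inner_axioms lb])
 \<comment> \<open>The first bound keeps half of the mass. The second gives
   \<open>et * k * (1 + L + ep) <= ep\<close>, which is what
   \<open>L + et * k <= (L + ep) * (1 - et * k)\<close> amounts to. Dividing by \<open>k + 1\<close>
   covers \<open>k = 0\<close>.\<close>
 define et where "et = min (1/2) (ep / (4 * (1 + L + ep))) / (k + 1)"
 have et: "et > 0" using \<open>ep > 0\<close> L by (simp add: et_def)
 have "\<forall>\<^sub>F n in sequentially. ALL i:{..<k}. ALL j:{..<k}. \<bar>a (w i n) (w j n) - a (eigf i) (eigf j)\<bar> < et & \<bar>B (w i n) (w j n) - B (eigf i) (eigf j)\<bar> < et"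
  using tendstoD[OF ba et] tendstoD[OF bb et]
  by (intro eventually_ball_finite ballI eventually_conj) (auto simp: dist_real_def)
 from eventually_happens'[OF sequentially_bot this] obtain n where
  n': "ALL i:{..<k}. ALL j:{..<k}. \<bar>a (w i n) (w j n) - a (eigf i) (eigf j)\<bar> < et & \<bar>B (w i n) (w j n) - B (eigf i) (eigf j)\<bar> < et"
  by (elim exE)
 have n: "\<bar>a (w i n) (w j n) - a (eigf i) (eigf j)\<bar> <= et" "\<bar>B (w i n) (w j n) - B (eigf i) (eigf j)\<bar> <= et"
  if "i < k" "j < k" for i j
  using n' that by (auto intro: less_imp_le)
 define v where "v i = w i n" for i
 have k1: "real k / (k+1) <= 1" by simp
 have etk: "et * k <= 1/2" "et * k <= ep / (4 * (1 + L + ep))"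
 proof -
  have "et * k = min (1/2) (ep / (4 * (1 + L + ep))) * (k / (k+1))" by (simp add: et_def)
  also have "... <= min (1/2) (ep / (4 * (1 + L + ep))) * 1"
   using k1 L \<open>ep > 0\<close> by (intro mult_left_mono) auto
  finally show "et * k <= 1/2" "et * k <= ep / (4 * (1 + L + ep))" by auto
 qed
 have "quad a (lincomb k c v) <= (L + ep) * quad B (lincomb k c v) &
   quad B (lincomb k c v) >= (\<Sum>i<k. (c i)^2) / 2" for c
 proof -
  define s where "s = (\<Sum>i<k. (c i)^2)"
  have s: "s >= 0" by (simp add: s_def sum_nonneg)
  have "\<bar>a (lincomb k c v) (lincomb k c v) - quad a (lincomb k c eigf)\<bar> <= et * k * s"
   unfolding s_def by (subst (1 2) A.B_lincomb2) (auto simp: v_def wD intro!: quadratic_perturbation n)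
  then have 1: "quad a (lincomb k c v) <= (L + et * k) * s"
   using Rayleigh_eigf(1)[of c k] by (simp add: L_def s_def algebra_simps)
  have "\<bar>B (lincomb k c v) (lincomb k c v) - quad B (lincomb k c eigf)\<bar> <= et * k * s"
   unfolding s_def by (subst (1 2) b.B_lincomb2) (auto simp: v_def wD intro!: quadratic_perturbation n)
  then have 2: "quad B (lincomb k c v) >= (1 - et * k) * s"
   using Rayleigh_eigf(2)[of c k] by (simp add: s_def algebra_simps)
  have "et * k * (4 * (1 + L + ep)) <= ep" using etk(2) L \<open>ep > 0\<close> by (simp add: field_simps)
  then have "4 * (et * k * (1 + L + ep)) <= ep" by (simp only: mult_ac)
  moreover have "0 <= et * k * (1 + L + ep)" using et L \<open>ep > 0\<close> by simp
  ultimately have "et * k * (1 + L + ep) <= ep" by linarith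
  then have "L + et * k <= (L + ep) * (1 - et * k)" by (simp add: algebra_simps)
  then have "(L + et * k) * s <= (L + ep) * ((1 - et * k) * s)"
   using mult_right_mono[OF _ s] by (simp only: mult.assoc[symmetric])
  also have "... <= (L + ep) * quad B (lincomb k c v)"
   using 2 L \<open>ep > 0\<close> by (intro mult_left_mono) auto
  finally have "quad a (lincomb k c v) <= (L + ep) * quad B (lincomb k c v)" using 1 by simp
  moreover have "s / 2 <= (1 - et * k) * s" using mult_right_mono[OF _ s, of "1/2" "1 - et * k"] etk(1) by simp
  ultimately show ?thesis using 2 unfolding s_def by simp
 qed
 then show ?thesis using w(1) by (intro exI[of _ v]) (auto simp: kth_eq L_def v_def)
qed

end

subsection \<open>Smooth functions and test functions\<close>

lemma partial_deriv_eq: "(f has_derivative D) (at x) ==> pd f i x = D i"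
 using frechet_derivative_at[of f D x] by (simp add: partial_deriv_def)

lemma partial_deriv_real: "(f has_real_derivative d) (at x) ==> pd f 1 x = d"
 by (simp add: has_field_derivative_def partial_deriv_eq)

lemma C_k_continuous: "C_k n f ==> continuous_on UNIV f"
 by (cases n) (auto intro: differentiable_imp_continuous_on)

lemma C_k_SucD: "C_k (Suc n) f ==> C_k n f"
proof (induction n arbitrary: f)
 case 0
 then show ?case by (auto intro: differentiable_imp_continuous_on)
qed auto

lemma C_k_has_derivative:
 assumes "C_k (Suc n) f"
 shows "(f has_derivative frechet_derivative f (at x)) (at x)"
 using assms frechet_derivative_works by (auto simp: differentiable_on_def)

lemma C_k_SucI:
 assumes "!!x. (f has_derivative D x) (at x)" "!!i. i : Basis ==> C_k n (%x. D x i)"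
 shows "C_k (Suc n) f"
proof -
 have "pd f i = (%x. D x i)" for i using partial_deriv_eq[OF assms(1)] by auto
 moreover have "f differentiable_on UNIV" using assms(1) by (auto simp: differentiable_on_def differentiable_def)
 ultimately show ?thesis using assms(2) by simp
qed

lemma C_k_const [simp]: "C_k n (%x. c)"
proof (induction n arbitrary: c)
 case (Suc n)
 show ?case by (rule C_k_SucI[where D = "%_ _. 0"]) (auto intro: Suc)
qed simp

lemma C_k_bounded_linear: "bounded_linear f ==> C_k n f"
proof (cases n)
 case 0
 then show "bounded_linear f ==> C_k n f" by (simp add: linear_continuous_on)
next
 case (Suc m)
 assume "bounded_linear f"
 then show ?thesis unfolding Suc by (intro C_k_SucI[where D = "%_. f"]) (auto intro: bounded_linear_imp_has_derivative)
qed

lemma C_k_add: "C_k n f ==> C_k n g ==> C_k n (%x. f x + g x)"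
proof (induction n arbitrary: f g)
 case 0
 then show ?case by (auto intro: continuous_intros)
next
 case (Suc n)
 show ?case
  by (rule C_k_SucI[OF has_derivative_add[OF C_k_has_derivative[OF Suc.prems(1)] C_k_has_derivative[OF Suc.prems(2)]]])
   (use Suc in "auto simp: partial_deriv_def[abs_def]")
qed

lemma C_k_mult: "C_k n f ==> C_k n g ==> C_k n (%x. f x * g x)"
proof (induction n arbitrary: f g)
 case 0
 then show ?case by (auto intro: continuous_intros)
next
 case (Suc n)
 have "C_k n (%x. f x * frechet_derivative g (at x) i + frechet_derivative f (at x) i * g x)" if "i : Basis" for i
  using Suc that C_k_SucD[OF Suc.prems(1)] C_k_SucD[OF Suc.prems(2)]
  by (intro C_k_add Suc.IH) (auto simp: partial_deriv_def[abs_def])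
 then show ?case
  by (intro C_k_SucI[OF has_derivative_mult[OF C_k_has_derivative[OF Suc.prems(1)] C_k_has_derivative[OF Suc.prems(2)]]])
qed

lemma C_k_compose:
 fixes F :: "real => real"
 shows "C_k n F ==> C_k n g ==> C_k n (%x. F (g x))"
proof (induction n arbitrary: F g)
 case 0
 then show ?case by (auto intro: continuous_on_compose2)
next
 case (Suc n)
 have d: "((%x. F (g x)) has_derivative (%i. pd F 1 (g x) * frechet_derivative g (at x) i)) (at x)" for x
 proof -
  have "linear (frechet_derivative F (at (g x)))"
   using C_k_has_derivative[OF Suc.prems(1)] has_derivative_linear by blast
  then have "frechet_derivative F (at (g x)) h = pd F 1 (g x) * h" for h
   using linear_cmul[of "frechet_derivative F (at (g x))" h 1] by (simp add: partial_deriv_def)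
  then show ?thesis
   using has_derivative_compose[OF C_k_has_derivative[OF Suc.prems(2), of x] C_k_has_derivative[OF Suc.prems(1), of "g x"]] by simp
 qed
 have "C_k n (%x. pd F 1 (g x) * frechet_derivative g (at x) i)" if "i : Basis" for i
 proof (rule C_k_mult)
  show "C_k n (%x. pd F 1 (g x))"
   by (rule Suc.IH[OF _ C_k_SucD[OF Suc.prems(2)]]) (use Suc.prems(1) in auto)
  show "C_k n (%x. frechet_derivative g (at x) i)"
   using Suc.prems(2) that by (auto simp: partial_deriv_def[abs_def])
 qed
 then show ?case by (intro C_k_SucI[OF d])
qed

lemma C_k_sum: "(!!i. i : A ==> C_k n (f i)) ==> C_k n (%x. \<Sum>i\<in>A. f i x)"
 by (induction A rule: infinite_finite_induct) (auto intro: C_k_add)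

lemma C_k_prod: "(!!i. i : A ==> C_k n (f i)) ==> C_k n (%x. \<Prod>i\<in>A. f i x)"
 by (induction A rule: infinite_finite_induct) (auto intro: C_k_mult)

lemma C_k_cmult: "C_k n f ==> C_k n (%x. c * f x)"
 by (rule C_k_mult) auto

lemma C_k_diff: "C_k n f ==> C_k n g ==> C_k n (%x. f x - g x)"
 using C_k_add[of n f "%x. (-1) * g x"] C_k_cmult[of n g "-1"] by simp

lemma C_k_powr: "C_k n f ==> (!!x. f x > 0) ==> C_k n (%x. f x powr a)"
proof (induction n arbitrary: a)
 case 0
 then show ?case by (auto intro!: continuous_intros simp: less_imp_neq[symmetric])
next
 case (Suc n)
 have d: "((%x. f x powr a) has_derivative (%i. a * f x powr (a - 1) * frechet_derivative f (at x) i)) (at x)" for x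
 proof -
  have "((%y. y powr a) has_derivative (%h. a * f x powr (a - 1) * h)) (at (f x))"
   using has_real_derivative_powr[OF Suc.prems(2)[of x], of a] by (simp add: has_field_derivative_def)
  then show ?thesis using has_derivative_compose[OF C_k_has_derivative[OF Suc.prems(1)]] by blast
 qed
 have "C_k n (%x. a * f x powr (a - 1) * frechet_derivative f (at x) i)" if "i : Basis" for i
 proof (intro C_k_mult C_k_const)
  show "C_k n (%x. f x powr (a - 1))"
   by (rule Suc.IH[OF C_k_SucD[OF Suc.prems(1)] Suc.prems(2)])
  show "C_k n (%x. frechet_derivative f (at x) i)"
   using Suc.prems(1) that by (auto simp: partial_deriv_def[abs_def])
 qed
 then show ?case by (intro C_k_SucI[OF d])
qed

lemma C_k_compose_affine:
 fixes L :: "'a::euclidean_space => 'b::euclidean_space"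
 assumes L: "bounded_linear L"
 shows "C_k n f ==> C_k n (%x. f (L x + c))"
proof (induction n arbitrary: f)
 case 0
 have "continuous_on UNIV (%x. L x + c)" by (intro continuous_intros linear_continuous_on L)
 then show ?case using 0 continuous_on_compose2[of UNIV f UNIV "%x. L x + c"] by auto
next
 case (Suc n)
 have dL: "((%x. L x + c) has_derivative L) (at x)" for x
  using bounded_linear_imp_has_derivative[OF L] by (auto intro!: derivative_eq_intros)
 have d: "((%x. f (L x + c)) has_derivative (%i. \<Sum>j\<in>Basis. (L i \<bullet> j) * pd f j (L x + c))) (at x)" for x
 proof -
  have lin: "linear (frechet_derivative f (at (L x + c)))"
   using C_k_has_derivative[OF Suc.prems] has_derivative_linear by blast
  have "frechet_derivative f (at (L x + c)) y = (\<Sum>j\<in>Basis. (y \<bullet> j) * pd f j (L x + c))" for y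
  proof -
   have "frechet_derivative f (at (L x + c)) y = frechet_derivative f (at (L x + c)) (\<Sum>j\<in>Basis. (y \<bullet> j) *\<^sub>R j)"
    by (simp add: euclidean_representation)
   then show ?thesis by (simp add: linear_sum[OF lin] linear_cmul[OF lin] partial_deriv_def)
  qed
  then show ?thesis
   using has_derivative_compose[OF dL[of x] C_k_has_derivative[OF Suc.prems, of "L x + c"]] by simp
 qed
 have "C_k n (%x. \<Sum>j\<in>Basis. (L i \<bullet> j) * pd f j (L x + c))" for i
  using Suc by (intro C_k_sum C_k_cmult Suc.IH) auto
 then show ?case by (intro C_k_SucI[OF d])
qed

section \<open>Smooth cut-off functions\<close>

definition flat :: "real poly => real => real" where
 "flat p x = (if x > 0 then poly p (1 / x) * exp (- (1 / x)) else 0)"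

lemma poly_times_exp_tendsto_0: "((%z. poly p z * exp (- z)) \<longlongrightarrow> 0) at_top" for p :: "real poly"
proof -
 have "((%z. \<Sum>i\<le>degree p. coeff p i * (z ^ i / exp z)) \<longlongrightarrow> (\<Sum>i\<le>degree p. coeff p i * 0)) at_top"
  by (intro tendsto_intros tendsto_power_div_exp_0)
 moreover have "(%z. \<Sum>i\<le>degree p. coeff p i * (z ^ i / exp z)) = (%z. poly p z * exp (- z))"
  by (auto simp: poly_altdef exp_minus field_simps sum_divide_distrib sum_distrib_left)
 ultimately show ?thesis by simp
qed

lemma flat_tendsto_0: "(flat p \<longlongrightarrow> 0) (at 0)"
proof -
 have inv: "filterlim (%x::real. 1 / x) at_top (at_right 0)"
  using filterlim_inverse_at_top_right by (simp add: inverse_eq_divide)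
 have r: "((%x. poly p (1 / x) * exp (- (1 / x))) \<longlongrightarrow> 0) (at_right 0)"
  by (rule filterlim_compose[OF poly_times_exp_tendsto_0 inv])
 have "(flat p \<longlongrightarrow> 0) (at_right 0)"
  by (rule Lim_transform_eventually[OF r]) (auto simp: flat_def eventually_at_filter)
 moreover have "(flat p \<longlongrightarrow> 0) (at_left 0)"
  by (rule Lim_transform_eventually[OF tendsto_const]) (auto simp: flat_def eventually_at_filter)
 ultimately show ?thesis by (simp add: filterlim_split_at)
qed

text \<open>A polynomial in \<open>1 / x\<close> is carried along as parameter to close the family
  under differentiation: for \<open>x > 0\<close> the chain and product rules produce the new
  polynomial, and at \<open>0\<close> every member is flat. Smoothness of all orders is then a
  single induction.\<close>

lemma flat_deriv:
 "(flat p has_real_derivative flat ([:0, 0, 1:] * (p - pderiv p)) x) (at x)"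
proof (cases x "0 :: real" rule: linorder_cases)
 case less
 have "(flat p has_real_derivative 0) (at x)"
  by (rule has_field_derivative_transform_within_open[where S = "{..<0}", OF DERIV_const[of 0]]) (use less in "auto simp: flat_def")
 then show ?thesis using less by (simp add: flat_def)
next
 case equal
 \<comment> \<open>The difference quotient of \<open>flat p\<close> at \<open>0\<close> is again a
   member of the family: the division by \<open>h\<close> adds one power of \<open>1 / h\<close>,
   which is \<open>pCons 0\<close>.\<close>
 have "((%h. flat (pCons 0 p) h) \<longlongrightarrow> 0) (at 0)" by (rule flat_tendsto_0)
 then have "((%h. (flat p (0 + h) - flat p 0) / h) \<longlongrightarrow> 0) (at 0)"
  by (rule Lim_transform_eventually) (auto simp: flat_def eventually_at_filter divide_simps)
 then show ?thesis using equal by (simp add: DERIV_def flat_def)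
next
 case greater
 have "((%x. poly p (1 / x) * exp (- (1 / x))) has_real_derivative
   (poly (pderiv p) (1 / x) * (- (1 / x^2))) * exp (- (1 / x)) + poly p (1 / x) * (exp (- (1 / x)) * (1 / x^2))) (at x)"
  using greater by (auto intro!: derivative_eq_intros DERIV_chain'[OF _ poly_DERIV] simp: power2_eq_square field_simps)
 then have "(flat p has_real_derivative
   (poly (pderiv p) (1 / x) * (- (1 / x^2))) * exp (- (1 / x)) + poly p (1 / x) * (exp (- (1 / x)) * (1 / x^2))) (at x)"
  by (rule has_field_derivative_transform_within_open[where S = "{0<..}"]) (use greater in "auto simp: flat_def")
 then show ?thesis using greater by (simp add: flat_def field_simps power2_eq_square)
qed

lemma C_k_SucI_real:
 fixes f :: "real => real"
 assumes "!!x. (f has_real_derivative f' x) (at x)" "C_k n f'"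
 shows "C_k (Suc n) f"
 by (rule C_k_SucI[where D = "%x. (*) (f' x)"]) (use assms in "auto simp: has_field_derivative_def")

lemma C_k_flat: "C_k n (flat p)"
proof (induction n arbitrary: p)
 case 0
 have "isCont (flat p) x" for x using flat_deriv DERIV_isCont by blast
 then show ?case by (simp add: continuous_at_imp_continuous_on)
next
 case (Suc n)
 show ?case by (rule C_k_SucI_real[OF flat_deriv Suc])
qed

text \<open>Equals \<open>0\<close> up to \<open>1\<close> and \<open>1\<close> from
  \<open>2\<close> on. The reciprocal is written with \<open>powr\<close> so that
  \<open>C_k_powr\<close> provides its smoothness.\<close>

definition smoothstep :: "real => real" where
 "smoothstep x = flat 1 (x - 1) * (flat 1 (x - 1) + flat 1 (2 - x)) powr (-1)"

lemma flat_1_pos: "x > 0 ==> flat 1 x > 0" and flat_1_0: "x <= 0 ==> flat 1 x = 0" and flat_1_nonneg: "flat 1 x >= 0"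
 by (auto simp: flat_def)

lemma smoothstep_denominator: "flat 1 (x - 1) + flat 1 (2 - x) > 0"
 using flat_1_pos[of "x - 1"] flat_1_pos[of "2 - x"] flat_1_nonneg[of "x - 1"] flat_1_nonneg[of "2 - x"]
 by (cases "x > 1") auto

lemma C_k_shift: fixes f :: "real => real" shows "C_k n f ==> C_k n (%x. f (a * x + b))"
 using C_k_compose_affine[of "(*) a" n f b] by (simp add: bounded_linear_mult_right)

lemma C_k_smoothstep: "C_k n smoothstep"
proof -
 have "C_k n (%x. flat 1 (1 * x + (-1)))" "C_k n (%x. flat 1 ((-1) * x + 2))"
  by (rule C_k_shift[OF C_k_flat])+
 then have "C_k n (%x. flat 1 (x - 1))" "C_k n (%x. flat 1 (2 - x))" by simp_all
 then show ?thesis unfolding smoothstep_def[abs_def]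
  by (intro C_k_mult C_k_powr C_k_add smoothstep_denominator)
qed

lemma smoothstep_0: "x <= 1 ==> smoothstep x = 0"
 by (simp add: smoothstep_def flat_1_0)

lemma smoothstep_1: "x >= 2 ==> smoothstep x = 1"
 using flat_1_pos[of "x - 1"] by (simp add: smoothstep_def flat_1_0 powr_minus_divide)

lemma smoothstep_range: "0 <= smoothstep x" "smoothstep x <= 1"
 using smoothstep_denominator[of x] flat_1_nonneg[of "x - 1"] flat_1_nonneg[of "2 - x"]
 by (auto simp: smoothstep_def powr_minus_divide)

lemma test_functionI:
 assumes "!!n. C_k n ph" "compact K" "K <= U" "!!x. x ~: K ==> ph x = 0"
 shows "test_function U ph"
proof -
 have "closure {x. ph x ~= 0} <= K"
  using assms by (intro closure_minimal) (auto intro: compact_imp_closed)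
 moreover have "bounded (closure {x. ph x ~= 0})"
  using bounded_subset[OF compact_imp_bounded[OF assms(2)] calculation] .
 then have "compact (closure {x. ph x ~= 0})" by (simp add: compact_eq_bounded_closed)
 moreover have "closure {x. ph x ~= 0} <= U" using calculation(1) assms(3) by (rule subset_trans)
 ultimately show ?thesis using assms(1) unfolding test_function_def by blast
qed

lemma test_functionD:
 assumes "test_function U ph"
 obtains K where "compact K" "K <= U" "!!x. x ~: K ==> ph x = 0"
proof (rule that)
 show "compact (closure {x. ph x ~= 0})" "closure {x. ph x ~= 0} <= U"
  using assms unfolding test_function_def by blast+
 fix x assume *: "x ~: closure {x. ph x ~= 0}"
 show "ph x = 0"
 proof (rule ccontr)
  assume "ph x ~= 0"
  then have "x : closure {x. ph x ~= 0}" by (intro subsetD[OF closure_subset]) simp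
  then show False using * by simp
 qed
qed

lemma test_function_C_k: "test_function U ph ==> C_k n ph"
 by (simp add: test_function_def)

lemma test_function_mono: "test_function U ph ==> U <= V ==> test_function V ph"
 by (auto simp: test_function_def)

lemma test_function_0: "test_function U (%x. 0)"
 by (rule test_functionI[of _ "{}"]) auto

lemma test_function_lin:
 assumes "test_function U ph" "test_function U ps"
 shows "test_function U (%x. c * ph x + d * ps x)"
proof -
 obtain K where K: "compact K" "K <= U" "!!x. x ~: K ==> ph x = 0" using test_functionD[OF assms(1)] by blast
 obtain L where L: "compact L" "L <= U" "!!x. x ~: L ==> ps x = 0" using test_functionD[OF assms(2)] by blast
 show ?thesis by (rule test_functionI[of _ "K \<union> L"])
   (use assms K L in "auto intro!: C_k_add C_k_cmult intro: test_function_C_k")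
qed

lemma partial_deriv_eq_0:
 assumes "closed K" "!!x. x ~: K ==> ph x = 0" "x ~: K"
 shows "pd ph i x = 0"
proof -
 have "(ph has_derivative (%_. 0)) (at x)"
  by (rule has_derivative_transform_within_open[where s = "- K", OF has_derivative_const[of 0]]) (use assms in auto)
 then show ?thesis by (rule partial_deriv_eq)
qed

lemma test_function_partial_deriv:
 assumes "test_function U ph" "i : Basis"
 shows "test_function U (pd ph i)"
proof -
 obtain K where K: "compact K" "K <= U" "!!x. x ~: K ==> ph x = 0" using test_functionD[OF assms(1)] by blast
 have "C_k n (pd ph i)" for n using test_function_C_k[OF assms(1), of "Suc n"] assms(2) by simp
 then show ?thesis
  by (rule test_functionI[OF _ K(1,2)]) (use K in "auto intro: partial_deriv_eq_0 compact_imp_closed")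
qed

text \<open>Smooth and positive exactly on the open box; it yields approximate indicators of boxes
  and independent families of test functions.\<close>

definition box_bump :: "'a::euclidean_space => 'a => 'a => real" where
 "box_bump a b x = (\<Prod>i\<in>Basis. flat 1 (x \<bullet> i - a \<bullet> i) * flat 1 (b \<bullet> i - x \<bullet> i))"

lemma C_k_box_bump: "C_k n (box_bump a b)"
proof -
 have "C_k n (%x::'a. x \<bullet> i)" for i by (rule C_k_bounded_linear[OF bounded_linear_inner_left])
 then show ?thesis unfolding box_bump_def[abs_def]
  by (intro C_k_prod C_k_mult C_k_compose[OF C_k_flat] C_k_diff) auto
qed

lemma box_bump_pos_iff: "box_bump a b x > 0 \<longleftrightarrow> x : box a b" and box_bump_nonneg: "box_bump a b x >= 0"
proof -
 show n: "box_bump a b x >= 0" by (auto simp: box_bump_def intro!: prod_nonneg mult_nonneg_nonneg flat_1_nonneg)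
 have "box_bump a b x ~= 0 \<longleftrightarrow> x : box a b"
  by (auto simp: box_bump_def mem_box flat_def)
 then show "box_bump a b x > 0 \<longleftrightarrow> x : box a b" using n by (metis less_le)
qed

lemma test_function_box_bump:
 assumes "cbox a b <= U"
 shows "test_function U (box_bump a b)"
proof (rule test_functionI[OF C_k_box_bump compact_cbox assms])
 fix x assume "x ~: cbox a b"
 then have "x ~: box a b" using box_subset_cbox by blast
 then have "~ 0 < box_bump a b x" using box_bump_pos_iff[of a b x] by blast
 then show "box_bump a b x = 0" using box_bump_nonneg[of a b x] by linarith
qed

text \<open>At a point of the open box \<open>real n * box_bump a b x\<close> eventually exceeds
  \<open>2\<close>, where \<open>smoothstep\<close> is \<open>1\<close>. The bound by the closed box
  supplies the domination for passing to the limit in integrals.\<close>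

lemma test_function_box_indicator:
 fixes a b :: "'a::euclidean_space"
 assumes "cbox a b <= U"
 shows "test_function U (%x. smoothstep (real n * box_bump a b x))"
  "\<bar>smoothstep (real n * box_bump a b x)\<bar> <= indicator (cbox a b) x"
  "(%n. smoothstep (real n * box_bump a b x)) ----> indicator (box a b) x"
proof -
 have z: "box_bump a b x = 0" if "x ~: box a b" for x
 proof -
  have "~ 0 < box_bump a b x" using that box_bump_pos_iff[of a b x] by blast
  then show ?thesis using box_bump_nonneg[of a b x] by linarith
 qed
 have z': "smoothstep (real n * box_bump a b x) = 0" if "x ~: cbox a b" for n x
 proof -
  have "x ~: box a b" using that box_subset_cbox[of a b] by blast
  then show ?thesis by (simp add: z smoothstep_0)
 qed
 show "test_function U (%x. smoothstep (real n * box_bump a b x))"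
  by (rule test_functionI[OF C_k_compose[OF C_k_smoothstep C_k_cmult[OF C_k_box_bump]] compact_cbox assms z'])
 show "\<bar>smoothstep (real n * box_bump a b x)\<bar> <= indicator (cbox a b) x"
  using smoothstep_range[of "real n * box_bump a b x"] z'[of x n] by (cases "x : cbox a b") auto
 show "(%n. smoothstep (real n * box_bump a b x)) ----> indicator (box a b) x"
 proof (cases "x : box a b")
  case True
  then have p: "box_bump a b x > 0" by (simp add: box_bump_pos_iff)
  obtain N :: nat where N: "real N > 2 / box_bump a b x" using reals_Archimedean2 by blast
  have "\<forall>\<^sub>F n in sequentially. smoothstep (real n * box_bump a b x) = 1"
  proof (rule eventually_sequentiallyI[of N])
   fix n assume "n >= N"
   then have "2 / box_bump a b x <= real n" using N by linarith
   then show "smoothstep (real n * box_bump a b x) = 1" using p by (intro smoothstep_1) (simp add: field_simps)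
  qed
  then show ?thesis using True by (simp add: tendsto_eventually)
 qed (simp add: z smoothstep_0)
qed

subsection \<open>Weak derivatives\<close>

text \<open>The definitions integrate over \<open>lebesgue_on U\<close>, whereas Fubini and the
  fundamental theorem of calculus are applied over \<open>lborel\<close>. For Borel functions
  vanishing outside \<open>U\<close>, this lemma and the next make the integrals
  interchangeable.\<close>

lemma lebesgue_on_support:
 fixes f :: "'a::euclidean_space => real"
 assumes "U : sets lebesgue" "!!x. x ~: U ==> f x = 0"
 shows "integrable (lebesgue_on U) f \<longleftrightarrow> integrable lebesgue f"
  "integral\<^sup>L (lebesgue_on U) f = integral\<^sup>L lebesgue f"
proof -
 have "(%x. indicator U x *\<^sub>R f x) = f" using assms(2) by (auto simp: indicator_def of_bool_def fun_eq_iff)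
 then show "integrable (lebesgue_on U) f \<longleftrightarrow> integrable lebesgue f"
  "integral\<^sup>L (lebesgue_on U) f = integral\<^sup>L lebesgue f"
  using assms(1) by (simp_all add: integrable_restrict_space integral_restrict_space)
qed

lemma lebesgue_lborel:
 fixes f :: "'a::euclidean_space => real"
 assumes "f : borel_measurable borel"
 shows "integrable lebesgue f \<longleftrightarrow> integrable lborel f" "integral\<^sup>L lebesgue f = integral\<^sup>L lborel f"
 using assms by (simp_all add: integrable_completion integral_completion)

lemma open_sets_lebesgue: "open U ==> U : sets lebesgue"
 by (simp add: borel_open)

text \<open>Integrability of an almost everywhere limit comes together with the bound; in this way
  weighted norms pass to limits without prior convergence in the weighted space.\<close>

lemma Fatou_real:
 fixes u :: "nat => 'a => real"
 assumes "!!k. integrable M (u k)" "!!k x. u k x >= 0" "!!k. integral\<^sup>L M (u k) <= C"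
  "f : borel_measurable M" "AE x in M. (%k. u k x) ----> f x"
 shows "integrable M f" "integral\<^sup>L M f <= C"
proof -
 have "0 <= integral\<^sup>L M (u 0)" by (rule lebesgue_nonneg) (simp add: assms(2))
 then have C: "C >= 0" using assms(3)[of 0] by simp
 have m [measurable]: "u k : borel_measurable M" for k using assms(1) by auto
 have f0: "AE x in M. f x >= 0" using assms(5)
  by eventually_elim (rule LIMSEQ_le_const, auto simp: assms(2))
 have "(\<integral>\<^sup>+x. ennreal (f x) \<partial>M) = (\<integral>\<^sup>+x. liminf (%k. ennreal (u k x)) \<partial>M)"
  by (rule nn_integral_cong_AE) (use assms(5) in "eventually_elim, auto intro!: lim_imp_Liminf[symmetric] tendsto_ennrealI")
 also have "... <= liminf (%k. \<integral>\<^sup>+x. ennreal (u k x) \<partial>M)"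
  by (rule nn_integral_liminf) measurable
 also have "... <= liminf (%k::nat. ennreal C)"
  by (rule Liminf_mono) (auto simp: nn_integral_eq_integral assms intro!: always_eventually ennreal_leI)
 finally have le: "(\<integral>\<^sup>+x. ennreal (f x) \<partial>M) <= ennreal C" by (simp add: Liminf_const)
 show "integrable M f" by (rule integrableI_nonneg) (use assms f0 le in "auto intro: le_less_trans")
 then show "integral\<^sup>L M f <= C" using le f0 C by (simp add: nn_integral_eq_integral)
qed

lemma continuous_compact_support:
 fixes f :: "'a::euclidean_space => real"
 assumes "continuous_on UNIV f" "compact K" "!!x. x ~: K ==> f x = 0"
 shows "integrable lborel f" "EX M>=0. ALL x. \<bar>f x\<bar> <= M"
proof -
 have "bounded (f ` K)" using assms by (intro compact_imp_bounded compact_continuous_image continuous_on_subset[OF assms(1)]) auto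
 then obtain M where M: "ALL x:K. norm (f x) <= M" by (auto simp: bounded_iff)
 then have M': "\<bar>f x\<bar> <= max M 0" for x using assms(3)[of x] by (cases "x : K") (auto simp: le_max_iff_disj)
 then show "EX M>=0. ALL x. \<bar>f x\<bar> <= M" by (intro exI[of _ "max M 0"]) auto
 have fm: "f : borel_measurable borel" using assms(1) by (rule borel_measurable_continuous_onI)
 show "integrable lborel f"
 proof (rule lebesgue_bound)
  show "integrable lborel (%x. max M 0 * indicator K x)"
   using assms(2) emeasure_bounded_finite[of K] by (auto intro!: integrable_mult_right integrable_real_indicator borel_compact simp: compact_imp_bounded)
  show "AE x in lborel. norm (f x) <= norm (max M 0 * indicator K x)"
   using M' assms(3) by (auto simp: indicator_def of_bool_def fun_eq_iff)
 qed (use fm in simp)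
qed

lemma integral_lborel_shift:
 fixes f :: "'a::euclidean_space => real"
 assumes "f : borel_measurable borel"
 shows "(LBINT x. f (c + x)) = integral\<^sup>L lborel f"
proof -
 have "integral\<^sup>L (distr lborel borel ((+) c)) f = (LBINT x. f (c + x))"
  using assms by (intro integral_distr) auto
 then show ?thesis by (simp add: lborel_distr_plus)
qed

lemma DERIV_along_line:
 assumes "C_k (Suc n) f"
 shows "((%s. f (x + s *\<^sub>R i)) has_real_derivative pd f i (x + s *\<^sub>R i)) (at s)"
proof -
 have "((%s. x + s *\<^sub>R i) has_derivative (%h. h *\<^sub>R i)) (at s)"
  by (auto intro!: derivative_eq_intros)
 from has_derivative_compose[OF this C_k_has_derivative[OF assms, of "x + s *\<^sub>R i"]]
 have "((%s. f (x + s *\<^sub>R i)) has_derivative (%h. frechet_derivative f (at (x + s *\<^sub>R i)) (h *\<^sub>R i))) (at s)" .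
 moreover have "linear (frechet_derivative f (at (x + s *\<^sub>R i)))"
  using C_k_has_derivative[OF assms] has_derivative_linear by blast
 moreover have "(%h. h * c) = (*) c" for c :: real by (auto simp: mult.commute)
 ultimately show ?thesis
  by (simp add: has_field_derivative_def partial_deriv_def linear_cmul)
qed

text \<open>Difference quotients have integral \<open>0\<close> by translation invariance. The mean
  value theorem bounds them uniformly and one compact set carries them all, so dominated convergence
  applies.\<close>

lemma integral_partial_deriv_eq_0:
 fixes ps :: "'a::euclidean_space => real"
 assumes C: "C_k 1 ps" and K: "compact K" "!!x. x ~: K ==> ps x = 0" and i: "i : Basis"
 shows "integrable lborel (pd ps i)" "integral\<^sup>L lborel (pd ps i) = 0"
proof -
 have C': "C_k (Suc 0) ps" using C by simp
 have cd: "continuous_on UNIV (pd ps i)" using C' i by simp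
 have c: "continuous_on UNIV ps" using C by (rule C_k_continuous)
 have z: "pd ps i x = 0" if "x ~: K" for x
  using partial_deriv_eq_0[OF compact_imp_closed[OF K(1)] K(2) that] .
 show int: "integrable lborel (pd ps i)"
  by (rule continuous_compact_support[OF cd K(1) z])
 obtain M where M: "M >= 0" "!!x. \<bar>pd ps i x\<bar> <= M"
  using continuous_compact_support(2)[OF cd K(1) z] by blast
 have intps: "integrable lborel ps" by (rule continuous_compact_support[OF c K])
 have mps: "ps : borel_measurable borel" using c by (rule borel_measurable_continuous_onI)
 define h where "h n = 1 / real (Suc n)" for n
 have h: "h n > 0" "h n <= 1" for n by (auto simp: h_def)
 \<comment> \<open>\<open>K\<close> swept along \<open>- i\<close> over unit length; since
   \<open>h n <= 1\<close>, it contains the supports of all difference quotients.\<close>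
 define L where "L = (%p. fst p - snd p *\<^sub>R i) ` (K \<times> {0..1::real})"
 have L: "compact L" unfolding L_def using K(1)
  by (intro compact_continuous_image compact_Times continuous_intros) auto
 define q where "q n x = (ps (h n *\<^sub>R i + x) - ps x) / h n" for n x
 have qL: "q n x = 0" if "x ~: L" for n x
 proof -
  have "x ~: K" using that by (force simp: L_def image_iff intro: bexI[of _ "(x, 0)"])
  moreover have "h n *\<^sub>R i + x ~: K"
  proof
   assume "h n *\<^sub>R i + x : K"
   then have "x : L" unfolding L_def using h[of n]
    by (intro image_eqI[of _ _ "(h n *\<^sub>R i + x, h n)"]) auto
   then show False using that by simp
  qed
  ultimately show ?thesis using K(2) by (simp add: q_def)
 qed
 have qM: "\<bar>q n x\<bar> <= M" for n x
 proof -
  have "EX z. 0 < z & z < h n & ps (x + h n *\<^sub>R i) - ps (x + 0 *\<^sub>R i) = (h n - 0) * pd ps i (x + z *\<^sub>R i)"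
   by (rule MVT2[OF h(1)]) (rule DERIV_along_line[OF C'])
  then show ?thesis using M h[of n] by (auto simp: q_def abs_mult add.commute)
 qed
 have qlim: "(%n. q n x) ----> pd ps i x" for x
 proof -
  have "((%k. (ps (x + (0 + k) *\<^sub>R i) - ps (x + 0 *\<^sub>R i)) / k) \<longlongrightarrow> pd ps i (x + 0 *\<^sub>R i)) (at 0)"
   using DERIV_along_line[OF C', of x i 0] unfolding DERIV_def .
  moreover have "filterlim h (at 0) sequentially"
  proof -
   have "(%n. 1 / real (Suc n)) ----> 0" by (rule LIMSEQ_Suc[OF lim_1_over_n])
   moreover have "h n ~= 0" for n using h(1)[of n] by simp
   ultimately show ?thesis unfolding filterlim_at h_def[abs_def] by auto
  qed
  ultimately have "(%n. (ps (x + (0 + h n) *\<^sub>R i) - ps (x + 0 *\<^sub>R i)) / h n) ----> pd ps i (x + 0 *\<^sub>R i)"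
   by (rule filterlim_compose)
  then show ?thesis by (simp add: q_def add.commute)
 qed
 have "(%n. integral\<^sup>L lborel (q n)) ----> integral\<^sup>L lborel (pd ps i)"
 proof (rule integral_dominated_convergence)
  show "integrable lborel (%x. M * indicator L x)"
   using L emeasure_bounded_finite[of L] by (auto intro!: integrable_mult_right integrable_real_indicator borel_compact simp: compact_imp_bounded)
  show "AE x in lborel. norm (q n x) <= M * indicator L x" for n
   using qM qL by (auto simp: indicator_def of_bool_def fun_eq_iff)
  show "pd ps i : borel_measurable lborel" using cd by (simp add: borel_measurable_continuous_onI)
  show "q n : borel_measurable lborel" for n
   using mps unfolding q_def[abs_def] by measurable
 qed (use qlim in auto)
 moreover have "integral\<^sup>L lborel (q n) = 0" for n
 proof -
  have "integrable lborel (%x. ps (h n *\<^sub>R i + x))"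
  proof (rule continuous_compact_support)
   show "continuous_on UNIV (%x. ps (h n *\<^sub>R i + x))"
    by (rule continuous_on_compose2[OF c]) (auto intro!: continuous_intros)
   show "compact ((%x. x - h n *\<^sub>R i) ` K)" using K(1) by (intro compact_continuous_image continuous_intros)
   show "ps (h n *\<^sub>R i + x) = 0" if "x ~: (%x. x - h n *\<^sub>R i) ` K" for x
    using that by (intro K(2)) (auto simp: image_iff)
  qed
  then show ?thesis using intps integral_lborel_shift[OF mps, of "h n *\<^sub>R i"] by (simp add: q_def[abs_def])
 qed
 ultimately show "integral\<^sup>L lborel (pd ps i) = 0" by (simp add: LIMSEQ_const_iff)
qed

lemma partial_deriv_mult:
 assumes "C_k (Suc n) f" "C_k (Suc m) g"
 shows "pd (%x. f x * g x) i x = f x * pd g i x + pd f i x * g x"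
 using partial_deriv_eq[OF has_derivative_mult[OF C_k_has_derivative[OF assms(1), of x] C_k_has_derivative[OF assms(2), of x]]]
 by (simp add: partial_deriv_def)

lemma partial_deriv_lin:
 assumes "C_k (Suc n) f" "C_k (Suc m) g"
 shows "pd (%x. c * f x + d * g x) i x = c * pd f i x + d * pd g i x"
 using partial_deriv_eq[OF has_derivative_add[OF has_derivative_mult_right[OF C_k_has_derivative[OF assms(1), of x], of c]
   has_derivative_mult_right[OF C_k_has_derivative[OF assms(2), of x], of d]]]
 by (simp add: partial_deriv_def)

lemma integration_by_parts_test:
 fixes f :: "'a::euclidean_space => real"
 assumes f: "C_k 1 f" and ph: "test_function U ph" and i: "i : Basis"
 shows "(LBINT x. f x * pd ph i x) = - (LBINT x. pd f i x * ph x)"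
proof -
 obtain K where K: "compact K" "K <= U" "!!x. x ~: K ==> ph x = 0" using test_functionD[OF ph] by blast
 have f': "C_k (Suc 0) f" using f by simp
 have ph': "C_k (Suc 0) ph" using test_function_C_k[OF ph] .
 have eq: "pd (%x. f x * ph x) i x = f x * pd ph i x + pd f i x * ph x" for x
  by (rule partial_deriv_mult[OF f' ph'])
 have z: "pd ph i x = 0" if "x ~: K" for x
  using partial_deriv_eq_0[OF compact_imp_closed[OF K(1)] K(3) that] .
 have cont: "continuous_on UNIV f" "continuous_on UNIV ph" "continuous_on UNIV (pd f i)" "continuous_on UNIV (pd ph i)"
  using C_k_continuous[OF f] C_k_continuous[OF ph'] f' ph' i by auto
 have 1: "integrable lborel (%x. f x * pd ph i x)"
  by (rule continuous_compact_support[OF _ K(1)]) (auto intro!: continuous_intros cont simp: z)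
 have 2: "integrable lborel (%x. pd f i x * ph x)"
  by (rule continuous_compact_support[OF _ K(1)]) (auto intro!: continuous_intros cont simp: K)
 have "C_k 1 (%x. f x * ph x)" using f ph' by (intro C_k_mult) simp_all
 from integral_partial_deriv_eq_0(2)[OF this K(1) _ i]
 have "(LBINT x. f x * pd ph i x + pd f i x * ph x) = 0"
  using K(3) by (simp add: eq[abs_def])
 then show ?thesis using 1 2 by simp
qed

lemma locally_integrable_times_test:
 fixes f :: "'a::euclidean_space => real"
 assumes f: "locally_integrable U f" and "open U" and ph: "continuous_on UNIV ph" "compact K" "K <= U" "!!x. x ~: K ==> ph x = 0"
 shows "integrable (lebesgue_on U) (%x. f x * ph x)"
proof -
 obtain M where M: "M >= 0" "!!x. \<bar>ph x\<bar> <= M" using continuous_compact_support(2)[OF ph(1,2,4)] by blast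
 have fK: "integrable lebesgue (%x. indicator K x *\<^sub>R f x)"
  using f ph by (auto simp: locally_integrable_def set_integrable_def)
 have eq: "(%x. f x * ph x) = (%x. (indicator K x *\<^sub>R f x) * ph x)"
  using ph(4) by (auto simp: indicator_def of_bool_def fun_eq_iff)
 have phm: "ph : borel_measurable lebesgue"
  using ph(1) by (intro measurable_completion) (simp add: borel_measurable_continuous_onI)
 have "integrable lebesgue (%x. f x * ph x)"
  unfolding eq
 proof (rule lebesgue_bound)
  show "integrable lebesgue (%x. M * (indicator K x *\<^sub>R f x))" using fK by simp
  show "(%x. indicator K x *\<^sub>R f x * ph x) : borel_measurable lebesgue"
   using fK phm by (intro borel_measurable_times) (simp_all add: borel_measurable_integrable)
  show "AE x in lebesgue. norm (indicator K x *\<^sub>R f x * ph x) <= norm (M * (indicator K x *\<^sub>R f x))"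
   using M by (auto simp: abs_mult mult.commute[of M] intro!: always_eventually mult_left_mono)
 qed
 moreover have "f x * ph x = 0" if "x ~: U" for x using ph(3) ph(4)[of x] that by auto
 ultimately show ?thesis
  using lebesgue_on_support(1)[OF open_sets_lebesgue[OF \<open>open U\<close>], of "%x. f x * ph x"] by simp
qed

lemma locally_integrable_times_test_function:
 assumes "locally_integrable U f" "open U" "test_function U ph"
 shows "integrable (lebesgue_on U) (%x. f x * ph x)"
  "i : Basis ==> integrable (lebesgue_on U) (%x. f x * pd ph i x)"
proof -
 have *: "integrable (lebesgue_on U) (%x. f x * ps x)" if ps: "test_function U ps" for ps
 proof -
  obtain K where "compact K" "K <= U" "!!x. x ~: K ==> ps x = 0" using test_functionD[OF ps] by blast
  then show ?thesis
   using locally_integrable_times_test[OF assms(1,2) C_k_continuous[OF test_function_C_k[OF ps, of 0]]] by blast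
 qed
 show "integrable (lebesgue_on U) (%x. f x * ph x)" using * assms(3) .
 show "integrable (lebesgue_on U) (%x. f x * pd ph i x)" if "i : Basis"
  using * test_function_partial_deriv[OF assms(3) that] .
qed

lemma locally_integrable_continuous: "continuous_on UNIV f ==> locally_integrable U f"
 unfolding locally_integrable_def
proof (intro allI impI)
 fix K :: "'a set" assume c: "continuous_on UNIV f" and K: "compact K & K <= U"
 then have "set_integrable lborel K f"
  unfolding set_integrable_def by (intro borel_integrable_compact) (auto intro: continuous_on_subset)
 then show "set_integrable lebesgue K f"
  unfolding set_integrable_def using c K
  by (subst lebesgue_lborel) (auto intro!: borel_measurable_continuous_onI borel_measurable_scaleR borel_measurable_indicator borel_compact)
qed

lemma has_weak_deriv_C1:
 fixes f :: "'a::euclidean_space => real"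
 assumes f: "C_k 1 f" and U: "open U" and i: "i : Basis"
 shows "has_weak_deriv U f i (pd f i)"
 unfolding has_weak_deriv_def
proof (intro conjI allI impI)
 have c: "continuous_on UNIV f" "continuous_on UNIV (pd f i)"
  using C_k_continuous[OF f] f i by auto
 show "locally_integrable U f" "locally_integrable U (pd f i)"
  by (rule locally_integrable_continuous, rule c)+
 fix ph assume ph: "test_function U ph"
 obtain K where K: "compact K" "K <= U" "!!x. x ~: K ==> ph x = 0" using test_functionD[OF ph] by blast
 have cph: "continuous_on UNIV ph" "continuous_on UNIV (pd ph i)"
  using test_function_C_k[OF ph, of 0] test_function_C_k[OF ph, of 1] i by auto
 have z: "pd ph i x = 0" if "x ~: K" for x
  using partial_deriv_eq_0[OF compact_imp_closed[OF K(1)] K(3) that] .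
 have e1: "(LINT x|lebesgue_on U. f x * pd ph i x) = (LBINT x. f x * pd ph i x)"
  using K z by (subst lebesgue_on_support) (auto intro!: open_sets_lebesgue U lebesgue_lborel borel_measurable_continuous_onI continuous_intros c cph)
 have e2: "(LINT x|lebesgue_on U. pd f i x * ph x) = (LBINT x. pd f i x * ph x)"
  using K z by (subst lebesgue_on_support) (auto intro!: open_sets_lebesgue U lebesgue_lborel borel_measurable_continuous_onI continuous_intros c cph)
 show "(LINT x|lebesgue_on U. f x * pd ph i x) = - (LINT x|lebesgue_on U. pd f i x * ph x)"
  unfolding e1 e2 by (rule integration_by_parts_test[OF f ph i])
qed

text \<open>The positive and negative parts of \<open>g\<close> are densities of two measures that
  agree on boxes. Boxes are stable under intersection and generate the Borel sets, so the measures
  coincide, and hence almost everywhere the densities \<open>ennreal (g x)\<close> and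
  \<open>ennreal (- g x)\<close>, at least one of which is always \<open>0\<close>.\<close>

lemma AE_0_from_box_integrals_lborel:
 fixes g :: "'a::euclidean_space => real"
 assumes g: "integrable lborel g" and z: "!!a b. (LBINT x. indicator (box a b) x * g x) = 0"
 shows "AE x in lborel. g x = 0"
proof -
 have gm [measurable]: "g : borel_measurable borel" using g by auto
 let ?p = "%x. ennreal (g x)" and ?n = "%x. ennreal (- g x)"
 have box: "emeasure (density lborel ?p) (box a b) = emeasure (density lborel ?n) (box a b)"
  "emeasure (density lborel ?p) (box a b) ~= \<infinity>" for a b
 proof -
  have i: "integrable lborel (%x. indicator (box a b) x * g x)"
   using integrable_mult_indicator[of "box a b" lborel g] g by simp
  have iM: "integrable lborel (%x. max 0 (indicator (box a b) x * g x))"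
   "integrable lborel (%x. max 0 (- (indicator (box a b) x * g x)))"
   using i by (intro integrable_max; simp)+
  have P: "emeasure (density lborel ?p) (box a b) = ennreal (LBINT x. max 0 (indicator (box a b) x * g x))"
   using iM by (subst nn_integral_eq_integral[symmetric])
    (auto simp: emeasure_density intro!: nn_integral_cong split: split_indicator, auto simp: max_def ennreal_neg)
  have N: "emeasure (density lborel ?n) (box a b) = ennreal (LBINT x. max 0 (- (indicator (box a b) x * g x)))"
   using iM by (subst nn_integral_eq_integral[symmetric])
    (auto simp: emeasure_density intro!: nn_integral_cong split: split_indicator, auto simp: max_def ennreal_neg)
  have "(LBINT x. max 0 (indicator (box a b) x * g x)) - (LBINT x. max 0 (- (indicator (box a b) x * g x)))
    = (LBINT x. max 0 (indicator (box a b) x * g x) - max 0 (- (indicator (box a b) x * g x)))"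
   using i by (subst Bochner_Integration.integral_diff) auto
  also have "... = (LBINT x. indicator (box a b) x * g x)"
   by (intro lebesgue_cong) auto
  finally show "emeasure (density lborel ?p) (box a b) = emeasure (density lborel ?n) (box a b)"
   unfolding P N using z by simp
  show "emeasure (density lborel ?p) (box a b) ~= \<infinity>" unfolding P by simp
 qed
 have "density lborel ?p = density lborel ?n"
 proof (rule measure_eqI_generator_eq)
  let ?E = "range (%(a, b). box a b::'a set)"
  show "Int_stable ?E"
   by (auto simp: Int_stable_def box_Int_box)
  show "?E <= Pow UNIV" "sets (density lborel ?p) = sigma_sets UNIV ?E" "sets (density lborel ?n) = sigma_sets UNIV ?E"
   by (simp_all add: borel_eq_box sets_measure_of)
  let ?A = "%n::nat. box (- (real n *\<^sub>R One)) (real n *\<^sub>R One) :: 'a set"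
  show "range ?A <= ?E" "(\<Union>i. ?A i) = UNIV"
   unfolding UN_box_eq_UNIV by auto
  show "emeasure (density lborel ?p) (?A i) ~= \<infinity>" for i by (rule box)
  show "emeasure (density lborel ?p) X = emeasure (density lborel ?n) X" if "X : ?E" for X using that box by auto
 qed
 then have "AE x in lborel. ?p x = ?n x"
  by (intro sigma_finite_measure.density_unique[OF sigma_finite_lborel]) measurable
 then show ?thesis
 proof eventually_elim
  case (elim x)
  then show ?case by (cases "g x >= 0") (auto simp: ennreal_neg)
 qed
qed

lemma AE_0_from_box_integrals:
 fixes g :: "'a::euclidean_space => real"
 assumes g: "integrable lebesgue g" and z: "!!a b. (LINT x|lebesgue. indicator (box a b) x * g x) = 0"
 shows "AE x in lebesgue. g x = 0"
proof -
 obtain g' where g'm [measurable]: "g' : borel_measurable borel" and ae: "AE x in lborel. g x = g' x"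
  using completion_ex_borel_measurable_real[OF borel_measurable_integrable[OF g]] by auto
 have ae': "AE x in lebesgue. g x = g' x" using ae by (rule AE_completion)
 have g'l: "g' : borel_measurable lebesgue" by (rule measurable_completion) simp
 have "integrable lebesgue g'" using g ae' g'l by (subst integrable_cong_AE[of _ _ g]) auto
 then have i: "integrable lborel g'" by (simp add: lebesgue_lborel)
 have "AE x in lborel. g' x = 0"
 proof (rule AE_0_from_box_integrals_lborel[OF i])
  fix a b :: 'a
  have bm: "(%x. indicator (box a b) x * h x) : borel_measurable lebesgue" if "h : borel_measurable lebesgue" for h :: "'a => real"
   using that by (intro borel_measurable_times borel_measurable_indicator) auto
  have "(LBINT x. indicator (box a b) x * g' x) = (LINT x|lebesgue. indicator (box a b) x * g' x)"
   by (rule lebesgue_lborel(2)[symmetric]) measurable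
  also have "... = (LINT x|lebesgue. indicator (box a b) x * g x)"
   using ae' by (intro integral_cong_AE bm g'l borel_measurable_integrable[OF g]) auto
  finally show "(LBINT x. indicator (box a b) x * g' x) = 0" using z by simp
 qed
 with ae have "AE x in lborel. g x = 0" by eventually_elim simp
 then show ?thesis by (rule AE_completion)
qed

text \<open>Test functions tend to box indicators, so the integrals of \<open>f\<close> over boxes
  inside \<open>U\<close> vanish. An open set is a countable union of closed boxes, which reduces
  the claim to a single box.\<close>

lemma fundamental_lemma:
 fixes f :: "'a::euclidean_space => real"
 assumes f: "locally_integrable U f" and U: "open U"
  and z: "!!ph. test_function U ph ==> (LINT x|lebesgue_on U. f x * ph x) = 0"
 shows "AE x in lebesgue_on U. f x = 0"
proof -
 have cb: "AE x in lebesgue. x : cbox a b --> f x = 0" if ab: "cbox a b <= U" for a b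
 proof -
  have fi: "integrable lebesgue (%x. indicator (cbox a b) x * f x)"
   using f ab by (auto simp: locally_integrable_def set_integrable_def)
  have zero: "(LINT x|lebesgue. indicator (box c d) x * f x) = 0" if cd: "cbox c d <= cbox a b" for c d
  proof -
   let ?s = "%n x. f x * smoothstep (real n * box_bump c d x)"
   have cdU: "cbox c d <= U" using cd ab by blast
   note ind = test_function_box_indicator[OF cdU]
   have sm: "(%x. smoothstep (real n * box_bump c d x)) : borel_measurable lebesgue" for n
    using test_function_C_k[OF ind(1), of 0 n] by (intro measurable_completion) (simp add: borel_measurable_continuous_onI)
   have se: "?s n = (%x. (indicator (cbox a b) x * f x) * smoothstep (real n * box_bump c d x))" for n
   proof
    fix x show "?s n x = (indicator (cbox a b) x * f x) * smoothstep (real n * box_bump c d x)"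
    proof (cases "x : cbox a b")
     case False
     then have "x ~: cbox c d" using cd by blast
     then show ?thesis using ind(2)[of n x] by simp
    qed simp
   qed
   have be: "(%x. indicator (box c d) x * f x) = (%x. (indicator (cbox a b) x * f x) * indicator (box c d) x)"
    using cd box_subset_cbox[of c d] by (auto simp: indicator_def of_bool_def fun_eq_iff)
   have "(%n. integral\<^sup>L lebesgue (?s n)) ----> (LINT x|lebesgue. indicator (box c d) x * f x)"
   proof (rule integral_dominated_convergence)
    show "integrable lebesgue (%x. \<bar>indicator (cbox a b) x * f x\<bar>)" using fi by simp
    show "(%x. indicator (box c d) x * f x) : borel_measurable lebesgue"
     unfolding be by (intro borel_measurable_times borel_measurable_integrable[OF fi] borel_measurable_indicator) auto
    show "?s n : borel_measurable lebesgue" for n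
     unfolding se by (intro borel_measurable_times borel_measurable_integrable[OF fi] sm)
    show "AE x in lebesgue. (%n. ?s n x) ----> indicator (box c d) x * f x"
     using tendsto_mult[OF tendsto_const ind(3)] by (auto simp: mult.commute[of _ "f _"])
    show "AE x in lebesgue. norm (?s n x) <= \<bar>indicator (cbox a b) x * f x\<bar>" for n
    proof (rule always_eventually, rule allI)
     fix x
     have "\<bar>smoothstep (real n * box_bump c d x)\<bar> <= 1" using smoothstep_range[of "real n * box_bump c d x"] by simp
     then show "norm (?s n x) <= \<bar>indicator (cbox a b) x * f x\<bar>"
      unfolding fun_cong[OF se[of n], of x] by (simp only: real_norm_def abs_mult[of "_ * f x"] mult_left_le abs_ge_zero)
    qed
   qed
   moreover have "integral\<^sup>L lebesgue (?s n) = 0" for n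
   proof -
    have "?s n x = 0" if "x ~: U" for x
    proof -
     have "x ~: cbox c d" using cdU that by blast
     then show ?thesis using ind(2)[of n x] by simp
    qed
    then show ?thesis using z[OF ind(1), of n] lebesgue_on_support(2)[OF open_sets_lebesgue[OF U], of "?s n"] by simp
   qed
   ultimately show ?thesis by (simp add: LIMSEQ_const_iff)
  qed
  have "AE x in lebesgue. indicator (box a b) x * f x = 0"
  proof (rule AE_0_from_box_integrals)
   have "integrable lebesgue (%x. indicator (box a b) x *\<^sub>R (indicator (cbox a b) x * f x))"
    by (rule integrable_mult_indicator[OF _ fi]) auto
   moreover have "(%x. indicator (box a b) x *\<^sub>R (indicator (cbox a b) x * f x)) = (%x. indicator (box a b) x * f x)"
    using box_subset_cbox[of a b] by (auto simp: fun_eq_iff split: split_indicator)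
   ultimately show "integrable lebesgue (%x. indicator (box a b) x * f x)" by (simp only:)
   fix c d :: 'a
   \<comment> \<open>\<open>zero\<close> covers only boxes whose closure lies in
     \<open>cbox a b\<close>; intersecting with \<open>box a b\<close> arranges this.\<close>
   obtain p q where pq: "box c d \<inter> box a b = box p q" using box_Int_box[of c d a b] that by blast
   show "(LINT x|lebesgue. indicator (box c d) x * (indicator (box a b) x * f x)) = 0"
   proof (cases "box p q = {}")
    case True
    then have "(%x. indicator (box c d) x * (indicator (box a b) x * f x)) = (%x. 0)"
     using pq by (auto simp: fun_eq_iff split: split_indicator)
    then show ?thesis by (simp only: integral_zero)
   next
    case False
    have "cbox p q <= cbox a b"
    proof -
     have "box p q <= box a b" using pq by blast
     then have "closure (box p q) <= closure (box a b)" by (rule closure_mono)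
     moreover have "closure (box a b) <= cbox a b" by (intro closure_minimal box_subset_cbox closed_cbox)
     ultimately show ?thesis using closure_box[OF False] by simp
    qed
    moreover have "(%x. indicator (box c d) x * (indicator (box a b) x * f x)) = (%x. indicator (box p q) x * f x)"
     unfolding pq[symmetric] by (auto simp: fun_eq_iff split: split_indicator)
    ultimately show ?thesis using zero by (simp only:)
   qed
  qed
  moreover have "AE x in lebesgue. x ~: cbox a b - box a b"
   using negligible_frontier_interval[of a b] by (intro AE_not_in) (simp add: negligible_iff_null_sets)
  ultimately show ?thesis by eventually_elim (auto simp: indicator_def of_bool_def fun_eq_iff split: if_splits)
 qed
 obtain \<D> where \<D>: "countable \<D>" "\<D> <= Pow U" "!!X. X : \<D> ==> EX a b. X = cbox a b" "\<Union>\<D> = U"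
  using open_countable_Union_open_cbox[OF U] by metis
 have "AE x in lebesgue. ALL X:\<D>. x : X --> f x = 0"
 proof (subst AE_ball_countable[OF \<D>(1)], rule ballI)
  fix X assume X: "X : \<D>"
  then obtain a b where "X = cbox a b" using \<D>(3) by blast
  then show "AE x in lebesgue. x : X --> f x = 0" using cb \<D>(2) X by blast
 qed
 then have "AE x in lebesgue. x : U --> f x = 0" using \<D>(4) by (rule_tac AE_mp) auto
 then show ?thesis using open_sets_lebesgue[OF U] by (subst AE_restrict_space_iff) auto
qed

lemma locally_integrable_lin:
 "locally_integrable U f ==> locally_integrable U g ==> locally_integrable U (%x. c * f x + d * g x)"
 unfolding locally_integrable_def
 by (auto intro!: set_integral_add set_integrable_mult_right)

text \<open>\<open>weak_deriv\<close> is a choice; uniqueness is what allows explicit weak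
  derivatives to replace it under integrals.\<close>

lemma has_weak_deriv_unique:
 assumes "has_weak_deriv U f i g" "has_weak_deriv U f i h" "open U"
 shows "AE x in lebesgue_on U. g x = h x"
proof -
 have li: "locally_integrable U g" "locally_integrable U h" using assms by (auto simp: has_weak_deriv_def)
 have "AE x in lebesgue_on U. 1 * g x + (-1) * h x = 0"
 proof (rule fundamental_lemma[OF locally_integrable_lin[OF li] assms(3)])
  fix ph assume ph: "test_function U ph"
  have "(LINT x|lebesgue_on U. g x * ph x) = (LINT x|lebesgue_on U. h x * ph x)"
   using assms(1,2) ph unfolding has_weak_deriv_def by (metis neg_equal_iff_equal)
  then show "(LINT x|lebesgue_on U. (1 * g x + (-1) * h x) * ph x) = 0"
   using locally_integrable_times_test_function(1)[OF li(1) assms(3) ph] locally_integrable_times_test_function(1)[OF li(2) assms(3) ph]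
   by (simp add: left_diff_distrib)
 qed
 then show ?thesis by simp
qed

lemma has_weak_deriv_lin:
 assumes "has_weak_deriv U f i f'" "has_weak_deriv U g i g'" "open U" "i : Basis"
 shows "has_weak_deriv U (%x. c * f x + d * g x) i (%x. c * f' x + d * g' x)"
 unfolding has_weak_deriv_def
proof (intro conjI allI impI)
 have li: "locally_integrable U f" "locally_integrable U g" "locally_integrable U f'" "locally_integrable U g'"
  using assms by (auto simp: has_weak_deriv_def)
 then show "locally_integrable U (%x. c * f x + d * g x)" "locally_integrable U (%x. c * f' x + d * g' x)"
  by (auto intro: locally_integrable_lin)
 fix ph assume ph: "test_function U ph"
 note I = locally_integrable_times_test_function[OF _ assms(3) ph]
 have "(LINT x|lebesgue_on U. f x * pd ph i x) = - (LINT x|lebesgue_on U. f' x * ph x)"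
  "(LINT x|lebesgue_on U. g x * pd ph i x) = - (LINT x|lebesgue_on U. g' x * ph x)"
  using assms(1,2) ph by (auto simp: has_weak_deriv_def)
 then show "(LINT x|lebesgue_on U. (c * f x + d * g x) * pd ph i x) = - (LINT x|lebesgue_on U. (c * f' x + d * g' x) * ph x)"
  using I(1)[OF li(3)] I(1)[OF li(4)] I(2)[OF li(1) assms(4)] I(2)[OF li(2) assms(4)]
  by (simp add: distrib_right mult.assoc)
qed

subsection \<open>Sobolev spaces\<close>

lemma square_integrable_mult:
 fixes f g :: "'a => real"
 assumes "f : borel_measurable M" "g : borel_measurable M" "integrable M (%x. (f x)^2)" "integrable M (%x. (g x)^2)"
 shows "integrable M (%x. f x * g x)"
proof (rule lebesgue_bound)
 show "integrable M (%x. (f x)^2 + (g x)^2)" using assms by simp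
 show "(%x. f x * g x) : borel_measurable M" using assms by simp
 show "AE x in M. norm (f x * g x) <= norm ((f x)^2 + (g x)^2)"
 proof (rule always_eventually, rule allI)
  fix x
  have "0 <= (\<bar>f x\<bar> - \<bar>g x\<bar>)^2 + (\<bar>f x\<bar>)^2 + (\<bar>g x\<bar>)^2" by simp
  then show "norm (f x * g x) <= norm ((f x)^2 + (g x)^2)" by (simp add: power2_diff abs_mult)
 qed
qed

lemma square_integrable_lin:
 fixes f g :: "'a => real"
 assumes "f : borel_measurable M" "g : borel_measurable M" "integrable M (%x. (f x)^2)" "integrable M (%x. (g x)^2)"
 shows "integrable M (%x. (c * f x + d * g x)^2)"
proof -
 have "(c * f x + d * g x)^2 = c^2 * (f x)^2 + 2 * c * d * (f x * g x) + d^2 * (g x)^2" for x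
  by (simp add: power2_eq_square algebra_simps)
 then show ?thesis using square_integrable_mult[OF assms] assms(3,4) by simp
qed

text \<open>The weight \<open>2^k\<close> does two things. The weighted squares keep summable
  integrals, since \<open>2^k * (1/8)^k = (1/4)^k\<close>; and
  \<open>\<bar>d\<bar> <= (1/2)^k + 2^k * d^2\<close> makes the increments summable wherever the
  weighted series is finite.\<close>

lemma AE_limit_of_summable_increments:
 fixes g :: "nat => 'a => real"
 assumes m [measurable]: "!!k. g k : borel_measurable M"
  and i: "!!k. integrable M (%x. (g (Suc k) x - g k x)^2)"
  and le: "!!k. (LINT x|M. (g (Suc k) x - g k x)^2) <= (1/8)^k"
 shows "AE x in M. convergent (%k. g k x)"
proof -
 let ?F = "%k x. 2^k * (g (Suc k) x - g k x)^2"
 have "(\<integral>\<^sup>+x. (\<Sum>k. ennreal (?F k x)) \<partial>M) = (\<Sum>k. \<integral>\<^sup>+x. ennreal (?F k x) \<partial>M)"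
  by (rule nn_integral_suminf) measurable
 also have "... = (\<Sum>k. ennreal (LINT x|M. ?F k x))"
  using i by (intro suminf_cong nn_integral_eq_integral) auto
 also have "... <= (\<Sum>k. ennreal ((1/4)^k))"
 proof (rule suminf_le)
  fix k :: nat
  have "(LINT x|M. ?F k x) <= 2^k * (1/8)^k" using le[of k] by simp
  also have "(2::real)^k * (1/8)^k = (1/4)^k" by (simp add: power_mult_distrib[symmetric])
  finally show "ennreal (LINT x|M. ?F k x) <= ennreal ((1/4)^k)" by (rule ennreal_leI)
 qed auto
 also have "... = ennreal (\<Sum>k. (1/4)^k)" by (rule suminf_ennreal2) (auto intro: summable_geometric)
 also have "... < \<infinity>" by simp
 finally have "AE x in M. (\<Sum>k. ennreal (?F k x)) ~= \<infinity>" by (intro nn_integral_PInf_AE) auto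
 then show ?thesis
 proof eventually_elim
  case (elim x)
  have s: "summable (%k. ?F k x)" by (rule summable_suminf_not_top) (use elim in auto)
  have "summable (%k. g (Suc k) x - g k x)"
  proof (rule summable_comparison_test')
   show "summable (%k. (1/2)^k + ?F k x)" by (intro summable_add s summable_geometric) simp
   fix k :: nat
   let ?d = "\<bar>g (Suc k) x - g k x\<bar>"
   have "0 <= (1 - 2^k * ?d)^2" by simp
   then have "2^k * ?d <= 2^k * ((1/2)^k + ?F k x)"
    by (simp add: power2_diff power_mult_distrib power_divide algebra_simps power2_eq_square) (smt (verit) zero_le_mult_iff zero_le_power2 power2_eq_square zero_le_power)
   then show "norm (g (Suc k) x - g k x) <= (1/2)^k + ?F k x" by simp
  qed
  then have "convergent (%n. \<Sum>k<n. g (Suc k) x - g k x)" by (simp add: summable_iff_convergent)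
  then have "convergent (%n. g n x - g 0 x)" by (simp add: sum_lessThan_telescope[of "%k. g k x"])
  then have "convergent (%n. (g n x - g 0 x) + g 0 x)" by (intro convergent_add convergent_const)
  then show ?case by simp
 qed
qed

text \<open>Riesz-Fischer. The almost everywhere convergent subsequence belongs to the conclusion
  because the weighted terms of the forms are later controlled by Fatou's lemma along it.\<close>

lemma L2_completeness:
 fixes f :: "nat => 'a => real"
 assumes m [measurable]: "!!n. f n : borel_measurable M" and i: "!!n. integrable M (%x. (f n x)^2)"
  and cau: "!!ep. ep > 0 ==> EX N. ALL m>=N. ALL n>=N. (LINT x|M. (f m x - f n x)^2) < ep"
 shows "EX g:borel_measurable M. integrable M (%x. (g x)^2) & (%n. LINT x|M. (f n x - g x)^2) ----> 0
   & (EX r. strict_mono r & (AE x in M. (%k. f (r k) x) ----> g x))"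
proof -
 have id: "integrable M (%x. (f m x - f n x)^2)" for m n
  using square_integrable_lin[OF m[of m] m[of n] i[of m] i[of n], where c = 1 and d = "-1"] by simp
 have "EX N. ALL m>=N. ALL n>=N. (LINT x|M. (f m x - f n x)^2) < (1/8)^k" for k :: nat
  by (rule cau) simp
 then obtain N where N: "!!k m n. m >= N k ==> n >= N k ==> (LINT x|M. (f m x - f n x)^2) < (1/8)^k"
  by metis
 define r where "r k = (\<Sum>j\<le>k. N j) + k" for k
 have r: "strict_mono r" by (rule strict_monoI_Suc) (simp add: r_def)
 have rN: "N k <= r k" for k unfolding r_def using member_le_sum[of k "{..k}" N] by simp
 have ge: "r k <= r (Suc k)" for k using r by (simp add: strict_mono_less_eq)
 have conv: "AE x in M. convergent (%k. f (r k) x)"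
 proof (rule AE_limit_of_summable_increments)
  show "(LINT x|M. (f (r (Suc k)) x - f (r k) x)^2) <= (1/8)^k" for k
   using N[of k "r (Suc k)" "r k"] rN[of k] ge[of k] by (intro less_imp_le) auto
 qed (use id in auto)
 define g where "g x = lim (%k. f (r k) x)" for x
 have gm [measurable]: "g : borel_measurable M" unfolding g_def[abs_def] by measurable
 have lim: "AE x in M. (%k. f (r k) x) ----> g x"
  using conv by eventually_elim (simp add: g_def convergent_LIMSEQ_iff)
 have F: "integrable M (%x. (f n x - g x)^2) & (LINT x|M. (f n x - g x)^2) <= (1/8)^k" if n: "n >= N k" for n k
 proof -
  have ae: "AE x in M. (%j. (f n x - f (r (j + k)) x)^2) ----> (f n x - g x)^2"
   using lim by eventually_elim (intro tendsto_intros, rule LIMSEQ_ignore_initial_segment)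
  have le: "(LINT x|M. (f n x - f (r (j + k)) x)^2) <= (1/8)^k" for j
  proof -
   have "r k <= r (j + k)" using r by (simp add: strict_mono_less_eq)
   then show ?thesis using N[OF n, of "r (j + k)"] rN[of k] by simp
  qed
  have fgm: "(%x. (f n x - g x)^2) : borel_measurable M" by measurable
  show ?thesis
   using Fatou_real[of M "%j x. (f n x - f (r (j + k)) x)^2", OF id _ le fgm ae] by simp
 qed
 have "integrable M (%x. (1 * f (N 0) x + (-1) * (f (N 0) x - g x))^2)"
  by (rule square_integrable_lin) (use F[of 0 "N 0"] i in auto)
 then have gi: "integrable M (%x. (g x)^2)" by simp
 have "(%n. LINT x|M. (f n x - g x)^2) ----> 0"
 proof (rule LIMSEQ_I)
  fix e :: real assume "e > 0"
  then obtain k where k: "(1/8)^k < e" using real_arch_pow_inv[of e "1/8"] by auto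
  have "norm ((LINT x|M. (f n x - g x)^2) - 0) < e" if "n >= N k" for n
   using F[OF that] k lebesgue_nonneg[of M "%x. (f n x - g x)^2"] by simp
  then show "EX no. ALL n>=no. norm ((LINT x|M. (f n x - g x)^2) - 0) < e" by blast
 qed
 then show ?thesis using gi gm r lim by blast
qed

lemma L2_D: "f : L2 U ==> f : borel_measurable (lebesgue_on U)" "f : L2 U ==> integrable (lebesgue_on U) (%x. (f x)^2)"
 by (auto simp: L2_def)

lemma L2_mult_integrable: "f : L2 U ==> g : L2 U ==> integrable (lebesgue_on U) (%x. f x * g x)"
 by (intro square_integrable_mult) (auto simp: L2_def)

lemma L2_lin: "f : L2 U ==> g : L2 U ==> (%x. c * f x + d * g x) : L2 U"
 by (auto simp: L2_def intro!: square_integrable_lin)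

lemma L2_cong_AE:
 fixes f g :: "'a::euclidean_space => real"
 assumes "f : L2 U" "AE x in lebesgue_on U. f x = g x" "open U"
 shows "g : L2 U"
proof -
 have U: "U : sets lebesgue" using assms by (simp add: open_sets_lebesgue)
 have "(%x. indicator U x *\<^sub>R f x) : borel_measurable lebesgue"
  using L2_D(1)[OF assms(1)] U by (simp add: borel_measurable_restrict_space_iff)
 moreover have "AE x in lebesgue. indicator U x *\<^sub>R f x = indicator U x *\<^sub>R g x"
  using assms(2) U by (subst (asm) AE_restrict_space_iff) (auto elim!: eventually_mono simp: indicator_def)
 ultimately have "(%x. indicator U x *\<^sub>R g x) : borel_measurable lebesgue" by (rule borel_measurable_AE)
 then have gm: "g : borel_measurable (lebesgue_on U)" using U by (simp add: borel_measurable_restrict_space_iff)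
 have "integrable (lebesgue_on U) (%x. (g x)^2)"
  using L2_D[OF assms(1)] assms(2) gm by (subst integrable_cong_AE[of _ _ "%x. (f x)^2"]) auto
 then show ?thesis using gm by (simp add: L2_def)
qed

lemma L2_inner_cong_AE:
 assumes "f : L2 U" "g : L2 U" "f' : L2 U" "g' : L2 U"
  "AE x in lebesgue_on U. f x = f' x" "AE x in lebesgue_on U. g x = g' x"
 shows "L2_inner U f g = L2_inner U f' g'"
 unfolding L2_inner_def
 using assms(5,6) by (intro integral_cong_AE borel_measurable_times) (auto intro: L2_D assms)

lemma semi_inner_L2: "semi_inner (L2 U) (L2_inner U)"
proof
 show "(%x. 0) : L2 U" by (simp add: L2_def)
 show "L2_inner U (%x. c * u x + d * v x) w = c * L2_inner U u w + d * L2_inner U v w"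
  if "u : L2 U" "v : L2 U" "w : L2 U" for u v w c d
  using L2_mult_integrable[OF that(1,3)] L2_mult_integrable[OF that(2,3)]
  by (simp add: L2_inner_def distrib_right mult.assoc)
qed (auto simp: L2_inner_def mult.commute L2_lin)

lemma semi_inner_mono:
 assumes "semi_inner D B" "E <= D" "(%x. 0) : E" "!!u v c d. u : E ==> v : E ==> (%x. c * u x + d * v x) : E"
 shows "semi_inner E B"
proof -
 interpret semi_inner D B by fact
 have E: "u : D" if "u : E" for u using assms(2) that by blast
 show ?thesis
 proof
  show "B (%x. c * u x + d * v x) w = c * B u w + d * B v w" if "u : E" "v : E" "w : E" for u v w c d
   using bilin[OF that[THEN E]] .
  show "B u v = B v u" if "u : E" "v : E" for u v using sym[OF that[THEN E]] .
 qed (use assms(3,4) E nonneg in auto)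
qed

lemma L2_null_iff:
 assumes "u : L2 U"
 shows "L2_inner U u u = 0 \<longleftrightarrow> (AE x in lebesgue_on U. u x = 0)"
 using integral_nonneg_eq_0_iff_AE[OF L2_D(2)[OF assms]] by (simp add: L2_inner_def power2_eq_square)

lemma L2_locally_integrable:
 fixes f :: "'a::euclidean_space => real"
 assumes f: "f : L2 U" and U: "open U"
 shows "locally_integrable U f"
 unfolding locally_integrable_def
proof (intro allI impI)
 fix K assume K: "compact K & K <= U"
 have Us: "U : sets lebesgue" using U by (rule open_sets_lebesgue)
 have Ks: "K : sets lebesgue" using K by (simp add: borel_compact)
 have fm: "(%x. indicator U x *\<^sub>R f x) : borel_measurable lebesgue"
  using L2_D(1)[OF f] Us by (simp add: borel_measurable_restrict_space_iff)
 have fi: "integrable lebesgue (%x. indicator U x *\<^sub>R (f x)^2)"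
  using L2_D(2)[OF f] Us by (simp add: integrable_restrict_space)
 have Ki: "integrable lebesgue (indicator K :: 'a => real)"
  using K emeasure_bounded_finite[of K] by (subst lebesgue_lborel) (auto intro!: integrable_real_indicator borel_compact borel_measurable_indicator simp: compact_imp_bounded)
 show "set_integrable lebesgue K f" unfolding set_integrable_def
 proof (rule lebesgue_bound)
  show "integrable lebesgue (%x. indicator K x + indicator U x *\<^sub>R (f x)^2)" using Ki fi by (intro Bochner_Integration.integrable_add)
  have e: "(%x. indicator K x *\<^sub>R f x) = (%x. indicator K x *\<^sub>R (indicator U x *\<^sub>R f x))"
   using K by (auto simp: fun_eq_iff split: split_indicator)
  show "(%x. indicator K x *\<^sub>R f x) : borel_measurable lebesgue"
   unfolding e by (rule borel_measurable_scaleR[OF borel_measurable_indicator[OF Ks] fm])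
  show "AE x in lebesgue. norm (indicator K x *\<^sub>R f x) <= norm (indicator K x + indicator U x *\<^sub>R (f x)^2)"
  proof (rule always_eventually, rule allI)
   fix x
   have "\<bar>f x\<bar> <= 1 + (f x)^2"
   proof -
    have "0 <= (\<bar>f x\<bar> - 1)^2 + \<bar>f x\<bar>" by simp
    then show ?thesis by (simp add: power2_diff)
   qed
   then show "norm (indicator K x *\<^sub>R f x) <= norm (indicator K x + indicator U x *\<^sub>R (f x)^2)"
    using K by (auto simp: fun_eq_iff split: split_indicator)
  qed
 qed
qed

lemma continuous_compact_L2:
 fixes f :: "'a::euclidean_space => real"
 assumes "continuous_on UNIV f" "compact K" "!!x. x ~: K ==> f x = 0" "open U"
 shows "f : L2 U"
proof -
 have fm: "f : borel_measurable borel" using assms(1) by (rule borel_measurable_continuous_onI)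
 have "integrable lborel (%x. (f x)^2)"
  by (rule continuous_compact_support[OF _ assms(2)]) (auto intro!: continuous_intros assms)
 then have "integrable lebesgue (%x. (f x)^2)" using fm by (subst lebesgue_lborel) auto
 then have "integrable (lebesgue_on U) (%x. (f x)^2)"
  using open_sets_lebesgue[OF assms(4)] integrable_mult_indicator[of U lebesgue "%x. (f x)^2"]
  by (simp add: integrable_restrict_space)
 moreover have "f : borel_measurable (lebesgue_on U)"
  by (rule measurable_restrict_space1[OF measurable_completion]) (use fm in simp)
 ultimately show ?thesis by (simp add: L2_def)
qed

lemma test_function_L2: "test_function U ph ==> open V ==> ph : L2 V"
proof -
 assume ph: "test_function U ph" and "open V"
 obtain K where K: "compact K" "K <= U" "!!x. x ~: K ==> ph x = 0" using test_functionD[OF ph] by blast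
 show ?thesis
  by (rule continuous_compact_L2[OF C_k_continuous[OF test_function_C_k[OF ph, of 0]] K(1,3) \<open>open V\<close>])
qed

text \<open>\<open>H1\<close> provides some square integrable weak derivative; the chosen one agrees
  with it almost everywhere and inherits square integrability.\<close>

lemma H1_weak_deriv:
 fixes u :: "'a::euclidean_space => real"
 assumes "u : H1 U" "i : Basis" "open U"
 shows "has_weak_deriv U u i (weak_deriv U u i)" "weak_deriv U u i : L2 U"
proof -
 obtain g where g: "g : L2 U" "has_weak_deriv U u i g" using assms by (auto simp: H1_def)
 show w: "has_weak_deriv U u i (weak_deriv U u i)"
  unfolding weak_deriv_def using g(2) by (rule someI[of "has_weak_deriv U u i"])
 show "weak_deriv U u i : L2 U"
  by (rule L2_cong_AE[OF g(1) has_weak_deriv_unique[OF g(2) w assms(3)] assms(3)])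
qed

lemma weak_deriv_AE_eq:
 assumes "has_weak_deriv U u i g" "open U"
 shows "AE x in lebesgue_on U. weak_deriv U u i x = g x"
proof -
 have "has_weak_deriv U u i (weak_deriv U u i)"
  unfolding weak_deriv_def using assms(1) by (rule someI[of "has_weak_deriv U u i"])
 then show ?thesis using has_weak_deriv_unique assms by blast
qed

lemma H1_lin:
 assumes "u : H1 U" "v : H1 U" "open U"
 shows "(%x. c * u x + d * v x) : H1 U"
 using assms L2_lin has_weak_deriv_lin unfolding H1_def by (fastforce simp: L2_lin)

lemma H1_L2: "u : H1 U ==> u : L2 U" by (simp add: H1_def)

lemma has_weak_deriv_0: "open U ==> i : Basis ==> has_weak_deriv U (%x. 0) i (%x. 0)"
 by (auto simp: has_weak_deriv_def locally_integrable_def set_integrable_def)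

lemma L2_0: "(%x. 0) : L2 U" by (simp add: L2_def)

lemma H1_0: "open U ==> (%x. 0) : H1 U"
 unfolding H1_def using has_weak_deriv_0 L2_0 by blast

lemma grad_inner_eq:
 assumes "u : H1 U" "v : H1 U" "open U"
  "!!i. i : Basis ==> has_weak_deriv U u i (g i)" "!!i. i : Basis ==> has_weak_deriv U v i (h i)"
 shows "grad_inner U u v = (\<Sum>i\<in>Basis. L2_inner U (g i) (h i))"
proof -
 have "L2_inner U (weak_deriv U u i) (weak_deriv U v i) = L2_inner U (g i) (h i)" if i: "i : Basis" for i
 proof -
  have a: "AE x in lebesgue_on U. weak_deriv U u i x = g i x" "AE x in lebesgue_on U. weak_deriv U v i x = h i x"
   using weak_deriv_AE_eq assms i by blast+
  show ?thesis
   using H1_weak_deriv(2) i assms(1-3) by (intro L2_inner_cong_AE a) (auto intro: L2_cong_AE a)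
 qed
 then show ?thesis by (simp add: grad_inner_def)
qed

lemma semi_inner_H1:
 assumes U: "open U"
 shows "semi_inner (H1 U) (grad_inner U)"
proof
 interpret L: semi_inner "L2 U" "L2_inner U" by (rule semi_inner_L2)
 note w = H1_weak_deriv[OF _ _ U]
 show "(%x. 0) : H1 U" using H1_0[OF U] .
 show "(%x. c * u x + d * v x) : H1 U" if "u : H1 U" "v : H1 U" for u v c d
  using H1_lin[OF that U] .
 show "grad_inner U u v = grad_inner U v u" if "u : H1 U" "v : H1 U" for u v
  unfolding grad_inner_def using that by (intro sum.cong) (auto intro: L.sym w)
 show "grad_inner U (%x. c * u x + d * v x) z = c * grad_inner U u z + d * grad_inner U v z"
  if uv: "u : H1 U" "v : H1 U" "z : H1 U" for u v z c d
 proof -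
  have "grad_inner U (%x. c * u x + d * v x) z
    = (\<Sum>i\<in>Basis. L2_inner U (%x. c * weak_deriv U u i x + d * weak_deriv U v i x) (weak_deriv U z i))"
   by (rule grad_inner_eq) (use uv U in "auto intro!: H1_lin has_weak_deriv_lin w")
  also have "... = (\<Sum>i\<in>Basis. c * L2_inner U (weak_deriv U u i) (weak_deriv U z i) + d * L2_inner U (weak_deriv U v i) (weak_deriv U z i))"
   using uv by (intro sum.cong refl L.bilin w)
  finally show ?thesis by (simp add: grad_inner_def sum.distrib sum_distrib_left)
 qed
 show "0 <= grad_inner U u u" if "u : H1 U" for u
  unfolding grad_inner_def using that by (intro sum_nonneg L.nonneg w)
qed

lemma test_function_H1:
 fixes ph :: "'a::euclidean_space => real"
 assumes "test_function V ph" "open U"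
 shows "ph : H1 U" "i : Basis ==> has_weak_deriv U ph i (pd ph i)"
proof -
 have w: "has_weak_deriv U ph i (pd ph i)" if "i : Basis" for i
  by (rule has_weak_deriv_C1[OF test_function_C_k[OF assms(1)] assms(2) that])
 then show "i : Basis ==> has_weak_deriv U ph i (pd ph i)" .
 show "ph : H1 U" unfolding H1_def
  using w test_function_L2[OF assms] test_function_L2[OF test_function_partial_deriv[OF assms(1)] assms(2)] by blast
qed

lemma tendsto_L2_inner:
 fixes U :: "'a::euclidean_space set"
 assumes "!!n. v n : L2 U" "u : L2 U" "(%n. L2_sq U (%x. v n x - u x)) ----> 0" "w : L2 U"
 shows "(%n. LINT x|lebesgue_on U. v n x * w x) ----> (LINT x|lebesgue_on U. u x * w x)"
 using semi_inner.tendsto_B[OF semi_inner_L2 assms] by (simp add: L2_inner_def)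

text \<open>Both sides of the defining identity are \<open>L2\<close> inner products with fixed
  functions, hence continuous: weak differentiation is a closed operator.\<close>

lemma has_weak_deriv_limit:
 fixes U :: "'a::euclidean_space set"
 assumes U: "open U" "i : Basis" and w: "!!n. has_weak_deriv U (v n) i (g n)" and L: "!!n. v n : L2 U" "!!n. g n : L2 U" "u : L2 U" "h : L2 U"
  and lim: "(%n. L2_sq U (%x. v n x - u x)) ----> 0"
   "(%n. L2_sq U (%x. g n x - h x)) ----> 0"
 shows "has_weak_deriv U u i h"
 unfolding has_weak_deriv_def
proof (intro conjI allI impI L2_locally_integrable L U)
 fix ph assume ph: "test_function U ph"
 have "(%n. LINT x|lebesgue_on U. v n x * pd ph i x) ----> (LINT x|lebesgue_on U. u x * pd ph i x)"
  by (rule tendsto_L2_inner[OF L(1,3) lim(1)]) (rule test_function_L2[OF test_function_partial_deriv[OF ph U(2)] U(1)])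
 moreover have "(%n. LINT x|lebesgue_on U. g n x * ph x) ----> (LINT x|lebesgue_on U. h x * ph x)"
  by (rule tendsto_L2_inner[OF L(2,4) lim(2)]) (rule test_function_L2[OF ph U(1)])
 then have "(%n. - (LINT x|lebesgue_on U. g n x * ph x)) ----> - (LINT x|lebesgue_on U. h x * ph x)"
  by (rule tendsto_minus)
 moreover have "(LINT x|lebesgue_on U. v n x * pd ph i x) = - (LINT x|lebesgue_on U. g n x * ph x)" for n
  using w[of n] ph by (auto simp: has_weak_deriv_def)
 ultimately show "(LINT x|lebesgue_on U. u x * pd ph i x) = - (LINT x|lebesgue_on U. h x * ph x)"
  using LIMSEQ_unique by simp
qed

text \<open>The square of \<open>H1_norm\<close>, kept without the root so that it is the quadratic
  form of a semi-inner product.\<close>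

definition energy :: "'a::euclidean_space set => ('a => real) => real" where
 "energy U u = L2_inner U u u + grad_inner U u u"

lemma grad_diff_eq:
 assumes "u : H1 U" "v : H1 U" "open U"
 shows "quad (grad_inner U) (%x. u x - v x) =
   (\<Sum>i\<in>Basis. L2_sq U (%x. weak_deriv U u i x - weak_deriv U v i x))"
proof (rule grad_inner_eq)
 show "(%x. u x - v x) : H1 U" "(%x. u x - v x) : H1 U"
  using H1_lin[OF assms, of 1 "-1"] by simp_all
 show "has_weak_deriv U (%x. u x - v x) i (%x. weak_deriv U u i x - weak_deriv U v i x)" if "i : Basis" for i
  using has_weak_deriv_lin[OF H1_weak_deriv(1)[OF assms(1) that assms(3)] H1_weak_deriv(1)[OF assms(2) that assms(3)] assms(3) that, of 1 "-1"] by simp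
 then show "has_weak_deriv U (%x. u x - v x) i (%x. weak_deriv U u i x - weak_deriv U v i x)" if "i : Basis" for i
  using that .
qed (rule assms)

lemma H1_complete:
 fixes v :: "nat => 'a::euclidean_space => real"
 assumes U: "open U" and v: "!!n. v n : H1 U"
  and cau: "!!ep. ep > 0 ==> EX N. ALL m>=N. ALL n>=N. energy U (%x. v m x - v n x) < ep"
 shows "EX u:H1 U. (%n. energy U (%x. v n x - u x)) ----> 0 &
   (EX r. strict_mono r & (AE x in lebesgue_on U. (%k. v (r k) x) ----> u x))"
proof -
 interpret L: semi_inner "L2 U" "L2_inner U" by (rule semi_inner_L2)
 interpret G: semi_inner "H1 U" "grad_inner U" by (rule semi_inner_H1[OF U])
 let ?sq = "%f. L2_inner U f f"
 have wL: "weak_deriv U (v n) i : L2 U" if "i : Basis" for n i using H1_weak_deriv(2)[OF v that U] .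
 have vL: "v n : L2 U" for n using v H1_L2 by blast
 have e1: "?sq (%x. v m x - v n x) <= energy U (%x. v m x - v n x)" for m n
  using G.nonneg[OF G.diff[OF v v]] by (simp add: energy_def)
 have e2: "?sq (%x. weak_deriv U (v m) i x - weak_deriv U (v n) i x) <= energy U (%x. v m x - v n x)" if "i : Basis" for m n i
 proof -
  have "?sq (%x. weak_deriv U (v m) i x - weak_deriv U (v n) i x) <= quad (grad_inner U) (%x. v m x - v n x)"
   unfolding grad_diff_eq[OF v v U]
   by (rule member_le_sum[OF that]) (auto intro: L.nonneg L.diff wL)
  then show ?thesis using L.nonneg[OF L.diff[OF vL vL], of m n] by (simp add: energy_def)
 qed
 have lim: "EX g:L2 U. (%n. ?sq (%x. f n x - g x)) ----> 0 & (EX r. strict_mono r & (AE x in lebesgue_on U. (%k. f (r k) x) ----> g x))"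
  if f: "!!n. f n : L2 U" "!!m n. ?sq (%x. f m x - f n x) <= energy U (%x. v m x - v n x)" for f
 proof -
  have "EX N. ALL m>=N. ALL n>=N. (LINT x|lebesgue_on U. (f m x - f n x)^2) < ep" if e: "ep > 0" for ep
  proof -
   obtain N where "ALL m>=N. ALL n>=N. energy U (%x. v m x - v n x) < ep" using cau[OF e] by blast
   then have "ALL m>=N. ALL n>=N. ?sq (%x. f m x - f n x) < ep" using f(2) by (meson le_less_trans)
   then show ?thesis by (auto simp: L2_inner_def power2_eq_square)
  qed
  from L2_completeness[OF L2_D(1)[OF f(1)] L2_D(2)[OF f(1)] this]
  show ?thesis by (auto simp: L2_def L2_inner_def power2_eq_square)
 qed
 obtain u where u: "u : L2 U" "(%n. ?sq (%x. v n x - u x)) ----> 0"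
  and r: "EX r. strict_mono r & (AE x in lebesgue_on U. (%k. v (r k) x) ----> u x)"
  using lim[of v, OF vL e1] by blast
 have "ALL i:Basis. EX g. g : L2 U & (%n. ?sq (%x. weak_deriv U (v n) i x - g x)) ----> 0"
  using lim[OF wL e2] by blast
 from bchoice[OF this] obtain g where g: "!!i. i : Basis ==> g i : L2 U"
   "!!i. i : Basis ==> (%n. ?sq (%x. weak_deriv U (v n) i x - g i x)) ----> 0" by blast
 have gw: "has_weak_deriv U u i (g i)" if "i : Basis" for i
  by (rule has_weak_deriv_limit[OF U that H1_weak_deriv(1)[OF v that U] vL wL[OF that] u(1) g(1)[OF that] u(2) g(2)[OF that]])
 then have uH: "u : H1 U" using u g by (auto simp: H1_def)
 have ge: "quad (grad_inner U) (%x. v n x - u x) = (\<Sum>i\<in>Basis. ?sq (%x. weak_deriv U (v n) i x - g i x))" for n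
 proof (rule grad_inner_eq)
  show "has_weak_deriv U (%x. v n x - u x) i (%x. weak_deriv U (v n) i x - g i x)" if "i : Basis" for i
   using has_weak_deriv_lin[OF H1_weak_deriv(1)[OF v that U] gw[OF that] U that, where c = 1 and d = "-1"] by simp
  then show "has_weak_deriv U (%x. v n x - u x) i (%x. weak_deriv U (v n) i x - g i x)" if "i : Basis" for i
   using that .
 qed (use G.diff[OF v uH] U in auto)
 have "(%n. energy U (%x. v n x - u x)) ----> 0 + (\<Sum>i\<in>(Basis::'a set). 0)"
  unfolding energy_def ge by (intro tendsto_add u(2) tendsto_sum g(2))
 then show ?thesis using uH r by auto
qed

lemma H1_norm_sq: "u : H1 U ==> open U ==> (H1_norm U u)^2 = energy U u"
 using semi_inner.nonneg[OF semi_inner_H1, of U u] semi_inner.nonneg[OF semi_inner_L2 H1_L2, of u U]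
 by (simp add: H1_norm_def energy_def)

lemma H10_H1: "u : H10 U ==> u : H1 U" by (simp add: H10_def)

lemma semi_inner_energy:
 assumes "open U"
 shows "semi_inner (H1 U) (%u v. L2_inner U u v + grad_inner U u v)"
proof -
 interpret G: semi_inner "H1 U" "grad_inner U" by (rule semi_inner_H1[OF assms])
 interpret L: semi_inner "H1 U" "L2_inner U"
  by (rule semi_inner_mono[OF semi_inner_L2]) (auto simp: H1_L2 H1_0 H1_lin assms)
 show ?thesis
 proof
  show "(%x. c * u x + d * v x) : H1 U" if "u : H1 U" "v : H1 U" for u v c d using G.lin[OF that] .
  show "L2_inner U u v + grad_inner U u v = L2_inner U v u + grad_inner U v u" if "u : H1 U" "v : H1 U" for u v
   using G.sym[OF that] L.sym[OF that] by simp
  show "L2_inner U (%x. c * u x + d * v x) w + grad_inner U (%x. c * u x + d * v x) w =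
    c * (L2_inner U u w + grad_inner U u w) + d * (L2_inner U v w + grad_inner U v w)"
   if "u : H1 U" "v : H1 U" "w : H1 U" for u v w c d
   using G.bilin[OF that] L.bilin[OF that] by (simp add: algebra_simps)
 qed (auto simp: G.zero G.nonneg L.nonneg)
qed

lemma H10_iff:
 assumes "open U"
 shows "u : H10 U \<longleftrightarrow> u : H1 U & (ALL ep>0. EX ph. test_function U ph & energy U (%x. u x - ph x) < ep)"
proof safe
 assume u: "u : H10 U"
 then show uH: "u : H1 U" by (rule H10_H1)
 fix ep :: real assume "ep > 0"
 obtain ph where ph: "!!n::nat. test_function U (ph n)" "(%n. H1_norm U (%x. u x - ph n x)) ----> 0"
  using u by (auto simp: H10_def)
 have d: "(%x. u x - ph n x) : H1 U" for n
  using H1_lin[OF uH test_function_H1(1)[OF ph(1) assms] assms, of 1 "-1" n] by simp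
 have "(%n. (H1_norm U (%x. u x - ph n x))^2) ----> 0^2" by (intro tendsto_intros ph(2))
 then have "(%n. energy U (%x. u x - ph n x)) ----> 0" using H1_norm_sq[OF d assms] by simp
 then have "\<forall>\<^sub>F n in sequentially. energy U (%x. u x - ph n x) < ep" using \<open>ep > 0\<close> by (rule order_tendstoD(2))
 then obtain n where "energy U (%x. u x - ph n x) < ep" by (auto simp: eventually_sequentially)
 then show "EX ph. test_function U ph & energy U (%x. u x - ph x) < ep" using ph(1) by blast
next
 assume uH: "u : H1 U" and a: "ALL ep>0. EX ph. test_function U ph & energy U (%x. u x - ph x) < ep"
 have "EX ph. test_function U ph & energy U (%x. u x - ph x) < (1 / real (Suc n))^2" for n
  using a by simp
 then obtain ph where ph: "!!n. test_function U (ph n)" "!!n. energy U (%x. u x - ph n x) < (1 / real (Suc n))^2"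
  by metis
 have lim: "(%n. 1 / real (Suc n)) ----> 0" by (rule LIMSEQ_Suc[OF lim_1_over_n])
 have "(%n. H1_norm U (%x. u x - ph n x)) ----> 0"
 proof (rule Lim_null_comparison[OF always_eventually[OF allI] lim])
  fix n
  have d: "(%x. u x - ph n x) : H1 U"
   using H1_lin[OF uH test_function_H1(1)[OF ph(1) assms] assms, of 1 "-1" n] by simp
  have "\<bar>H1_norm U (%x. u x - ph n x)\<bar> <= 1 / real (Suc n)"
   by (rule power2_le_imp_le) (use ph(2)[of n] H1_norm_sq[OF d assms] in auto)
  then show "norm (H1_norm U (%x. u x - ph n x)) <= 1 / real (Suc n)" by simp
 qed
 then show "u : H10 U" using uH ph(1) by (auto simp: H10_def)
qed

lemma test_function_H10:
 assumes "test_function U ph" "open U"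
 shows "ph : H10 U"
proof -
 interpret E: semi_inner "H1 U" "%u v. L2_inner U u v + grad_inner U u v" by (rule semi_inner_energy[OF assms(2)])
 have "energy U (%x. ph x - ph x) = 0" using E.B_zero[OF E.zero] by (simp add: energy_def)
 then have "test_function U ph & energy U (%x. ph x - ph x) < ep" if "ep > 0" for ep using that assms by simp
 then show ?thesis unfolding H10_iff[OF assms(2)] using test_function_H1(1)[OF assms] by blast
qed

lemma H10_lin:
 assumes "u : H10 U" "v : H10 U" "open U"
 shows "(%x. c * u x + d * v x) : H10 U"
proof -
 interpret E: semi_inner "H1 U" "%u v. L2_inner U u v + grad_inner U u v" by (rule semi_inner_energy[OF assms(3)])
 have H: "u : H1 U" "v : H1 U" using assms H10_H1 by auto
 have "EX ph. test_function U ph & energy U (%x. (c * u x + d * v x) - ph x) < ep" if e: "ep > 0" for ep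
 proof -
  \<comment> \<open>The summand \<open>1\<close> keeps \<open>?M\<close> positive and leaves room
    for strictness: the errors add up to \<open>(?M - 1) * (ep / ?M) < ep\<close>.\<close>
  let ?M = "2 * c^2 + 2 * d^2 + 1"
  have M: "?M > 0" by (simp add: add_nonneg_pos)
  then have eM: "ep / ?M > 0" using e by simp
  obtain ph where ph: "test_function U ph" "energy U (%x. u x - ph x) < ep / ?M"
   using assms(1) eM unfolding H10_iff[OF assms(3)] by blast
  obtain ps where ps: "test_function U ps" "energy U (%x. v x - ps x) < ep / ?M"
   using assms(2) eM unfolding H10_iff[OF assms(3)] by blast
  let ?f = "%x. u x - ph x" and ?g = "%x. v x - ps x"
  have f: "?f : H1 U" "?g : H1 U" using H E.diff test_function_H1(1)[OF _ assms(3)] ph ps by auto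
  have s: "energy U (%x. k * w x) = k^2 * energy U w" if "w : H1 U" for k w
   using E.B_sq_comb[OF that that, of k 0] by (simp add: energy_def)
  have "(%x. (c * u x + d * v x) - (c * ph x + d * ps x)) = (%x. c * ?f x + d * ?g x)" by (simp add: algebra_simps)
  then have "energy U (%x. (c * u x + d * v x) - (c * ph x + d * ps x)) = energy U (%x. c * ?f x + d * ?g x)" by simp
  also have "... <= 2 * energy U (%x. c * ?f x) + 2 * energy U (%x. d * ?g x)"
   using E.le_twice[OF E.scale[OF f(1)] E.scale[OF f(2)]] by (simp add: energy_def)
  also have "... = 2 * c^2 * energy U ?f + 2 * d^2 * energy U ?g" using s f by simp
  also have "... <= 2 * c^2 * (ep / ?M) + 2 * d^2 * (ep / ?M)" using ph ps by (intro add_mono mult_left_mono) auto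
  also have "... = (?M - 1) * (ep / ?M)" by (simp add: distrib_right add_divide_distrib)
  also have "... = ep - ep / ?M"
  proof -
   have gen: "(M - 1) * (e / M) = e - e / M" if "M > 0" for M e :: real using that by (simp add: field_simps)
   show ?thesis by (rule gen[OF M])
  qed
  also have "... < ep" using eM by simp
  finally show ?thesis using test_function_lin[OF ph(1) ps(1), of c d] by blast
 qed
 then show ?thesis unfolding H10_iff[OF assms(3)] using E.lin[OF H] by blast
qed

lemma H10_closed:
 assumes U: "open U" and u: "u : H1 U" and v: "!!n. v n : H10 U" and lim: "(%n. energy U (%x. v n x - u x)) ----> 0"
 shows "u : H10 U"
 unfolding H10_iff[OF U]
proof (intro conjI allI impI u)
 interpret E: semi_inner "H1 U" "%u v. L2_inner U u v + grad_inner U u v" by (rule semi_inner_energy[OF U])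
 fix ep :: real assume "ep > 0"
 then have "\<forall>\<^sub>F n in sequentially. energy U (%x. v n x - u x) < ep / 4" using lim by (intro order_tendstoD(2)) auto
 then obtain n where n: "energy U (%x. v n x - u x) < ep / 4" by (auto simp: eventually_sequentially)
 obtain ph where ph: "test_function U ph" "energy U (%x. v n x - ph x) < ep / 4"
 proof -
  have "ep / 4 > 0" using \<open>ep > 0\<close> by simp
  then show ?thesis using v[of n] that unfolding H10_iff[OF U] by blast
 qed
 have vH: "v n : H1 U" and phH: "ph : H1 U" using v H10_H1 test_function_H1(1)[OF ph(1) U] by auto
 have "energy U (%x. u x - ph x) <= 2 * energy U (%x. u x - v n x) + 2 * energy U (%x. ph x - v n x)"
  using E.le_twice_via[OF u phH vH] by (simp add: energy_def)
 also have "... = 2 * energy U (%x. v n x - u x) + 2 * energy U (%x. v n x - ph x)"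
  using E.sq_diff_commute[OF u vH] E.sq_diff_commute[OF phH vH] by (simp add: energy_def)
 also have "... < ep" using n ph(2) by simp
 finally show "EX ph. test_function U ph & energy U (%x. u x - ph x) < ep" using ph(1) by blast
qed

subsection \<open>One-dimensional Sobolev functions\<close>

lemma box_bump_not_AE_0:
 fixes a b :: "'a::euclidean_space"
 assumes "box a b ~= {}"
 shows "~ (AE x in lebesgue. box_bump a b x = 0)"
proof
 assume "AE x in lebesgue. box_bump a b x = 0"
 then obtain N where N: "negligible N" "{x. box_bump a b x ~= 0} <= N"
  unfolding eventually_ae_filter_negligible by blast
 have "box a b <= {x. box_bump a b x ~= 0}" using box_bump_pos_iff[of a b] by force
 then have "negligible (box a b)" using N negligible_subset by blast
 then show False using open_not_negligible[OF open_box assms] by blast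
qed

lemma box_bump_integral_pos:
 fixes a b :: "'a::euclidean_space"
 assumes "box a b ~= {}"
 shows "(LBINT x. box_bump a b x) > 0" "cbox a b <= U ==> open U ==> L2_sq U (box_bump a b) > 0"
proof -
 have t: "test_function UNIV (box_bump a b)" by (rule test_function_box_bump) simp
 have c: "continuous_on UNIV (box_bump a b)" by (rule C_k_continuous[OF C_k_box_bump])
 then have m: "box_bump a b : borel_measurable borel" by (rule borel_measurable_continuous_onI)
 have z: "box_bump a b x = 0" if "x ~: cbox a b" for x
 proof -
  have "~ box_bump a b x > 0" using that box_subset_cbox[of a b] unfolding box_bump_pos_iff by blast
  then show ?thesis using box_bump_nonneg[of a b x] by simp
 qed
 have i: "integrable lborel (box_bump a b)" by (rule continuous_compact_support[OF c compact_cbox z])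
 have "integral\<^sup>L lborel (box_bump a b) ~= 0"
 proof
  assume "integral\<^sup>L lborel (box_bump a b) = 0"
  then have "AE x in lborel. box_bump a b x = 0"
   using integral_nonneg_eq_0_iff_AE[OF i] box_bump_nonneg by auto
  then show False using box_bump_not_AE_0[OF assms] AE_completion by blast
 qed
 moreover have "integral\<^sup>L lborel (box_bump a b) >= 0" by (rule lebesgue_nonneg) (rule box_bump_nonneg)
 ultimately show "(LBINT x. box_bump a b x) > 0" by simp
 assume ab: "cbox a b <= U" and U: "open U"
 have L: "box_bump a b : L2 U" by (rule test_function_L2[OF t U])
 have "L2_sq U (box_bump a b) ~= 0"
 proof
  assume "L2_sq U (box_bump a b) = 0"
  then have "AE x in lebesgue_on U. box_bump a b x = 0" using L2_null_iff[OF L] by simp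
  then have "AE x in lebesgue. x : U --> box_bump a b x = 0"
   using open_sets_lebesgue[OF U] by (subst (asm) AE_restrict_space_iff) auto
  then have "AE x in lebesgue. box_bump a b x = 0"
   by eventually_elim (use z ab in blast)
  then show False using box_bump_not_AE_0[OF assms] by blast
 qed
 then show "L2_sq U (box_bump a b) > 0"
  using semi_inner.nonneg[OF semi_inner_L2 L] by simp
qed

lemma has_weak_deriv_subset:
 fixes U V :: "'a::euclidean_space set"
 assumes w: "has_weak_deriv U u i g" and V: "V <= U" "open V" "open U"
 shows "has_weak_deriv V u i g"
 unfolding has_weak_deriv_def
proof (intro conjI allI impI)
 show "locally_integrable V u" "locally_integrable V g"
  using w V(1) by (auto simp: has_weak_deriv_def locally_integrable_def)
 fix ph assume ph: "test_function V ph"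
 obtain K where K: "compact K" "K <= V" "!!x. x ~: K ==> ph x = 0" using test_functionD[OF ph] by blast
 have z: "pd ph i x = 0" if "x ~: K" for x
  using partial_deriv_eq_0[OF compact_imp_closed[OF K(1)] K(3) that] .
 have e: "integral\<^sup>L (lebesgue_on V) f = integral\<^sup>L (lebesgue_on U) f" if "!!x. x ~: K ==> f x = 0" for f :: "'a => real"
 proof -
  have "x ~: V ==> f x = 0" "x ~: U ==> f x = 0" for x using that K(2) V(1) by auto
  then show ?thesis
   using lebesgue_on_support(2)[OF open_sets_lebesgue[OF V(2)], of f] lebesgue_on_support(2)[OF open_sets_lebesgue[OF V(3)], of f] by simp
 qed
 have "test_function U ph" using test_function_mono[OF ph V(1)] .
 then have "(LINT x|lebesgue_on U. u x * pd ph i x) = - (LINT x|lebesgue_on U. g x * ph x)"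
  using w by (auto simp: has_weak_deriv_def)
 moreover have "(LINT x|lebesgue_on V. u x * pd ph i x) = (LINT x|lebesgue_on U. u x * pd ph i x)"
  by (rule e) (simp add: z)
 moreover have "(LINT x|lebesgue_on V. g x * ph x) = (LINT x|lebesgue_on U. g x * ph x)"
  by (rule e) (simp add: K)
 ultimately show "(LINT x|lebesgue_on V. u x * pd ph i x) = - (LINT x|lebesgue_on V. g x * ph x)"
  by simp
qed

lemma integrable_kernel_product:
 fixes ps :: "'a::euclidean_space => real" and g :: "'b::euclidean_space => real"
 assumes ps: "integrable lborel ps" and g: "integrable lborel g" and k: "k : borel_measurable (lborel \<Otimes>\<^sub>M lborel)" "!!p. \<bar>k p\<bar> <= 1"
 shows "integrable (lborel \<Otimes>\<^sub>M lborel) (%p. k p * (ps (fst p) * g (snd p)))"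
proof (rule lebesgue_bound)
 have m [measurable]: "ps : borel_measurable borel" "g : borel_measurable borel" using ps g by auto
 note k [measurable]
 show "integrable (lborel \<Otimes>\<^sub>M lborel) (%p. ps (fst p) * g (snd p))"
  by (rule lborel_pair.Fubini_integrable) (use ps g in "auto simp: abs_mult")
 show "(%p. k p * (ps (fst p) * g (snd p))) : borel_measurable (lborel \<Otimes>\<^sub>M lborel)" by measurable
 show "AE p in lborel \<Otimes>\<^sub>M lborel. norm (k p * (ps (fst p) * g (snd p))) <= norm (ps (fst p) * g (snd p))"
  using k(2) by (auto simp: abs_mult intro!: always_eventually mult_left_le_one_le)
qed

lemma continuous_antiderivative:
 fixes f :: "real => real"
 assumes "continuous_on UNIV f"
 shows "EX F. ALL x. (F has_real_derivative f x) (at x)"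
 using einterval_antiderivative[of "-\<infinity>" "\<infinity>" f] assms
 by (auto simp: has_real_derivative_iff_has_vector_derivative continuous_on_eq_continuous_at)

lemma FTC_lborel:
 fixes f :: "real => real"
 assumes "a <= b" "!!x. (F has_real_derivative f x) (at x)" "continuous_on UNIV f"
 shows "(LBINT x. f x * indicator {a..b} x) = F b - F a"
 using assms by (intro integral_FTC_Icc_real) (auto simp: continuous_on_eq_continuous_at)

text \<open>The primitive vanishes left of the support by normalisation and right of it because the
  total integral is \<open>0\<close>. So the mean-zero test functions are exactly what the du
  Bois-Reymond argument can use as derivatives.\<close>

lemma test_function_antiderivative:
 fixes et :: "real => real"
 assumes et: "test_function {a<..<b} et" and z: "(LBINT x. et x) = 0"
 shows "EX ph. test_function {a<..<b} ph & (ALL x. (ph has_real_derivative et x) (at x))"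
proof -
 obtain K where K: "compact K" "K <= {a<..<b}" "!!x. x ~: K ==> et x = 0" using test_functionD[OF et] by blast
 show ?thesis
 proof (cases "K = {}")
  case True
  then have "et = (%x. 0)" using K(3) by auto
  then show ?thesis using test_function_0 by (intro exI[of _ "%x. 0"]) auto
 next
  case False
  obtain m where m: "m : K" "!!x. x : K ==> m <= x" using compact_attains_inf[OF K(1) False] by blast
  obtain M where M: "M : K" "!!x. x : K ==> x <= M" using compact_attains_sup[OF K(1) False] by blast
  \<comment> \<open>\<open>c\<close> and \<open>d\<close> lie strictly between the support and the
    ends of the interval, so that the primitive is supported in the compact set
    \<open>{c..d}\<close> inside it.\<close>
  define c where "c = (a + m) / 2"
  define d where "d = (M + b) / 2"
  have cd: "a < c" "c < m" "m <= M" "M < d" "d < b" using m M K(2) by (auto simp: c_def d_def)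
  have etz: "et x = 0" if "x <= c | d <= x" for x
  proof (cases "x : K")
   case True
   then show ?thesis using m(2)[of x] M(2)[of x] cd that by linarith
  qed (rule K(3))
  have cont: "continuous_on UNIV et" using C_k_continuous[OF test_function_C_k[OF et, of 0]] .
  obtain F where F: "!!x. (F has_real_derivative et x) (at x)" using continuous_antiderivative[OF cont] by blast
  define ph where "ph x = F x - F c" for x
  have dph: "(ph has_real_derivative et x) (at x)" for x
   unfolding ph_def[abs_def] using F by (auto intro!: derivative_eq_intros)
  have ints: "F y - F x = (LBINT s. et s * indicator {x..y} s)" if "x <= y" for x y
   using FTC_lborel[OF that F cont] by simp
  have zero: "ph x = 0" if "x ~: {c..d}" for x
  proof (cases "x < c")
   case True
   have "(%s. et s * indicator {x..c} s) = (%s. 0)" using etz by (auto simp: fun_eq_iff split: split_indicator)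
   then show ?thesis using ints[of x c] True by (simp add: ph_def)
  next
   case False
   then have "x > d" using that by auto
   then have "(%s. et s * indicator {c..x} s) = et" using etz by (auto simp: fun_eq_iff split: split_indicator)
   then show ?thesis using ints[of c x] \<open>x > d\<close> cd z by (simp add: ph_def)
  qed
  have "C_k n ph" for n
   using C_k_SucI_real[OF dph test_function_C_k[OF et]] C_k_SucD by blast
  then have "test_function {a<..<b} ph" by (rule test_functionI[OF _ compact_Icc _ zero]) (use cd in auto)
  then show ?thesis using dph by blast
 qed
qed

text \<open>The primitive \<open>G\<close> has weak derivative \<open>g\<close> by Fubini over the
  region \<open>z <= x\<close>, so \<open>u - G\<close> has weak derivative \<open>0\<close>; a du
  Bois-Reymond argument shows that it is constant.\<close>

lemma weak_deriv_interval_representation: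
 fixes u g :: "real => real"
 assumes ab: "a < b" and w: "has_weak_deriv {a<..<b} u 1 g'"
  and g: "integrable lborel g" "!!x. x ~: {a<..<b} ==> g x = 0" "AE x in lebesgue_on {a<..<b}. g' x = g x"
 shows "EX k. AE x in lebesgue_on {a<..<b}. u x = k + (LBINT z. g z * indicator {..x} z)"
proof -
 let ?J = "{a<..<b}"
 have J: "open ?J" "?J : sets lebesgue" by auto
 have gm [measurable]: "g : borel_measurable borel" using g by auto
 define G where "G x = (LBINT z. g z * indicator {..x} z)" for x
 have ind: "(%p::real\<times>real. indicator {..fst p} (snd p) :: real) : borel_measurable (lborel \<Otimes>\<^sub>M lborel)"
 proof -
  have "(%p::real\<times>real. indicator {..fst p} (snd p) :: real) = (%p. indicator {p. snd p <= fst p} p)" by (auto simp: indicator_def)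
  then show ?thesis by simp
 qed
 have Gb: "\<bar>G x\<bar> <= (LBINT z. \<bar>g z\<bar>)" for x
 proof -
  have "\<bar>G x\<bar> <= (LBINT z. \<bar>g z * indicator {..x} z\<bar>)" unfolding G_def by (rule integral_abs_bound)
  also have "... <= (LBINT z. \<bar>g z\<bar>)"
  proof (rule integral_mono)
   show "integrable lborel (%z. \<bar>g z * indicator {..x} z\<bar>)"
    using integrable_mult_indicator[of "{..x}" lborel g] g(1) by (simp add: mult.commute integrable_abs)
  qed (use g(1) in "auto simp: abs_mult split: split_indicator")
  finally show ?thesis .
 qed
 have Gm: "G : borel_measurable borel"
 proof -
  have "(%p. g (snd p) * indicator {..fst p} (snd p)) : borel_measurable (lborel \<Otimes>\<^sub>M lborel)" using ind by measurable
  then have "(%x. LBINT z. g (snd (x, z)) * indicator {..fst (x, z)} (snd (x, z))) : borel_measurable lborel"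
   by (intro lborel.borel_measurable_lebesgue_integral) (simp add: case_prod_unfold)
  then show ?thesis by (simp add: G_def[abs_def])
 qed
 have Gli: "locally_integrable ?J G"
  unfolding locally_integrable_def set_integrable_def
 proof (intro allI impI)
  fix K :: "real set" assume K: "compact K & K <= ?J"
  have "integrable lborel (%x. indicator K x *\<^sub>R G x)"
  proof (rule lebesgue_bound)
   show "integrable lborel (%x. (LBINT z. \<bar>g z\<bar>) * indicator K x)"
    using K emeasure_bounded_finite[of K] by (auto intro!: integrable_mult_right integrable_real_indicator borel_compact simp: compact_imp_bounded)
   show "(%x. indicator K x *\<^sub>R G x) : borel_measurable lborel" using Gm K borel_compact[of K] by simp
   show "AE x in lborel. norm (indicator K x *\<^sub>R G x) <= norm ((LBINT z. \<bar>g z\<bar>) * indicator K x)"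
    using Gb by (auto intro!: always_eventually split: split_indicator intro: order_trans[OF Gb abs_ge_self])
  qed
  then show "integrable lebesgue (%x. indicator K x *\<^sub>R G x)"
   using Gm K borel_compact[of K] by (subst lebesgue_lborel) auto
 qed
 have byparts: "(LINT x|lebesgue_on ?J. G x * pd ph 1 x) = - (LINT x|lebesgue_on ?J. g x * ph x)"
  if ph: "test_function ?J ph" for ph
 proof -
  let ?d = "pd ph 1"
  obtain K where K: "compact K" "K <= ?J" "!!x. x ~: K ==> ph x = 0" using test_functionD[OF ph] by blast
  have phz: "ph x = 0" if "x ~: ?J" for x using K(2) K(3)[of x] that by blast
  have dz: "?d x = 0" if "x ~: ?J" for x
  proof -
   have xK: "x ~: K" using K(2) that by blast
   show ?thesis by (rule partial_deriv_eq_0[OF compact_imp_closed[OF K(1)] K(3) xK])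
  qed
  have cph: "continuous_on UNIV ph" using C_k_continuous[OF test_function_C_k[OF ph, of 0]] .
  have cd: "continuous_on UNIV ?d" using test_function_C_k[OF ph, of 1] by simp
  have [measurable]: "ph : borel_measurable borel" "?d : borel_measurable borel"
   using cph cd by (auto intro: borel_measurable_continuous_onI)
  have der: "(ph has_real_derivative ?d x) (at x)" for x
   using DERIV_along_line[OF test_function_C_k[OF ph], of 0 1 x] by simp
  have id: "integrable lborel ?d"
   by (rule continuous_compact_support[OF cd K(1)]) (rule partial_deriv_eq_0[OF compact_imp_closed[OF K(1)] K(3)])
  have "integrable (lborel \<Otimes>\<^sub>M lborel) (%p. indicator {..fst p} (snd p) * (?d (fst p) * g (snd p)))"
   by (rule integrable_kernel_product[OF id g(1) ind]) (auto split: split_indicator)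
  then have I: "integrable (lborel \<Otimes>\<^sub>M lborel) (case_prod (%x z. indicator {..x} z * (?d x * g z)))"
   by (simp add: case_prod_unfold)
  have "(LBINT x. G x * ?d x) = (LBINT x. (LBINT z. indicator {..x} z * (?d x * g z)))"
   unfolding G_def by (simp add: mult_ac flip: integral_mult_right_zero integral_mult_left_zero)
  also have "... = (LBINT z. (LBINT x. indicator {..x} z * (?d x * g z)))"
   by (rule lborel_pair.Fubini_integral[OF I, symmetric])
  also have "... = (LBINT z. - (g z * ph z))"
  proof (rule lebesgue_cong[OF refl])
   fix z
   have "(LBINT x. indicator {..x} z * (?d x * g z)) = (LBINT x. g z * (?d x * indicator {z..max z b} x))"
   proof (rule lebesgue_cong[OF refl])
    fix x
    have "?d x = 0 | x < b" using dz[of x] by force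
    then show "indicator {..x} z * (?d x * g z) = g z * (?d x * indicator {z..max z b} x)"
     by (auto split: split_indicator)
   qed
   also have "... = g z * (ph (max z b) - ph z)"
    using FTC_lborel[OF _ der cd, of z "max z b"] by simp
   also have "ph (max z b) = 0" by (rule phz) auto
   finally show "(LBINT x. indicator {..x} z * (?d x * g z)) = - (g z * ph z)" by simp
  qed
  finally have e: "(LBINT x. G x * ?d x) = - (LBINT x. g x * ph x)" by simp
  have "(LINT x|lebesgue_on ?J. G x * ?d x) = (LBINT x. G x * ?d x)"
   using Gm dz by (subst lebesgue_on_support) (auto simp: lebesgue_lborel)
  moreover have "(LINT x|lebesgue_on ?J. g x * ph x) = (LBINT x. g x * ph x)"
   using phz by (subst lebesgue_on_support) (auto simp: lebesgue_lborel)
  ultimately show ?thesis using e by simp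
 qed
 have uli: "locally_integrable ?J u" "locally_integrable ?J g'" using w by (auto simp: has_weak_deriv_def)
 define h where "h x = 1 * u x + (-1) * G x" for x
 have hli: "locally_integrable ?J h" unfolding h_def[abs_def] by (rule locally_integrable_lin[OF uli(1) Gli])
 have hd: "(LINT x|lebesgue_on ?J. h x * pd ph 1 x) = 0" if ph: "test_function ?J ph" for ph
 proof -
  have "(LINT x|lebesgue_on ?J. u x * pd ph 1 x) = - (LINT x|lebesgue_on ?J. g' x * ph x)"
   using w ph by (auto simp: has_weak_deriv_def)
  also have "(LINT x|lebesgue_on ?J. g' x * ph x) = (LINT x|lebesgue_on ?J. g x * ph x)"
  proof (rule integral_cong_AE)
   show "(%x. g' x * ph x) : borel_measurable (lebesgue_on ?J)"
    using locally_integrable_times_test_function(1)[OF uli(2) J(1) ph] by simp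
   have "(%x. g x * ph x) : borel_measurable borel"
    using C_k_continuous[OF test_function_C_k[OF ph, of 0]] by (intro borel_measurable_times gm borel_measurable_continuous_onI)
   then show "(%x. g x * ph x) : borel_measurable (lebesgue_on ?J)"
    by (intro measurable_restrict_space1 measurable_completion) simp
  qed (use g(3) in auto)
  finally have "(LINT x|lebesgue_on ?J. u x * pd ph 1 x) = (LINT x|lebesgue_on ?J. G x * pd ph 1 x)"
   using byparts[OF ph] by simp
  then show ?thesis
   using locally_integrable_times_test_function(2)[OF uli(1) J(1) ph, of 1] locally_integrable_times_test_function(2)[OF Gli J(1) ph, of 1]
   by (simp add: h_def left_diff_distrib)
 qed
 define p where "p = (2 * a + b) / 3"
 define q where "q = (a + 2 * b) / 3"
 have pq: "a < p" "p < q" "q < b" using ab by (auto simp: p_def q_def)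
 let ?c = "box_bump p q"
 have cI: "(LBINT x. ?c x) > 0" using box_bump_integral_pos(1)[of p q] pq by (simp add: box_real)
 have ct: "test_function ?J ?c" by (rule test_function_box_bump) (use pq in auto)
 define k where "k = (LINT x|lebesgue_on ?J. h x * ?c x) / (LBINT x. ?c x)"
 have tint: "integrable lborel ze & (LINT x|lebesgue_on ?J. ze x) = (LBINT x. ze x) & integrable (lebesgue_on ?J) ze" if ze: "test_function ?J ze" for ze
 proof -
  obtain K where K: "compact K" "K <= ?J" "!!x. x ~: K ==> ze x = 0" using test_functionD[OF ze] by blast
  have c: "continuous_on UNIV ze" using C_k_continuous[OF test_function_C_k[OF ze, of 0]] .
  have m: "ze : borel_measurable borel" using c by (rule borel_measurable_continuous_onI)
  have z: "ze x = 0" if "x ~: ?J" for x using K(2) K(3)[of x] that by blast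
  have "integrable lborel ze" by (rule continuous_compact_support[OF c K(1,3)])
  then show ?thesis
   using lebesgue_on_support[OF J(2), of ze] z lebesgue_lborel[OF m] by auto
 qed
 have "AE x in lebesgue_on ?J. 1 * h x + (- k) * 1 = 0"
 proof (rule fundamental_lemma[OF locally_integrable_lin[OF hli locally_integrable_continuous] J(1)])
  fix ze assume ze: "test_function ?J ze"
  \<comment> \<open>Subtracting this multiple of the fixed bump \<open>?c\<close> makes
    \<open>ze\<close> mean zero, hence the derivative of a test function, against which
    \<open>h\<close> integrates to \<open>0\<close>.\<close>
  define r where "r = (LBINT x. ze x) / (LBINT x. ?c x)"
  have et: "test_function ?J (%x. 1 * ze x + (- r) * ?c x)" by (rule test_function_lin[OF ze ct])
  have "(LBINT x. 1 * ze x + (- r) * ?c x) = 0"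
   using tint[OF ze] tint[OF ct] cI by (simp add: r_def)
  from test_function_antiderivative[OF et this] obtain ph where
   ph: "test_function ?J ph" "!!x. (ph has_real_derivative (1 * ze x + (- r) * ?c x)) (at x)" by blast
  have "(LINT x|lebesgue_on ?J. h x * (1 * ze x + (- r) * ?c x)) = 0"
   using hd[OF ph(1)] by (simp add: partial_deriv_real[OF ph(2)])
  moreover have hi: "integrable (lebesgue_on ?J) (%x. h x * ze x)" "integrable (lebesgue_on ?J) (%x. h x * ?c x)"
   using locally_integrable_times_test_function(1)[OF hli J(1)] ze ct by auto
  ultimately have "(LINT x|lebesgue_on ?J. h x * ze x) = r * (LINT x|lebesgue_on ?J. h x * ?c x)"
   by (simp add: distrib_left right_diff_distrib mult.left_commute[of _ r])
  then have e: "(LINT x|lebesgue_on ?J. h x * ze x) = k * (LBINT x. ze x)"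
   by (simp add: r_def k_def)
  have "(LINT x|lebesgue_on ?J. (1 * h x + - k * 1) * ze x) = (LINT x|lebesgue_on ?J. h x * ze x - k * ze x)"
   by (simp add: left_diff_distrib)
  also have "... = (LINT x|lebesgue_on ?J. h x * ze x) - k * (LINT x|lebesgue_on ?J. ze x)"
   using hi(1) tint[OF ze] by simp
  finally show "(LINT x|lebesgue_on ?J. (1 * h x + - k * 1) * ze x) = 0"
   using e tint[OF ze] by simp
 qed simp
 then have "AE x in lebesgue_on ?J. u x = k + G x" by (rule AE_mp) (auto simp: h_def)
 then show ?thesis unfolding G_def by blast
qed

lemma L2_borel_representative:
 fixes g :: "'a::euclidean_space => real"
 assumes "g : L2 U" "open U"
 shows "EX f:borel_measurable borel. (ALL x. x ~: U --> f x = 0) & (AE x in lebesgue_on U. g x = f x) &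
   integrable lborel (%x. (f x)^2) & L2_inner U g g = (LBINT x. (f x)^2)"
proof -
 have U: "U : sets lebesgue" using assms(2) by (rule open_sets_lebesgue)
 have gm: "(%x. indicator U x *\<^sub>R g x) : borel_measurable lebesgue"
  using L2_D(1)[OF assms(1)] U by (simp add: borel_measurable_restrict_space_iff)
 obtain f0 where f0 [measurable]: "f0 : borel_measurable borel" and ae: "AE x in lborel. indicator U x *\<^sub>R g x = f0 x"
  using completion_ex_borel_measurable_real[OF gm] by auto
 define f where "f x = indicator U x * f0 x" for x
 have Ub [measurable]: "U : sets borel" using assms(2) by (rule borel_open)
 have fm [measurable]: "f : borel_measurable borel" unfolding f_def[abs_def] by measurable
 have z: "x ~: U ==> f x = 0" for x by (simp add: f_def)
 have ae': "AE x in lebesgue_on U. g x = f x"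
  using AE_completion[OF ae] U by (subst AE_restrict_space_iff) (auto elim!: eventually_mono simp: f_def)
 have i1: "integrable (lebesgue_on U) (%x. (f x)^2)"
  using L2_cong_AE[OF assms(1) ae' assms(2)] by (rule L2_D(2))
 have i2: "integrable lborel (%x. (f x)^2)"
  using i1 lebesgue_on_support(1)[OF U, of "%x. (f x)^2"] z by (simp add: lebesgue_lborel)
 have "L2_inner U g g = L2_inner U f f"
  using L2_cong_AE[OF assms(1) ae' assms(2)] ae' assms(1) by (intro L2_inner_cong_AE)
 also have "... = (LBINT x. (f x)^2)"
  unfolding L2_inner_def power2_eq_square[symmetric]
  using lebesgue_on_support(2)[OF U, of "%x. (f x)^2"] z by (simp add: lebesgue_lborel)
 finally show ?thesis using fm z ae' i2 by blast
qed

lemma integral_interval_const: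
 fixes a b :: real
 assumes "a <= b"
 shows "integrable (lebesgue_on {a<..<b}) (%x. c :: real)" "(LINT x|lebesgue_on {a<..<b}. c) = c * (b - a)"
proof -
 have m: "measure lebesgue {a<..<b} = b - a" using assms by simp
 have "(LINT x|lebesgue_on {a<..<b}. c) = (LINT x|lebesgue. indicator {a<..<b} x * c)"
  by (subst integral_restrict_space) auto
 also have "... = c * (b - a)" using m by simp
 finally show "(LINT x|lebesgue_on {a<..<b}. c) = c * (b - a)" .
 show "integrable (lebesgue_on {a<..<b}) (%x. c :: real)"
 proof (subst integrable_restrict_space)
  have "integrable lebesgue (indicator {a<..<b} :: real => real)"
   using assms by (intro integrable_real_indicator) auto
  then show "integrable lebesgue (%x. indicator {a<..<b} x *\<^sub>R c)" by simp
 qed auto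
qed

text \<open>Writing \<open>u = k + G\<close>, Cauchy-Schwarz bounds \<open>G^2\<close> by
  \<open>b - a\<close> times the energy, and no constant is closer to \<open>u\<close> in
  \<open>L2\<close> than its mean. The factor \<open>(b - a)^2\<close> is not sharp: only its
  smallness on short cells matters.\<close>

lemma Poincare_cell:
 fixes u g :: "real => real"
 assumes ab: "a < b" and w: "has_weak_deriv {a<..<b} u 1 g" and L: "u : L2 {a<..<b}" "g : L2 {a<..<b}"
 shows "L2_inner {a<..<b} u u <= (b - a)^2 * L2_inner {a<..<b} g g + (LINT x|lebesgue_on {a<..<b}. u x)^2 / (b - a)"
proof -
 let ?J = "{a<..<b}" and ?M = "lebesgue_on {a<..<b}"
 obtain f where f [measurable]: "f : borel_measurable borel" and fz: "!!x. x ~: ?J ==> f x = 0" and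
  fae: "AE x in ?M. g x = f x" and fi: "integrable lborel (%x. (f x)^2)" and fe: "L2_inner ?J g g = (LBINT x. (f x)^2)"
  using L2_borel_representative[OF L(2)] by auto
 have indi: "integrable lborel (%x. indicator ?J x :: real)" using ab by (auto intro!: integrable_real_indicator)
 have f1: "integrable lborel f"
 proof -
  have "integrable lborel (%x. indicator ?J x * f x)"
  proof (rule square_integrable_mult)
   have "(%x. (indicator ?J x :: real)^2) = indicator ?J" by (auto simp: fun_eq_iff split: split_indicator)
   then show "integrable lborel (%x. (indicator ?J x :: real)^2)" using indi by simp
  qed (use fi in auto)
  moreover have "(%x. indicator ?J x * f x) = f" using fz by (auto simp: fun_eq_iff split: split_indicator)
  ultimately show ?thesis by (simp only:)
 qed
 obtain k where k: "AE x in ?M. u x = k + (LBINT z. f z * indicator {..x} z)"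
  using weak_deriv_interval_representation[OF ab w f1 fz fae] by blast
 have Gb: "(LBINT z. f z * indicator {..x} z)^2 <= (b - a) * L2_inner ?J g g" for x
 proof -
  interpret LL: semi_inner "L2 (UNIV::real set)" "L2_inner UNIV" by (rule semi_inner_L2)
  have fL: "f : L2 UNIV" using fi by (auto simp: L2_def lebesgue_lborel lebesgue_on_UNIV_eq intro!: measurable_completion)
  let ?i = "%z. indicator (?J \<inter> {..x}) z :: real"
  have ii: "integrable lborel ?i" using integrable_mult_indicator[of "{..x}" lborel "%x. indicator ?J x :: real"] indi
   by (simp add: indicator_inter_arith mult.commute)
  have iL: "?i : L2 UNIV"
  proof -
   have "(%x. (?i x)^2) = ?i" by (auto simp: fun_eq_iff split: split_indicator)
   then show ?thesis using ii by (auto simp: L2_def lebesgue_lborel lebesgue_on_UNIV_eq intro!: measurable_completion)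
  qed
  have "(LBINT z. f z * indicator {..x} z) = L2_inner UNIV ?i f"
   unfolding L2_inner_def using fz
   by (simp add: lebesgue_lborel lebesgue_on_UNIV_eq) (intro lebesgue_cong refl, auto split: split_indicator)
  then have "(LBINT z. f z * indicator {..x} z)^2 <= L2_inner UNIV ?i ?i * L2_inner UNIV f f"
   using LL.Cauchy_Schwarz[OF iL fL] by simp
  also have "L2_inner UNIV f f = L2_inner ?J g g"
   unfolding fe by (simp add: L2_inner_def lebesgue_lborel lebesgue_on_UNIV_eq power2_eq_square)
  also have "L2_inner UNIV ?i ?i <= b - a"
  proof -
   have "L2_inner UNIV ?i ?i = (LBINT z. ?i z)"
   proof -
    have "(%z. ?i z * ?i z) = ?i" by (auto simp: fun_eq_iff split: split_indicator)
    then have "L2_inner UNIV ?i ?i = integral\<^sup>L lebesgue ?i" by (simp only: L2_inner_def lebesgue_on_UNIV_eq)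
    then show ?thesis by (subst (asm) lebesgue_lborel) auto
   qed
   also have "... <= (LBINT z. indicator ?J z)" using ii indi by (intro integral_mono) (auto split: split_indicator)
   also have "... = b - a" using ab by simp
   finally show ?thesis .
  qed
  finally show ?thesis using semi_inner.nonneg[OF semi_inner_L2 L(2)] by (simp add: mult_right_mono)
 qed
 note c = integral_interval_const[OF less_imp_le[OF ab]]
 have cL: "(%x. 1) : L2 ?J" using c by (simp add: L2_def)
 have ui: "integrable ?M u" using L2_mult_integrable[OF L(1) cL] by simp
 have u2: "integrable ?M (%x. (u x)^2)" using L2_D(2)[OF L(1)] .
 have e: "(u x - k)^2 = (u x)^2 - 2 * k * u x + k^2" for x by (simp add: power2_diff)
 have i3: "integrable ?M (%x. (u x - k)^2)" unfolding e using ui u2 c by simp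
 define U where "U = (LINT x|?M. u x)"
 have "(LINT x|?M. (u x - k)^2) = L2_inner ?J u u - 2 * k * U + k^2 * (b - a)"
  unfolding e using ui u2 c by (simp add: L2_inner_def power2_eq_square U_def)
 also have "... >= L2_inner ?J u u - U^2 / (b - a)"
 proof -
  have "0 <= (U - k * (b - a))^2 / (b - a)" using ab by simp
  also have "... = U^2 / (b - a) - 2 * k * U + k^2 * (b - a)"
   using ab by (simp add: power2_eq_square field_simps)
  finally show ?thesis by simp
 qed
 finally have "L2_inner ?J u u - U^2 / (b - a) <= (LINT x|?M. (u x - k)^2)" .
 also have "... <= (LINT x|?M. (b - a) * L2_inner ?J g g)"
 proof (rule integral_mono_AE[OF i3 c(1)])
  show "AE x in ?M. (u x - k)^2 <= (b - a) * L2_inner ?J g g"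
   using k by eventually_elim (use Gb in simp)
 qed
 also have "... = (b - a)^2 * L2_inner ?J g g" unfolding c(2) by (simp add: power2_eq_square)
 finally show ?thesis by (simp add: U_def)
qed

subsection \<open>Compactness and forms with a potential\<close>

text \<open>Bumps on disjoint boxes strung along a diagonal have products zero, so they are
  orthogonal and therefore independent.\<close>

lemma infinite_dim_test:
 fixes U :: "'a::euclidean_space set"
 assumes U: "open U" "U ~= {}"
 shows "EX v. (ALL i<n. test_function U (v i)) & (ALL c. L2_sq U (lincomb n c v) = 0 --> (ALL i<n. c i = 0))"
proof -
 obtain x0 where x0: "x0 : U" using U by blast
 then obtain e where e: "e > 0" "ball x0 e <= U" using U by (meson openE)
 \<comment> \<open>Box \<open>i\<close> occupies the multiples \<open>2 * i\<close> to
   \<open>2 * i + 1\<close> of \<open>et\<close> in every coordinate, so all \<open>n\<close> boxes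
   stay within \<open>2 * n * et * norm One < e\<close> of \<open>x0\<close>.\<close>
 define et where "et = e / (real (2 * n + 1) * (1 + norm (One::'a)))"
 have et: "et > 0" using e by (simp add: et_def add_pos_nonneg)
 define p where "p i = x0 + (real (2 * i) * et) *\<^sub>R (One::'a)" for i
 define q where "q i = x0 + (real (2 * i + 1) * et) *\<^sub>R (One::'a)" for i
 have mem: "x : box (p i) (q i) \<longleftrightarrow> (ALL b:Basis. real (2 * i) * et < (x - x0) \<bullet> b & (x - x0) \<bullet> b < real (2 * i + 1) * et)" for x i
  by (auto simp: mem_box p_def q_def inner_simps)
 have cmem: "x : cbox (p i) (q i) \<longleftrightarrow> (ALL b:Basis. real (2 * i) * et <= (x - x0) \<bullet> b & (x - x0) \<bullet> b <= real (2 * i + 1) * et)" for x i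
  by (auto simp: mem_box p_def q_def inner_simps)
 have ne: "box (p i) (q i) ~= {}" for i
  using et by (auto simp: box_ne_empty p_def q_def inner_simps)
 have sub: "cbox (p i) (q i) <= U" if "i < n" for i
 proof
  fix x assume x: "x : cbox (p i) (q i)"
  have "norm (x - x0) <= norm ((real (2 * n) * et) *\<^sub>R (One::'a))"
  proof (rule norm_le_componentwise)
   fix b :: 'a assume b: "b : Basis"
   have 1: "0 <= (x - x0) \<bullet> b" "(x - x0) \<bullet> b <= real (2 * i + 1) * et"
   proof -
    have "real (2 * i) * et <= (x - x0) \<bullet> b & (x - x0) \<bullet> b <= real (2 * i + 1) * et" using x b unfolding cmem by blast
    moreover have "0 <= real (2 * i) * et" using et by simp
    ultimately show "0 <= (x - x0) \<bullet> b" "(x - x0) \<bullet> b <= real (2 * i + 1) * et" by linarith+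
   qed
   have "real (2 * i + 1) * et <= real (2 * n) * et" using that et by (intro mult_right_mono) auto
   then have "(x - x0) \<bullet> b <= real (2 * n) * et" using 1(2) by linarith
   then show "\<bar>(x - x0) \<bullet> b\<bar> <= \<bar>((real (2 * n) * et) *\<^sub>R (One::'a)) \<bullet> b\<bar>"
    using 1 b et by (simp add: abs_mult)
  qed
  also have "... = real (2 * n) * et * norm (One::'a)" using et by simp
  also have "... < real (2 * n + 1) * et * (1 + norm (One::'a))"
   using et by (simp add: algebra_simps add_pos_nonneg)
  also have "... = e" using e by (simp add: et_def add_nonneg_eq_0_iff field_simps)
  finally show "x : U" using e(2) by (auto simp: dist_norm norm_minus_commute)
 qed
 define v where "v i = box_bump (p i) (q i)" for i
 have vt: "test_function U (v i)" if "i < n" for i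
  unfolding v_def by (rule test_function_box_bump[OF sub[OF that]])
 have orth: "v i x * v j x = 0" if "i ~= j" for i j x
 proof (rule ccontr)
  assume "v i x * v j x ~= 0"
  then have "v i x > 0" "v j x > 0" using box_bump_nonneg[of "p i" "q i" x] box_bump_nonneg[of "p j" "q j" x] by (auto simp: v_def)
  then have m: "x : box (p i) (q i)" "x : box (p j) (q j)" by (auto simp: v_def box_bump_pos_iff)
  obtain b :: 'a where b: "b : Basis" using nonempty_Basis by blast
  have m': "real (2 * i) * et < real (2 * j + 1) * et" "real (2 * j) * et < real (2 * i + 1) * et"
   using m b unfolding mem by (meson less_trans)+
  then have "real (2 * i) < real (2 * j + 1)" "real (2 * j) < real (2 * i + 1)" using et by simp_all
  then have "i = j" by linarith
  then show False using that by simp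
 qed
 have "ALL i<n. c i = 0" if z: "L2_sq U (lincomb n c v) = 0" for c
 proof -
  interpret L: semi_inner "L2 U" "L2_inner U" by (rule semi_inner_L2)
  have vL: "v i : L2 U" if "i < n" for i using test_function_L2[OF vt[OF that] U(1)] .
  have "L2_sq U (lincomb n c v) = (\<Sum>i<n. \<Sum>j<n. c i * c j * L2_inner U (v i) (v j))"
   by (rule L.B_lincomb2[OF vL])
  also have "... = (\<Sum>i<n. \<Sum>j<n. if j = i then (c i)^2 * L2_sq U (v i) else 0)"
  proof (intro sum.cong refl)
   fix i j
   have "L2_inner U (v i) (v j) = 0" if "i ~= j"
   proof -
    have "(%x. v i x * v j x) = (%x. 0)" using orth[OF that] by (rule ext)
    then show ?thesis by (simp only: L2_inner_def integral_zero)
   qed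
   then show "c i * c j * L2_inner U (v i) (v j) = (if j = i then (c i)^2 * L2_sq U (v i) else 0)"
    by (auto simp: power2_eq_square)
  qed
  also have "... = (\<Sum>i<n. (c i)^2 * L2_sq U (v i))" by simp
  finally have s: "(\<Sum>i<n. (c i)^2 * L2_sq U (v i)) = 0" using z by simp
  have vp: "L2_sq U (v i) > 0" if "i < n" for i
   unfolding v_def by (rule box_bump_integral_pos(2)[OF ne sub[OF that] U(1)])
  show ?thesis
  proof (intro allI impI)
   fix i assume i: "i < n"
   have nn: "0 <= (c j)^2 * L2_sq U (v j)" if "j : {..<n}" for j
    using vp[of j] that by (intro mult_nonneg_nonneg) auto
   have "ALL j:{..<n}. (c j)^2 * L2_sq U (v j) = 0"
    using s sum_nonneg_eq_0_iff[of "{..<n}" "%j. (c j)^2 * L2_sq U (v j)"] nn by auto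
   then have "(c i)^2 * L2_sq U (v i) = 0" using i by blast
   then show "c i = 0" using vp[OF i] by simp
  qed
 qed
 then show ?thesis using vt by blast
qed

text \<open>Ehrling's inequality takes the place of a compact embedding.\<close>

lemma compact_from_Ehrling:
 fixes v :: "nat => 'a::euclidean_space => real"
 assumes D: "semi_inner D Q" "D <= L2 U" and QB: "!!u. u : D ==> L2_inner U u u <= Q u u"
  and E: "!!ep. ep > 0 ==> EX N w. (ALL j<N. w j : L2 U) &
     (ALL u:D. L2_inner U u u <= ep * Q u u + (\<Sum>j<(N::nat). (L2_inner U (w j) u)^2))"
  and v: "!!n. v n : D" "!!n. quad Q (v n) <= M"
 shows "EX r::nat => nat. strict_mono r & (ALL ep>0. EX N. ALL m>=N. ALL n>=N.
     L2_sq U (%x. v (r m) x - v (r n) x) < ep)"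
proof -
 interpret Q: semi_inner D Q by fact
 interpret L: semi_inner "L2 U" "L2_inner U" by (rule semi_inner_L2)
 have vL: "v n : L2 U" for n using v(1) D(2) by blast
 have M: "M >= 0" using Q.nonneg[OF v(1)[of 0]] v(2)[of 0] by linarith
 have "EX p. (ALL j<fst p. snd p j : L2 U) &
     (ALL u:D. L2_inner U u u <= 1 / real (Suc k) * Q u u + (\<Sum>j<(fst p::nat). (L2_inner U (snd p j) u)^2))" for k
 proof -
  have "1 / real (Suc k) > 0" by simp
  from E[OF this] obtain N w where "(ALL j<N. w j : L2 U) &
     (ALL u:D. L2_inner U u u <= 1 / real (Suc k) * Q u u + (\<Sum>j<(N::nat). (L2_inner U (w j) u)^2))" by blast
  then show ?thesis by (intro exI[of _ "(N, w)"]) simp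
 qed
 then have "EX P. ALL k. (ALL j<fst (P k). snd (P k) j : L2 U) &
     (ALL u:D. L2_inner U u u <= 1 / real (Suc k) * Q u u + (\<Sum>j<(fst (P k)::nat). (L2_inner U (snd (P k) j) u)^2))"
  by (intro choice allI)
 then obtain P where P: "ALL k. (ALL j<fst (P k). snd (P k) j : L2 U) &
     (ALL u:D. L2_inner U u u <= 1 / real (Suc k) * Q u u + (\<Sum>j<(fst (P k)::nat). (L2_inner U (snd (P k) j) u)^2))"
  by blast
 define N where "N k = fst (P k)" for k
 define w where "w k = snd (P k)" for k
 have w: "w k j : L2 U" if "j < N k" for k j using P that by (simp add: N_def w_def)
 have Eh: "L2_inner U u u <= 1 / real (Suc k) * Q u u + (\<Sum>j<N k. (L2_inner U (w k j) u)^2)" if "u : D" for u k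
  using P that by (simp add: N_def w_def)
 \<comment> \<open>The functionals of all accuracies \<open>1 / Suc k\<close> form one countable
   family. Dividing by \<open>c\<close> bounds it by \<open>1\<close>, so a single diagonal
   subsequence makes all of them converge.\<close>
 define S where "S = {p :: nat \<times> nat. snd p < N (fst p)}"
 define c where "c p = 1 + sqrt (L2_sq U (w (fst p) (snd p))) * sqrt M" for p
 define f where "f n p = L2_inner U (w (fst p) (snd p)) (v n) / c p" for n p
 have cp: "c p >= 1" if "p : S" for p
  using L.nonneg[OF w] that M by (auto simp: c_def S_def)
 have fb: "norm (f n p) <= 1" if p: "p : S" for n p
 proof -
  have wp: "w (fst p) (snd p) : L2 U" using p w by (auto simp: S_def)
  have "\<bar>L2_inner U (w (fst p) (snd p)) (v n)\<bar> <= sqrt (L2_sq U (w (fst p) (snd p))) * sqrt (L2_sq U (v n))"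
   by (rule L.abs_le_sqrt[OF wp vL])
  also have "... <= sqrt (L2_sq U (w (fst p) (snd p))) * sqrt M"
   using QB[OF v(1)[of n]] v(2)[of n] L.nonneg[OF wp] by (intro mult_left_mono) auto
  also have "... <= c p" by (simp add: c_def)
  finally show ?thesis using cp[OF p] by (simp add: f_def divide_simps)
 qed
 have "countable S" by simp
 then obtain r where r: "strict_mono (r::nat=>nat)" "!!p. p : S ==> EX l. (%n. f (r n) p) ----> l"
  using function_convergent_subsequence[of S f 1] fb by blast
 have conv: "Cauchy (%n. L2_inner U (w k j) (v (r n)))" if "j < N k" for k j
 proof -
  have p: "(k, j) : S" using that by (simp add: S_def)
  then obtain l where "(%n. f (r n) (k, j)) ----> l" using r(2) by blast
  then have "(%n. f (r n) (k, j) * c (k, j)) ----> l * c (k, j)" by (intro tendsto_intros)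
  moreover have "f (r n) (k, j) * c (k, j) = L2_inner U (w k j) (v (r n))" for n
   using cp[OF p] by (simp add: f_def)
  ultimately show ?thesis by (simp add: LIMSEQ_imp_Cauchy)
 qed
 have "EX K. ALL m>=K. ALL n>=K. L2_sq U (%x. v (r m) x - v (r n) x) < ep" if ep: "ep > 0" for ep
 proof -
  \<comment> \<open>\<open>k\<close> spends at most \<open>ep / 2\<close> on the form term, as
    differences have form at most \<open>4 * M\<close>; \<open>de\<close> spends less than
    \<open>ep / 2\<close> on the finitely many functionals.\<close>
  obtain k :: nat where k: "real (Suc k) > 8 * (M + 1) / ep" using reals_Archimedean2[of "8 * (M + 1) / ep"] by (metis less_Suc_eq of_nat_less_iff less_trans)
  then have k': "1 / real (Suc k) * (4 * M) < ep / 2" using ep M by (simp add: field_simps)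
  define de where "de = sqrt (ep / (4 * (1 + real (N k))))"
  have de: "de > 0" "de^2 = ep / (4 * (1 + real (N k)))" using ep by (simp_all add: de_def)
  have "ALL j:{..<N k}. \<forall>\<^sub>F K in sequentially. ALL m>=K. ALL n>=K. \<bar>L2_inner U (w k j) (v (r m)) - L2_inner U (w k j) (v (r n))\<bar> < de"
  proof
   fix j assume "j : {..<N k}"
   then obtain K where "ALL m>=K. ALL n>=K. dist (L2_inner U (w k j) (v (r m))) (L2_inner U (w k j) (v (r n))) < de"
    using conv[of j k] de(1) unfolding Cauchy_def by blast
   then show "\<forall>\<^sub>F K in sequentially. ALL m>=K. ALL n>=K. \<bar>L2_inner U (w k j) (v (r m)) - L2_inner U (w k j) (v (r n))\<bar> < de"
    by (intro eventually_sequentiallyI[of K]) (auto simp: dist_real_def)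
  qed
  then have "\<forall>\<^sub>F K in sequentially. ALL j:{..<N k}. ALL m>=K. ALL n>=K. \<bar>L2_inner U (w k j) (v (r m)) - L2_inner U (w k j) (v (r n))\<bar> < de"
   by (intro eventually_ball_finite) auto
  then obtain K where K: "ALL j:{..<N k}. ALL m>=K. ALL n>=K. \<bar>L2_inner U (w k j) (v (r m)) - L2_inner U (w k j) (v (r n))\<bar> < de"
   by (auto simp: eventually_sequentially)
  have "L2_sq U (%x. v (r m) x - v (r n) x) < ep" if mn: "m >= K" "n >= K" for m n
  proof -
   let ?u = "%x. v (r m) x - v (r n) x"
   have uD: "?u : D" using v(1) by (rule Q.diff) (rule v(1))
   have "Q ?u ?u <= 4 * M" using Q.le_twice_diff[OF v(1) v(1), of "r m" "r n"] v(2)[of "r m"] v(2)[of "r n"] by linarith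
   then have "1 / real (Suc k) * Q ?u ?u <= 1 / real (Suc k) * (4 * M)" by (intro mult_left_mono) auto
   moreover have "(\<Sum>j<N k. (L2_inner U (w k j) ?u)^2) <= (\<Sum>j<N k. de^2)"
   proof (rule sum_mono)
    fix j assume j: "j : {..<N k}"
    have "L2_inner U (w k j) ?u = L2_inner U (w k j) (v (r m)) - L2_inner U (w k j) (v (r n))"
     using L.bilin2[OF vL vL w, of j k 1 "r m" "-1" "r n"] j by simp
    then have "\<bar>L2_inner U (w k j) ?u\<bar> <= de" using K j mn by (auto intro: less_imp_le)
    then show "(L2_inner U (w k j) ?u)^2 <= de^2" using de(1) by (metis abs_le_square_iff abs_of_pos)
   qed
   moreover have "(\<Sum>j<N k. de^2) < ep / 2"
   proof -
    have "real (N k) / (1 + real (N k)) <= 1" by simp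
    moreover have "(\<Sum>j<N k. de^2) = ep / 4 * (real (N k) / (1 + real (N k)))" by (simp add: de(2))
    ultimately have "(\<Sum>j<N k. de^2) <= ep / 4 * 1" using ep by (simp only: mult_left_mono)
    then show ?thesis using ep by linarith
   qed
   ultimately show ?thesis using Eh[OF uD, of k] k' by linarith
  qed
  then show ?thesis by blast
 qed
 then show ?thesis using r(1) by blast
qed

text \<open>Every term is continuous in the energy norm, in which test functions are dense in
  \<open>H10\<close>.\<close>

lemma Ehrling_extend:
 fixes U :: "'a::euclidean_space set"
 assumes U: "open U" and w: "!!j. j < N ==> w j : L2 U"
  and le: "!!ph. test_function U ph ==> L2_inner U ph ph <= ep * energy U ph + (\<Sum>j<(N::nat). (L2_inner U (w j) ph)^2)"
  and u: "u : H10 U"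
 shows "L2_inner U u u <= ep * energy U u + (\<Sum>j<N. (L2_inner U (w j) u)^2)"
proof -
 interpret E: semi_inner "H1 U" "%u v. L2_inner U u v + grad_inner U u v" by (rule semi_inner_energy[OF U])
 interpret L: semi_inner "L2 U" "L2_inner U" by (rule semi_inner_L2)
 have uH: "u : H1 U" using u by (rule H10_H1)
 have "EX ph. test_function U ph & energy U (%x. u x - ph x) < 1 / real (Suc n)" for n
  using u unfolding H10_iff[OF U] by simp
 then obtain ph where ph: "!!n. test_function U (ph n)" "!!n. energy U (%x. u x - ph n x) < 1 / real (Suc n)" by metis
 have phH: "ph n : H1 U" for n using test_function_H1(1)[OF ph(1) U] .
 have l0: "(%n. energy U (%x. ph n x - u x)) ----> 0"
 proof (rule Lim_null_comparison)
  show "(%n. 1 / real (Suc n)) ----> 0" by (rule LIMSEQ_Suc[OF lim_1_over_n])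
  show "\<forall>\<^sub>F n in sequentially. norm (energy U (%x. ph n x - u x)) <= 1 / real (Suc n)"
  proof (rule always_eventually, rule allI)
   fix n
   have "energy U (%x. ph n x - u x) = energy U (%x. u x - ph n x)"
    using E.sq_diff_commute[OF phH uH] by (simp add: energy_def)
   then show "norm (energy U (%x. ph n x - u x)) <= 1 / real (Suc n)"
    using ph(2)[of n] E.nonneg[OF E.diff[OF phH uH], of n] by (simp add: energy_def)
  qed
 qed
 have l1: "(%n. energy U (ph n)) ----> energy U u"
  using E.tendsto_B_sq[OF phH uH] l0 by (simp add: energy_def)
 have l0': "(%n. L2_sq U (%x. ph n x - u x)) ----> 0"
 proof (rule Lim_null_comparison[OF _ l0], rule always_eventually, rule allI)
  fix n
  show "norm (L2_sq U (%x. ph n x - u x)) <= energy U (%x. ph n x - u x)"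
   using L.nonneg[OF L.diff[OF H1_L2[OF phH] H1_L2[OF uH]], of n] semi_inner.nonneg[OF semi_inner_H1[OF U] E.diff[OF phH uH], of n]
   by (simp add: energy_def)
 qed
 note lL = L.tendsto_B[OF H1_L2[OF phH] H1_L2[OF uH] l0']
 have l2: "(%n. L2_sq U (ph n)) ----> L2_inner U u u"
  by (rule L.tendsto_B_sq[OF H1_L2[OF phH] H1_L2[OF uH] l0'])
 have l3: "(%n. L2_inner U (w j) (ph n)) ----> L2_inner U (w j) u" if "j < N" for j
  using lL[OF w[OF that]] L.sym[OF w[OF that] H1_L2[OF phH]] L.sym[OF w[OF that] H1_L2[OF uH]] by simp
 show ?thesis
 proof (rule LIMSEQ_le[OF l2])
  show "(%n. ep * energy U (ph n) + (\<Sum>j<N. (L2_inner U (w j) (ph n))^2)) ----> ep * energy U u + (\<Sum>j<N. (L2_inner U (w j) u)^2)"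
   by (intro tendsto_intros l1 l3) simp
 qed (use le[OF ph(1)] in blast)
qed

text \<open>\<open>s\<close> is a square root of the potential: the potential term becomes an
  \<open>L2\<close> inner product of weighted functions and takes its bilinearity and positivity
  from there. \<open>X\<close> will be \<open>H1\<close> on the line and \<open>H10\<close> on the
  interval.\<close>

locale potential_form =
 fixes U :: "'a::euclidean_space set" and X :: "('a => real) set" and s :: "'a => real"
 assumes U: "open U"
  and X: "X <= H1 U" "(%x. 0) : X" "!!u v c d. u : X ==> v : X ==> (%x. c * u x + d * v x) : X"
   "!!u v. u : H1 U ==> (!!n. v n : X) ==> (%n. energy U (%x. v n x - u x)) ----> 0 ==> u : X"
  and s: "s : borel_measurable (lebesgue_on U)"
begin

definition "fdom = {u : X. (%x. s x * u x) : L2 U}"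

definition "form u v = grad_inner U u v + L2_inner U (%x. s x * u x) (%x. s x * v x)"

lemma fdom_H1: "u : fdom ==> u : H1 U" using X by (auto simp: fdom_def)

lemma fdom_weighted: "u : fdom ==> (%x. s x * u x) : L2 U" by (simp add: fdom_def)

lemma weighted_lin: "(%x. s x * (c * u x + d * v x)) = (%x. c * (s x * u x) + d * (s x * v x))"
 by (simp add: algebra_simps)

lemma semi_inner_weighted: "semi_inner fdom (%u v. L2_inner U (%x. s x * u x) (%x. s x * v x))"
proof
 interpret L: semi_inner "L2 U" "L2_inner U" by (rule semi_inner_L2)
 show "(%x. 0) : fdom" using X L2_0 by (simp add: fdom_def)
 show "(%x. c * u x + d * v x) : fdom" if "u : fdom" "v : fdom" for u v c d
  using that X(3) L.lin unfolding fdom_def weighted_lin mem_Collect_eq by blast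
 show "L2_inner U (%x. s x * u x) (%x. s x * v x) = L2_inner U (%x. s x * v x) (%x. s x * u x)" for u v
  by (simp add: L2_inner_def mult.commute)
 show "L2_inner U (%x. s x * (c * u x + d * v x)) (%x. s x * w x)
   = c * L2_inner U (%x. s x * u x) (%x. s x * w x) + d * L2_inner U (%x. s x * v x) (%x. s x * w x)"
  if "u : fdom" "v : fdom" "w : fdom" for u v w c d
  unfolding weighted_lin by (rule L.bilin[OF that[THEN fdom_weighted]])
 show "0 <= L2_sq U (%x. s x * u x)" if "u : fdom" for u
  by (rule L.nonneg[OF fdom_weighted[OF that]])
qed

sublocale S: semi_inner fdom "%u v. L2_inner U (%x. s x * u x) (%x. s x * v x)"
 by (rule semi_inner_weighted)

sublocale G: semi_inner fdom "grad_inner U"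
 by (rule semi_inner_mono[OF semi_inner_H1[OF U]]) (auto simp: fdom_H1 S.zero S.lin)

sublocale B: semi_inner fdom "L2_inner U"
 by (rule semi_inner_mono[OF semi_inner_L2]) (auto simp: fdom_H1 H1_L2 S.zero S.lin)

lemma semi_inner_form: "semi_inner fdom form"
proof
 show "form (%x. c * u x + d * v x) w = c * form u w + d * form v w" if "u : fdom" "v : fdom" "w : fdom" for u v w c d
  using G.bilin[OF that] S.bilin[OF that] by (simp add: form_def algebra_simps)
 show "form u v = form v u" if "u : fdom" "v : fdom" for u v
  using G.sym[OF that] S.sym[OF that] by (simp add: form_def)
qed (auto simp: S.zero S.lin form_def S.nonneg G.nonneg)

text \<open>The unweighted part converges in \<open>H1\<close>. Along an almost everywhere
  convergent subsequence, Fatou bounds the weighted distance to the limit by the weighted Cauchy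
  bound, which also puts the limit into \<open>fdom\<close>.\<close>

lemma form_complete:
 assumes v: "!!n. v n : fdom"
  and cau: "!!ep. ep > 0 ==> EX N. ALL m>=N. ALL n>=N.
     quad form (%x. v m x - v n x) + L2_sq U (%x. v m x - v n x) < ep"
 shows "EX u:fdom. (%n. quad form (%x. v n x - u x) + L2_sq U (%x. v n x - u x)) ----> 0"
proof -
 let ?sq = "%f. L2_sq U (%x. s x * f x)"
 have split: "form f f + L2_inner U f f = energy U f + ?sq f" for f by (simp add: form_def energy_def)
 have en: "energy U f >= 0" if "f : fdom" for f using G.nonneg[OF that] B.nonneg[OF that] by (simp add: energy_def)
 have "EX N. ALL m>=N. ALL n>=N. energy U (%x. v m x - v n x) < ep" if ep: "ep > 0" for ep
 proof -
  obtain N where N: "ALL m>=N. ALL n>=N. quad form (%x. v m x - v n x) + L2_sq U (%x. v m x - v n x) < ep"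
   using cau[OF ep] by blast
  have "energy U (%x. v m x - v n x) < ep" if "m >= N" "n >= N" for m n
   using N[rule_format, OF that] S.nonneg[OF S.diff[OF v[of m] v[of n]]] unfolding split by linarith
  then show ?thesis by blast
 qed
 from H1_complete[OF U fdom_H1[OF v] this] obtain u r where u: "u : H1 U"
  and lim: "(%n. energy U (%x. v n x - u x)) ----> 0"
  and r: "strict_mono (r::nat=>nat)" "AE x in lebesgue_on U. (%k. v (r k) x) ----> u x"
  by blast
 have uX: "u : X" using X(4)[OF u _ lim] v by (simp add: fdom_def)
 have um: "u : borel_measurable (lebesgue_on U)" using H1_L2[OF u] by (rule L2_D)
 have vm: "v n : borel_measurable (lebesgue_on U)" for n using H1_L2[OF fdom_H1[OF v]] by (rule L2_D)
 have F: "integrable (lebesgue_on U) (%x. (s x * (v n x - u x))^2) & (LINT x|lebesgue_on U. (s x * (v n x - u x))^2) <= ep"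
  if N: "ALL m>=N. ALL n>=N. ?sq (%x. v m x - v n x) <= ep" and n: "n >= N" for n N ep
 proof -
  have i: "integrable (lebesgue_on U) (%x. (s x * (v n x - v (r (k + N)) x))^2)" for k
   using L2_D(2)[OF fdom_weighted[OF S.diff[OF v v]]] .
  have le: "(LINT x|lebesgue_on U. (s x * (v n x - v (r (k + N)) x))^2) <= ep" for k
  proof -
   have "N <= r (k + N)" using seq_suble[OF r(1), of "k + N"] by linarith
   then show ?thesis using N n by (simp add: L2_inner_def power2_eq_square)
  qed
  have ae: "AE x in lebesgue_on U. (%k. (s x * (v n x - v (r (k + N)) x))^2) ----> (s x * (v n x - u x))^2"
   using r(2) by eventually_elim (intro tendsto_intros, rule LIMSEQ_ignore_initial_segment)
  have m: "(%x. (s x * (v n x - u x))^2) : borel_measurable (lebesgue_on U)" using s um vm by simp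
  show ?thesis using Fatou_real[of "lebesgue_on U" "%k x. (s x * (v n x - v (r (k + N)) x))^2", OF i _ le m ae] by simp
 qed
 have Nex: "EX N. ALL m>=N. ALL n>=N. ?sq (%x. v m x - v n x) <= ep" if ep: "ep > 0" for ep
 proof -
  obtain N where N: "ALL m>=N. ALL n>=N. quad form (%x. v m x - v n x) + L2_sq U (%x. v m x - v n x) < ep"
   using cau[OF ep] by blast
  have "?sq (%x. v m x - v n x) <= ep" if "m >= N" "n >= N" for m n
   using N[rule_format, OF that] en[OF S.diff[OF v[of m] v[of n]]] unfolding split by linarith
  then show ?thesis by blast
 qed
 have diffL: "(%x. s x * (v n x - u x)) : L2 U" if "ALL m>=N. ALL n>=N. ?sq (%x. v m x - v n x) <= 1" "n >= N" for n N
  using F[OF that] s um vm by (simp add: L2_def)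
 obtain N1 where N1: "ALL m>=N1. ALL n>=N1. ?sq (%x. v m x - v n x) <= 1" using Nex[of 1] by auto
 have "(%x. 1 * (s x * v N1 x) + (-1) * (s x * (v N1 x - u x))) : L2 U"
  by (rule L2_lin[OF fdom_weighted[OF v] diffL[OF N1]]) simp
 moreover have "(%x. 1 * (s x * v N1 x) + (-1) * (s x * (v N1 x - u x))) = (%x. s x * u x)" by (simp add: algebra_simps)
 ultimately have uD: "u : fdom" using uX by (simp add: fdom_def)
 have "(%n. ?sq (%x. v n x - u x)) ----> 0"
 proof (rule LIMSEQ_I)
  fix e :: real assume "e > 0"
  then obtain N where N: "ALL m>=N. ALL n>=N. ?sq (%x. v m x - v n x) <= e / 2" using Nex[of "e / 2"] by auto
  have "norm (?sq (%x. v n x - u x) - 0) < e" if "n >= N" for n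
   using F[OF N that] \<open>e > 0\<close> S.nonneg[OF S.diff[OF v[of n] uD]] by (simp add: L2_inner_def power2_eq_square)
  then show "EX no. ALL n>=no. norm (?sq (%x. v n x - u x) - 0) < e" by blast
 qed
 then have "(%n. energy U (%x. v n x - u x) + ?sq (%x. v n x - u x)) ----> 0 + 0" by (intro tendsto_add lim)
 then show ?thesis using uD unfolding split by auto
qed

end

subsection \<open>The problem on the line\<close>

text \<open>As the weight is almost nowhere zero, the form is positive on nonnull functions; the
  analytic input that remains to be given for each problem is Ehrling's inequality
  \<open>E\<close>.\<close>

lemma (in potential_form) spectral_form:
 assumes ne: "U ~= {}" and tests: "!!ph. test_function U ph ==> ph : fdom"
  and s0: "AE x in lebesgue_on U. s x ~= 0"
  and E: "!!ep. ep > 0 ==> EX N w. (ALL j<N. w j : L2 U) &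
     (ALL u:fdom. L2_inner U u u <= ep * (form u u + L2_inner U u u) + (\<Sum>j<(N::nat). (L2_inner U (w j) u)^2))"
 shows "spectral U fdom form"
proof -
 interpret F: semi_inner fdom form by (rule semi_inner_form)
 interpret FB: semi_inner fdom "%u v. form u v + L2_inner U u v"
 proof
  show "form (%x. c * u x + d * v x) w + L2_inner U (%x. c * u x + d * v x) w = c * (form u w + L2_inner U u w) + d * (form v w + L2_inner U v w)"
   if "u : fdom" "v : fdom" "w : fdom" for u v w c d
   using F.bilin[OF that] B.bilin[OF that] by (simp add: algebra_simps)
  show "form u v + L2_inner U u v = form v u + L2_inner U v u" if "u : fdom" "v : fdom" for u v
   using F.sym[OF that] B.sym[OF that] by simp
 qed (auto simp: F.zero F.lin F.nonneg B.nonneg)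
 show ?thesis
 proof
  fix u assume u: "u : fdom"
  show "L2_inner U u u = 0 \<longleftrightarrow> (AE x in lebesgue_on U. u x = 0)" by (rule L2_null_iff[OF H1_L2[OF fdom_H1[OF u]]])
  assume p: "L2_inner U u u > 0"
  have "L2_sq U (%x. s x * u x) ~= 0"
  proof
   assume "L2_sq U (%x. s x * u x) = 0"
   then have "AE x in lebesgue_on U. s x * u x = 0" using L2_null_iff[OF fdom_weighted[OF u]] by simp
   with s0 have "AE x in lebesgue_on U. u x = 0" by eventually_elim simp
   then show False using L2_null_iff[OF H1_L2[OF fdom_H1[OF u]]] p by simp
  qed
  then show "form u u > 0" using S.nonneg[OF u] G.nonneg[OF u] by (simp add: form_def)
 next
  fix v :: "nat => 'a => real"
  assume "!!n. v n : fdom" "!!ep. ep > 0 ==> EX N. ALL m>=N. ALL n>=N.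
     quad form (%x. v m x - v n x) + L2_sq U (%x. v m x - v n x) < ep"
  then show "EX u:fdom. (%n. quad form (%x. v n x - u x) + L2_sq U (%x. v n x - u x)) ----> 0"
   by (rule form_complete)
 next
  fix v :: "nat => 'a => real" and M
  assume v: "!!n. v n : fdom" "!!n. quad form (v n) + L2_sq U (v n) <= M"
  show "EX r::nat => nat. strict_mono r & (ALL ep>0. EX N. ALL m>=N. ALL n>=N.
     L2_sq U (%x. v (r m) x - v (r n) x) < ep)"
  proof (rule compact_from_Ehrling[where D = fdom and Q = "%u v. form u v + L2_inner U u v" and U = U and v = v and M = M, OF FB.semi_inner_axioms])
   show "v n : fdom" for n by (rule v)
   show "quad form (v n) + L2_sq U (v n) <= M" for n by (rule v)
   show "EX N w. (ALL j<N. w j : L2 U) &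
     (ALL u:fdom. L2_inner U u u <= ep * (form u u + L2_inner U u u) + (\<Sum>j<(N::nat). (L2_inner U (w j) u)^2))" if "ep > 0" for ep
    by (rule E[OF that])
   show "fdom <= L2 U" using H1_L2 fdom_H1 by blast
   show "L2_inner U u u <= form u u + L2_inner U u u" if "u : fdom" for u using F.nonneg[OF that] by simp
  qed
 next
  fix n
  show "EX v. (ALL i<n. v i : fdom) & (ALL c. L2_sq U (lincomb n c v) = 0 --> (ALL i<n. c i = 0))"
  proof -
   obtain v where v: "ALL i<n. test_function U (v i)" "ALL c. L2_sq U (lincomb n c v) = 0 --> (ALL i<n. c i = 0)"
    using infinite_dim_test[OF U ne, of n] by (elim exE conjE)
   have "ALL i<n. v i : fdom" using v(1) tests by simp
   with v(2) show ?thesis by (intro exI[of _ v] conjI)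
  qed
 qed
qed

lemma grad_inner_real: "grad_inner U u v = L2_inner U (weak_deriv U u 1) (weak_deriv U v (1::real))"
 by (simp add: grad_inner_def)

lemma indicator_interval_L2: "(%x::real. c * indicator {a<..<b} x) : L2 U" if U: "open U"
proof -
 have m: "(%x::real. c * indicator {a<..<b} x) : borel_measurable borel" by simp
 have "integrable lborel (%x::real. c^2 * indicator {a<..<b} x)"
  by (cases "a <= b") (auto intro!: integrable_mult_right integrable_real_indicator)
 then have "integrable lebesgue (%x::real. c^2 * indicator {a<..<b} x)" by (subst lebesgue_lborel) auto
 moreover have "(%x::real. (c * indicator {a<..<b} x)^2) = (%x. c^2 * indicator {a<..<b} x)"
  by (auto simp: fun_eq_iff split: split_indicator)
 ultimately have "integrable lebesgue (%x::real. (c * indicator {a<..<b} x)^2)" by (simp only:)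
 then have "integrable (lebesgue_on U) (%x::real. (c * indicator {a<..<b} x)^2)"
  using integrable_mult_indicator[of U lebesgue "%x::real. (c * indicator {a<..<b} x)^2"] open_sets_lebesgue[OF U]
  by (subst integrable_restrict_space) auto
 moreover have "(%x::real. c * indicator {a<..<b} x) : borel_measurable (lebesgue_on U)"
  by (rule measurable_restrict_space1[OF measurable_completion]) (use m in simp)
 ultimately show ?thesis by (simp add: L2_def)
qed

lemma L2_subset:
 assumes "f : L2 U" "V <= U" "open V" "open U"
 shows "f : L2 V" "L2_inner V f f = (LINT x|lebesgue_on U. indicator V x * (f x)^2)" "integrable (lebesgue_on U) (%x. indicator V x * (f x)^2)"
proof -
 have VU: "lebesgue_on V = restrict_space (lebesgue_on U) V"
  using assms by (subst restrict_restrict_space) (auto simp: open_sets_lebesgue inf.absorb2)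
 have V: "V \<inter> space (lebesgue_on U) : sets (lebesgue_on U)"
  using assms open_sets_lebesgue[OF assms(3)] open_sets_lebesgue[OF assms(4)] by (auto simp: sets_restrict_space_iff Int_absorb2)
 have i: "integrable (lebesgue_on U) (%x. indicator V x *\<^sub>R (f x)^2)"
  using integrable_mult_indicator[of "V \<inter> U" "lebesgue_on U" "%x. (f x)^2"] L2_D(2)[OF assms(1)] V assms(2) by (simp add: Int_absorb2)
 then show "integrable (lebesgue_on U) (%x. indicator V x * (f x)^2)" by simp
 have "f : borel_measurable (lebesgue_on V)"
  unfolding VU using L2_D(1)[OF assms(1)] by (rule measurable_restrict_space1)
 moreover have "integrable (lebesgue_on V) (%x. (f x)^2)"
  unfolding VU using i V by (subst integrable_restrict_space)
 ultimately show "f : L2 V" by (simp add: L2_def)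
 show "L2_inner V f f = (LINT x|lebesgue_on U. indicator V x * (f x)^2)"
  unfolding VU L2_inner_def using V by (subst integral_restrict_space) (auto simp: power2_eq_square)
qed

definition cell :: "real => real => nat => real set" where
 "cell A de j = {A + real j * de <..< A + real (Suc j) * de}"

lemma cell_sum_le_1:
 assumes "de > 0"
 shows "(\<Sum>j<N. indicator (cell A de j) x) <= (1::real)"
proof -
 have "i = j" if "x : cell A de i" "x : cell A de j" for i j
 proof -
  have "real i * de < real (Suc j) * de" "real j * de < real (Suc i) * de" using that by (auto simp: cell_def)
  then have "real i < real (Suc j)" "real j < real (Suc i)" using assms by simp_all
  then show ?thesis by linarith
 qed
 then have "finite {j:{..<N}. x : cell A de j} & card {j:{..<N}. x : cell A de j} <= 1"
  by (auto simp: card_le_Suc0_iff_eq)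
 moreover have "(\<Sum>j<N. indicator (cell A de j) x) = real (card {j:{..<N}. x : cell A de j})"
  by (simp add: indicator_def sum.If_cases Int_def of_bool_def)
 ultimately show ?thesis by simp
qed

lemma cell_sum_ge_1:
 assumes de: "de > 0"
 shows "AE x in lebesgue. indicator {A<..<A + real N * de} x <= (\<Sum>j<N. indicator (cell A de j) x :: real)"
proof -
 have "negligible ((%j. A + real j * de) ` {..N})" by (rule negligible_finite) simp
 then have "AE x in lebesgue. x ~: (%j. A + real j * de) ` {..N}"
  by (intro AE_not_in) (simp add: negligible_iff_null_sets)
 then show ?thesis
 proof eventually_elim
  case (elim x)
  show ?case
  proof (cases "x : {A<..<A + real N * de}")
   case True
   define j where "j = nat \<lfloor>(x - A) / de\<rfloor>"
   have nn: "0 <= (x - A) / de" using True de by simp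
   then have j: "real j <= (x - A) / de" "(x - A) / de < real j + 1" unfolding j_def by linarith+
   then have j': "real j * de <= x - A" "x - A < real (Suc j) * de" using de by (simp_all add: field_simps)
   have "(x - A) / de < real N" using True de by (simp add: field_simps)
   then have jN: "j < N" using j(1) by linarith
   have "x ~= A + real j * de" using elim jN by auto
   then have "x : cell A de j" using j' by (auto simp: cell_def)
   then have "1 <= (indicator (cell A de j) x :: real)" by simp
   also have "... <= (\<Sum>j<N. indicator (cell A de j) x)" using jN by (intro member_le_sum) auto
   finally show ?thesis using True by simp
  qed (auto intro: sum_nonneg)
 qed
qed

text \<open>The cells fill the interval up to finitely many points. The integrals over cells become
  the finitely many functionals of Ehrling's inequality.\<close>

lemma Poincare_partition:
 fixes u g :: "real => real"
 assumes de: "de > 0" and w: "has_weak_deriv UNIV u 1 g" and L: "u : L2 UNIV" "g : L2 UNIV"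
 shows "(LINT x|lebesgue. indicator {A<..<A + real N * de} x * (u x)^2) <= de^2 * L2_inner UNIV g g
   + (\<Sum>j<N. (LINT x|lebesgue_on (cell A de j). u x)^2 / de)"
proof -
 have op: "open (cell A de j)" for j by (simp add: cell_def)
 have len: "A + real j * de < A + real (Suc j) * de" "A + real (Suc j) * de - (A + real j * de) = de" for j
  using de by (simp_all add: algebra_simps)
 note Lu = L2_subset[OF L(1) subset_UNIV op open_UNIV, unfolded lebesgue_on_UNIV_eq]
 note Lg = L2_subset[OF L(2) subset_UNIV op open_UNIV, unfolded lebesgue_on_UNIV_eq]
 have P: "L2_inner (cell A de j) u u <= de^2 * L2_inner (cell A de j) g g + (LINT x|lebesgue_on (cell A de j). u x)^2 / de" for j
  using Poincare_cell[OF len(1) has_weak_deriv_subset[OF w subset_UNIV _ open_UNIV], of j] Lu(1)[of j] Lg(1)[of j]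
  unfolding cell_def len(2) by simp
 have iu: "integrable lebesgue (%x. indicator {A<..<A + real N * de} x * (u x)^2)"
  using L2_subset(3)[OF L(1) subset_UNIV, of "{A<..<A + real N * de}"] by (simp add: lebesgue_on_UNIV_eq)
 have gi: "integrable lebesgue (%x. (g x)^2)" using L2_D(2)[OF L(2)] by (simp add: lebesgue_on_UNIV_eq)
 have "(LINT x|lebesgue. indicator {A<..<A + real N * de} x * (u x)^2) <= (LINT x|lebesgue. (\<Sum>j<N. indicator (cell A de j) x * (u x)^2))"
 proof (rule integral_mono_AE[OF iu])
  show "integrable lebesgue (%x. \<Sum>j<N. indicator (cell A de j) x * (u x)^2)" using Lu(3) by (intro Bochner_Integration.integrable_sum)
  show "AE x in lebesgue. indicator {A<..<A + real N * de} x * (u x)^2 <= (\<Sum>j<N. indicator (cell A de j) x * (u x)^2)"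
   using cell_sum_ge_1[OF de, of A N] by eventually_elim (auto simp: sum_distrib_right[symmetric] intro!: mult_right_mono)
 qed
 also have "... = (\<Sum>j<N. L2_inner (cell A de j) u u)" unfolding Lu(2) using Lu(3) by (intro Bochner_Integration.integral_sum)
 also have "... <= (\<Sum>j<N. de^2 * L2_inner (cell A de j) g g + (LINT x|lebesgue_on (cell A de j). u x)^2 / de)"
  by (rule sum_mono[OF P])
 also have "... = de^2 * (\<Sum>j<N. L2_inner (cell A de j) g g) + (\<Sum>j<N. (LINT x|lebesgue_on (cell A de j). u x)^2 / de)"
  by (simp add: sum.distrib sum_distrib_left)
 also have "(\<Sum>j<N. L2_inner (cell A de j) g g) = (LINT x|lebesgue. (\<Sum>j<N. indicator (cell A de j) x * (g x)^2))"
  unfolding Lg(2) using Lg(3) by (intro Bochner_Integration.integral_sum[symmetric])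
 also have "... <= (LINT x|lebesgue. (g x)^2)"
 proof (rule integral_mono[OF _ gi])
  show "integrable lebesgue (%x. \<Sum>j<N. indicator (cell A de j) x * (g x)^2)" using Lg(3) by (intro Bochner_Integration.integrable_sum)
  show "(\<Sum>j<N. indicator (cell A de j) x * (g x)^2) <= (g x)^2" for x
   using mult_right_mono[OF cell_sum_le_1[OF de, where N = N and A = A and x = x], of "(g x)^2"] by (simp add: sum_distrib_right)
 qed
 also have "(LINT x|lebesgue. (g x)^2) = L2_inner UNIV g g" by (simp add: L2_inner_def lebesgue_on_UNIV_eq power2_eq_square)
 finally show ?thesis using de by (simp add: mult_left_mono)
qed

text \<open>Scaled so that the square of its inner product with \<open>u\<close> is the mean term in
  \<open>Poincare_partition\<close>.\<close>

definition cell_weight :: "real => real => nat => real => real" where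
 "cell_weight A de j x = (1 / sqrt de) * indicator (cell A de j) x"

lemma cell_weight_L2: "open U ==> cell_weight A de j : L2 U"
 unfolding cell_weight_def[abs_def] cell_def by (rule indicator_interval_L2)

lemma cell_weight_sq:
 assumes "de > 0"
 shows "(L2_inner UNIV (cell_weight A de j) u)^2 = (LINT x|lebesgue_on (cell A de j). u x)^2 / de"
proof -
 have "(LINT x|lebesgue_on (cell A de j). u x) = (LINT x|lebesgue. indicator (cell A de j) x * u x)"
  by (subst integral_restrict_space) (auto simp: cell_def)
 moreover have "L2_inner UNIV (cell_weight A de j) u = (1 / sqrt de) * (LINT x|lebesgue. indicator (cell A de j) x * u x)"
  by (simp add: L2_inner_def cell_weight_def lebesgue_on_UNIV_eq flip: integral_mult_right_zero)
 ultimately show ?thesis using assms by (simp add: power_mult_distrib power_divide)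
qed

text \<open>Both \<open>1 - s\<close> and \<open>1 + s\<close> are below \<open>2\<close>. One
  linear lower bound serves for positivity as well as for growth at infinity.\<close>

lemma V_bar_ge:
 assumes s: "s : {-1<..<1}"
 shows "V_bar s x >= pi^2 * \<bar>x\<bar>"
proof -
 have gen: "pi^2 * \<bar>x\<bar> <= 2 * pi^2 / r * \<bar>x\<bar>" if r: "0 < r" "r < 2" for r
 proof (rule mult_right_mono)
  show "pi^2 <= 2 * pi^2 / r" using r by (simp add: field_simps)
 qed simp
 show ?thesis using gen[of "1 - s"] gen[of "1 + s"] s by (auto simp: V_bar_def)
qed

lemma V_bar_nonneg: "s : {-1<..<1} ==> V_bar s x >= 0"
 using V_bar_ge[of s x] by (meson abs_ge_zero mult_nonneg_nonneg order_trans zero_le_power2)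

lemma V_bar_continuous:
 assumes "s : {-1<..<1}"
 shows "continuous_on UNIV (V_bar s)"
proof -
 have "V_bar s = (%x. 2 * pi^2 / (1 - s) * max x 0 + 2 * pi^2 / (1 + s) * max (-x) 0)"
  by (auto simp: V_bar_def fun_eq_iff max_def)
 then show ?thesis using assms by (auto intro!: continuous_intros)
qed

locale bar_form =
 fixes s :: real
 assumes s_range: "s : {-1<..<1}"
begin

abbreviation "rtV x == sqrt (V_bar s x)"

sublocale potential_form UNIV "H1 UNIV" rtV
proof
 have "continuous_on UNIV rtV" using V_bar_continuous[OF s_range] by (intro continuous_intros)
 then show "rtV : borel_measurable (lebesgue_on UNIV)"
  by (intro measurable_restrict_space1 measurable_completion) (simp add: borel_measurable_continuous_onI)
qed (auto simp: H1_0 H1_lin)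

definition "bdom = {u : H1 UNIV. integrable lebesgue (%x. V_bar s x * (u x)^2)}"

definition "bform u v = grad_inner UNIV u v + (LINT x|lebesgue. V_bar s x * u x * v x)"

lemma rtV_sq: "(rtV x * a) * (rtV x * b) = V_bar s x * a * b" "(rtV x * a)^2 = V_bar s x * a^2"
proof -
 have "rtV x * rtV x = V_bar s x" using V_bar_nonneg[OF s_range] by simp
 then show "(rtV x * a) * (rtV x * b) = V_bar s x * a * b" "(rtV x * a)^2 = V_bar s x * a^2"
  by (simp_all add: power2_eq_square mult_ac)
qed

lemma fdom_eq: "fdom = bdom"
proof -
 have "(%x. rtV x * u x) : L2 UNIV \<longleftrightarrow> integrable lebesgue (%x. V_bar s x * (u x)^2)" if "u : H1 UNIV" for u
  using L2_D(1)[OF H1_L2[OF that]] potential_form.s[OF potential_form_axioms]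
  by (simp add: L2_def rtV_sq lebesgue_on_UNIV_eq)
 then show ?thesis by (auto simp: fdom_def bdom_def)
qed

lemma form_eq: "form = bform"
 by (simp add: fun_eq_iff form_def bform_def L2_inner_def rtV_sq lebesgue_on_UNIV_eq)

lemma mu_bar_eq: "mu_bar s = kth_eigenvalue UNIV fdom form"
 by (simp add: fun_eq_iff mu_bar_def fdom_eq form_eq bdom_def bform_def[abs_def])

lemma continuous_compact_fdom:
 assumes "u : H1 UNIV" "compact K" "!!x. x ~: K ==> u x = 0"
 shows "u : fdom"
proof -
 have "bounded (rtV ` K)"
  using assms(2) V_bar_continuous[OF s_range] by (intro compact_imp_bounded compact_continuous_image continuous_intros) (auto intro: continuous_on_subset)
 then obtain M where M: "!!x. x : K ==> norm (rtV x) <= M" by (auto simp: bounded_iff)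
 have uL: "u : L2 UNIV" using H1_L2[OF assms(1)] .
 have m: "(%x. rtV x * u x) : borel_measurable (lebesgue_on UNIV)"
  using L2_D(1)[OF uL] potential_form.s[OF potential_form_axioms] by simp
 have "integrable (lebesgue_on UNIV) (%x. (rtV x * u x)^2)"
 proof (rule lebesgue_bound)
  show "integrable (lebesgue_on UNIV) (%x. M^2 * (u x)^2)" using L2_D(2)[OF uL] by simp
  show "AE x in lebesgue_on UNIV. norm ((rtV x * u x)^2) <= norm (M^2 * (u x)^2)"
  proof (rule always_eventually, rule allI)
   fix x
   show "norm ((rtV x * u x)^2) <= norm (M^2 * (u x)^2)"
   proof (cases "x : K")
    case True
    have "\<bar>rtV x\<bar> <= \<bar>M\<bar>" using M[OF True] by simp
    then have "(rtV x)^2 <= M^2" by (simp only: abs_le_square_iff)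
    then have "(rtV x)^2 * (u x)^2 <= M^2 * (u x)^2" by (intro mult_right_mono) auto
    then show ?thesis by (simp only: power_mult_distrib real_norm_def abs_mult abs_power2)
   qed (simp add: assms(3))
  qed
 qed (use m in simp)
 then have "(%x. rtV x * u x) : L2 UNIV" using m by (simp add: L2_def)
 then show ?thesis using assms(1) by (simp add: fdom_def)
qed

text \<open>The potential confines: outside \<open>(-R, R)\<close> it is at least
  \<open>R = 1 / ep\<close>, so there \<open>u^2\<close> is at most \<open>ep\<close> times the
  potential term. Inside, cells of length at most \<open>sqrt ep\<close> suffice.\<close>

lemma Ehrling:
 assumes ep: "ep > 0"
 shows "EX N w. (ALL j<N. w j : L2 UNIV) &
     (ALL u:fdom. L2_inner UNIV u u <= ep * (form u u + L2_inner UNIV u u) + (\<Sum>j<(N::nat). (L2_inner UNIV (w j) u)^2))"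
proof -
 define R where "R = 1 / ep"
 have R: "R > 0" using ep by (simp add: R_def)
 obtain N0 :: nat where N0: "real N0 > 2 * R / sqrt ep" using reals_Archimedean2 by blast
 define N where "N = Suc N0"
 define de where "de = 2 * R / real N"
 have de: "de > 0" using R by (simp add: de_def N_def)
 have RN: "-R + real N * de = R" by (simp add: de_def N_def)
 have "2 * R / sqrt ep < real N" using N0 by (simp add: N_def)
 then have "de < sqrt ep" using ep by (simp add: de_def N_def field_simps)
 then have deep: "de^2 <= ep" using de ep by (metis less_imp_le power_mono real_sqrt_pow2)
 have "L2_inner UNIV u u <= ep * (form u u + L2_inner UNIV u u) + (\<Sum>j<N. (L2_inner UNIV (cell_weight (-R) de j) u)^2)"
  if u: "u : fdom" for u
 proof -
  let ?I = "{-R<..<R}"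
  have uH: "u : H1 UNIV" and uL: "u : L2 UNIV" using fdom_H1[OF u] H1_L2 by auto
  have one: "(1::real) : Basis" by simp
  note wd = H1_weak_deriv[OF uH one open_UNIV]
  have 1: "(LINT x|lebesgue. indicator ?I x * (u x)^2) <= de^2 * grad_inner UNIV u u + (\<Sum>j<N. (L2_inner UNIV (cell_weight (-R) de j) u)^2)"
   using Poincare_partition[OF de wd(1) uL wd(2), of "-R" N] unfolding RN grad_inner_real cell_weight_sq[OF de] .
  have u2: "integrable lebesgue (%x. (u x)^2)" using L2_D(2)[OF uL] by (simp add: lebesgue_on_UNIV_eq)
  have Vu: "integrable lebesgue (%x. V_bar s x * (u x)^2)" using u unfolding fdom_eq bdom_def by simp
  have iI: "integrable lebesgue (%x. indicator ?I x * (u x)^2)"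
   using L2_subset(3)[OF uL subset_UNIV, of ?I] by (simp add: lebesgue_on_UNIV_eq)
  have "L2_inner UNIV u u = (LINT x|lebesgue. (u x)^2)" by (simp add: L2_inner_def lebesgue_on_UNIV_eq power2_eq_square)
  also have "... <= (LINT x|lebesgue. indicator ?I x * (u x)^2 + ep * (V_bar s x * (u x)^2))"
  proof (rule integral_mono[OF u2])
   show "integrable lebesgue (%x. indicator ?I x * (u x)^2 + ep * (V_bar s x * (u x)^2))" using iI Vu by simp
   fix x
   show "(u x)^2 <= indicator ?I x * (u x)^2 + ep * (V_bar s x * (u x)^2)"
   proof (cases "x : ?I")
    case True
    then show ?thesis using ep V_bar_nonneg[OF s_range, of x] by simp
   next
    case False
    then have "R <= \<bar>x\<bar>" by (auto simp: abs_if)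
    have "1 <= pi^2" using pi_gt3 by (simp add: one_le_power)
    then have "R <= pi^2 * \<bar>x\<bar>" using \<open>R <= \<bar>x\<bar>\<close> R mult_mono[of 1 "pi^2" R "\<bar>x\<bar>"] by simp
    then have "R <= V_bar s x" using V_bar_ge[OF s_range, of x] by simp
    then have "1 <= ep * V_bar s x" using ep by (simp add: R_def field_simps)
    then have "1 * (u x)^2 <= (ep * V_bar s x) * (u x)^2" by (rule mult_right_mono) simp
    then show ?thesis using False by simp
   qed
  qed
  also have "... = (LINT x|lebesgue. indicator ?I x * (u x)^2) + ep * (LINT x|lebesgue. V_bar s x * (u x)^2)"
   using iI Vu by simp
  also have "(LINT x|lebesgue. V_bar s x * (u x)^2) = form u u - grad_inner UNIV u u"
   by (simp add: form_eq bform_def power2_eq_square mult.assoc)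
  finally have "L2_inner UNIV u u <= de^2 * grad_inner UNIV u u + ep * (form u u - grad_inner UNIV u u) + (\<Sum>j<N. (L2_inner UNIV (cell_weight (-R) de j) u)^2)"
   using 1 by simp
  moreover have "de^2 * grad_inner UNIV u u <= ep * grad_inner UNIV u u" using deep G.nonneg[OF u] by (rule mult_right_mono)
  moreover have "0 <= ep * L2_inner UNIV u u" using B.nonneg[OF u] ep by simp
  ultimately show ?thesis by (simp add: algebra_simps)
 qed
 then show ?thesis using cell_weight_L2[OF open_UNIV] by blast
qed

sublocale spectral UNIV fdom form
proof (rule spectral_form)
 show "ph : fdom" if ph: "test_function UNIV ph" for ph
 proof -
  obtain K where K: "compact K" "K <= UNIV" "!!x. x ~: K ==> ph x = 0" using test_functionD[OF ph] by blast
  show ?thesis by (rule continuous_compact_fdom[OF test_function_H1(1)[OF ph open_UNIV] K(1,3)])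
 qed
 have "AE x in lebesgue. x ~= (0::real)"
  using AE_not_in[of "{0::real}" lebesgue] by (simp add: negligible_iff_null_sets[symmetric])
 then have "AE x in lebesgue. rtV x ~= 0"
 proof eventually_elim
  case (elim x)
  then have "pi^2 * \<bar>x\<bar> > 0" by simp
  then show ?case using V_bar_ge[OF s_range, of x] by simp
 qed
 then show "AE x in lebesgue_on UNIV. rtV x ~= 0" by (simp only: lebesgue_on_UNIV_eq)
qed (use Ehrling in auto)

end

subsection \<open>The problem on the interval\<close>

text \<open>No measurability is assumed, as \<open>V_hat\<close> contains a chosen representative:
  completeness of the measure makes both functions measurable or neither, and in the latter case
  both integrals take the default value.\<close>

lemma integral_lebesgue_on_cong_AE:
 fixes f g :: "'a::euclidean_space => real"
 assumes U: "open U" and ae: "AE x in lebesgue_on U. f x = g x"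
 shows "integral\<^sup>L (lebesgue_on U) f = integral\<^sup>L (lebesgue_on U) g"
proof -
 have Us: "U : sets lebesgue" using U by (rule open_sets_lebesgue)
 have m: "q : borel_measurable (lebesgue_on U)"
  if "p : borel_measurable (lebesgue_on U)" "AE x in lebesgue_on U. p x = q x" for p q :: "'a => real"
 proof -
  have "(%x. indicator U x *\<^sub>R p x) : borel_measurable lebesgue"
   using that(1) Us by (simp add: borel_measurable_restrict_space_iff)
  moreover have "AE x in lebesgue. indicator U x *\<^sub>R p x = indicator U x *\<^sub>R q x"
   using that(2) Us by (subst (asm) AE_restrict_space_iff) (auto elim!: eventually_mono simp: indicator_def)
  ultimately have "(%x. indicator U x *\<^sub>R q x) : borel_measurable lebesgue" by (rule borel_measurable_AE)
  then show ?thesis using Us by (simp add: borel_measurable_restrict_space_iff)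
 qed
 have ae': "AE x in lebesgue_on U. g x = f x" using ae by eventually_elim simp
 show ?thesis
 proof (cases "f : borel_measurable (lebesgue_on U)")
  case True
  then show ?thesis using m[OF True ae] ae by (intro integral_cong_AE)
 next
  case False
  then have "g ~: borel_measurable (lebesgue_on U)" using m[OF _ ae'] by blast
  with False have "~ integrable (lebesgue_on U) f" "~ integrable (lebesgue_on U) g" by auto
  then show ?thesis by (simp add: not_integrable_integral_eq)
 qed
qed

lemma test_function_inner:
 fixes ph ps :: "'a::euclidean_space => real"
 assumes U: "open U" and ph: "test_function U ph" and ps: "test_function U ps"
 shows "L2_inner U ph ps = (LBINT x. ph x * ps x)"
  "grad_inner U ph ps = (\<Sum>i\<in>Basis. LBINT x. pd ph i x * pd ps i x)"
proof -
 have *: "L2_inner U al bet = (LBINT x. al x * bet x)" if al: "test_function U al" and bet: "test_function U bet" for al bet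
 proof -
  obtain K where K: "compact K" "K <= U" "!!x. x ~: K ==> al x = 0" using test_functionD[OF al] by blast
  have z: "al x * bet x = 0" if "x ~: U" for x using K(2) K(3)[of x] that by auto
  have m: "(%x. al x * bet x) : borel_measurable borel"
   using C_k_continuous[OF test_function_C_k[OF al, of 0]] C_k_continuous[OF test_function_C_k[OF bet, of 0]]
   by (intro borel_measurable_continuous_onI continuous_intros)
  show ?thesis unfolding L2_inner_def
   using lebesgue_on_support(2)[OF open_sets_lebesgue[OF U], of "%x. al x * bet x"] z lebesgue_lborel(2)[OF m] by simp
 qed
 show "L2_inner U ph ps = (LBINT x. ph x * ps x)" by (rule *[OF ph ps])
 have "grad_inner U ph ps = (\<Sum>i\<in>Basis. L2_inner U (pd ph i) (pd ps i))"
  using test_function_H1[OF ph U] test_function_H1[OF ps U] U by (intro grad_inner_eq) auto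
 also have "... = (\<Sum>i\<in>Basis. LBINT x. pd ph i x * pd ps i x)"
  by (intro sum.cong refl * test_function_partial_deriv ph ps)
 finally show "grad_inner U ph ps = (\<Sum>i\<in>Basis. LBINT x. pd ph i x * pd ps i x)" .
qed

text \<open>For inequalities obtained by completing a square: the integrand exceeds a derivative by
  a nonnegative term, and only boundary values remain.\<close>

lemma FTC_le:
 fixes f F F' :: "real => real"
 assumes "a <= b" and d: "!!x. a <= x ==> x <= b ==> (F has_real_derivative F' x) (at x)"
  and c: "!!x. a <= x ==> x <= b ==> isCont F' x" and le: "!!x. a <= x ==> x <= b ==> F' x <= f x"
  and i: "integrable lborel (%x. f x * indicator {a..b} x)"
 shows "F b - F a <= (LBINT x. f x * indicator {a..b} x)"
proof -
 have h: "has_bochner_integral lborel (%x. F' x * indicator {a..b} x) (F b - F a)"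
  using assms by (intro has_bochner_integral_FTC_Icc_real) auto
 then have "F b - F a = (LBINT x. F' x * indicator {a..b} x)" by (simp add: has_bochner_integral_iff)
 also have "... <= (LBINT x. f x * indicator {a..b} x)"
  using h i le by (intro integral_mono) (auto simp: has_bochner_integral_iff split: split_indicator)
 finally show ?thesis .
qed

lemma test_function_interval_support:
 fixes ph :: "real => real"
 assumes "test_function {a<..<b} ph" "a < b"
 shows "EX al bet. a < al & al < bet & bet < b & (ALL x. x ~: {al<..<bet} --> ph x = 0)"
proof -
 obtain K where K: "compact K" "K <= {a<..<b}" "!!x. x ~: K ==> ph x = 0" using test_functionD[OF assms(1)] by blast
 show ?thesis
 proof (cases "K = {}")
  case True
  then show ?thesis using K(3) assms(2) by (intro exI[of _ "(2*a+b)/3"] exI[of _ "(a+2*b)/3"]) auto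
 next
  case False
  obtain m where m: "m : K" "!!x. x : K ==> m <= x" using compact_attains_inf[OF K(1) False] by blast
  obtain M where M: "M : K" "!!x. x : K ==> x <= M" using compact_attains_sup[OF K(1) False] by blast
  have mM: "a < m" "m <= M" "M < b" using m M K(2) by auto
  have "ph x = 0" if "x ~: {(a + m) / 2<..<(M + b) / 2}" for x
  proof (rule K(3), rule notI)
   assume x: "x : K"
   have "m <= x" "x <= M" using m(2)[OF x] M(2)[OF x] by auto
   then show False using that mM by auto
  qed
  then show ?thesis using mM by (intro exI[of _ "(a + m) / 2"] exI[of _ "(M + b) / 2"]) auto
 qed
qed

lemma test_function_real_derivative:
 "test_function U ph ==> (ph has_real_derivative pd ph 1 x) (at x)"
 using DERIV_along_line[OF test_function_C_k, of U ph 0 1 x] by simp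

text \<open>With \<open>z = f / (x - c)\<close> one has
  \<open>f'^2 - z^2 / 4 = (f' - z / 2)^2 + (f * z / 2)'\<close>, and the boundary terms vanish. The
  compact support keeps away from \<open>c\<close>, so no integrand is singular.\<close>

lemma Hardy:
 fixes ph :: "real => real"
 assumes ph: "test_function {a<..<b} ph" and ab: "a < b" and c: "c ~: {a<..<b}"
 shows "integrable lborel (%x. (ph x / (x - c))^2)" "(LBINT x. (ph x / (x - c))^2) <= 4 * (LBINT x. (pd ph 1 x)^2)"
proof -
 let ?d = "pd ph 1"
 obtain al bet where albet: "a < al" "al < bet" "bet < b" and z: "!!x. x ~: {al<..<bet} ==> ph x = 0"
  using test_function_interval_support[OF ph ab] by blast
 have cph: "continuous_on UNIV ph" using C_k_continuous[OF test_function_C_k[OF ph, of 0]] .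
 have dt: "test_function {a<..<b} ?d" by (rule test_function_partial_deriv[OF ph]) simp
 have cd: "continuous_on UNIV ?d" using C_k_continuous[OF test_function_C_k[OF dt, of 0]] .
 have [measurable]: "ph : borel_measurable borel" "?d : borel_measurable borel"
  using cph cd by (auto intro: borel_measurable_continuous_onI)
 have der: "(ph has_real_derivative ?d x) (at x)" for x by (rule test_function_real_derivative[OF ph])
 have dz: "?d x = 0" if "x ~: {al..bet}" for x
  by (rule partial_deriv_eq_0[of "{al..bet}"]) (use z that in auto)
 have id: "integrable lborel (%x. (?d x)^2)"
  by (rule continuous_compact_support[of _ "{al..bet}"]) (auto intro!: continuous_intros cd dz)
 have iph: "integrable lborel (%x. (ph x)^2)"
  by (rule continuous_compact_support[of _ "{al..bet}"]) (auto intro!: continuous_intros cph z)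
 define D where "D = min (al - a) (b - bet)"
 have D: "D > 0" using albet by (simp add: D_def)
 have far: "D <= \<bar>x - c\<bar>" if "x : {al..bet}" for x using that c albet by (auto simp: D_def abs_if)
 show ih: "integrable lborel (%x. (ph x / (x - c))^2)"
 proof (rule lebesgue_bound)
  show "integrable lborel (%x. 1 / D^2 * (ph x)^2)" using iph by simp
  show "AE x in lborel. norm ((ph x / (x - c))^2) <= norm (1 / D^2 * (ph x)^2)"
  proof (rule always_eventually, rule allI)
   fix x show "norm ((ph x / (x - c))^2) <= norm (1 / D^2 * (ph x)^2)"
   proof (cases "x : {al..bet}")
    case True
    have "D^2 <= (x - c)^2" using far[OF True] D by (metis abs_le_square_iff abs_of_pos)
    moreover have "0 < (x - c)^2 * D^2" using far[OF True] D by auto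
    ultimately have "(ph x)^2 / (x - c)^2 <= (ph x)^2 / D^2" by (intro divide_left_mono) auto
    then show ?thesis by (simp add: power_divide)
   qed (use z in auto)
  qed
 qed measurable
 let ?f = "%x. (?d x)^2 - 1/4 * (ph x / (x - c))^2"
 let ?F = "%x. 1/2 * ((ph x)^2 / (x - c))"
 let ?F' = "%x. ph x * ?d x / (x - c) - 1/2 * (ph x / (x - c))^2"
 have "?F bet - ?F al <= (LBINT x. ?f x * indicator {al..bet} x)"
 proof (rule FTC_le[where F' = ?F'])
  show "al <= bet" using albet by simp
  show "integrable lborel (%x. ?f x * indicator {al..bet} x)"
   using integrable_mult_indicator[of "{al..bet}" lborel ?f] id ih by (simp add: mult.commute)
  fix x assume x: "al <= x" "x <= bet"
  have nz: "x - c ~= 0" using far[of x] D x by auto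
  show "(?F has_real_derivative ?F' x) (at x)"
  proof -
   have sq: "((%x. (ph x)^2) has_real_derivative 2 * ph x * ?d x) (at x)"
    using DERIV_power[OF der[of x], where n = 2] by (simp add: mult_ac)
   have ln: "((%x. x - c) has_real_derivative 1) (at x)" by (auto intro!: derivative_eq_intros)
   have gen: "1/2 * ((2 * p * q * y - p^2 * 1) / (y * y)) = p * q / y - 1/2 * (p / y)^2" if "y ~= 0" for p q y :: real
    using that by (simp add: power2_eq_square field_simps)
   show ?thesis using DERIV_cmult[OF DERIV_divide[OF sq ln nz], of "1/2"] unfolding gen[OF nz] .
  qed
  show "isCont ?F' x" using nz cph cd by (auto intro!: continuous_intros simp: continuous_on_eq_continuous_at)
  have gen: "(d^2 - 1/4 * z^2) - (d * z - 1/2 * z^2) = (d - 1/2 * z)^2" for d z :: real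
   by (simp add: power2_eq_square algebra_simps)
  have "ph x * ?d x / (x - c) = ?d x * (ph x / (x - c))" by simp
  then have "?f x - ?F' x = (?d x - 1/2 * (ph x / (x - c)))^2" by (simp only: gen)
  then have "0 <= ?f x - ?F' x" by simp
  then show "?F' x <= ?f x" by simp
 qed
 moreover have "ph al = 0" "ph bet = 0" using z by auto
 ultimately have "0 <= (LBINT x. ?f x * indicator {al..bet} x)" by simp
 also have "... = (LBINT x. ?f x)"
  using z dz by (intro lebesgue_cong) (auto split: split_indicator)
 also have "... = (LBINT x. (?d x)^2) - 1/4 * (LBINT x. (ph x / (x - c))^2)" using id ih by simp
 finally show "(LBINT x. (ph x / (x - c))^2) <= 4 * (LBINT x. (?d x)^2)" by simp
qed

text \<open>Approximating test functions converge almost everywhere along a subsequence, and Fatou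
  carries the weighted bound to the limit; the slack \<open>e\<close> absorbs that their energies
  merely converge.\<close>

lemma weighted_H10:
 fixes U :: "'a::euclidean_space set"
 assumes U: "open U" and s: "s : borel_measurable (lebesgue_on U)" and K: "K >= 0"
  and t: "!!ph. test_function U ph ==> (%x. s x * ph x) : L2 U & L2_sq U (%x. s x * ph x) <= K * energy U ph"
  and u: "u : H10 U"
 shows "(%x. s x * u x) : L2 U" "L2_sq U (%x. s x * u x) <= K * energy U u"
proof -
 interpret E: semi_inner "H1 U" "%u v. L2_inner U u v + grad_inner U u v" by (rule semi_inner_energy[OF U])
 have uH: "u : H1 U" using u by (rule H10_H1)
 have um: "u : borel_measurable (lebesgue_on U)" using H1_L2[OF uH] by (rule L2_D)
 have main: "(%x. s x * u x) : L2 U & L2_sq U (%x. s x * u x) <= K * (energy U u + e)" if e: "e > 0" for e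
 proof -
  have "EX ph. test_function U ph & energy U (%x. u x - ph x) < 1 / real (Suc n)" for n
   using u unfolding H10_iff[OF U] by simp
  then obtain ph where ph: "!!n. test_function U (ph n)" "!!n. energy U (%x. u x - ph n x) < 1 / real (Suc n)" by metis
  have phH: "ph n : H1 U" for n using test_function_H1(1)[OF ph(1) U] .
  have dH: "(%x. ph n x - u x) : H1 U" for n by (rule E.diff[OF phH uH])
  have sm: "energy U (%x. ph n x - u x) < 1 / real (Suc n)" for n
   using ph(2)[of n] E.sq_diff_commute[OF phH uH, of n] by (simp add: energy_def)
  have l0: "(%n. energy U (%x. ph n x - u x)) ----> 0"
  proof (rule Lim_null_comparison)
   show "(%n. 1 / real (Suc n)) ----> 0" by (rule LIMSEQ_Suc[OF lim_1_over_n])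
   show "\<forall>\<^sub>F n in sequentially. norm (energy U (%x. ph n x - u x)) <= 1 / real (Suc n)"
   proof (rule always_eventually, rule allI)
    fix n show "norm (energy U (%x. ph n x - u x)) <= 1 / real (Suc n)"
     using sm[of n] E.nonneg[OF dH, of n] by (simp add: energy_def)
   qed
  qed
  have l1: "(%n. energy U (ph n)) ----> energy U u"
   using E.tendsto_B_sq[OF phH uH] l0 by (simp add: energy_def)
  have "(%n. LINT x|lebesgue_on U. norm ((ph n x - u x)^2)) ----> 0"
  proof (rule Lim_null_comparison[OF _ l0], rule always_eventually, rule allI)
   fix n
   have "(LINT x|lebesgue_on U. norm ((ph n x - u x)^2)) = L2_sq U (%x. ph n x - u x)"
    by (simp add: L2_inner_def power2_eq_square)
   then show "norm (LINT x|lebesgue_on U. norm ((ph n x - u x)^2)) <= energy U (%x. ph n x - u x)"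
    using semi_inner.nonneg[OF semi_inner_L2 H1_L2[OF dH], of n] semi_inner.nonneg[OF semi_inner_H1[OF U] dH, of n]
    by (simp add: energy_def)
  qed
  from tendsto_L1_AE_subseq[OF _ this] obtain r where r: "strict_mono (r::nat=>nat)"
   and ae: "AE x in lebesgue_on U. (%n. (ph (r n) x - u x)^2) ----> 0"
   using L2_D(2)[OF H1_L2[OF dH]] by blast
  have "\<forall>\<^sub>F n in sequentially. energy U (ph n) < energy U u + e" using e by (intro order_tendstoD(2)[OF l1]) simp
  then obtain N where N: "!!n. n >= N ==> energy U (ph n) < energy U u + e" by (auto simp: eventually_sequentially)
  have i: "integrable (lebesgue_on U) (%x. (s x * ph (r (k + N)) x)^2)" for k
   using t[OF ph(1)] L2_D(2) by blast
  have le: "(LINT x|lebesgue_on U. (s x * ph (r (k + N)) x)^2) <= K * (energy U u + e)" for k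
  proof -
   have "N <= r (k + N)" using seq_suble[OF r, of "k + N"] by linarith
   then have "K * energy U (ph (r (k + N))) <= K * (energy U u + e)" by (rule mult_left_mono[OF less_imp_le[OF N] K])
   moreover have "(LINT x|lebesgue_on U. (s x * ph (r (k + N)) x)^2) <= K * energy U (ph (r (k + N)))"
    using t[OF ph(1)] by (simp add: L2_inner_def power2_eq_square)
   ultimately show ?thesis by linarith
  qed
  have ae': "AE x in lebesgue_on U. (%k. (s x * ph (r (k + N)) x)^2) ----> (s x * u x)^2"
   using ae
  proof eventually_elim
   case (elim x)
   then have "(%n. sqrt ((ph (r n) x - u x)^2)) ----> sqrt 0" by (rule tendsto_real_sqrt)
   then have "(%n. ph (r n) x) ----> u x" by (simp add: tendsto_rabs_zero_iff LIM_zero_iff)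
   then have "(%k. ph (r (k + N)) x) ----> u x" by (rule LIMSEQ_ignore_initial_segment)
   then show ?case by (intro tendsto_intros)
  qed
  have m: "(%x. (s x * u x)^2) : borel_measurable (lebesgue_on U)" using s um by simp
  have F: "integrable (lebesgue_on U) (%x. (s x * u x)^2)" "(LINT x|lebesgue_on U. (s x * u x)^2) <= K * (energy U u + e)"
   using Fatou_real[of "lebesgue_on U" "%k x. (s x * ph (r (k + N)) x)^2", OF i _ le m ae'] by simp_all
  then show ?thesis using s um by (simp add: L2_def L2_inner_def power2_eq_square)
 qed
 show "(%x. s x * u x) : L2 U" using main[of 1] by simp
 show "L2_sq U (%x. s x * u x) <= K * energy U u"
 proof (rule field_le_epsilon)
  fix e :: real assume e: "e > 0"
  have "L2_sq U (%x. s x * u x) <= K * (energy U u + e / (K + 1))" using main[of "e / (K + 1)"] e K by simp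
  also have "... <= K * energy U u + e" using e K by (simp add: field_simps)
  finally show "L2_sq U (%x. s x * u x) <= K * energy U u + e" .
 qed
qed

section \<open>The height of the triangle and its weak derivative\<close>

lemma height_eq_min:
 assumes "s : {-1<..<1}" "t > 0"
 shows "height s t x = min (t / (1 + s) * (x + 1)) (t / (1 - s) * (1 - x))"
proof -
 have e: "t / (1 + s) * (x + 1) = t + t / (1 + s) * (x - s)" "t / (1 - s) * (1 - x) = t - t / (1 - s) * (x - s)"
  using assms by (simp_all add: field_simps)
 have p: "t / (1 + s) > 0" "t / (1 - s) > 0" using assms by simp_all
 show ?thesis
 proof (cases "x <= s")
  case True
  have "t / (1 + s) * (x - s) <= 0" "t / (1 - s) * (x - s) <= 0" using mult_nonneg_nonpos[of "t / (1 + s)" "x - s"] mult_nonneg_nonpos[of "t / (1 - s)" "x - s"] p True by auto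
  then have "t / (1 + s) * (x + 1) <= t / (1 - s) * (1 - x)" using e by linarith
  then show ?thesis using True by (simp add: height_def min_def)
 next
  case False
  have "t / (1 + s) * (x - s) > 0" "t / (1 - s) * (x - s) > 0" using mult_pos_pos[of "t / (1 + s)" "x - s"] mult_pos_pos[of "t / (1 - s)" "x - s"] p False by auto
  then have "t / (1 - s) * (1 - x) < t / (1 + s) * (x + 1)" using e by linarith
  moreover have "- t / (1 - s) * (x - 1) = t / (1 - s) * (1 - x)" by (simp add: right_diff_distrib diff_divide_distrib)
  ultimately show ?thesis using False by (simp add: height_def min_def)
 qed
qed

definition slope :: "real => real => real => real" where
 "slope s t x = (if x <= s then t / (1 + s) else - t / (1 - s))"

text \<open>Integration by parts on either side of \<open>s\<close>: the boundary terms at the apex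
  cancel because both branches take the value \<open>t\<close> there.\<close>

lemma height_has_weak_deriv:
 assumes s: "s : {-1<..<1}" and t: "t > 0"
 shows "has_weak_deriv {-1<..<1} (height s t) 1 (slope s t)"
 unfolding has_weak_deriv_def
proof (intro conjI allI impI)
 let ?J = "{-1<..<1::real}"
 have hc: "continuous_on UNIV (height s t)"
 proof -
  have "height s t = (%x. min (t / (1 + s) * (x + 1)) (t / (1 - s) * (1 - x)))" using height_eq_min[OF s t] by (rule ext)
  then show ?thesis using s by (auto intro!: continuous_intros)
 qed
 have sm [measurable]: "slope s t : borel_measurable borel" unfolding slope_def[abs_def] by measurable
 have hm [measurable]: "height s t : borel_measurable borel" using hc by (rule borel_measurable_continuous_onI)
 show "locally_integrable ?J (height s t)" by (rule locally_integrable_continuous[OF hc])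
 show "locally_integrable ?J (slope s t)"
  unfolding locally_integrable_def set_integrable_def
 proof (intro allI impI)
  fix K :: "real set" assume K: "compact K & K <= ?J"
  define M where "M = \<bar>t / (1 + s)\<bar> + \<bar>t / (1 - s)\<bar>"
  have "integrable lborel (%x. indicator K x *\<^sub>R slope s t x)"
  proof (rule lebesgue_bound)
   show "integrable lborel (%x. M * indicator K x)"
    using K emeasure_bounded_finite[of K] by (auto intro!: integrable_mult_right integrable_real_indicator borel_compact simp: compact_imp_bounded)
   show "(%x. indicator K x *\<^sub>R slope s t x) : borel_measurable lborel" using K borel_compact[of K] by simp
   show "AE x in lborel. norm (indicator K x *\<^sub>R slope s t x) <= norm (M * indicator K x)"
    by (auto simp: slope_def M_def split: split_indicator)
  qed
  then show "integrable lebesgue (%x. indicator K x *\<^sub>R slope s t x)"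
   using K borel_compact[of K] by (subst lebesgue_lborel) auto
 qed
 fix ph assume ph: "test_function ?J ph"
 let ?d = "pd ph 1"
 obtain al bet where albet: "-1 < al" "al < bet" "bet < 1" and z: "!!x. x ~: {al<..<bet} ==> ph x = 0"
  using test_function_interval_support[OF ph] by auto
 have dt: "test_function ?J ?d" by (rule test_function_partial_deriv[OF ph]) simp
 have cph: "continuous_on UNIV ph" using C_k_continuous[OF test_function_C_k[OF ph, of 0]] .
 have cd: "continuous_on UNIV ?d" using C_k_continuous[OF test_function_C_k[OF dt, of 0]] .
 have [measurable]: "ph : borel_measurable borel" "?d : borel_measurable borel"
  using cph cd by (auto intro: borel_measurable_continuous_onI)
 have der: "(ph has_real_derivative ?d x) (at x)" for x by (rule test_function_real_derivative[OF ph])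
 have dz: "?d x = 0" if "x ~: {al..bet}" for x
  by (rule partial_deriv_eq_0[of "{al..bet}"]) (use z that in auto)
 define p where "p = t / (1 + s)"
 define q where "q = - t / (1 - s)"
 define F1 where "F1 x = p * (x + 1) * ph x" for x
 define F2 where "F2 x = q * (x - 1) * ph x" for x
 define f1 where "f1 x = p * (x + 1) * ?d x + p * ph x" for x
 define f2 where "f2 x = q * (x - 1) * ?d x + q * ph x" for x
 have s': "1 + s ~= 0" "1 - s ~= 0" using s by auto
 have h1: "has_bochner_integral lborel (%x. f1 x * indicator {-1..s} x) (F1 s - F1 (-1))"
 proof (rule has_bochner_integral_FTC_Icc_real)
  show "(F1 has_real_derivative f1 x) (at x)" for x
   unfolding F1_def f1_def by (auto intro!: derivative_eq_intros der simp: algebra_simps)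
  show "isCont f1 x" for x
   unfolding f1_def using cph cd by (auto intro!: continuous_intros simp: continuous_on_eq_continuous_at)
 qed (use s in auto)
 have h2: "has_bochner_integral lborel (%x. f2 x * indicator {s..1} x) (F2 1 - F2 s)"
 proof (rule has_bochner_integral_FTC_Icc_real)
  show "(F2 has_real_derivative f2 x) (at x)" for x
   unfolding F2_def f2_def by (auto intro!: derivative_eq_intros der simp: algebra_simps)
  show "isCont f2 x" for x
   unfolding f2_def using cph cd by (auto intro!: continuous_intros simp: continuous_on_eq_continuous_at)
 qed (use s in auto)
 have "F1 s = t * ph s" "F2 s = t * ph s" using s' by (simp_all add: F1_def F2_def p_def q_def field_simps)
 moreover have "F1 (-1) = 0" "F2 1 = 0" by (simp_all add: F1_def F2_def)
 ultimately have sum0: "(F1 s - F1 (-1)) + (F2 1 - F2 s) = 0" by linarith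
 have i1: "integrable lborel (%x. height s t x * ?d x)"
  by (rule continuous_compact_support[of _ "{al..bet}"]) (auto intro!: continuous_intros hc cd dz)
 have i2: "integrable lborel (%x. slope s t x * ph x)"
 proof (rule lebesgue_bound)
  show "integrable lborel (%x. (\<bar>t / (1 + s)\<bar> + \<bar>t / (1 - s)\<bar>) * ph x)"
   by (intro integrable_mult_right, rule continuous_compact_support[of _ "{al..bet}"]) (auto intro!: cph z)
  show "AE x in lborel. norm (slope s t x * ph x) <= norm ((\<bar>t / (1 + s)\<bar> + \<bar>t / (1 - s)\<bar>) * ph x)"
  proof (rule always_eventually, rule allI)
   fix x
   have "\<bar>slope s t x\<bar> <= \<bar>t / (1 + s)\<bar> + \<bar>t / (1 - s)\<bar>" by (auto simp: slope_def)
   then have "\<bar>slope s t x\<bar> * \<bar>ph x\<bar> <= (\<bar>t / (1 + s)\<bar> + \<bar>t / (1 - s)\<bar>) * \<bar>ph x\<bar>" by (rule mult_right_mono) simp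
   moreover have "\<bar>\<bar>t / (1 + s)\<bar> + \<bar>t / (1 - s)\<bar>\<bar> = \<bar>t / (1 + s)\<bar> + \<bar>t / (1 - s)\<bar>" by (rule abs_of_nonneg) (intro add_nonneg_nonneg abs_ge_zero)
   ultimately show "norm (slope s t x * ph x) <= norm ((\<bar>t / (1 + s)\<bar> + \<bar>t / (1 - s)\<bar>) * ph x)"
    by (simp only: real_norm_def abs_mult)
  qed
 qed measurable
 have "(LBINT x. height s t x * ?d x) + (LBINT x. slope s t x * ph x) = (LBINT x. height s t x * ?d x + slope s t x * ph x)"
  using i1 i2 by simp
 also have "... = (LBINT x. f1 x * indicator {-1..s} x + f2 x * indicator {s..1} x)"
 proof (rule integral_cong_AE)
  have "AE x in lborel. x ~= s" by (rule AE_lborel_singleton)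
  then show "AE x in lborel. height s t x * ?d x + slope s t x * ph x = f1 x * indicator {-1..s} x + f2 x * indicator {s..1} x"
  proof eventually_elim
   case (elim x)
   show ?case
   proof (cases "x : {-1..1}")
    case True
    then show ?thesis using elim by (auto simp: height_def slope_def f1_def f2_def p_def q_def split: split_indicator)
   next
    case False
    then have "ph x = 0" "?d x = 0" using z[of x] dz[of x] albet by auto
    then show ?thesis by (simp add: f1_def f2_def)
   qed
  qed
  show "(%x. f1 x * indicator {-1..s} x + f2 x * indicator {s..1} x) : borel_measurable lborel"
   using h1 h2 by (auto simp: has_bochner_integral_iff)
 qed measurable
 also have "... = 0" using has_bochner_integral_add[OF h1 h2] sum0 by (simp add: has_bochner_integral_iff)
 finally have e: "(LBINT x. height s t x * ?d x) = - (LBINT x. slope s t x * ph x)" by simp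
 have 1: "(LINT x|lebesgue_on ?J. height s t x * ?d x) = (LBINT x. height s t x * ?d x)"
  using dz albet by (subst lebesgue_on_support) (auto simp: lebesgue_lborel)
 have 2: "(LINT x|lebesgue_on ?J. slope s t x * ph x) = (LBINT x. slope s t x * ph x)"
  using z albet by (subst lebesgue_on_support) (auto simp: lebesgue_lborel)
 show "(LINT x|lebesgue_on ?J. height s t x * ?d x) = - (LINT x|lebesgue_on ?J. slope s t x * ph x)"
  unfolding 1 2 by (rule e)
qed

section \<open>The potential on the interval in scaled coordinates\<close>

definition side :: "real => real => real" where
 "side s x = (if x <= 0 then 1 + s else 1 - s)"

text \<open>The distance left from \<open>s + ta * x\<close> to the end of the base on its side,
  while \<open>side\<close> is the whole distance from \<open>s\<close> to that end; the height
  there is \<open>t * hat_gap s ta x / side s x\<close>.\<close>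

definition hat_gap :: "real => real => real => real" where
 "hat_gap s ta x = side s x - ta * \<bar>x\<bar>"

text \<open>Equal almost everywhere to \<open>V_hat s t\<close>, with \<open>ta = t\<^bsup>2/3\<^esup>\<close>.\<close>

definition hat_pot :: "real => real => real => real" where
 "hat_pot s ta x = pi^2 / ta * ((side s x)^2 / (hat_gap s ta x)^2 - 1) + (3 + 4 * pi^2) / 12 * ta^2 / (hat_gap s ta x)^2"

definition hat_int :: "real => real => real set" where
 "hat_int s ta = {- ((1 + s) / ta) <..< (1 - s) / ta}"

text \<open>The relation \<open>ta^3 = t^2\<close> turns the fractional powers of \<open>t\<close>
  into rational expressions in \<open>ta\<close>.\<close>

lemma powr_two_thirds:
 fixes t :: real
 assumes "t > 0"
 shows "t powr (-2/3) = 1 / t powr (2/3)" "t powr (4/3) = (t powr (2/3))^2" "(t powr (2/3))^3 = t^2"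
proof -
 show "t powr (-2/3) = 1 / t powr (2/3)" using powr_minus_divide[of t "2/3"] by simp
 have "(t powr (2/3))^2 = t powr (2/3 + 2/3)" by (simp only: power2_eq_square powr_add)
 then show "t powr (4/3) = (t powr (2/3))^2" by simp
 have "(t powr (2/3))^3 = t powr (2/3 + 2/3 + 2/3)" by (simp only: power3_eq_cube powr_add)
 also have "... = t^2" using assms powr_realpow[of t 2] by simp
 finally show "(t powr (2/3))^3 = t^2" .
qed

lemma I_int_eq: "t > 0 ==> I_int s t = hat_int s (t powr (2/3))"
 using powr_two_thirds(1)[of t] by (simp add: I_int_def hat_int_def interior_atLeastAtMost_real)

lemma hat_gap_pos:
 assumes "ta > 0" "x : hat_int s ta"
 shows "hat_gap s ta x > 0" "hat_gap s ta x <= side s x" "side s x > 0"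
proof -
 have b: "- (1 + s) < ta * x" "ta * x < 1 - s" using assms by (auto simp: hat_int_def field_simps)
 have a: "ta * \<bar>x\<bar> = (if x <= 0 then - (ta * x) else ta * x)" by (simp add: abs_if)
 show p: "hat_gap s ta x > 0" unfolding hat_gap_def side_def a using b by auto
 show l: "hat_gap s ta x <= side s x" using assms by (simp add: hat_gap_def)
 show "side s x > 0" using p l by linarith
qed

lemma hat_pot_pos:
 assumes "ta > 0" "x : hat_int s ta"
 shows "hat_pot s ta x > 0"
proof -
 note g = hat_gap_pos[OF assms]
 have "(hat_gap s ta x)^2 <= (side s x)^2" using g by (intro power_mono) auto
 then have "1 <= (side s x)^2 / (hat_gap s ta x)^2" using g by simp
 then have "0 <= pi^2 / ta * ((side s x)^2 / (hat_gap s ta x)^2 - 1)" using assms(1) by simp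
 moreover have "0 < (3 + 4 * pi^2) / 12 * ta^2 / (hat_gap s ta x)^2" using g(1) assms(1)
  by (intro divide_pos_pos mult_pos_pos) (auto intro: add_pos_nonneg)
 ultimately show ?thesis by (simp add: hat_pot_def)
qed

text \<open>With \<open>y = \<bar>x\<bar>\<close> and \<open>r = side s x\<close>, the quotient
  \<open>((r / (r - rh * y))^2 - 1) / rh\<close> equals
  \<open>y * (1 / (r - rh * y) + r / (r - rh * y)^2)\<close>: the factor \<open>1 / rh\<close>
  cancels, and each summand increases with \<open>rh\<close>.\<close>

lemma hat_pot_mono:
 assumes "0 < sg" "sg <= ta" "x : hat_int s ta"
 shows "hat_pot s sg x <= hat_pot s ta x"
proof -
 define r where "r = side s x"
 define y where "y = \<bar>x\<bar>"
 have g: "r - ta * y > 0" "r > 0" using hat_gap_pos[OF _ assms(3)] assms by (auto simp: hat_gap_def r_def y_def)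
 have y: "y >= 0" by (simp add: y_def)
 have le: "sg * y <= ta * y" using assms y by (intro mult_right_mono)
 have g': "r - sg * y > 0" using g le by linarith
 have e: "(r^2 / (r - rh * y)^2 - 1) / rh = y * (2 * r - rh * y) / (r - rh * y)^2" if "rh > 0" "r - rh * y > 0" for rh
 proof -
  have gen: "(R / (D * D) - 1) / rh = y * z / (D * D)" if "D ~= 0" "rh ~= 0" "R - D * D = rh * (y * z)" for D R z :: real
  proof -
   have "R = D * D + rh * (y * z)" using that(3) by simp
   then show ?thesis using that(1,2) by (simp add: add_divide_distrib)
  qed
  show ?thesis unfolding power2_eq_square by (rule gen) (use that in "auto simp: algebra_simps")
 qed
 have sq: "(r - ta * y)^2 <= (r - sg * y)^2" using g le by (intro power_mono) auto
 have f: "(2 * r - rh * y) / (r - rh * y)^2 = 1 / (r - rh * y) + r / (r - rh * y)^2" if "r - rh * y > 0" for rh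
 proof -
  have gen: "(D + r) / D^2 = 1 / D + r / D^2" if "D ~= 0" for D :: real
   using that by (simp add: power2_eq_square add_divide_distrib)
  have "2 * r - rh * y = (r - rh * y) + r" by simp
  then show ?thesis using gen[of "r - rh * y"] that by simp
 qed
 have i1: "1 / (r - sg * y) <= 1 / (r - ta * y)" using g le by (intro divide_left_mono) auto
 have i2: "r / (r - sg * y)^2 <= r / (r - ta * y)^2" using g g' sq by (intro divide_left_mono) auto
 have "y * ((2 * r - sg * y) / (r - sg * y)^2) <= y * ((2 * r - ta * y) / (r - ta * y)^2)"
  unfolding f[OF g(1)] f[OF g'] using i1 i2 y by (intro mult_left_mono) auto
 then have "pi^2 * ((r^2 / (r - sg * y)^2 - 1) / sg) <= pi^2 * ((r^2 / (r - ta * y)^2 - 1) / ta)"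
  using e[OF assms(1) g'] e[OF _ g(1)] assms by (intro mult_left_mono) auto
 moreover have "(3 + 4 * pi^2) / 12 * (sg^2 / (r - sg * y)^2) <= (3 + 4 * pi^2) / 12 * (ta^2 / (r - ta * y)^2)"
  using g g' sq assms by (intro mult_left_mono frac_le power_mono) (auto intro: add_nonneg_nonneg)
 ultimately show ?thesis by (simp add: hat_pot_def hat_gap_def r_def[symmetric] y_def[symmetric])
qed

lemma AE_lebesgue_affine:
 fixes c d :: real
 assumes "AE x in lebesgue. P x" "c ~= 0"
 shows "AE x in lebesgue. P (d + c * x)"
proof -
 have "AE x in lborel. P x" using assms(1) by (simp add: AE_completion_iff)
 then obtain N where N: "N : null_sets lborel" "{x : space lborel. ~ P x} <= N" by (auto elim: AE_E3 simp: eventually_ae_filter)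
 have Ns: "N : sets borel" using N(1) by auto
 have "AE x in lborel. x ~: N" by (rule AE_not_in[OF N(1)])
 then have "AE x in lborel. d + c * x ~: N"
  using Ns assms(2) by (intro AE_borel_affine) auto
 then have "AE x in lborel. P (d + c * x)" by eventually_elim (use N(2) in auto)
 then show ?thesis by (rule AE_completion)
qed

text \<open>\<open>V_hat\<close> uses the chosen weak derivative \<open>height'\<close>, which
  agrees with \<open>slope\<close> only almost everywhere; the exceptional null set is carried
  through the scaling \<open>s + ta * x\<close>.\<close>

lemma V_hat_AE:
 assumes s: "s : {-1<..<1}" and t: "t > 0"
 shows "AE x in lebesgue. x : hat_int s (t powr (2/3)) --> V_hat s t x = hat_pot s (t powr (2/3)) x"
proof -
 define ta where "ta = t powr (2/3)"
 have ta: "ta > 0" using t by (simp add: ta_def)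
 have t3: "ta^3 = t^2" using powr_two_thirds(3)[OF t] by (simp add: ta_def)
 have "AE x in lebesgue_on {-1<..<1}. height' s t x = slope s t x"
  unfolding height'_def by (rule weak_deriv_AE_eq[OF height_has_weak_deriv[OF s t]]) simp
 then have "AE x in lebesgue. x : {-1<..<1} --> height' s t x = slope s t x"
  by (subst (asm) AE_restrict_space_iff) auto
 then have "AE x in lebesgue. s + ta * x : {-1<..<1} --> height' s t (s + ta * x) = slope s t (s + ta * x)"
  using ta by (intro AE_lebesgue_affine[where P = "%x. x : {-1<..<1} --> height' s t x = slope s t x"]) auto
 then show ?thesis
 proof eventually_elim
  case (elim x)
  show ?case
  proof
   assume x: "x : hat_int s (t powr (2/3))"
   then have x': "x : hat_int s ta" by (simp add: ta_def)
   note g = hat_gap_pos[OF ta x']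
   have b: "- (1 + s) < ta * x" "ta * x < 1 - s" using x' ta by (auto simp: hat_int_def field_simps)
   then have h': "height' s t (ta * x + s) = slope s t (ta * x + s)" using elim by (simp add: add.commute)
   have sgn: "ta * x + s <= s \<longleftrightarrow> x <= 0" using ta by (simp add: mult_le_0_iff)
   have sl: "(slope s t (ta * x + s))^2 = t^2 / (side s x)^2"
    unfolding slope_def sgn side_def by (simp add: power_divide)
   have h: "height s t (ta * x + s) = t * hat_gap s ta x / side s x"
    unfolding height_def sgn side_def hat_gap_def using s by (auto simp: field_simps abs_if)
   have r: "side s x ~= 0" "hat_gap s ta x ~= 0" "t ~= 0" "ta ~= 0" using g t ta by auto
   have tt: "t^2 = ta * ta * ta" using t3 by (simp add: power3_eq_cube)
   have "V_hat s t x = ta^2 * (pi^2 / (t * hat_gap s ta x / side s x)^2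
     + (3 + 4 * pi^2) * (t^2 / (side s x)^2) / (12 * (t * hat_gap s ta x / side s x)^2) - pi^2 / t^2)"
    unfolding V_hat_def powr_two_thirds(2)[OF t] ta_def[symmetric] h' sl h ..
   also have "... = ta^2 * (pi^2 / t^2 * (side s x)^2 / (hat_gap s ta x)^2
     + (3 + 4 * pi^2) / 12 / (hat_gap s ta x)^2 - pi^2 / t^2)"
    using r by (simp add: power_divide power_mult_distrib)
   also have "... = hat_pot s ta x"
    unfolding hat_pot_def tt using r by (simp add: field_simps power2_eq_square)
   finally show "V_hat s t x = hat_pot s (t powr (2/3)) x" by (simp add: ta_def)
  qed
 qed
qed

section \<open>The form on the interval\<close>

locale hat_form =
 fixes s ta :: real
 assumes s_range: "s : {-1<..<1}" and ta_pos: "ta > 0"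
begin

abbreviation "I == hat_int s ta"
abbreviation "rtW x == sqrt (hat_pot s ta x)"

lemma open_I: "open I" by (simp add: hat_int_def)

lemma I_bounds: "- ((1 + s) / ta) < (1 - s) / ta"
proof -
 have "- ((1 + s) / ta) < 0" "0 < (1 - s) / ta" using s_range ta_pos by simp_all
 then show ?thesis by linarith
qed

lemma hat_pot_measurable [measurable]: "hat_pot s ta : borel_measurable borel"
 unfolding hat_pot_def[abs_def] hat_gap_def[abs_def] side_def[abs_def] by measurable

lemma rtW_measurable: "rtW : borel_measurable (lebesgue_on I)"
proof -
 have "rtW : borel_measurable borel" by measurable
 then show ?thesis by (intro measurable_restrict_space1 measurable_completion) simp
qed

sublocale potential_form I "H10 I" rtW
proof
 show "open I" by (rule open_I)
 show "H10 I <= H1 I" using H10_H1 by blast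
 show "(%x. 0) : H10 I" by (rule test_function_H10[OF test_function_0 open_I])
 show "(%x. c * u x + d * v x) : H10 I" if "u : H10 I" "v : H10 I" for u v c d
  by (rule H10_lin[OF that open_I])
 show "rtW : borel_measurable (lebesgue_on I)" by (rule rtW_measurable)
 show "u : H10 I" if "u : H1 I" "!!n. v n : H10 I" "(%n. energy I (%x. v n x - u x)) ----> 0" for u v
  by (rule H10_closed[OF open_I that])
qed

lemma rtW_sq: "x : I ==> rtW x * rtW x = hat_pot s ta x"
 using hat_pot_pos[OF ta_pos, of x s] by simp

text \<open>The potential blows up like the inverse square of the distance to an endpoint. This
  constant, in which \<open>4\<close> bounds \<open>(side s x)^2\<close>, majorises it by the
  inverse squares to which Hardy's inequality applies.\<close>

definition "hardy_const = (4 * pi^2 / ta + (3 + 4 * pi^2) / 12 * ta^2) / ta^2"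

lemma hardy_const_nonneg: "hardy_const >= 0"
 using ta_pos by (auto simp: hardy_const_def intro!: divide_nonneg_nonneg add_nonneg_nonneg mult_nonneg_nonneg)

lemma hat_pot_le:
 assumes x: "x : I"
 shows "hat_pot s ta x <= hardy_const * (1 / (x - (- ((1 + s) / ta)))^2 + 1 / (x - (1 - s) / ta)^2)"
proof -
 note g = hat_gap_pos[OF ta_pos x]
 have s2: "(side s x)^2 <= 4"
 proof -
  have "side s x <= 2" using s_range by (auto simp: side_def)
  then have "(side s x)^2 <= 2^2" using g by (intro power_mono) auto
  then show ?thesis by simp
 qed
 have "hat_pot s ta x <= pi^2 / ta * ((side s x)^2 / (hat_gap s ta x)^2) + (3 + 4 * pi^2) / 12 * ta^2 / (hat_gap s ta x)^2"
  using ta_pos by (simp add: hat_pot_def right_diff_distrib)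
 also have "... = (pi^2 / ta * (side s x)^2 + (3 + 4 * pi^2) / 12 * ta^2) / (hat_gap s ta x)^2"
  by (simp add: add_divide_distrib)
 also have "... <= (pi^2 / ta * 4 + (3 + 4 * pi^2) / 12 * ta^2) / (hat_gap s ta x)^2"
  using s2 ta_pos by (intro divide_right_mono add_right_mono mult_left_mono) auto
 also have "... = hardy_const * (ta^2 / (hat_gap s ta x)^2)" using ta_pos by (simp add: hardy_const_def mult.commute)
 also have "ta^2 / (hat_gap s ta x)^2 <= 1 / (x - (- ((1 + s) / ta)))^2 + 1 / (x - (1 - s) / ta)^2"
 proof (cases "x <= 0")
  case True
  then have "hat_gap s ta x = ta * (x - (- ((1 + s) / ta)))" using ta_pos by (simp add: hat_gap_def side_def field_simps)
  then have "ta^2 / (hat_gap s ta x)^2 = 1 / (x - (- ((1 + s) / ta)))^2" using ta_pos by (simp add: power_mult_distrib)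
  then show ?thesis by simp
 next
  case False
  then have "hat_gap s ta x = - ta * (x - (1 - s) / ta)" using ta_pos by (simp add: hat_gap_def side_def field_simps)
  then have "ta^2 / (hat_gap s ta x)^2 = 1 / (x - (1 - s) / ta)^2" using ta_pos by (simp add: power_mult_distrib)
  then show ?thesis by simp
 qed
 finally show ?thesis using hardy_const_nonneg by (simp add: mult_left_mono)
qed

text \<open>The factor \<open>8\<close> is Hardy's constant \<open>4\<close> counted for both
  endpoints.\<close>

lemma weighted_test:
 assumes ph: "test_function I ph"
 shows "(%x. rtW x * ph x) : L2 I & L2_sq I (%x. rtW x * ph x) <= (8 * hardy_const) * energy I ph"
proof -
 let ?a = "- ((1 + s) / ta)" and ?b = "(1 - s) / ta"
 have ph': "test_function {?a<..<?b} ph" using ph by (simp add: hat_int_def)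
 obtain K where K: "compact K" "K <= I" "!!x. x ~: K ==> ph x = 0" using test_functionD[OF ph] by blast
 have z: "ph x = 0" if "x ~: I" for x using K(2) K(3)[of x] that by auto
 have m [measurable]: "ph : borel_measurable borel"
  using C_k_continuous[OF test_function_C_k[OF ph, of 0]] by (rule borel_measurable_continuous_onI)
 note ha = Hardy[OF ph' I_bounds, of ?a] and hb = Hardy[OF ph' I_bounds, of ?b]
 have le: "(rtW x * ph x)^2 <= hardy_const * ((ph x / (x - ?a))^2 + (ph x / (x - ?b))^2)" for x
 proof (cases "x : I")
  case True
  have "(rtW x * ph x)^2 = hat_pot s ta x * (ph x)^2" using rtW_sq[OF True] by (simp add: power2_eq_square mult_ac)
  also have "... <= hardy_const * (1 / (x - ?a)^2 + 1 / (x - ?b)^2) * (ph x)^2"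
   using hat_pot_le[OF True] by (intro mult_right_mono) auto
  finally show ?thesis by (simp add: power_divide distrib_right mult.assoc)
 next
  case False
  then show ?thesis using z[OF False] by simp
 qed
 have ih: "integrable lborel (%x. hardy_const * ((ph x / (x - ?a))^2 + (ph x / (x - ?b))^2))"
  using ha(1) hb(1) by simp
 have i: "integrable lborel (%x. (rtW x * ph x)^2)"
 proof (rule lebesgue_bound[OF ih])
  show "AE x in lborel. norm ((rtW x * ph x)^2) <= norm (hardy_const * ((ph x / (x - ?a))^2 + (ph x / (x - ?b))^2))"
  proof (rule always_eventually, rule allI)
   fix x
   have "norm ((rtW x * ph x)^2) = (rtW x * ph x)^2" by simp
   also have "... <= norm (hardy_const * ((ph x / (x - ?a))^2 + (ph x / (x - ?b))^2))"
    using order_trans[OF le[of x] abs_ge_self] by (simp only: real_norm_def)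
   finally show "norm ((rtW x * ph x)^2) <= norm (hardy_const * ((ph x / (x - ?a))^2 + (ph x / (x - ?b))^2))" .
  qed
 qed measurable
 have mw: "(%x. rtW x * ph x) : borel_measurable borel" by measurable
 have z2: "(rtW x * ph x)^2 = 0" if "x ~: I" for x using z[OF that] by simp
 have i': "integrable (lebesgue_on I) (%x. (rtW x * ph x)^2)"
  using i lebesgue_on_support(1)[OF open_sets_lebesgue[OF open_I] z2] mw by (simp add: lebesgue_lborel)
 have L: "(%x. rtW x * ph x) : L2 I"
  using i' mw by (auto simp: L2_def intro!: measurable_restrict_space1 measurable_completion)
 have "L2_sq I (%x. rtW x * ph x) = (LBINT x. (rtW x * ph x)^2)"
  unfolding L2_inner_def power2_eq_square[symmetric]
  using lebesgue_on_support(2)[OF open_sets_lebesgue[OF open_I] z2] mw by (simp add: lebesgue_lborel)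
 also have "... <= (LBINT x. hardy_const * ((ph x / (x - ?a))^2 + (ph x / (x - ?b))^2))"
  by (rule integral_mono[OF i ih le])
 also have "... = hardy_const * ((LBINT x. (ph x / (x - ?a))^2) + (LBINT x. (ph x / (x - ?b))^2))"
  using ha(1) hb(1) by simp
 also have "... <= hardy_const * (4 * (LBINT x. (pd ph 1 x)^2) + 4 * (LBINT x. (pd ph 1 x)^2))"
  using ha(2) hb(2) hardy_const_nonneg by (intro mult_left_mono add_mono) auto
 also have "... = 8 * hardy_const * grad_inner I ph ph"
  using test_function_inner(2)[OF open_I ph ph] by (simp add: power2_eq_square)
 also have "... <= 8 * hardy_const * energy I ph"
  using hardy_const_nonneg semi_inner.nonneg[OF semi_inner_L2 test_function_L2[OF ph open_I]]
  by (intro mult_left_mono) (auto simp: energy_def)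
 finally show ?thesis using L by blast
qed

lemma weighted_H10_I:
 assumes "u : H10 I"
 shows "(%x. rtW x * u x) : L2 I" "L2_sq I (%x. rtW x * u x) <= 8 * hardy_const * energy I u"
 using weighted_H10[OF open_I rtW_measurable _ weighted_test assms] hardy_const_nonneg by auto

text \<open>The problem is posed on all of \<open>H10\<close>, whereas \<open>fdom\<close> asks for
  finite potential energy; by Hardy's inequality the latter is automatic despite the singular
  endpoints.\<close>

lemma fdom_eq: "fdom = H10 I"
 using weighted_H10_I(1) by (auto simp: fdom_def)

lemma dense:
 assumes u: "u : fdom" and ep: "ep > 0"
 shows "EX ph:{ph. test_function I ph}. quad form (%x. ph x - u x) + L2_sq I (%x. ph x - u x) < ep"
proof -
 interpret E: semi_inner "H1 I" "%u v. L2_inner I u v + grad_inner I u v" by (rule semi_inner_energy[OF open_I])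
 define K where "K = 1 + 8 * hardy_const"
 have K: "K > 0" using hardy_const_nonneg by (simp add: K_def)
 have uH: "u : H10 I" using u fdom_eq by simp
 have "ep / K > 0" using ep K by simp
 then obtain ph where ph: "test_function I ph" "energy I (%x. u x - ph x) < ep / K"
  using uH unfolding H10_iff[OF open_I] by blast
 have phH: "ph : H10 I" by (rule test_function_H10[OF ph(1) open_I])
 have d: "(%x. ph x - u x) : H10 I" using H10_lin[OF phH uH open_I, of 1 "-1"] by simp
 have e: "energy I (%x. ph x - u x) < ep / K"
  using ph(2) E.sq_diff_commute[OF H10_H1[OF phH] H10_H1[OF uH]] by (simp add: energy_def)
 have "quad form (%x. ph x - u x) + L2_sq I (%x. ph x - u x) <= K * energy I (%x. ph x - u x)"
  using weighted_H10_I(2)[OF d] by (simp add: form_def energy_def K_def algebra_simps)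
 also have "... < ep" using e K by (simp add: field_simps)
 finally show ?thesis using ph(1) by blast
qed

text \<open>A test function extended by zero lives on the line, where
  \<open>Poincare_partition\<close> applies with cells that exactly fill the interval; density
  covers the remaining functions.\<close>

lemma Ehrling:
 assumes ep: "ep > 0"
 shows "EX N w. (ALL j<N. w j : L2 I) &
     (ALL u:fdom. L2_inner I u u <= ep * (form u u + L2_inner I u u) + (\<Sum>j<(N::nat). (L2_inner I (w j) u)^2))"
proof -
 define A where "A = - ((1 + s) / ta)"
 define l where "l = (1 - s) / ta - A"
 have l: "l > 0" using I_bounds by (simp add: l_def A_def)
 obtain N0 :: nat where N0: "real N0 > l / sqrt ep" using reals_Archimedean2 by blast
 define N where "N = Suc N0"
 define de where "de = l / real N"
 have de: "de > 0" using l by (simp add: de_def N_def)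
 have AN: "A + real N * de = (1 - s) / ta" by (simp add: de_def N_def l_def)
 then have I_eq: "{A<..<A + real N * de} = I" by (simp add: hat_int_def A_def)
 have "l / sqrt ep < real N" using N0 by (simp add: N_def)
 then have "de < sqrt ep" using ep by (simp add: de_def N_def field_simps)
 then have deep: "de^2 <= ep" using de ep by (metis less_imp_le power_mono real_sqrt_pow2)
 have test: "L2_inner I ph ph <= ep * energy I ph + (\<Sum>j<N. (L2_inner I (cell_weight A de j) ph)^2)" if ph: "test_function I ph" for ph
 proof -
  have phU: "test_function UNIV ph" by (rule test_function_mono[OF ph]) simp
  obtain K where K: "compact K" "K <= I" "!!x. x ~: K ==> ph x = 0" using test_functionD[OF ph] by blast
  have z: "ph x = 0" if "x ~: I" for x using K(2) K(3)[of x] that by auto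
  have dt: "test_function UNIV (pd ph 1)" by (rule test_function_partial_deriv[OF phU]) simp
  have one: "(1::real) : Basis" by simp
  have P: "(LINT x|lebesgue. indicator I x * (ph x)^2) <= de^2 * L2_sq UNIV (pd ph 1)
    + (\<Sum>j<N. (L2_inner UNIV (cell_weight A de j) ph)^2)"
   using Poincare_partition[OF de test_function_H1(2)[OF phU open_UNIV one] test_function_L2[OF phU open_UNIV] test_function_L2[OF dt open_UNIV], of A N]
   unfolding I_eq cell_weight_sq[OF de] .
  have "L2_inner I ph ph = (LINT x|lebesgue. indicator I x * (ph x)^2)"
   unfolding L2_inner_def by (subst integral_restrict_space) (auto simp: open_sets_lebesgue[OF open_I] power2_eq_square)
  also note P
  also have "L2_sq UNIV (pd ph 1) = grad_inner I ph ph"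
   using test_function_inner(2)[OF open_I ph ph] test_function_inner(1)[OF open_UNIV dt dt] by simp
  also have "(\<Sum>j<N. (L2_inner UNIV (cell_weight A de j) ph)^2) = (\<Sum>j<N. (L2_inner I (cell_weight A de j) ph)^2)"
  proof (intro sum.cong refl arg_cong[where f = "%x. x^2"])
   fix j
   have "cell_weight A de j x * ph x = 0" if "x ~: I" for x using z[OF that] by simp
   then show "L2_inner UNIV (cell_weight A de j) ph = L2_inner I (cell_weight A de j) ph"
    unfolding L2_inner_def lebesgue_on_UNIV_eq
    using lebesgue_on_support(2)[OF open_sets_lebesgue[OF open_I], of "%x. cell_weight A de j x * ph x"] by simp
  qed
  finally have "L2_inner I ph ph <= de^2 * grad_inner I ph ph + (\<Sum>j<N. (L2_inner I (cell_weight A de j) ph)^2)" .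
  moreover have "de^2 * grad_inner I ph ph <= ep * energy I ph"
   using deep ep semi_inner.nonneg[OF semi_inner_H1[OF open_I] test_function_H1(1)[OF ph open_I]]
    semi_inner.nonneg[OF semi_inner_L2 test_function_L2[OF ph open_I]]
   by (intro mult_mono) (auto simp: energy_def)
  ultimately show ?thesis by simp
 qed
 have "L2_inner I u u <= ep * (form u u + L2_inner I u u) + (\<Sum>j<N. (L2_inner I (cell_weight A de j) u)^2)" if u: "u : fdom" for u
 proof -
  have "L2_inner I u u <= ep * energy I u + (\<Sum>j<N. (L2_inner I (cell_weight A de j) u)^2)"
   by (rule Ehrling_extend[OF open_I cell_weight_L2[OF open_I] test]) (use u fdom_eq in auto)
  moreover have "ep * energy I u <= ep * (form u u + L2_inner I u u)"
   using S.nonneg[OF u] ep by (intro mult_left_mono) (auto simp: energy_def form_def)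
  ultimately show ?thesis by simp
 qed
 then show ?thesis using cell_weight_L2[OF open_I] by blast
qed

sublocale spectral I fdom form
proof (rule spectral_form)
 have "0 : I" using s_range ta_pos by (simp add: hat_int_def)
 then show "I ~= {}" by blast
 show "ph : fdom" if "test_function I ph" for ph
  unfolding fdom_eq by (rule test_function_H10[OF that open_I])
 have "rtW x ~= 0" if "x : I" for x using hat_pot_pos[OF ta_pos that] by simp
 then show "AE x in lebesgue_on I. rtW x ~= 0" by (intro AE_I2) (auto simp: space_restrict_space)
qed (use Ehrling in auto)

end

lemma mu_hat_eq:
 assumes sr: "s : {-1<..<1}" and t: "t > 0"
 shows "mu_hat s t k = kth_eigenvalue (hat_int s (t powr (2/3))) (potential_form.fdom (hat_int s (t powr (2/3))) (H10 (hat_int s (t powr (2/3)))) (%x. sqrt (hat_pot s (t powr (2/3)) x)))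
   (potential_form.form (hat_int s (t powr (2/3))) (%x. sqrt (hat_pot s (t powr (2/3)) x))) k"
proof -
 interpret hat_form s "t powr (2/3)" using sr t by unfold_locales auto
 have "(LINT x|lebesgue_on I. V_hat s t x * u x * v x) = L2_inner I (%x. rtW x * u x) (%x. rtW x * v x)" for u v
  unfolding L2_inner_def
 proof (rule integral_lebesgue_on_cong_AE[OF open_I])
  have "AE x in lebesgue_on I. V_hat s t x = hat_pot s (t powr (2/3)) x"
   using V_hat_AE[OF sr t] by (subst AE_restrict_space_iff) (auto simp: open_sets_lebesgue[OF open_I])
  then show "AE x in lebesgue_on I. V_hat s t x * u x * v x = rtW x * u x * (rtW x * v x)"
  proof (rule AE_mp, intro AE_I2 impI)
   fix x assume "x : space (lebesgue_on I)" "V_hat s t x = hat_pot s (t powr (2/3)) x"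
   then show "V_hat s t x * u x * v x = rtW x * u x * (rtW x * v x)"
    using rtW_sq[of x] by (simp add: space_restrict_space mult_ac)
  qed
 qed
 then have "form = (%u v. grad_inner I u v + (LINT x|lebesgue_on I. V_hat s t x * u x * v x))"
  by (simp add: fun_eq_iff form_def)
 then show ?thesis unfolding mu_hat_def I_int_eq[OF t] fdom_eq by simp
qed

subsection \<open>Functions on the triangle\<close>

lemma sum_Basis_plane: "(\<Sum>i\<in>(Basis :: (real \<times> real) set). f i) = f (1, 0) + f (0, 1)"
proof -
 have "(Basis :: (real \<times> real) set) = {(1, 0), (0, 1)}" by (auto simp: Basis_prod_def)
 moreover have "(\<Sum>i\<in>{(1, 0), (0, 1 :: real)}. f i) = f (1 :: real, 0) + f (0, 1)" by simp
 ultimately show ?thesis by (simp only:)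
qed

text \<open>The hull is an intersection of three closed half-planes, whose interiors are the open
  ones. For the inclusion of the half-planes, the barycentric coordinates are solved for, starting
  with the weight \<open>y / t\<close> of the apex.\<close>

lemma triangle_eq:
 assumes s: "s : {-1<..<1}" and t: "t > 0"
 shows "triangle s t = {z. 0 < snd z & snd z < t / (1 + s) * (fst z + 1) & snd z < t / (1 - s) * (1 - fst z)}"
proof -
 define p where "p = t / (1 + s)"
 define q where "q = t / (1 - s)"
 have pt: "p * (1 + s) = t" "q * (1 - s) = t" using s by (auto simp: p_def q_def)
 have pq: "p > 0" "q > 0" using s t by (auto simp: p_def q_def)
 define H1 :: "(real \<times> real) set" where "H1 = {z. (0, -1) \<bullet> z <= 0}"
 define H2 :: "(real \<times> real) set" where "H2 = {z. (-p, 1) \<bullet> z <= p}"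
 define H3 :: "(real \<times> real) set" where "H3 = {z. (q, 1) \<bullet> z <= q}"
 have "convex hull {(-1, 0), (1, 0), (s, t)} = H1 \<inter> H2 \<inter> H3"
 proof (intro equalityI subsetI)
  fix z assume "z : convex hull {(-1, 0), (1, 0), (s, t)}"
  then obtain u v w where uvw: "0 <= u" "0 <= v" "0 <= w" "u + v + w = 1"
   and z: "z = u *\<^sub>R (-1, 0) + v *\<^sub>R (1, 0) + w *\<^sub>R (s, t)" unfolding convex_hull_3 by blast
  have "p * (fst z + 1) - snd z = p * (2 * v) + w * (p * (1 + s) - t)"
  proof -
   have "fst z + 1 = 2 * v + w * (1 + s)" using uvw(4) by (simp add: z algebra_simps)
   moreover have "snd z = w * t" by (simp add: z)
   ultimately show ?thesis by (simp only: distrib_left right_diff_distrib) (simp add: algebra_simps)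
  qed
  then have "p * (fst z + 1) - snd z = p * (2 * v)" using pt by simp
  moreover have "0 <= p * (2 * v)" using pq uvw by simp
  ultimately have 2: "snd z <= p * (fst z + 1)" by linarith
  have "q * (1 - fst z) - snd z = q * (2 * u) + w * (q * (1 - s) - t)"
  proof -
   have "1 - fst z = 2 * u + w * (1 - s)" using uvw(4) by (simp add: z algebra_simps)
   moreover have "snd z = w * t" by (simp add: z)
   ultimately show ?thesis by (simp only: distrib_left right_diff_distrib) (simp add: algebra_simps)
  qed
  then have "q * (1 - fst z) - snd z = q * (2 * u)" using pt by simp
  moreover have "0 <= q * (2 * u)" using pq uvw by simp
  ultimately have 3: "snd z <= q * (1 - fst z)" by linarith
  have "0 <= snd z" using uvw t by (simp add: z)
  then show "z : H1 \<inter> H2 \<inter> H3" using 2 3 by (cases z) (auto simp: H1_def H2_def H3_def algebra_simps)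
 next
  fix z assume "z : H1 \<inter> H2 \<inter> H3"
  then obtain x y where z: "z = (x, y)" and h: "0 <= y" "y <= p * (x + 1)" "y <= q * (1 - x)"
   by (cases z) (auto simp: H1_def H2_def H3_def algebra_simps)
  define w where "w = y / t"
  define v where "v = (x + 1 - w * (1 + s)) / 2"
  define u where "u = (1 - x - w * (1 - s)) / 2"
  have wa: "w * (1 + s) <= x + 1"
  proof -
   have "w * (1 + s) = y / p" using s t by (simp add: w_def p_def)
   also have "... <= x + 1" using h pq by (simp add: field_simps)
   finally show ?thesis .
  qed
  have wb: "w * (1 - s) <= 1 - x"
  proof -
   have "w * (1 - s) = y / q" using s t by (simp add: w_def q_def)
   also have "... <= 1 - x" using h pq by (simp add: field_simps)
   finally show ?thesis .
  qed
  have "0 <= u" "0 <= v" using wa wb by (simp_all add: u_def v_def)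
  moreover have "w >= 0" using h t by (simp add: w_def)
  moreover have "u + v + w = 1" by (simp add: u_def v_def algebra_simps) (simp add: field_simps)
  moreover have "z = u *\<^sub>R (-1, 0) + v *\<^sub>R (1, 0) + w *\<^sub>R (s, t)"
   using t by (simp add: z u_def v_def w_def) (simp add: field_simps)
  ultimately show "z : convex hull {(-1, 0), (1, 0), (s, t)}" unfolding convex_hull_3 by blast
 qed
 then have "triangle s t = interior H1 \<inter> interior H2 \<inter> interior H3" by (simp add: triangle_def)
 also have "... = {z. (0, -1) \<bullet> z < 0} \<inter> {z. (-p, 1) \<bullet> z < p} \<inter> {z. (q, 1) \<bullet> z < q}"
  unfolding H1_def H2_def H3_def by (subst (1 2 3) interior_halfspace_le) (auto simp: zero_prod_def)
 also have "... = {z. 0 < snd z & snd z < p * (fst z + 1) & snd z < q * (1 - fst z)}"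
  by (auto simp: inner_prod_def algebra_simps)
 finally show ?thesis by (simp add: p_def q_def)
qed

lemma open_triangle: "open (triangle s t)"
 by (simp add: triangle_def)

lemma triangle_bounds:
 assumes "s : {-1<..<1}" "t > 0" "(x, y) : triangle s t"
 shows "0 < y" "y < height s t x" "-1 < x" "x < 1" "height s t x <= t"
proof -
 have h: "0 < y" "y < t / (1 + s) * (x + 1)" "y < t / (1 - s) * (1 - x)"
  using assms(3) unfolding triangle_eq[OF assms(1,2)] by auto
 then show "0 < y" "y < height s t x" by (auto simp: height_eq_min[OF assms(1,2)])
 have "0 < t / (1 + s) * (x + 1)" "0 < t / (1 - s) * (1 - x)" using h by linarith+
 then show x: "-1 < x" "x < 1" using assms by (auto simp: zero_less_mult_iff zero_less_divide_iff)
 show "height s t x <= t"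
 proof (cases "x <= s")
  case True
  have "t / (1 + s) * (x + 1) <= t / (1 + s) * (1 + s)" using True assms by (intro mult_left_mono) auto
  then show ?thesis using True assms by (simp add: height_def)
 next
  case False
  have "t / (1 - s) * (1 - x) <= t / (1 - s) * (1 - s)" using False assms by (intro mult_left_mono) auto
  then show ?thesis using False assms by (simp add: height_eq_min)
 qed
qed

lemma triangle_nonempty:
 assumes "s : {-1<..<1}" "t > 0"
 shows "(s, t / 2) : triangle s t"
proof -
 have e: "t / (1 + s) * (s + 1) = t" "t / (1 - s) * (1 - s) = t" using assms by (auto simp: field_simps)
 show ?thesis unfolding triangle_eq[OF assms] mem_Collect_eq fst_conv snd_conv e using assms(2) by simp
qed

lemma plane_slices:
 fixes k :: "real \<times> real => real"
 assumes c: "continuous_on UNIV k" and K: "compact K" "!!p. p ~: K ==> k p = 0"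
 shows "integrable lborel (%y. k (x, y))" "integrable lborel (%x. k (x, y))"
  "integrable lborel (%x. LBINT y. k (x, y))" "integrable lborel (%y. LBINT x. k (x, y))"
  "integral\<^sup>L lborel k = (LBINT x. LBINT y. k (x, y))"
  "integral\<^sup>L lborel k = (LBINT y. LBINT x. k (x, y))"
proof -
 have s1: "compact (snd ` K)" "compact (fst ` K)" using K(1) by (auto intro!: compact_continuous_image continuous_intros)
 show "integrable lborel (%y. k (x, y))"
 proof (rule continuous_compact_support[OF _ s1(1)])
  show "continuous_on UNIV (%y. k (x, y))" by (rule continuous_on_compose2[OF c]) (auto intro!: continuous_intros)
  show "k (x, y) = 0" if "y ~: snd ` K" for y using that by (intro K(2)) force
 qed
 show "integrable lborel (%x. k (x, y))"
 proof (rule continuous_compact_support[OF _ s1(2)])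
  show "continuous_on UNIV (%x. k (x, y))" by (rule continuous_on_compose2[OF c]) (auto intro!: continuous_intros)
  show "k (x, y) = 0" if "x ~: fst ` K" for x using that by (intro K(2)) force
 qed
 have "integrable lborel k" by (rule continuous_compact_support[OF c K])
 then have i: "integrable (lborel \<Otimes>\<^sub>M lborel) k" by (simp add: lborel_prod)
 then have i': "integrable (lborel \<Otimes>\<^sub>M lborel) (case_prod (%x y. k (x, y)))" by (simp add: case_prod_unfold)
 show "integrable lborel (%x. LBINT y. k (x, y))" by (rule lborel_pair.integrable_fst'[OF i])
 show "integral\<^sup>L lborel k = (LBINT x. LBINT y. k (x, y))"
  using lborel_pair.integral_fst'[OF i] by (simp add: lborel_prod)
 also have "... = (LBINT y. LBINT x. k (x, y))"
  by (rule lborel_pair.Fubini_integral[OF i', symmetric])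
 finally show "integral\<^sup>L lborel k = (LBINT y. LBINT x. k (x, y))" .
 have "integrable (lborel \<Otimes>\<^sub>M lborel) (%p. k (snd p, fst p))"
  using lborel_pair.integrable_product_swap[OF i] by (simp add: case_prod_unfold)
 from lborel_pair.integrable_fst'[OF this] show "integrable lborel (%y. LBINT x. k (x, y))" by simp
qed

lemma test_function_slice:
 fixes ph :: "real \<times> real => real"
 assumes ph: "test_function UNIV ph"
 shows "test_function UNIV (%x. ph (x, y))" "pd (%x. ph (x, y)) 1 x = pd ph (1, 0) (x, y)"
  "test_function UNIV (%y. ph (x, y))" "pd (%y. ph (x, y)) 1 y = pd ph (0, 1) (x, y)"
proof -
 obtain K where K: "compact K" "K <= UNIV" "!!p. p ~: K ==> ph p = 0" using test_functionD[OF ph] by blast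
 have s1: "compact (snd ` K)" "compact (fst ` K)" using K(1) by (auto intro!: compact_continuous_image continuous_intros)
 have b1: "bounded_linear (%x::real. (x, 0::real))" and b2: "bounded_linear (%y::real. (0::real, y))"
  by (auto intro!: bounded_linear_Pair bounded_linear_ident bounded_linear_zero)
 show "test_function UNIV (%x. ph (x, y))"
 proof (rule test_functionI[OF _ s1(2) subset_UNIV])
  show "C_k n (%x. ph (x, y))" for n using C_k_compose_affine[OF b1 test_function_C_k[OF ph], of n "(0, y)"] by simp
  show "ph (x, y) = 0" if "x ~: fst ` K" for x using that by (intro K(3)) force
 qed
 show "test_function UNIV (%y. ph (x, y))"
 proof (rule test_functionI[OF _ s1(1) subset_UNIV])
  show "C_k n (%y. ph (x, y))" for n using C_k_compose_affine[OF b2 test_function_C_k[OF ph], of n "(x, 0)"] by simp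
  show "ph (x, y) = 0" if "y ~: snd ` K" for y using that by (intro K(3)) force
 qed
 show "pd (%x. ph (x, y)) 1 x = pd ph (1, 0) (x, y)"
  by (rule partial_deriv_real) (use DERIV_along_line[OF test_function_C_k[OF ph, of "Suc 0"], of "(0, y)" "(1, 0)" x] in simp)
 show "pd (%y. ph (x, y)) 1 y = pd ph (0, 1) (x, y)"
  by (rule partial_deriv_real) (use DERIV_along_line[OF test_function_C_k[OF ph, of "Suc 0"], of "(x, 0)" "(0, 1)" y] in simp)
qed

text \<open>Lets \<open>weighted_slice\<close>, which averages over the second variable, also
  average over the first.\<close>

lemma test_function_swap:
 fixes ph :: "real \<times> real => real"
 assumes ph: "test_function UNIV ph"
 shows "test_function UNIV (%p. ph (snd p, fst p))"
  "pd (%p. ph (snd p, fst p)) (1, 0) (y, x) = pd ph (0, 1) (x, y)"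
proof -
 obtain K where K: "compact K" "K <= UNIV" "!!p. p ~: K ==> ph p = 0" using test_functionD[OF ph] by blast
 have b: "bounded_linear (%p::real\<times>real. (snd p, fst p))"
  by (intro bounded_linear_Pair bounded_linear_fst bounded_linear_snd)
 show T: "test_function UNIV (%p. ph (snd p, fst p))"
 proof (rule test_functionI)
  show "C_k n (%p. ph (snd p, fst p))" for n using C_k_compose_affine[OF b test_function_C_k[OF ph], of n 0] by simp
  show "compact ((%p. (snd p, fst p)) ` K)" using K(1) by (intro compact_continuous_image continuous_intros)
  show "ph (snd p, fst p) = 0" if "p ~: (%p. (snd p, fst p)) ` K" for p
   using that by (intro K(3)) (metis (no_types, lifting) fst_conv image_eqI prod.collapse snd_conv)
 qed simp
 have "pd (%y. ph (x, y)) 1 y = pd (%p. ph (snd p, fst p)) (1, 0) (y, x)"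
  using test_function_slice(2)[OF T, of x y] by simp
 then show "pd (%p. ph (snd p, fst p)) (1, 0) (y, x) = pd ph (0, 1) (x, y)"
  using test_function_slice(4)[OF ph, of x y] by simp
qed

lemma lborel_Cauchy_Schwarz:
 fixes f g :: "'a::euclidean_space => real"
 assumes "f : borel_measurable borel" "g : borel_measurable borel" "integrable lborel (%x. (f x)^2)" "integrable lborel (%x. (g x)^2)"
 shows "(LBINT x. f x * g x)^2 <= (LBINT x. (f x)^2) * (LBINT x. (g x)^2)"
proof -
 have L: "f : L2 UNIV" "g : L2 UNIV"
  using assms by (auto simp: L2_def lebesgue_on_UNIV_eq lebesgue_lborel intro!: measurable_completion)
 have e: "L2_inner UNIV h j = (LBINT x. h x * j x)" if "h : borel_measurable borel" "j : borel_measurable borel" for h j :: "'a => real"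
  unfolding L2_inner_def lebesgue_on_UNIV_eq using that by (intro lebesgue_lborel(2)) simp
 show ?thesis using semi_inner.Cauchy_Schwarz[OF semi_inner_L2 L] assms(1,2) by (simp add: e power2_eq_square)
qed

lemma borel_L2:
 fixes f :: "'a::euclidean_space => real"
 assumes "f : borel_measurable borel" "integrable lborel (%x. (f x)^2)"
 shows "f : L2 UNIV" "L2_inner UNIV f f = (LBINT x. (f x)^2)"
proof -
 show "f : L2 UNIV"
  using assms by (auto simp: L2_def lebesgue_on_UNIV_eq lebesgue_lborel intro!: measurable_completion)
 show "L2_inner UNIV f f = (LBINT x. (f x)^2)"
  unfolding L2_inner_def lebesgue_on_UNIV_eq power2_eq_square using assms(1) by (intro lebesgue_lborel(2)) simp
qed

text \<open>The weight is merely square integrable, so the average is differentiated in the weak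
  sense: Fubini reduces this to integration by parts on each line parallel to the first axis.
  Cauchy-Schwarz on the fibre gives the pointwise bounds.\<close>

lemma weighted_slice:
 fixes ph :: "real \<times> real => real" and w :: "real => real"
 assumes ph: "test_function UNIV ph" and w: "w : borel_measurable borel" "integrable lborel (%y. (w y)^2)"
 defines "m == %x. LBINT y. ph (x, y) * w y"
 defines "m' == %x. LBINT y. pd ph (1, 0) (x, y) * w y"
 shows "m : borel_measurable borel" "integrable lborel (%x. (m x)^2)"
  "(m x)^2 <= (LBINT y. (ph (x, y))^2) * (LBINT y. (w y)^2)"
  "m' : borel_measurable borel" "integrable lborel (%x. (m' x)^2)"
  "(m' x)^2 <= (LBINT y. (pd ph (1, 0) (x, y))^2) * (LBINT y. (w y)^2)"
  "has_weak_deriv UNIV m 1 m'" "EX K. compact K & (ALL x. x ~: K --> m x = 0)"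
proof -
 have d: "test_function UNIV (pd ph (1, 0))" by (rule test_function_partial_deriv[OF ph]) (simp add: Basis_prod_def)
 have main: "(%x. LBINT y. ps (x, y) * w y) : borel_measurable borel"
   "integrable lborel (%x. (LBINT y. ps (x, y) * w y)^2)"
   "(LBINT y. ps (x, y) * w y)^2 <= (LBINT y. (ps (x, y))^2) * (LBINT y. (w y)^2)"
   "integrable (lborel \<Otimes>\<^sub>M lborel) (%p. ps p * w (snd p) * ze (fst p))"
  if ps: "test_function UNIV ps" and ze: "continuous_on UNIV ze" for ps :: "real \<times> real => real" and ze x
 proof -
  obtain K where K: "compact K" "K <= UNIV" "!!p. p ~: K ==> ps p = 0" using test_functionD[OF ps] by blast
  have c: "continuous_on UNIV ps" using C_k_continuous[OF test_function_C_k[OF ps, of 0]] .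
  have c2: "continuous_on UNIV (%p. (ps p)^2)" by (intro continuous_intros c)
  have z2: "(ps p)^2 = 0" if "p ~: K" for p using K(3)[OF that] by simp
  have mm [measurable]: "ps : borel_measurable borel" using c by (rule borel_measurable_continuous_onI)
  have mm2 [measurable]: "ps : borel_measurable (lborel \<Otimes>\<^sub>M lborel)" by (simp add: lborel_prod)
  note w(1) [measurable]
  have zem [measurable]: "ze : borel_measurable borel" using ze by (rule borel_measurable_continuous_onI)
  have ms: "(%y. ps (x, y)) : borel_measurable borel" for x by measurable
  show m1: "(%x. LBINT y. ps (x, y) * w y) : borel_measurable borel"
  proof -
   have "(%p. ps p * w (snd p)) : borel_measurable (lborel \<Otimes>\<^sub>M lborel)" by measurable
   then have "(%x. LBINT y. ps (x, y) * w (snd (x, y))) : borel_measurable lborel"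
    by (intro lborel.borel_measurable_lebesgue_integral) (simp add: case_prod_unfold)
   then show ?thesis by simp
  qed
  show CS: "(LBINT y. ps (x, y) * w y)^2 <= (LBINT y. (ps (x, y))^2) * (LBINT y. (w y)^2)" for x
   by (rule lborel_Cauchy_Schwarz[OF ms w(1) plane_slices(1)[OF c2 K(1) z2] w(2)])
  show "integrable lborel (%x. (LBINT y. ps (x, y) * w y)^2)"
  proof (rule lebesgue_bound)
   show "integrable lborel (%x. (LBINT y. (ps (x, y))^2) * (LBINT y. (w y)^2))"
    using plane_slices(3)[OF c2 K(1) z2] by simp
   show "AE x in lborel. norm ((LBINT y. ps (x, y) * w y)^2) <= norm ((LBINT y. (ps (x, y))^2) * (LBINT y. (w y)^2))"
    using order_trans[OF CS abs_ge_self] by (intro always_eventually allI) (simp only: real_norm_def abs_power2)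
  qed (use m1 in measurable)
  show "integrable (lborel \<Otimes>\<^sub>M lborel) (%p. ps p * w (snd p) * ze (fst p))"
  proof -
   \<comment> \<open>The weight depends on one variable only and need not be square integrable on
     the plane. Inserting the indicator of \<open>K\<close>, harmless next to \<open>ps\<close>,
     splits the integrand into two square integrable factors.\<close>
   have "integrable (lborel \<Otimes>\<^sub>M lborel) (%p. (ps p * ze (fst p)) * (indicator K p * w (snd p)))"
   proof (rule square_integrable_mult)
    have "integrable lborel (%p. (ps p * ze (fst p))^2)"
     by (rule continuous_compact_support[OF _ K(1)])
      (auto intro!: continuous_intros c continuous_on_compose2[OF ze] simp: K(3))
    then show "integrable (lborel \<Otimes>\<^sub>M lborel) (%p. (ps p * ze (fst p))^2)" by (simp add: lborel_prod)
    have "K : sets lborel" using K(1) by (simp add: borel_compact)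
    then have Km: "K : sets (lborel \<Otimes>\<^sub>M lborel)" by (simp only: lborel_prod)
    then show mK: "(%p. indicator K p * w (snd p)) : borel_measurable (lborel \<Otimes>\<^sub>M lborel)" by measurable
    have "compact (fst ` K)" using K(1) by (auto intro!: compact_continuous_image continuous_intros)
    then have "integrable lborel (%x. indicator (fst ` K) x :: real)"
     using emeasure_bounded_finite[of "fst ` K"] by (intro integrable_real_indicator) (auto simp: compact_imp_bounded borel_compact)
    then have "integrable (lborel \<Otimes>\<^sub>M lborel) (%p. 1 * (indicator (fst ` K) (fst p) * (w (snd p))^2) :: real)"
     using w(2) by (intro integrable_kernel_product) auto
    then show "integrable (lborel \<Otimes>\<^sub>M lborel) (%p. (indicator K p * w (snd p))^2)"
    proof (rule lebesgue_bound)
     show "AE p in lborel \<Otimes>\<^sub>M lborel. norm ((indicator K p * w (snd p))^2) <= norm (1 * (indicator (fst ` K) (fst p) * (w (snd p))^2))"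
      by (intro always_eventually allI) (auto split: split_indicator)
    qed (use mK in measurable)
   qed measurable
   moreover have "(%p. (ps p * ze (fst p)) * (indicator K p * w (snd p))) = (%p. ps p * w (snd p) * ze (fst p))"
    using K(3) by (auto simp: fun_eq_iff split: split_indicator)
   ultimately show ?thesis by (simp only:)
  qed
 qed
 have c1: "continuous_on UNIV (%x::real. 1::real)" by simp
 show mm: "m : borel_measurable borel" and mi: "integrable lborel (%x. (m x)^2)"
  and "(m x)^2 <= (LBINT y. (ph (x, y))^2) * (LBINT y. (w y)^2)"
  unfolding m_def by (rule main[OF ph c1])+
 show mm': "m' : borel_measurable borel" and mi': "integrable lborel (%x. (m' x)^2)"
  and "(m' x)^2 <= (LBINT y. (pd ph (1, 0) (x, y))^2) * (LBINT y. (w y)^2)"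
  unfolding m'_def by (rule main[OF d c1])+
 show "EX K. compact K & (ALL x. x ~: K --> m x = 0)"
 proof -
  obtain K where K: "compact K" "K <= UNIV" "!!p. p ~: K ==> ph p = 0" using test_functionD[OF ph] by blast
  have "m x = 0" if "x ~: fst ` K" for x
  proof -
   have "ph (x, y) = 0" for y using that by (intro K(3)) force
   then show ?thesis by (simp add: m_def)
  qed
  moreover have "compact (fst ` K)" using K(1) by (auto intro!: compact_continuous_image continuous_intros)
  ultimately show ?thesis by blast
 qed
 show "has_weak_deriv UNIV m 1 m'"
  unfolding has_weak_deriv_def
 proof (intro conjI allI impI)
  show "locally_integrable UNIV m" by (rule L2_locally_integrable[OF borel_L2(1)[OF mm mi] open_UNIV])
  show "locally_integrable UNIV m'" by (rule L2_locally_integrable[OF borel_L2(1)[OF mm' mi'] open_UNIV])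
  fix ze :: "real => real" assume ze: "test_function UNIV ze"
  have dze: "test_function UNIV (pd ze 1)" by (rule test_function_partial_deriv[OF ze]) simp
  have cze: "continuous_on UNIV ze" "continuous_on UNIV (pd ze 1)"
   using C_k_continuous[OF test_function_C_k[OF ze, of 0]] C_k_continuous[OF test_function_C_k[OF dze, of 0]] .
  have [measurable]: "ze : borel_measurable borel" "pd ze 1 : borel_measurable borel"
   using cze by (auto intro: borel_measurable_continuous_onI)
  have I1: "integrable (lborel \<Otimes>\<^sub>M lborel) (case_prod (%x y. ph (x, y) * w y * pd ze 1 x))"
   using main(4)[OF ph cze(2)] by (simp add: case_prod_unfold)
  have I2: "integrable (lborel \<Otimes>\<^sub>M lborel) (case_prod (%x y. pd ph (1, 0) (x, y) * w y * ze x))"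
   using main(4)[OF d cze(1)] by (simp add: case_prod_unfold)
  have "(LBINT x. m x * pd ze 1 x) = (LBINT x. LBINT y. ph (x, y) * w y * pd ze 1 x)"
   unfolding m_def by simp
  also have "... = (LBINT y. LBINT x. ph (x, y) * w y * pd ze 1 x)"
   by (rule lborel_pair.Fubini_integral[OF I1, symmetric])
  also have "... = (LBINT y. - (LBINT x. pd ph (1, 0) (x, y) * w y * ze x))"
  proof (rule lebesgue_cong[OF refl])
   fix y
   have "C_k 1 (%x. ph (x, y))" by (rule test_function_C_k[OF test_function_slice(1)[OF ph]])
   then have "(LBINT x. ph (x, y) * pd ze 1 x) = - (LBINT x. pd (%x. ph (x, y)) 1 x * ze x)"
    by (rule integration_by_parts_test[OF _ ze]) simp
   then have "w y * (LBINT x. ph (x, y) * pd ze 1 x) = - (w y * (LBINT x. pd ph (1, 0) (x, y) * ze x))"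
    by (simp add: test_function_slice(2)[OF ph])
   moreover have "(LBINT x. ph (x, y) * w y * pd ze 1 x) = w y * (LBINT x. ph (x, y) * pd ze 1 x)"
    by (simp add: mult_ac flip: integral_mult_right_zero)
   moreover have "(LBINT x. pd ph (1, 0) (x, y) * w y * ze x) = w y * (LBINT x. pd ph (1, 0) (x, y) * ze x)"
    by (simp add: mult_ac flip: integral_mult_right_zero)
   ultimately show "(LBINT x. ph (x, y) * w y * pd ze 1 x) = - (LBINT x. pd ph (1, 0) (x, y) * w y * ze x)"
    by simp
  qed
  also have "... = - (LBINT x. LBINT y. pd ph (1, 0) (x, y) * w y * ze x)"
   using lborel_pair.Fubini_integral[OF I2] by simp
  also have "... = - (LBINT x. m' x * ze x)" unfolding m'_def by simp
  finally have "(LBINT x. m x * pd ze 1 x) = - (LBINT x. m' x * ze x)" .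
  then show "(LINT x|lebesgue_on UNIV. m x * pd ze 1 x) = - (LINT x|lebesgue_on UNIV. m' x * ze x)"
   using mm mm' by (simp add: lebesgue_on_UNIV_eq lebesgue_lborel)
 qed
qed

subsection \<open>Dirichlet modes on a fibre\<close>

text \<open>Jacobi's factorisation: \<open>f'\<^sup>2 - k\<^sup>2 f\<^sup>2 = (f' - k cot(k y) f)\<^sup>2 + (k cot(k y) f\<^sup>2)'\<close>.\<close>

lemma fiber_ground_identity:
 assumes f: "test_function {0<..<h} f" and h: "h > 0"
 defines "k == pi / h"
 shows "EX al bet. 0 < al & al < bet & bet < h & (ALL y. y ~: {al<..<bet} --> f y = 0) &
  integrable lborel (%y. (pd f 1 y - k * cos (k * y) * f y / sin (k * y))^2 * indicator {al..bet} y) &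
  (LBINT y. (pd f 1 y)^2) - k^2 * (LBINT y. (f y)^2)
   = (LBINT y. (pd f 1 y - k * cos (k * y) * f y / sin (k * y))^2 * indicator {al..bet} y)"
proof -
 let ?d = "pd f 1"
 obtain al bet where albet: "0 < al" "al < bet" "bet < h" and z: "!!y. y ~: {al<..<bet} ==> f y = 0"
  using test_function_interval_support[OF f h] by blast
 have dt: "test_function {0<..<h} ?d" by (rule test_function_partial_deriv[OF f]) simp
 have cf: "continuous_on UNIV f" "continuous_on UNIV ?d"
  using C_k_continuous[OF test_function_C_k[OF f, of 0]] C_k_continuous[OF test_function_C_k[OF dt, of 0]] .
 have der: "(f has_real_derivative ?d x) (at x)" for x by (rule test_function_real_derivative[OF f])
 have dz: "?d x = 0" if "x ~: {al..bet}" for x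
  by (rule partial_deriv_eq_0[of "{al..bet}"]) (use z that in auto)
 have i: "integrable lborel (%x. (?d x)^2)" "integrable lborel (%x. (f x)^2)"
  by (rule continuous_compact_support[of _ "{al..bet}"]; auto intro!: continuous_intros cf dz z)+
 \<comment> \<open>The support keeps clear of \<open>0\<close> and \<open>h\<close>, so the
   cotangent is finite on \<open>{al..bet}\<close> and the total derivative may be integrated over
   it.\<close>
 have S: "sin (k * y) > 0" if "al <= y" "y <= bet" for y
 proof (rule sin_gt_zero)
  show "0 < k * y" using that albet h by (simp add: k_def)
  show "k * y < pi" using that albet h by (simp add: k_def field_simps)
 qed
 let ?g = "%y. (?d y - k * cos (k * y) * f y / sin (k * y))^2"
 let ?F = "%y. k * cos (k * y) * (f y)^2 / sin (k * y)"
 let ?F' = "%y. ((?d y)^2 - k^2 * (f y)^2) - ?g y"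
 have hb: "has_bochner_integral lborel (%y. ?F' y * indicator {al..bet} y) (?F bet - ?F al)"
 proof (rule has_bochner_integral_FTC_Icc_real)
  show "al <= bet" using albet by simp
  fix y assume y: "al <= y" "y <= bet"
  have s0: "sin (k * y) ~= 0" using S[OF y] by simp
  have sq: "((%y. (f y)^2) has_real_derivative 2 * f y * ?d y) (at y)"
   using DERIV_power[OF der[of y], where n = 2] by (simp add: mult_ac)
  have cs: "((%y. k * cos (k * y)) has_real_derivative k * (- sin (k * y) * k)) (at y)"
   "((%y. sin (k * y)) has_real_derivative cos (k * y) * k) (at y)"
   by (auto intro!: derivative_eq_intros)
  have gen: "((k * (- S * k) * a^2 + 2 * a * d * (k * C)) * S - k * C * a^2 * (C * k)) / (S * S) = (d^2 - k^2 * a^2) - (d - k * C * a / S)^2"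
   if "S ~= 0" for S C a d :: real
   using that by (simp add: power2_eq_square field_simps)
  show "(?F has_real_derivative ?F' y) (at y)"
   using DERIV_divide[OF DERIV_mult[OF cs(1) sq] cs(2) s0] unfolding gen[OF s0] .
  show "isCont ?F' y" using s0 cf by (auto intro!: continuous_intros simp: continuous_on_eq_continuous_at)
 qed
 moreover have "f al = 0" "f bet = 0" using z by auto
 ultimately have hb0: "has_bochner_integral lborel (%y. ?F' y * indicator {al..bet} y) 0" by simp
 have ii: "integrable lborel (%y. ((?d y)^2 - k^2 * (f y)^2))" using i by simp
 have ind: "(%y. ((?d y)^2 - k^2 * (f y)^2) - ?F' y * indicator {al..bet} y) = (%y. ?g y * indicator {al..bet} y)"
  using z dz by (auto simp: fun_eq_iff split: split_indicator)
 have "integrable lborel (%y. ((?d y)^2 - k^2 * (f y)^2) - ?F' y * indicator {al..bet} y)"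
  "(LBINT y. ((?d y)^2 - k^2 * (f y)^2) - ?F' y * indicator {al..bet} y) = (LBINT y. (?d y)^2 - k^2 * (f y)^2)"
  using hb0 ii by (simp_all add: has_bochner_integral_iff)
 then have "integrable lborel (%y. ?g y * indicator {al..bet} y)"
  "(LBINT y. ?g y * indicator {al..bet} y) = (LBINT y. (?d y)^2 - k^2 * (f y)^2)" unfolding ind by auto
 moreover have "(LBINT y. (?d y)^2 - k^2 * (f y)^2) = (LBINT y. (?d y)^2) - k^2 * (LBINT y. (f y)^2)" using i by simp
 ultimately show ?thesis using albet z by (intro exI[of _ al] exI[of _ bet]) auto
qed

lemma fiber_first_mode:
 assumes f: "test_function {0<..<h} f" and h: "h > 0"
 shows "(pi / h)^2 * (LBINT y. (f y)^2) <= (LBINT y. (pd f 1 y)^2)"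
proof -
 obtain al bet where "(LBINT y. (pd f 1 y)^2) - (pi / h)^2 * (LBINT y. (f y)^2)
   = (LBINT y. (pd f 1 y - pi / h * cos (pi / h * y) * f y / sin (pi / h * y))^2 * indicator {al..bet} y)"
  using fiber_ground_identity[OF f h] by blast
 moreover have "0 <= (LBINT y. (pd f 1 y - pi / h * cos (pi / h * y) * f y / sin (pi / h * y))^2 * indicator {al..bet} y)"
  by (rule lebesgue_nonneg) simp
 ultimately show ?thesis by linarith
qed

lemma integral_sin_sq:
 assumes h: "h > 0"
 shows "has_bochner_integral lborel (%y. (sin (pi / h * y))^2 * indicator {0..h} y) (h / 2)"
proof -
 define k where "k = pi / h"
 have k: "k > 0" "k * h = pi" using h by (auto simp: k_def)
 have "has_bochner_integral lborel (%y. (sin (k * y))^2 * indicator {0..h} y)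
   ((h / 2 - sin (k * h) * cos (k * h) / (2 * k)) - (0 / 2 - sin (k * 0) * cos (k * 0) / (2 * k)))"
 proof (rule has_bochner_integral_FTC_Icc_real)
  fix y :: real
  have e: "1 / 2 - (cos (k * y) * k * cos (k * y) + (- sin (k * y) * k) * sin (k * y)) / (2 * k) = (sin (k * y))^2"
  proof -
   have gen: "1 / 2 - (C * k * C + (- S * k) * S) / (2 * k) = S^2" if "C * C = 1 - S * S" for C S :: real
   proof -
    have "C * k * C + (- S * k) * S = k * (C * C - S * S)" by (simp add: algebra_simps)
    also have "... = k * (1 - 2 * S^2)" unfolding that by (simp add: power2_eq_square)
    finally show ?thesis using k by (simp add: diff_divide_distrib)
   qed
   show ?thesis by (rule gen) (use sin_cos_squared_add3[of "k * y"] in linarith)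
  qed
  have "((%y. y / 2 - sin (k * y) * cos (k * y) / (2 * k)) has_real_derivative
    1 / 2 - (cos (k * y) * k * cos (k * y) + (- sin (k * y) * k) * sin (k * y)) / (2 * k)) (at y)"
  proof -
   have d1: "((%y. sin (k * y)) has_real_derivative cos (k * y) * k) (at y)" by (auto intro!: derivative_eq_intros)
   have d2: "((%y. cos (k * y)) has_real_derivative - sin (k * y) * k) (at y)" by (auto intro!: derivative_eq_intros)
   show ?thesis by (intro DERIV_diff DERIV_cdivide DERIV_mult d1 d2 DERIV_ident)
  qed
  then show "((%y. y / 2 - sin (k * y) * cos (k * y) / (2 * k)) has_real_derivative (sin (k * y))^2) (at y)" unfolding e .
 qed (use h in "auto intro!: continuous_intros")
 then show ?thesis unfolding k(2) by (simp add: k_def)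
qed

text \<open>With \<open>a = f - m sin\<close> orthogonal to the
  ground state and \<open>ps = \<integral>\<^sub>0 a sin\<close>, \<open>w = ps / sin\<close>, \<open>x = cot\<close>, \<open>b = f' - k x f\<close>, one has
  \<open>b\<^sup>2 - 3 k\<^sup>2 a\<^sup>2 = (b + 3 k\<^sup>2 w)\<^sup>2 + 3 k\<^sup>2 (a - 3 k x w)\<^sup>2 - (6 k\<^sup>2 w a - 9 k\<^sup>3 x w\<^sup>2)'\<close>.\<close>

lemma fiber_gap:
 assumes f: "test_function {0<..<h} f" and h: "h > 0"
 defines "k == pi / h"
 shows "k^2 * (LBINT y. (f y)^2) + 3 * k^2 * ((LBINT y. (f y)^2) - 2 / h * (LBINT y. f y * sin (k * y))^2)
  <= (LBINT y. (pd f 1 y)^2)"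
proof -
 let ?d = "pd f 1"
 have k: "k > 0" "k * h = pi" using h by (auto simp: k_def)
 obtain al bet where albet: "0 < al" "al < bet" "bet < h" and z: "!!y. y ~: {al<..<bet} ==> f y = 0"
  and gi: "integrable lborel (%y. (?d y - k * cos (k * y) * f y / sin (k * y))^2 * indicator {al..bet} y)"
  and ge: "(LBINT y. (?d y)^2) - k^2 * (LBINT y. (f y)^2)
   = (LBINT y. (?d y - k * cos (k * y) * f y / sin (k * y))^2 * indicator {al..bet} y)"
  using fiber_ground_identity[OF f h] unfolding k_def[symmetric] by blast
 have dt: "test_function {0<..<h} ?d" by (rule test_function_partial_deriv[OF f]) simp
 have cf: "continuous_on UNIV f" "continuous_on UNIV ?d"
  using C_k_continuous[OF test_function_C_k[OF f, of 0]] C_k_continuous[OF test_function_C_k[OF dt, of 0]] .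
 have [measurable]: "f : borel_measurable borel" "?d : borel_measurable borel"
  using cf by (auto intro: borel_measurable_continuous_onI)
 have der: "(f has_real_derivative ?d x) (at x)" for x by (rule test_function_real_derivative[OF f])
 have dz: "?d x = 0" if "x ~: {al..bet}" for x
  by (rule partial_deriv_eq_0[of "{al..bet}"]) (use z that in auto)
 define s where "s y = sin (k * y)" for y
 define c where "c y = cos (k * y)" for y
 have cs: "continuous_on UNIV s" "continuous_on UNIV c" unfolding s_def[abs_def] c_def[abs_def] by (auto intro!: continuous_intros)
 have ds: "(s has_real_derivative k * c y) (at y)" "(c has_real_derivative - (k * s y)) (at y)" for y
  unfolding s_def[abs_def] c_def[abs_def] by (auto intro!: derivative_eq_intros)
 have spos: "s y > 0" if "0 < y" "y < h" for y
  unfolding s_def using that h by (intro sin_gt_zero) (auto simp: k_def field_simps)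
 have fs: "integrable lborel (%y. f y * s y)"
  by (rule continuous_compact_support[of _ "{al..bet}"]) (auto intro!: continuous_intros cf cs z)
 \<comment> \<open>The coefficient of the sine in \<open>f\<close>: it makes \<open>a\<close>
   orthogonal to the ground state on \<open>{0..h}\<close>, whence \<open>ps\<close> vanishes at
   both ends.\<close>
 define m where "m = 2 / h * (LBINT y. f y * s y)"
 define a where "a y = f y - m * s y" for y
 have ca: "continuous_on UNIV a" unfolding a_def[abs_def] by (intro continuous_intros cf cs)
 have da: "(a has_real_derivative ?d y - m * (k * c y)) (at y)" for y
  unfolding a_def[abs_def] by (intro DERIV_diff der DERIV_cmult ds)
 have cas: "continuous_on UNIV (%y. s y * a y)" by (intro continuous_intros cs ca)
 obtain Ps where Ps: "!!y. (Ps has_real_derivative s y * a y) (at y)" using continuous_antiderivative[OF cas] by blast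
 define ps where "ps y = Ps y - Ps 0" for y
 have dps: "(ps has_real_derivative s y * a y) (at y)" for y
  unfolding ps_def[abs_def] using Ps by (auto intro!: derivative_eq_intros)
 have ps0: "ps 0 = 0" by (simp add: ps_def)
 have ss: "has_bochner_integral lborel (%y. (s y)^2 * indicator {0..h} y) (h / 2)"
  using integral_sin_sq[OF h] by (simp add: s_def k_def)
 have find: "f y * indicator {0..h} y = f y" for y using z[of y] albet by (auto split: split_indicator)
 have psh: "ps h = 0"
 proof -
  have "ps h - ps 0 = (LBINT y. (s y * a y) * indicator {0..h} y)"
   using FTC_lborel[OF less_imp_le[OF h] dps cas] by simp
  also have "... = (LBINT y. f y * s y - m * ((s y)^2 * indicator {0..h} y))"
  proof (rule lebesgue_cong[OF refl])
   fix y
   show "(s y * a y) * indicator {0..h} y = f y * s y - m * ((s y)^2 * indicator {0..h} y)"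
    using find[of y] by (auto simp: a_def power2_eq_square algebra_simps split: split_indicator)
  qed
  also have "... = (LBINT y. f y * s y) - m * (h / 2)" using fs ss by (simp add: has_bochner_integral_iff)
  also have "... = 0" using h by (simp add: m_def)
  finally show ?thesis using ps0 by simp
 qed
 define w where "w y = ps y / s y" for y
 define x where "x y = c y / s y" for y
 define b where "b y = ?d y - k * x y * f y" for y
 define Ph where "Ph y = 6 * k^2 * (w y * a y) - 9 * k^3 * (x y * (w y)^2)" for y
 define T where "T y = (b y)^2 - 3 * k^2 * (a y)^2" for y
 define Ph' where "Ph' y = (b y + 3 * k^2 * w y)^2 + 3 * k^2 * (a y - 3 * k * x y * w y)^2 - T y" for y
 have dPh: "(Ph has_real_derivative Ph' y) (at y)" if y: "0 < y" "y < h" for y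
 proof -
  have s0: "s y ~= 0" using spos[OF y] by simp
  have dw: "(w has_real_derivative a y - k * x y * w y) (at y)"
  proof -
   have "((s y * a y) * s y - ps y * (k * c y)) / (s y * s y) = a y - k * x y * w y"
    using s0 by (simp add: x_def w_def field_simps)
   then show ?thesis using DERIV_divide[OF dps ds(1) s0] by (simp add: w_def[abs_def])
  qed
  have dx: "(x has_real_derivative - (k * (1 + (x y)^2))) (at y)"
  proof -
   have "(- (k * s y) * s y - c y * (k * c y)) / (s y * s y) = - (k * (1 + (x y)^2))"
    using s0 by (simp add: x_def field_simps power2_eq_square)
   then show ?thesis using DERIV_divide[OF ds(2) ds(1) s0] by (simp add: x_def[abs_def])
  qed
  have dw2: "((%y. (w y)^2) has_real_derivative 2 * w y * (a y - k * x y * w y)) (at y)"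
   using DERIV_power[OF dw, where n = 2] by (simp add: mult_ac)
  have "(Ph has_real_derivative 6 * k^2 * ((a y - k * x y * w y) * a y + (?d y - m * (k * c y)) * w y)
    - 9 * k^3 * ((- (k * (1 + (x y)^2))) * (w y)^2 + 2 * w y * (a y - k * x y * w y) * x y)) (at y)"
   unfolding Ph_def[abs_def] by (intro DERIV_diff DERIV_cmult DERIV_mult dw da dx dw2)
  moreover have "?d y - m * (k * c y) = b y + k * x y * a y"
   using s0 by (simp add: b_def a_def x_def algebra_simps diff_divide_distrib)
  moreover have "6 * k^2 * ((A - k * X * W) * A + (B + k * X * A) * W)
    - 9 * k^3 * ((- (k * (1 + X^2))) * W^2 + 2 * W * (A - k * X * W) * X)
    = (B + 3 * k^2 * W)^2 + 3 * k^2 * (A - 3 * k * X * W)^2 - (B^2 - 3 * k^2 * A^2)" for A B W X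
   by (simp add: power2_eq_square power3_eq_cube algebra_simps)
  ultimately show ?thesis by (simp add: Ph'_def T_def)
 qed
 have contPh': "isCont Ph' y" if y: "0 < y" "y < h" for y
 proof -
  have s0: "s y ~= 0" using spos[OF y] by simp
  have "isCont s y" "isCont c y" "isCont f y" "isCont ?d y" "isCont a y" "isCont ps y"
   using cs cf ca DERIV_isCont[OF dps, of y] by (auto simp: continuous_on_eq_continuous_at)
  then show ?thesis unfolding Ph'_def[abs_def] T_def[abs_def] b_def[abs_def] w_def[abs_def] x_def[abs_def]
   using s0 by (auto intro!: continuous_intros)
 qed
 have bz: "b y = 0" if "y ~: {al..bet}" for y using z[of y] dz[OF that] that by (auto simp: b_def)
 have gint: "(?d y - k * cos (k * y) * f y / sin (k * y))^2 * indicator {al..bet} y = (b y)^2" for y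
  using bz[of y] by (auto simp: b_def x_def s_def c_def split: split_indicator)
 have bi: "integrable lborel (%y. (b y)^2)" and be: "(LBINT y. (?d y)^2) - k^2 * (LBINT y. (f y)^2) = (LBINT y. (b y)^2)"
  using gi ge unfolding gint by auto
 have ai: "integrable lborel (%y. (a y)^2 * indicator {0..h} y)"
  by (rule borel_integrable_atLeastAtMost) (use ca in "auto intro!: continuous_intros simp: continuous_on_eq_continuous_at")
 have ae: "(LBINT y. (a y)^2 * indicator {0..h} y) = (LBINT y. (f y)^2) - 2 / h * (LBINT y. f y * s y)^2"
 proof -
  have fi: "integrable lborel (%y. (f y)^2)"
   by (rule continuous_compact_support[of _ "{al..bet}"]) (auto intro!: continuous_intros cf z)
  have "(LBINT y. (a y)^2 * indicator {0..h} y) = (LBINT y. (f y)^2 - 2 * m * (f y * s y) + m^2 * ((s y)^2 * indicator {0..h} y))"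
  proof (rule lebesgue_cong[OF refl])
   fix y
   show "(a y)^2 * indicator {0..h} y = (f y)^2 - 2 * m * (f y * s y) + m^2 * ((s y)^2 * indicator {0..h} y)"
    using find[of y] by (auto simp: a_def power2_eq_square algebra_simps split: split_indicator)
  qed
  also have "... = (LBINT y. (f y)^2) - 2 * m * (LBINT y. f y * s y) + m^2 * (h / 2)"
   using fi fs ss by (simp add: has_bochner_integral_iff)
  also have "... = (LBINT y. (f y)^2) - 2 / h * (LBINT y. f y * s y)^2"
   using h by (simp add: m_def power2_eq_square field_simps)
  finally show ?thesis .
 qed
 \<comment> \<open>Unlike \<open>f\<close>, the function \<open>a\<close> is not zero near the
   endpoints, where \<open>w\<close> and \<open>x\<close> divide by the sine. Within
   \<open>ep\<close> of an endpoint \<open>f\<close> vanishes, so \<open>a\<close> is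
   \<open>- m\<close> times the sine, and integrating inward from the endpoint bounds
   \<open>ps\<close> by a multiple of \<open>ep * (s y)^2\<close>.\<close>
 have absa: "\<bar>ps y\<bar> <= \<bar>m\<bar> * ep * (s y)^2 & a y = - m * s y"
  if e: "0 < ep" "ep < al" "ep < h - bet" "ep < h / 2" and y: "y = ep | y = h - ep" for ep y
 proof
  have fy: "f y = 0" using z[of y] y e by auto
  then show "a y = - m * s y" by (simp add: a_def)
  have mono: "s u <= s ep" if u: "0 <= u" "u <= ep" for u
   unfolding s_def
  proof (rule sin_monotone_2pi_le)
   show "- (pi / 2) <= k * u" using u k by (meson mult_nonneg_nonneg less_imp_le order_trans neg_le_0_iff_le pi_half_ge_zero)
   show "k * u <= k * ep" using u k by simp
   have "k * ep <= k * (h / 2)" using e k by (intro mult_left_mono) auto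
   then show "k * ep <= pi / 2" using k by simp
  qed
  have refl_s: "s (h - u) = s u" for u
   unfolding s_def using k(2) sin_pi_minus[of "k * u"] by (simp add: right_diff_distrib)
  have nn: "0 <= s u" if "0 <= u" "u <= h" for u
   unfolding s_def using that k(1) mult_left_mono[of u h k] k(2) by (intro sin_ge_zero) auto
  have sq: "(s u)^2 <= (s ep)^2" if "u : {0..ep} | u : {h-ep..h}" for u
  proof -
   have "s u <= s ep & 0 <= s u"
   proof (cases "u : {0..ep}")
    case True
    then show ?thesis using mono[of u] nn[of u] e by auto
   next
    case False
    then have "u : {h-ep..h}" using that by auto
    then show ?thesis using mono[of "h - u"] nn[of u] refl_s[of u] e by auto
   qed
   then show ?thesis by (intro power_mono) auto
  qed
  \<comment> \<open>\<open>{p..p + ep}\<close> is the strip between \<open>y\<close> and the nearer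
    end of \<open>{0..h}\<close>, where \<open>ps\<close> vanishes.\<close>
  define p where "p = (if y = ep then 0 else h - ep)"
  have pz: "ps p = 0 | ps (p + ep) = 0" "y = p | y = p + ep" using y ps0 psh by (auto simp: p_def)
  have "ps p = 0 & y = p + ep | ps (p + ep) = 0 & y = p" using y ps0 psh by (auto simp: p_def)
  then have "\<bar>ps y\<bar> = \<bar>ps (p + ep) - ps p\<bar>" by auto
  also have "ps (p + ep) - ps p = (LBINT u. (s u * a u) * indicator {p..p+ep} u)"
   using FTC_lborel[OF _ dps cas, of p "p + ep"] e by simp
  also have "\<bar>...\<bar> <= (LBINT u. \<bar>(s u * a u) * indicator {p..p+ep} u\<bar>)" by (rule integral_abs_bound)
  also have "... <= (LBINT u. \<bar>m\<bar> * (s ep)^2 * indicator {p..p+ep} u)"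
  proof (rule integral_mono)
   have "integrable lborel (%u. (s u * a u) * indicator {p..p+ep} u)"
    by (rule borel_integrable_atLeastAtMost) (use cas in "auto simp: continuous_on_eq_continuous_at")
   then show "integrable lborel (%u. \<bar>(s u * a u) * indicator {p..p+ep} u\<bar>)" by (rule integrable_abs)
   show "integrable lborel (%u. \<bar>m\<bar> * (s ep)^2 * indicator {p..p+ep} u)"
    using e by (intro integrable_mult_right integrable_real_indicator) auto
   fix u
   show "\<bar>(s u * a u) * indicator {p..p+ep} u\<bar> <= \<bar>m\<bar> * (s ep)^2 * indicator {p..p+ep} u"
   proof (cases "u : {p..p+ep}")
    case True
    then have u: "u : {0..ep} | u : {h-ep..h}" using y by (auto simp: p_def split: if_splits)
    then have "f u = 0" using z[of u] e by auto
    then have "\<bar>s u * a u\<bar> = \<bar>m\<bar> * (s u)^2" by (simp add: a_def abs_mult power2_eq_square)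
    also have "... <= \<bar>m\<bar> * (s ep)^2" using sq[OF u] by (intro mult_left_mono) auto
    finally show ?thesis using True by simp
   qed simp
  qed
  also have "... = \<bar>m\<bar> * (s ep)^2 * ep" using e by simp
  also have "s ep = s y" using y refl_s by auto
  finally show "\<bar>ps y\<bar> <= \<bar>m\<bar> * ep * (s y)^2" by (simp add: mult_ac)
 qed
 \<comment> \<open>Two powers of the sine in the bound on \<open>ps\<close> outweigh the divisions
   in \<open>w\<close> and \<open>x\<close>, so the boundary terms are of order
   \<open>ep\<close>.\<close>
 have bound: "\<bar>Ph y\<bar> <= (6 * k^2 * m^2 + 9 * k^3 * m^2 * h) * ep"
  if e: "0 < ep" "ep < al" "ep < h - bet" "ep < h / 2" and y: "y = ep | y = h - ep" for ep y
 proof -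
  have yh: "0 < y" "y < h" using e y by auto
  have sp: "s y > 0" "s y <= 1" using spos[OF yh] by (auto simp: s_def)
  have cy: "\<bar>c y\<bar> <= 1" by (simp add: c_def)
  note A = absa[OF that]
  have aw: "\<bar>w y\<bar> <= \<bar>m\<bar> * ep * s y"
   using A sp by (simp add: w_def abs_divide divide_le_eq power2_eq_square mult_ac)
  have "\<bar>m\<bar> * s y <= \<bar>m\<bar> * 1" using sp by (intro mult_left_mono) auto
  then have "\<bar>a y\<bar> <= \<bar>m\<bar> * 1" using A sp by (simp add: abs_mult)
  moreover have "\<bar>w y\<bar> <= \<bar>m\<bar> * ep"
  proof -
   have "\<bar>m\<bar> * ep * s y <= \<bar>m\<bar> * ep * 1" using sp e by (intro mult_left_mono) auto
   then show ?thesis using aw by simp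
  qed
  ultimately have 1: "\<bar>w y * a y\<bar> <= (\<bar>m\<bar> * ep) * \<bar>m\<bar>" unfolding abs_mult using e by (intro mult_mono) auto
  have 2: "\<bar>x y * (w y)^2\<bar> <= m^2 * ep * h"
  proof -
   have "\<bar>x y * (w y)^2\<bar> = \<bar>c y\<bar> / s y * (\<bar>w y\<bar>)^2" using sp by (simp add: x_def abs_mult abs_divide)
   also have "... <= 1 / s y * (\<bar>m\<bar> * ep * s y)^2" using cy aw sp by (intro mult_mono divide_right_mono power_mono) auto
   also have "... = (m^2 * ep) * (ep * s y)" using sp by (simp add: power2_eq_square)
   also have "... <= (m^2 * ep) * (h * 1)" using sp e by (intro mult_left_mono mult_mono) auto
   finally show ?thesis by (simp add: mult_ac)
  qed
  have "\<bar>Ph y\<bar> <= \<bar>6 * k^2 * (w y * a y)\<bar> + \<bar>9 * k^3 * (x y * (w y)^2)\<bar>" unfolding Ph_def by (rule abs_triangle_ineq4)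
  also have "... = 6 * k^2 * \<bar>w y * a y\<bar> + 9 * k^3 * \<bar>x y * (w y)^2\<bar>" using k by (simp add: abs_mult)
  also have "... <= 6 * k^2 * ((\<bar>m\<bar> * ep) * \<bar>m\<bar>) + 9 * k^3 * (m^2 * ep * h)"
   using 1 2 k by (intro add_mono mult_left_mono) auto
  also have "... = (6 * k^2 * m^2 + 9 * k^3 * m^2 * h) * ep" by (simp add: power2_eq_square algebra_simps)
  finally show ?thesis .
 qed
 define K where "K = 6 * k^2 * m^2 + 9 * k^3 * m^2 * h"
 have K: "K >= 0" using k h by (simp add: K_def)
 have Tm: "T : borel_measurable borel"
 proof -
  have "s : borel_measurable borel" "c : borel_measurable borel" "a : borel_measurable borel"
   using cs ca by (auto intro: borel_measurable_continuous_onI)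
  then show ?thesis unfolding T_def[abs_def] b_def[abs_def] x_def[abs_def] by measurable
 qed
 \<comment> \<open>Integrating over \<open>{ep..h - ep}\<close> costs boundary terms of at most
   \<open>2 * K * ep\<close>, and the discarded part of the integral of \<open>a^2\<close> is at
   most \<open>2 * m^2 * ep\<close>. Letting \<open>ep\<close> tend to \<open>0\<close> removes both
   errors.\<close>
 have key: "(LBINT y. (b y)^2) - 3 * k^2 * (LBINT y. (a y)^2 * indicator {0..h} y) >= - (2 * K + 6 * k^2 * m^2) * ep"
  if e: "0 < ep" "ep < al" "ep < h - bet" "ep < h / 2" for ep
 proof -
  let ?J = "{ep..h-ep}"
  have bJ: "(b y)^2 * indicator ?J y = (b y)^2" for y using bz[of y] e by (auto split: split_indicator)
  have aJ: "integrable lborel (%y. (a y)^2 * indicator ?J y)"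
   by (rule borel_integrable_atLeastAtMost) (use ca in "auto intro!: continuous_intros simp: continuous_on_eq_continuous_at")
  have TJe: "T y * indicator ?J y = (b y)^2 - 3 * k^2 * ((a y)^2 * indicator ?J y)" for y
   using bJ[of y] by (simp add: T_def left_diff_distrib)
  have TJ: "integrable lborel (%y. T y * indicator ?J y)" unfolding TJe using bi aJ by simp
  have "(- Ph (h - ep)) - (- Ph ep) <= (LBINT y. T y * indicator ?J y)"
  proof (rule FTC_le[where F' = "%y. - Ph' y", OF _ _ _ _ TJ])
   show "ep <= h - ep" using e by simp
   fix y assume y: "ep <= y" "y <= h - ep"
   then have y': "0 < y" "y < h" using e by auto
   show "((%y. - Ph y) has_real_derivative - Ph' y) (at y)" by (rule DERIV_minus[OF dPh[OF y']])
   show "isCont (%y. - Ph' y) y" by (rule continuous_minus[OF contPh'[OF y']])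
   have "0 <= (b y + 3 * k^2 * w y)^2 + 3 * k^2 * (a y - 3 * k * x y * w y)^2" by simp
   then show "- Ph' y <= T y" unfolding Ph'_def by linarith
  qed
  moreover have "\<bar>Ph (h - ep)\<bar> <= K * ep" "\<bar>Ph ep\<bar> <= K * ep" using bound[OF e] by (auto simp: K_def)
  ultimately have 1: "(LBINT y. T y * indicator ?J y) >= - 2 * K * ep" by linarith
  have 2: "(LBINT y. T y * indicator ?J y) = (LBINT y. (b y)^2) - 3 * k^2 * (LBINT y. (a y)^2 * indicator ?J y)"
   unfolding TJe using bi aJ by simp
  have 3: "(LBINT y. (a y)^2 * indicator {0..h} y) <= (LBINT y. (a y)^2 * indicator ?J y) + 2 * m^2 * ep"
  proof -
   have "(LBINT y. (a y)^2 * indicator {0..h} y) <= (LBINT y. (a y)^2 * indicator ?J y + m^2 * (indicator {0..ep} y + indicator {h-ep..h} y))"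
   proof (rule integral_mono[OF ai])
    show "integrable lborel (%y. (a y)^2 * indicator ?J y + m^2 * (indicator {0..ep} y + indicator {h-ep..h} y))"
     using aJ e by (intro Bochner_Integration.integrable_add integrable_mult_right integrable_real_indicator) auto
    fix y
    show "(a y)^2 * indicator {0..h} y <= (a y)^2 * indicator ?J y + m^2 * (indicator {0..ep} y + indicator {h-ep..h} y)"
    proof (cases "y : ?J | y ~: {0..h}")
     case False
     then have "f y = 0" using z[of y] e by auto
     then have "(a y)^2 <= m^2 * 1" using mult_left_mono[of "(s y)^2" 1 "m^2"] by (simp add: a_def s_def power_mult_distrib abs_square_le_1)
     then show ?thesis using False e by (auto split: split_indicator)
    qed (use e in "auto split: split_indicator")
   qed
   also have "... = (LBINT y. (a y)^2 * indicator ?J y) + m^2 * (ep + ep)"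
   proof -
    have "integrable lborel (%y. indicator {0..ep} y :: real)" "integrable lborel (%y. indicator {h-ep..h} y :: real)"
     using e by (auto intro!: integrable_real_indicator)
    then show ?thesis using aJ e by simp
   qed
   finally show ?thesis by (simp add: algebra_simps)
  qed
  have "3 * k^2 * (LBINT y. (a y)^2 * indicator {0..h} y) <= 3 * k^2 * ((LBINT y. (a y)^2 * indicator ?J y) + 2 * m^2 * ep)"
   using 3 by (intro mult_left_mono) auto
  then show ?thesis using 1 2 by (simp add: algebra_simps)
 qed
 have "(LBINT y. (b y)^2) - 3 * k^2 * (LBINT y. (a y)^2 * indicator {0..h} y) >= 0"
 proof (rule ccontr)
  let ?D = "(LBINT y. (b y)^2) - 3 * k^2 * (LBINT y. (a y)^2 * indicator {0..h} y)"
  let ?M = "2 * K + 6 * k^2 * m^2"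
  assume "~ ?D >= 0"
  then have D: "?D < 0" by simp
  have M: "?M >= 0" using K by simp
  define q where "q = - ?D / (2 * (?M + 1))"
  have q: "q > 0"
  proof -
   have gen: "- E / (2 * (N + 1)) > 0" if "E < 0" "N >= 0" for N E :: real using that by (intro divide_pos_pos) auto
   show ?thesis unfolding q_def by (rule gen[OF D M])
  qed
  define ep where "ep = min (min (al / 2) ((h - bet) / 2)) (min (h / 4) q)"
  have ep0: "0 < ep" "ep <= al / 2" "ep <= (h - bet) / 2" "ep <= h / 4" "ep <= q"
   unfolding ep_def min_def using albet h q by simp_all
  have ep: "0 < ep" "ep < al" "ep < h - bet" "ep < h / 2" "ep <= - ?D / (2 * (?M + 1))"
  proof -
   show "0 < ep" by (rule ep0(1))
   show "ep < al" using ep0(1,2) by simp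
   show "ep < h - bet" using ep0(1,3) by simp
   show "ep < h / 2" using ep0(1,4) by simp
   show "ep <= - ?D / (2 * (?M + 1))" by (rule ep0(5)[unfolded q_def])
  qed
  have "(?M + 1) * ep <= - ?D / 2"
  proof -
   have gen: "(N + 1) * e <= E / 2" if "e <= E / (2 * (N + 1))" "N >= 0" for N e E :: real using that by (simp add: field_simps)
   show ?thesis by (rule gen[OF ep(5) M])
  qed
  then have "?M * ep + ep <= - ?D / 2" by (simp only: distrib_right mult_1)
  moreover have "?D >= - (?M * ep)" using key[OF ep(1-4)] by (simp only: mult_minus_left)
  moreover have "False" if "P + e <= - E / 2" "- P <= E" "0 < e" "E < 0" for P e E :: real using that by linarith
  ultimately show False using ep(1) D by blast
 qed
 then have fin: "3 * k^2 * ((LBINT y. (f y)^2) - 2 / h * (LBINT y. f y * s y)^2) <= (LBINT y. (b y)^2)"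
  unfolding ae by linarith
 have "(LBINT y. f y * s y) = (LBINT y. f y * sin (k * y))" by (simp add: s_def)
 with fin be show ?thesis by simp
qed

subsection \<open>The problem on the triangle\<close>

lemma cell_integral:
 fixes u :: "real => real"
 assumes "u : borel_measurable borel"
 shows "(LINT x|lebesgue_on (cell A de j). u x) = (LBINT x. u x * indicator (cell A de j) x)"
proof -
 have "(LINT x|lebesgue_on (cell A de j). u x) = (LINT x|lebesgue. u x * indicator (cell A de j) x)"
  by (subst integral_restrict_space) (auto simp: cell_def mult.commute)
 also have "... = (LBINT x. u x * indicator (cell A de j) x)"
  using assms by (intro lebesgue_lborel) (simp add: cell_def)
 finally show ?thesis .
qed

lemma test_function_cont:
 assumes "test_function U ph"
 shows "continuous_on UNIV ph" "ph : borel_measurable borel"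
 using C_k_continuous[OF test_function_C_k[OF assms, of 0]] by (auto intro: borel_measurable_continuous_onI)

lemma test_function_sq_slices:
 fixes ph :: "real \<times> real => real"
 assumes "test_function U ph"
 shows "integrable lborel (%y. (ph (x, y))^2)" "integrable lborel (%x. (ph (x, y))^2)"
  "integrable lborel (%x. LBINT y. (ph (x, y))^2)" "integrable lborel (%y. LBINT x. (ph (x, y))^2)"
  "(LBINT p. (ph p)^2) = (LBINT x. LBINT y. (ph (x, y))^2)"
  "(LBINT p. (ph p)^2) = (LBINT y. LBINT x. (ph (x, y))^2)"
proof -
 obtain K where K: "compact K" "K <= U" "!!p. p ~: K ==> ph p = 0" using test_functionD[OF assms] by blast
 have c2: "continuous_on UNIV (%p. (ph p)^2)" by (intro continuous_intros test_function_cont[OF assms])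
 have z2: "(ph p)^2 = 0" if "p ~: K" for p using K(3)[OF that] by simp
 note P = plane_slices[OF c2 K(1) z2]
 show "integrable lborel (%y. (ph (x, y))^2)" by (rule P(1))
 show "integrable lborel (%x. (ph (x, y))^2)" by (rule P(2))
 show "integrable lborel (%x. LBINT y. (ph (x, y))^2)" by (rule P(3))
 show "integrable lborel (%y. LBINT x. (ph (x, y))^2)" by (rule P(4))
 show "(LBINT p. (ph p)^2) = (LBINT x. LBINT y. (ph (x, y))^2)" by (rule P(5))
 show "(LBINT p. (ph p)^2) = (LBINT y. LBINT x. (ph (x, y))^2)" by (rule P(6))
qed

text \<open>The one-dimensional estimate is applied on every line in the first variable, and then in
  the second variable to the integrals \<open>m i\<close> over cells. Cauchy-Schwarz on the cells
  bounds the energies of all \<open>m i\<close> together by \<open>de\<close> times the transverse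
  energy, which compensates the division by \<open>de\<close>.\<close>

lemma Poincare_plane:
 fixes ph :: "real \<times> real => real"
 assumes ph: "test_function UNIV ph" and de: "de > 0"
  and z: "!!x y. x ~: {A<..<A + real N * de} | y ~: {A<..<A + real N * de} ==> ph (x, y) = 0"
 shows "(LBINT p. (ph p)^2) <= de^2 * ((LBINT p. (pd ph (1, 0) p)^2) + (LBINT p. (pd ph (0, 1) p)^2))
  + (\<Sum>i<N. \<Sum>j<N. (LBINT p. indicator (cell A de i) (fst p) * indicator (cell A de j) (snd p) * ph p)^2 / de^2)"
proof -
 let ?I = "{A<..<A + real N * de}"
 have B10: "(1::real, 0::real) : Basis" "(0::real, 1::real) : Basis" by (auto simp: Basis_prod_def)
 have dx: "test_function UNIV (pd ph (1, 0))" by (rule test_function_partial_deriv[OF ph B10(1)])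
 have dy: "test_function UNIV (pd ph (0, 1))" by (rule test_function_partial_deriv[OF ph B10(2)])
 note Sph = test_function_sq_slices[OF ph] and Sx = test_function_sq_slices[OF dx] and Sy = test_function_sq_slices[OF dy]
 have one: "(1::real) : Basis" by simp
 have ibor [measurable]: "(indicator (cell A de i) :: real => real) : borel_measurable borel" for i by (simp add: cell_def)
 have len: "A + real (Suc i) * de - (A + real i * de) = de" for i by (simp add: algebra_simps)
 have isq: "integrable lborel (%x. (indicator (cell A de i) x :: real)^2)" "(LBINT x. (indicator (cell A de i) x :: real)^2) = de" for i
 proof -
  have e: "(%x. (indicator (cell A de i) x :: real)^2) = indicator (cell A de i)" by (auto simp: fun_eq_iff split: split_indicator)
  have "A + real i * de <= A + real (Suc i) * de" using de by (simp add: algebra_simps)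
  then show "integrable lborel (%x. (indicator (cell A de i) x :: real)^2)" "(LBINT x. (indicator (cell A de i) x :: real)^2) = de"
   unfolding e unfolding cell_def using len[of i] by (auto intro!: integrable_real_indicator)
 qed
 define m where "m i y = (LBINT x. ph (x, y) * indicator (cell A de i) x)" for i y
 define m' where "m' i y = (LBINT x. pd ph (0, 1) (x, y) * indicator (cell A de i) x)" for i y
 note W = weighted_slice[OF test_function_swap(1)[OF ph] ibor isq(1), unfolded fst_conv snd_conv test_function_swap(2)[OF ph], folded m_def m'_def]
 have mL: "m i : L2 UNIV" "m' i : L2 UNIV" "L2_sq UNIV (m' i) = (LBINT y. (m' i y)^2)" for i
  using borel_L2[OF W(1,2)] borel_L2[OF W(4,5)] by auto
 have col: "(LBINT x. (ph (x, y))^2) <= de^2 * (LBINT x. (pd ph (1, 0) (x, y))^2) + (\<Sum>i<N. (m i y)^2 / de)" for y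
 proof -
  have t: "test_function UNIV (%x. ph (x, y))" by (rule test_function_slice(1)[OF ph])
  have e: "pd (%x. ph (x, y)) 1 = (%x. pd ph (1, 0) (x, y))"
   by (rule ext) (rule test_function_slice(2)[OF ph])
  have wd: "has_weak_deriv UNIV (%x. ph (x, y)) 1 (%x. pd ph (1, 0) (x, y))"
   using test_function_H1(2)[OF t open_UNIV one] unfolding e .
  have gt: "test_function UNIV (%x. pd ph (1, 0) (x, y))" by (rule test_function_slice(1)[OF dx])
  have "(LINT x|lebesgue. indicator ?I x * (ph (x, y))^2) <= de^2 * L2_sq UNIV (%x. pd ph (1, 0) (x, y))
    + (\<Sum>i<N. (LINT x|lebesgue_on (cell A de i). ph (x, y))^2 / de)"
   by (rule Poincare_partition[OF de wd test_function_L2[OF t open_UNIV] test_function_L2[OF gt open_UNIV]])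
  moreover have "(LINT x|lebesgue. indicator ?I x * (ph (x, y))^2) = (LBINT x. (ph (x, y))^2)"
  proof -
   have "(%x. indicator ?I x * (ph (x, y))^2) = (%x. (ph (x, y))^2)" using z by (auto simp: fun_eq_iff split: split_indicator)
   then show ?thesis using test_function_cont(2)[OF t] by (simp add: lebesgue_lborel)
  qed
  moreover have "L2_sq UNIV (%x. pd ph (1, 0) (x, y)) = (LBINT x. (pd ph (1, 0) (x, y))^2)"
   by (rule borel_L2(2)[OF test_function_cont(2)[OF gt] Sx(2)])
  moreover have "(LINT x|lebesgue_on (cell A de i). ph (x, y)) = m i y" for i
   unfolding m_def by (rule cell_integral[OF test_function_cont(2)[OF t]])
  ultimately show ?thesis by simp
 qed
 have row: "(LBINT y. (m i y)^2) <= de^2 * (LBINT y. (m' i y)^2) + (\<Sum>j<N. (LBINT y. m i y * indicator (cell A de j) y)^2 / de)" for i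
 proof -
  have "(LINT x|lebesgue. indicator ?I x * (m i x)^2) = (LBINT y. (m i y)^2)"
  proof -
   have "m i y = 0" if "y ~: ?I" for y using z that by (simp add: m_def)
   then have "(%x. indicator ?I x * (m i x)^2) = (%x. (m i x)^2)" by (auto simp: fun_eq_iff split: split_indicator)
   then show ?thesis using W(1) by (simp add: lebesgue_lborel)
  qed
  then show ?thesis
   using Poincare_partition[OF de W(7) mL(1,2), of A N i] unfolding mL(3) cell_integral[OF W(1)] by simp
 qed
 have m'b: "(\<Sum>i<N. (m' i y)^2) <= de * (LBINT x. (pd ph (0, 1) (x, y))^2)" for y
 proof -
  have gm [measurable]: "(%x. pd ph (0, 1) (x, y)) : borel_measurable borel"
   using test_function_cont(2)[OF test_function_slice(1)[OF dy]] .
  have gi: "integrable lborel (%x. indicator (cell A de i) x * (pd ph (0, 1) (x, y))^2)" for i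
   using integrable_mult_indicator[of "cell A de i" lborel "%x. (pd ph (0, 1) (x, y))^2"] Sy(2) by (simp add: cell_def)
  have "(m' i y)^2 <= de * (LBINT x. indicator (cell A de i) x * (pd ph (0, 1) (x, y))^2)" for i
  proof -
   have e: "(indicator (cell A de i) x * pd ph (0, 1) (x, y))^2 = indicator (cell A de i) x * (pd ph (0, 1) (x, y))^2" for x
    by (auto split: split_indicator)
   have m'e: "m' i y = (LBINT x. (indicator (cell A de i) x * pd ph (0, 1) (x, y)) * indicator (cell A de i) x)"
    unfolding m'_def by (intro lebesgue_cong) (auto split: split_indicator)
   have "(m' i y)^2 <= (LBINT x. (indicator (cell A de i) x * pd ph (0, 1) (x, y))^2) * (LBINT x. (indicator (cell A de i) x :: real)^2)"
    unfolding m'e by (rule lborel_Cauchy_Schwarz) (use gi isq(1) in "auto simp: e")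
   then show ?thesis unfolding e isq(2) by (simp add: mult.commute[of de])
  qed
  then have "(\<Sum>i<N. (m' i y)^2) <= (\<Sum>i<N. de * (LBINT x. indicator (cell A de i) x * (pd ph (0, 1) (x, y))^2))"
   by (rule sum_mono)
  also have "... = de * (LBINT x. (\<Sum>i<N. indicator (cell A de i) x * (pd ph (0, 1) (x, y))^2))"
   by (subst Bochner_Integration.integral_sum[OF gi]) (rule sum_distrib_left[symmetric])
  also have "... <= de * (LBINT x. (pd ph (0, 1) (x, y))^2)"
  proof (intro mult_left_mono integral_mono Sy(2) Bochner_Integration.integrable_sum gi)
   fix x
   show "(\<Sum>i<N. indicator (cell A de i) x * (pd ph (0, 1) (x, y))^2) <= (pd ph (0, 1) (x, y))^2"
    using mult_right_mono[OF cell_sum_le_1[OF de, where N = N and A = A and x = x], of "(pd ph (0, 1) (x, y))^2"] by (simp add: sum_distrib_right)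
  qed (use de in auto)
  finally show ?thesis .
 qed
 have dbl: "(LBINT y. m i y * indicator (cell A de j) y) = (LBINT p. indicator (cell A de i) (fst p) * indicator (cell A de j) (snd p) * ph p)" for i j
 proof -
  obtain K where K: "compact K" "K <= UNIV" "!!p. p ~: K ==> ph p = 0" using test_functionD[OF ph] by blast
  have iph: "integrable lborel ph" by (rule continuous_compact_support[OF test_function_cont(1)[OF ph] K(1,3)])
  have cm: "cell A de i \<times> cell A de j : sets lborel" by (intro sets_lborel[THEN equalityD2, THEN subsetD] borel_open open_Times) (auto simp: cell_def)
  have "integrable lborel (%p. indicator (cell A de i \<times> cell A de j) p *\<^sub>R ph p)"
   by (rule integrable_mult_indicator[OF cm iph])
  then have IP: "integrable (lborel \<Otimes>\<^sub>M lborel) (case_prod (%x y. ph (x, y) * indicator (cell A de i) x * indicator (cell A de j) y))"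
   by (simp add: lborel_prod case_prod_unfold indicator_times mult_ac)
  have I: "integrable (lborel \<Otimes>\<^sub>M lborel) (%p. ph p * indicator (cell A de i) (fst p) * indicator (cell A de j) (snd p))"
   and F: "(LBINT y. LBINT x. ph (x, y) * indicator (cell A de i) x * indicator (cell A de j) y)
    = (LBINT x. LBINT y. ph (x, y) * indicator (cell A de i) x * indicator (cell A de j) y)"
   using IP lborel_pair.Fubini_integral[OF IP] by (auto simp: case_prod_unfold)
  have "(LBINT y. m i y * indicator (cell A de j) y) = (LBINT y. LBINT x. ph (x, y) * indicator (cell A de i) x * indicator (cell A de j) y)"
   unfolding m_def by simp
  also have "... = (LBINT x. LBINT y. ph (x, y) * indicator (cell A de i) x * indicator (cell A de j) y)" by (rule F)
  also have "(LBINT x. LBINT y. ph (x, y) * indicator (cell A de i) x * indicator (cell A de j) y) = (LBINT p. ph p * indicator (cell A de i) (fst p) * indicator (cell A de j) (snd p))"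
   using lborel_pair.integral_fst'[OF I] by (simp add: lborel_prod)
  finally show ?thesis by (simp add: mult_ac)
 qed
 have mi: "integrable lborel (%y. (m i y)^2)" "integrable lborel (%y. (m' i y)^2)" for i using W(2,5) by auto
 have "(LBINT p. (ph p)^2) = (LBINT y. LBINT x. (ph (x, y))^2)" by (rule Sph(6))
 also have "... <= (LBINT y. de^2 * (LBINT x. (pd ph (1, 0) (x, y))^2) + (\<Sum>i<N. (m i y)^2 / de))"
  using Sx(4) mi by (intro integral_mono Sph(4) col) auto
 also have "... = de^2 * (LBINT p. (pd ph (1, 0) p)^2) + (\<Sum>i<N. (LBINT y. (m i y)^2) / de)"
  using Sx(4) mi by (simp add: Sx(6))
 also have "(\<Sum>i<N. (LBINT y. (m i y)^2) / de) <= (\<Sum>i<N. (de^2 * (LBINT y. (m' i y)^2) + (\<Sum>j<N. (LBINT y. m i y * indicator (cell A de j) y)^2 / de)) / de)"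
  using row de by (intro sum_mono divide_right_mono) auto
 also have "... = de * (\<Sum>i<N. (LBINT y. (m' i y)^2)) + (\<Sum>i<N. \<Sum>j<N. (LBINT y. m i y * indicator (cell A de j) y)^2 / de^2)"
  using de by (simp add: add_divide_distrib sum.distrib sum_distrib_left sum_divide_distrib power2_eq_square)
 also have "(\<Sum>i<N. (LBINT y. (m' i y)^2)) = (LBINT y. (\<Sum>i<N. (m' i y)^2))"
  using mi by (intro Bochner_Integration.integral_sum[symmetric])
 also have "... <= (LBINT y. de * (LBINT x. (pd ph (0, 1) (x, y))^2))"
  using Sy(4) mi by (intro integral_mono m'b) auto
 also have "... = de * (LBINT p. (pd ph (0, 1) p)^2)" by (simp add: Sy(6))
 finally show ?thesis unfolding dbl using de by (simp add: power2_eq_square algebra_simps mult_left_mono)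
qed

section \<open>The form on the triangle and its coercivity\<close>

locale tri_form =
 fixes s t :: real
 assumes s_range: "s : {-1<..<1}" and t_pos: "t > 0"
begin

abbreviation "T == triangle s t"
abbreviation "ta == t powr (2/3)"

lemma ta_pos: "ta > 0" using t_pos by simp
lemma ta_cube: "ta * ta * ta = t^2" using powr_two_thirds(3)[OF t_pos] by (simp add: power3_eq_cube)

definition "a u v = t powr (4/3) * (grad_inner T u v - pi^2 / t^2 * L2_inner T u v)"

lemma a_alt: "a u v = ta^2 * grad_inner T u v - pi^2 / ta * L2_inner T u v"
proof -
 have "ta^2 * (pi^2 / t^2) = pi^2 / ta" using ta_pos ta_cube by (simp add: field_simps power2_eq_square)
 moreover have "a u v = ta^2 * grad_inner T u v - (ta^2 * (pi^2 / t^2)) * L2_inner T u v"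
  unfolding a_def powr_two_thirds(2)[OF t_pos] by (simp only: right_diff_distrib mult.assoc)
 ultimately show ?thesis by simp
qed

text \<open>The potential of the line carried back to the base of the triangle by
  \<open>x = s + ta * X\<close>.\<close>

definition "pot x = V_bar s ((x - s) / ta)"

lemma pot_continuous: "continuous_on UNIV pot"
 unfolding pot_def[abs_def] using ta_pos by (intro continuous_on_compose2[OF V_bar_continuous[OF s_range]] continuous_intros) auto

lemma pot_nonneg: "pot x >= 0"
 by (simp add: pot_def V_bar_nonneg[OF s_range])

text \<open>In the relative distance \<open>xi\<close> from the apex the height is
  \<open>t * (1 - xi)\<close>, and \<open>1 + 2 * xi\<close> is the tangent at \<open>0\<close> of
  the convex function \<open>1 / (1 - xi)^2\<close>.\<close>

lemma pot_le:
 assumes x: "-1 < x" "x < 1"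
 shows "pot x <= ta^2 * (pi / height s t x)^2 - pi^2 / ta" "height s t x > 0"
proof -
 define r where "r = (if x <= s then 1 + s else 1 - s)"
 define d where "d = \<bar>x - s\<bar>"
 have r: "r > 0" "d < r" "d >= 0" using s_range x by (auto simp: r_def d_def)
 have h: "height s t x = t * (r - d) / r"
  using s_range by (auto simp: height_def r_def d_def field_simps)
 then show hp: "height s t x > 0" using r t_pos by simp
 have p: "pot x = 2 * pi^2 / r * (d / ta)"
 proof -
  have "((x - s) / ta > 0) = (~ x <= s)" using ta_pos by (auto simp: zero_less_divide_iff)
  then show ?thesis using ta_pos by (auto simp: pot_def V_bar_def r_def d_def abs_divide)
 qed
 define xi where "xi = d / r"
 have xi: "0 <= xi" "xi < 1" using r by (auto simp: xi_def)
 have h2: "height s t x = t * (1 - xi)" using h r by (simp add: xi_def field_simps)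
 have "1 + 2 * xi <= 1 / (1 - xi)^2"
 proof -
  have "(1 + 2 * xi) * (1 - xi)^2 = 1 - xi^2 * (3 - 2 * xi)" by (simp add: power2_eq_square algebra_simps)
  also have "... <= 1" using xi by simp
  finally show ?thesis using xi by (simp add: field_simps)
 qed
 then have "pi^2 / ta * (1 + 2 * xi) <= pi^2 / ta * (1 / (1 - xi)^2)" using ta_pos by (intro mult_left_mono) auto
 also have "... = ta^2 * (pi / height s t x)^2"
 proof -
  have "ta^2 * (pi^2 / t^2) = pi^2 / ta" using ta_pos ta_cube by (simp add: field_simps power2_eq_square)
  from this[symmetric] show ?thesis unfolding h2 by (simp add: power_divide power_mult_distrib)
 qed
 finally have "pi^2 / ta * (1 + 2 * xi) <= ta^2 * (pi / height s t x)^2" .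
 then show "pot x <= ta^2 * (pi / height s t x)^2 - pi^2 / ta"
 proof -
  have "pi^2 / ta * (1 + 2 * (d / r)) = pi^2 / ta + 2 * pi^2 / r * (d / ta)" using r ta_pos by (simp add: field_simps)
  then show ?thesis using \<open>pi^2 / ta * (1 + 2 * xi) <= ta^2 * (pi / height s t x)^2\<close> unfolding p xi_def by linarith
 qed
qed

text \<open>A fibre is viewed both inside its true interval, which produces the potential, and
  inside \<open>{0<..<t}\<close>, whose first mode does not depend on \<open>x\<close>.\<close>

lemma slice_test:
 assumes ph: "test_function T ph"
 shows "test_function {0<..<t} (%y. ph (x, y))" "-1 < x ==> x < 1 ==> test_function {0<..<height s t x} (%y. ph (x, y))"
  "~ (-1 < x & x < 1) ==> ph (x, y) = 0"
proof -
 obtain K where K: "compact K" "K <= T" "!!p. p ~: K ==> ph p = 0" using test_functionD[OF ph] by blast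
 have phU: "test_function UNIV ph" by (rule test_function_mono[OF ph]) simp
 define K' where "K' = snd ` (K \<inter> ({x} \<times> UNIV))"
 have K': "compact K'" unfolding K'_def
  by (auto intro!: compact_continuous_image continuous_intros compact_Int_closed K(1) closed_Times)
 have z: "ph (x, y) = 0" if "y ~: K'" for y
  using that by (intro K(3)) (force simp: K'_def)
 have b: "0 < y & y < height s t x & height s t x <= t" if "y : K'" for y
  using that K(2) triangle_bounds[OF s_range t_pos, of x y] by (auto simp: K'_def)
 have C: "C_k n (%y. ph (x, y))" for n by (rule test_function_C_k[OF test_function_slice(3)[OF phU]])
 show "test_function {0<..<t} (%y. ph (x, y))" by (rule test_functionI[OF C K' _ z]) (use b in force)
 show "test_function {0<..<height s t x} (%y. ph (x, y))" by (rule test_functionI[OF C K' _ z]) (use b in force)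
 show "ph (x, y) = 0" if "~ (-1 < x & x < 1)"
  using that K(2) triangle_bounds[OF s_range t_pos, of x y] by (intro K(3)) blast
qed

lemma form_test:
 assumes ph: "test_function T ph"
 shows "L2_inner T ph ph = (LBINT p. (ph p)^2)"
  "grad_inner T ph ph = (LBINT p. (pd ph (1, 0) p)^2) + (LBINT p. (pd ph (0, 1) p)^2)"
 using test_function_inner[OF open_triangle ph ph] by (simp_all add: sum_Basis_plane power2_eq_square)

lemma test_partials:
 assumes "test_function T ph"
 shows "test_function T (pd ph (1, 0))" "test_function T (pd ph (0, 1))"
 by (rule test_function_partial_deriv[OF assms]; simp add: Basis_prod_def)+

text \<open>The first bound keeps the horizontal energy and uses the first mode of the true fibre.
  The second drops the horizontal energy and uses the gap on \<open>{0<..<t}\<close>, where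
  subtracting \<open>pi^2 / t^2\<close> removes exactly the energy of the first mode.\<close>

lemma form_test_lower:
 assumes ph: "test_function T ph"
 shows "ta^2 * (LBINT p. (pd ph (1, 0) p)^2) + (LBINT x. pot x * (LBINT y. (ph (x, y))^2)) <= a ph ph"
  "3 * pi^2 / ta * ((LBINT p. (ph p)^2) - (LBINT x. 2 / t * (LBINT y. ph (x, y) * sin (pi / t * y))^2)) <= a ph ph"
  "integrable lborel (%x. pot x * (LBINT y. (ph (x, y))^2))"
proof -
 have phU: "test_function UNIV ph" by (rule test_function_mono[OF ph]) simp
 note Sph = test_function_sq_slices[OF ph] and Sy = test_function_sq_slices[OF test_partials(2)[OF ph]]
 have dsl: "pd (%y. ph (x, y)) 1 y = pd ph (0, 1) (x, y)" for x y by (rule test_function_slice(4)[OF phU])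
 have tt: "ta^2 * (pi / t)^2 = pi^2 / ta" using ta_pos ta_cube by (simp add: field_simps power2_eq_square)
 have fib1: "pot x * (LBINT y. (ph (x, y))^2) <= ta^2 * (LBINT y. (pd ph (0, 1) (x, y))^2) - pi^2 / ta * (LBINT y. (ph (x, y))^2)" for x
 proof (cases "-1 < x & x < 1")
  case True
  then have x: "-1 < x" "x < 1" by auto
  have "(pi / height s t x)^2 * (LBINT y. (ph (x, y))^2) <= (LBINT y. (pd ph (0, 1) (x, y))^2)"
   using fiber_first_mode[OF slice_test(2)[OF ph x] pot_le(2)[OF x]] unfolding dsl .
  then have "ta^2 * ((pi / height s t x)^2 * (LBINT y. (ph (x, y))^2)) <= ta^2 * (LBINT y. (pd ph (0, 1) (x, y))^2)"
   by (intro mult_left_mono) auto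
  moreover have "pot x * (LBINT y. (ph (x, y))^2) <= (ta^2 * (pi / height s t x)^2 - pi^2 / ta) * (LBINT y. (ph (x, y))^2)"
   by (intro mult_right_mono pot_le[OF x] lebesgue_nonneg) simp
  ultimately show ?thesis by (simp add: left_diff_distrib mult.assoc)
 next
  case False
  then have "ph (x, y) = 0" for y by (rule slice_test(3)[OF ph])
  then have "(LBINT y. (ph (x, y))^2) = 0" by simp
  moreover have "0 <= (LBINT y. (pd ph (0, 1) (x, y))^2)" by (rule lebesgue_nonneg) simp
  ultimately show ?thesis by simp
 qed
 show ip: "integrable lborel (%x. pot x * (LBINT y. (ph (x, y))^2))"
 proof (rule lebesgue_bound)
  show "integrable lborel (%x. ta^2 * (LBINT y. (pd ph (0, 1) (x, y))^2) - pi^2 / ta * (LBINT y. (ph (x, y))^2))"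
   using Sy(3) Sph(3) by simp
  show "(%x. pot x * (LBINT y. (ph (x, y))^2)) : borel_measurable lborel"
   using borel_measurable_continuous_onI[OF pot_continuous] Sph(3) by (intro borel_measurable_times) auto
  show "AE x in lborel. norm (pot x * (LBINT y. (ph (x, y))^2)) <= norm (ta^2 * (LBINT y. (pd ph (0, 1) (x, y))^2) - pi^2 / ta * (LBINT y. (ph (x, y))^2))"
  proof (rule always_eventually, rule allI)
   fix x
   have "0 <= pot x * (LBINT y. (ph (x, y))^2)" by (intro mult_nonneg_nonneg pot_nonneg lebesgue_nonneg) simp
   then show "norm (pot x * (LBINT y. (ph (x, y))^2)) <= norm (ta^2 * (LBINT y. (pd ph (0, 1) (x, y))^2) - pi^2 / ta * (LBINT y. (ph (x, y))^2))"
    using fib1[of x] unfolding real_norm_def by linarith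
  qed
 qed
 have aeq: "a ph ph = ta^2 * (LBINT p. (pd ph (1, 0) p)^2) + (ta^2 * (LBINT p. (pd ph (0, 1) p)^2) - pi^2 / ta * (LBINT p. (ph p)^2))"
  unfolding a_alt form_test[OF ph] by (simp add: distrib_left)
 have "(LBINT x. pot x * (LBINT y. (ph (x, y))^2)) <= (LBINT x. ta^2 * (LBINT y. (pd ph (0, 1) (x, y))^2) - pi^2 / ta * (LBINT y. (ph (x, y))^2))"
  using Sy(3) Sph(3) by (intro integral_mono ip fib1) simp
 also have "... = ta^2 * (LBINT p. (pd ph (0, 1) p)^2) - pi^2 / ta * (LBINT p. (ph p)^2)"
  using Sy(3) Sph(3) by (simp add: Sy(5) Sph(5))
 finally show "ta^2 * (LBINT p. (pd ph (1, 0) p)^2) + (LBINT x. pot x * (LBINT y. (ph (x, y))^2)) <= a ph ph"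
  unfolding aeq by simp
 define F where "F x = 2 / t * (LBINT y. ph (x, y) * sin (pi / t * y))^2" for x
 have fib2: "3 * (pi / t)^2 * ((LBINT y. (ph (x, y))^2) - F x) <= (LBINT y. (pd ph (0, 1) (x, y))^2) - (pi / t)^2 * (LBINT y. (ph (x, y))^2)" for x
  using fiber_gap[OF slice_test(1)[OF ph] t_pos, of x] unfolding dsl F_def by linarith
 have iF: "integrable lborel F"
 proof -
  have wm: "(%y. sin (pi / t * y) * indicator {0..t} y) : borel_measurable borel" by measurable
  have e: "(%y. (sin (pi / t * y) * indicator {0..t} y)^2) = (%y. (sin (pi / t * y))^2 * indicator {0..t} y)"
   by (auto simp: fun_eq_iff split: split_indicator)
  have wi: "integrable lborel (%y. (sin (pi / t * y) * indicator {0..t} y)^2)"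
   unfolding e using integral_sin_sq[OF t_pos] by (simp add: has_bochner_integral_iff)
  have "(LBINT y. ph (x, y) * (sin (pi / t * y) * indicator {0..t} y)) = (LBINT y. ph (x, y) * sin (pi / t * y))" for x
  proof (rule lebesgue_cong[OF refl])
   fix y
   obtain K where K: "compact K" "K <= {0<..<t}" "!!y. y ~: K ==> ph (x, y) = 0" using test_functionD[OF slice_test(1)[OF ph]] by blast
   show "ph (x, y) * (sin (pi / t * y) * indicator {0..t} y) = ph (x, y) * sin (pi / t * y)"

   proof (cases "y : K")
    case True
    then have "y : {0..t}" using K(2) by auto
    then show ?thesis by simp
   qed (simp add: K(3))
  qed
  then show ?thesis using weighted_slice(2)[OF phU wm wi] unfolding F_def[abs_def] by simp
 qed
 have "(LBINT x. 3 * (pi / t)^2 * ((LBINT y. (ph (x, y))^2) - F x)) <= (LBINT x. (LBINT y. (pd ph (0, 1) (x, y))^2) - (pi / t)^2 * (LBINT y. (ph (x, y))^2))"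
  using Sy(3) Sph(3) iF by (intro integral_mono fib2) auto
 then have "3 * (pi / t)^2 * ((LBINT p. (ph p)^2) - integral\<^sup>L lborel F) <= (LBINT p. (pd ph (0, 1) p)^2) - (pi / t)^2 * (LBINT p. (ph p)^2)"
  using Sy(3) Sph(3) iF by (simp add: Sy(5) Sph(5))
 then have lift: "ta^2 * (3 * (pi / t)^2 * ((LBINT p. (ph p)^2) - integral\<^sup>L lborel F)) <= ta^2 * ((LBINT p. (pd ph (0, 1) p)^2) - (pi / t)^2 * (LBINT p. (ph p)^2))"
  by (intro mult_left_mono) auto
 have "3 * (ta^2 * (pi / t)^2) * ((LBINT p. (ph p)^2) - integral\<^sup>L lborel F) <= ta^2 * (LBINT p. (pd ph (0, 1) p)^2) - (ta^2 * (pi / t)^2) * (LBINT p. (ph p)^2)"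

 proof -
  have gen: "3 * (K * q) * (A - F) <= K * B - (K * q) * A" if "K * (3 * q * (A - F)) <= K * (B - q * A)" for K q A B F :: real
   using that by (simp add: algebra_simps)
  show ?thesis by (rule gen[OF lift])
 qed
 moreover have "0 <= ta^2 * (LBINT p. (pd ph (1, 0) p)^2)"
  by (intro mult_nonneg_nonneg lebesgue_nonneg) auto
 ultimately have "3 * (pi^2 / ta) * ((LBINT p. (ph p)^2) - integral\<^sup>L lborel F) <= a ph ph"
  unfolding aeq tt by linarith
 then show "3 * pi^2 / ta * ((LBINT p. (ph p)^2) - (LBINT x. 2 / t * (LBINT y. ph (x, y) * sin (pi / t * y))^2)) <= a ph ph"
  unfolding F_def[abs_def] by simp
qed

end

text \<open>Renumbers the square cells so that their functionals form the singly indexed family of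
  Ehrling's inequality.\<close>

lemma sum_divmod:
 fixes f :: "nat => nat => real"
 shows "(\<Sum>i<N. \<Sum>j<N. f i j) = (\<Sum>k<N * N. f (k div N) (k mod N))"
proof -
 have "(\<Sum>j<N. f m j) = (\<Sum>k\<in>{m * N..<m * N + N}. f (k div N) (k mod N))" for m
 proof (rule sum.reindex_bij_witness[symmetric, of _ "%j. m * N + j" "%k. k - m * N"])
  fix k assume k: "k : {m * N..<m * N + N}"
  then obtain r where r: "k = m * N + r" "r < N" by (metis atLeastLessThan_iff le_Suc_ex nat_add_left_cancel_less)
  then have "(m * N + r) div N = m" "(m * N + r) mod N = r" by auto
  then show "f m (k - m * N) = f (k div N) (k mod N)" by (simp add: r(1))
 qed auto
 then show ?thesis by (simp add: sum.nat_group)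
qed

context tri_form begin

lemma test_zero: "test_function T ph ==> p ~: T ==> ph p = 0"
proof -
 assume ph: "test_function T ph" and p: "p ~: T"
 obtain K where K: "compact K" "K <= T" "!!p. p ~: K ==> ph p = 0" using test_functionD[OF ph] by blast
 show "ph p = 0" by (rule K(3)) (use p K(2) in auto)
qed

text \<open>Strict positivity is not evident once \<open>pi^2 / t^2\<close> is subtracted; the
  horizontal energy supplies it. Hardy's inequality at \<open>c = -1\<close> with
  \<open>\<bar>x + 1\<bar> <= 2\<close> is a Poincare inequality with constant
  \<open>4 * 4 = 16\<close>.\<close>

lemma a_lower_test:
 assumes ph: "test_function T ph"
 shows "ta^2 / 16 * L2_inner T ph ph <= a ph ph"
proof -
 have phU: "test_function UNIV ph" by (rule test_function_mono[OF ph]) simp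
 note Sph = test_function_sq_slices[OF ph] and Sx = test_function_sq_slices[OF test_partials(1)[OF ph]]
 obtain K where K: "compact K" "K <= T" "!!p. p ~: K ==> ph p = 0" using test_functionD[OF ph] by blast
 have row: "(LBINT x. (ph (x, y))^2) <= 16 * (LBINT x. (pd ph (1, 0) (x, y))^2)" for y
 proof -
  define K' where "K' = fst ` (K \<inter> (UNIV \<times> {y}))"
  have K': "compact K'" unfolding K'_def
   by (auto intro!: compact_continuous_image continuous_intros compact_Int_closed K(1) closed_Times)
  have z: "ph (x, y) = 0" if "x ~: K'" for x
   using that by (intro K(3)) (force simp: K'_def)
  have b: "-1 < x & x < 1" if "x : K'" for x
   using that K(2) triangle_bounds[OF s_range t_pos, of x y] by (auto simp: K'_def)
  have C: "C_k n (%x. ph (x, y))" for n by (rule test_function_C_k[OF test_function_slice(1)[OF phU]])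
  have t: "test_function {-1<..<1} (%x. ph (x, y))" by (rule test_functionI[OF C K' _ z]) (use b in force)
  have c: "(-1::real) ~: {-1<..<1}" by simp
  note H = Hardy[OF t _ c]
  have "(LBINT x. (ph (x, y))^2) <= (LBINT x. 4 * (ph (x, y) / (x - (-1)))^2)"
  proof (rule integral_mono[OF Sph(2)])
   show "integrable lborel (%x. 4 * (ph (x, y) / (x - (-1)))^2)" using H(1) by simp
   fix x
   show "(ph (x, y))^2 <= 4 * (ph (x, y) / (x - (-1)))^2"
   proof (cases "ph (x, y) = 0")
    case False
    then have x: "-1 < x" "x < 1" using z b by blast+
    then have "(x + 1)^2 <= 2^2" by (intro power_mono) auto
    then have "(ph (x, y))^2 * (x + 1)^2 <= (ph (x, y))^2 * 4" by (intro mult_left_mono) auto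
    then have "(ph (x, y))^2 <= (ph (x, y))^2 * 4 / (x + 1)^2" using x by (subst pos_le_divide_eq) auto
    then show ?thesis by (simp add: power_divide mult.commute)
   qed simp
  qed
  also have "... <= 16 * (LBINT x. (pd ph (1, 0) (x, y))^2)"
   using H(2) by (simp add: test_function_slice(2)[OF phU])
  finally show ?thesis .
 qed
 have "(LBINT p. (ph p)^2) <= (LBINT y. 16 * (LBINT x. (pd ph (1, 0) (x, y))^2))"
  unfolding Sph(6) using Sx(4) by (intro integral_mono Sph(4) row) auto
 then have "(LBINT p. (ph p)^2) <= 16 * (LBINT p. (pd ph (1, 0) p)^2)" by (simp add: Sx(6))
 then have "ta^2 / 16 * (LBINT p. (ph p)^2) <= ta^2 / 16 * (16 * (LBINT p. (pd ph (1, 0) p)^2))"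
  by (intro mult_left_mono) auto
 moreover have "0 <= (LBINT x. pot x * (LBINT y. (ph (x, y))^2))"
  by (intro lebesgue_nonneg mult_nonneg_nonneg pot_nonneg) simp
 ultimately show ?thesis using form_test_lower(1)[OF ph] by (simp add: form_test(1)[OF ph])
qed

lemma H10_in_H1: "u : H10 T ==> u : H1 T" by (rule H10_H1)
lemma H10_in_L2: "u : H10 T ==> u : L2 T" by (rule H1_L2[OF H10_H1])

lemma test_approx:
 assumes u: "u : H10 T"
 obtains ph where "!!n. test_function T (ph n)" "(%n. energy T (%x. ph n x - u x)) ----> 0"
proof -
 interpret E: semi_inner "H1 T" "%u v. L2_inner T u v + grad_inner T u v" by (rule semi_inner_energy[OF open_triangle])
 have "EX ph. test_function T ph & energy T (%x. u x - ph x) < 1 / real (Suc n)" for n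
  using u unfolding H10_iff[OF open_triangle] by simp
 then obtain ph where ph: "!!n. test_function T (ph n)" "!!n. energy T (%x. u x - ph n x) < 1 / real (Suc n)" by metis
 have phH: "ph n : H1 T" for n using test_function_H1(1)[OF ph(1) open_triangle] .
 have c: "energy T (%x. ph n x - u x) = energy T (%x. u x - ph n x)" for n
  using E.sq_diff_commute[OF phH[of n] H10_in_H1[OF u]] by (simp add: energy_def)
 have "(%n. energy T (%x. ph n x - u x)) ----> 0"
 proof (rule tendsto_sandwich[OF _ _ tendsto_const LIMSEQ_Suc[OF lim_1_over_n]])
  show "\<forall>\<^sub>F n in sequentially. 0 <= energy T (%x. ph n x - u x)"
   using E.nonneg[OF E.diff[OF phH H10_in_H1[OF u]]] by (simp add: energy_def)
  show "\<forall>\<^sub>F n in sequentially. energy T (%x. ph n x - u x) <= 1 / real (Suc n)"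
   unfolding c using ph(2) by (simp add: less_imp_le)
 qed
 then show ?thesis using ph(1) that by blast
qed

lemma L2_grad_le_energy:
 assumes "u : H1 T"
 shows "0 <= L2_inner T u u" "0 <= grad_inner T u u"
 using semi_inner.nonneg[OF semi_inner_L2 H1_L2[OF assms]] semi_inner.nonneg[OF semi_inner_H1[OF open_triangle] assms] .

lemma a_lower:
 assumes u: "u : H10 T"
 shows "ta^2 / 16 * L2_inner T u u <= a u u"
proof -
 interpret L: semi_inner "L2 T" "L2_inner T" by (rule semi_inner_L2)
 interpret G: semi_inner "H1 T" "grad_inner T" by (rule semi_inner_H1[OF open_triangle])
 obtain ph where ph: "!!n. test_function T (ph n)" and lim: "(%n. energy T (%x. ph n x - u x)) ----> 0"
  using test_approx[OF u] by blast
 have phH: "ph n : H1 T" for n using test_function_H1(1)[OF ph(1) open_triangle] .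
 have d: "(%x. ph n x - u x) : H1 T" for n by (rule G.diff[OF phH H10_in_H1[OF u]])
 have l: "(%n. L2_sq T (%x. ph n x - u x)) ----> 0"
  by (rule tendsto_sandwich[OF _ _ tendsto_const lim]) (use L2_grad_le_energy[OF d] in "auto simp: energy_def")
 have g: "(%n. quad (grad_inner T) (%x. ph n x - u x)) ----> 0"
  by (rule tendsto_sandwich[OF _ _ tendsto_const lim]) (use L2_grad_le_energy[OF d] in "auto simp: energy_def")
 note ll = L.tendsto_B_sq[OF H1_L2[OF phH] H10_in_L2[OF u] l] and gg = G.tendsto_B_sq[OF phH H10_in_H1[OF u] g]
 have "(%n. quad a (ph n)) ----> a u u" unfolding a_alt by (intro tendsto_intros ll gg)
 moreover have "(%n. ta^2 / 16 * L2_sq T (ph n)) ----> ta^2 / 16 * L2_inner T u u" by (intro tendsto_intros ll)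
 ultimately show ?thesis by (rule tendsto_le[OF sequentially_bot]) (use a_lower_test[OF ph] in auto)
qed

lemma semi_inner_a: "semi_inner (H10 T) a"
proof
 interpret L: semi_inner "L2 T" "L2_inner T" by (rule semi_inner_L2)
 interpret G: semi_inner "H1 T" "grad_inner T" by (rule semi_inner_H1[OF open_triangle])
 show "(%x. 0) : H10 T" by (rule test_function_H10[OF test_function_0 open_triangle])
 show "(%x. c * u x + d * v x) : H10 T" if "u : H10 T" "v : H10 T" for u v c d
  by (rule H10_lin[OF that open_triangle])
 show "a u v = a v u" if "u : H10 T" "v : H10 T" for u v
  using L.sym[OF that[THEN H10_in_L2]] G.sym[OF that[THEN H10_in_H1]] by (simp add: a_alt)
 show "a (%x. c * u x + d * v x) w = c * a u w + d * a v w" if "u : H10 T" "v : H10 T" "w : H10 T" for u v w c d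
  unfolding a_alt L.bilin[OF that[THEN H10_in_L2]] G.bilin[OF that[THEN H10_in_H1]] by (simp add: algebra_simps add_divide_distrib)
 show "0 <= a u u" if u: "u : H10 T" for u
 proof -
  have "0 <= ta^2 / 16 * L2_inner T u u" using L.nonneg[OF H10_in_L2[OF u]] by simp
  then show ?thesis using a_lower[OF u] by linarith
 qed
qed

lemma semi_inner_L2_H10: "semi_inner (H10 T) (L2_inner T)"
 by (rule semi_inner_mono[OF semi_inner_L2])
   (auto simp: H10_in_L2 H10_lin[OF _ _ open_triangle] test_function_H10[OF test_function_0 open_triangle])

text \<open>Solving \<open>a\<close> for the gradient term gives \<open>a / ta^2\<close> plus
  \<open>pi^2 / ta^3\<close> times the \<open>L2\<close> part; the middle summand \<open>1\<close>
  pays for the \<open>L2\<close> part of \<open>energy\<close>.\<close>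

definition "energy_const = 1 / ta^2 + 1 + pi^2 / (ta * ta^2)"

lemma energy_const_pos: "energy_const > 0"
 using ta_pos by (auto simp: energy_const_def intro!: add_pos_nonneg add_nonneg_pos divide_nonneg_nonneg)

lemma energy_le:
 assumes u: "u : H10 T"
 shows "energy T u <= energy_const * (a u u + L2_inner T u u)"
proof -
 have a0: "0 <= a u u" by (rule semi_inner.nonneg[OF semi_inner_a u])
 have l0: "0 <= L2_inner T u u" by (rule L2_grad_le_energy(1)[OF H10_in_H1[OF u]])
 have g: "grad_inner T u u = a u u / ta^2 + pi^2 / (ta * ta^2) * L2_inner T u u"
  using ta_pos by (simp add: a_alt field_simps)
 have "energy_const * (a u u + L2_inner T u u) - energy T u = (1 + pi^2 / (ta * ta^2)) * a u u + 1 / ta^2 * L2_inner T u u"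
 proof -
  have gen: "(1 / K + 1 + P) * (A + L) - (L + (A / K + P * L)) = (1 + P) * A + 1 / K * L" for K P A L :: real
   by (simp add: algebra_simps add_divide_distrib)
  show ?thesis unfolding energy_def g energy_const_def by (rule gen)
 qed
 moreover have "0 <= (1 + pi^2 / (ta * ta^2)) * a u u" "0 <= 1 / ta^2 * L2_inner T u u"
  using a0 l0 ta_pos by (intro mult_nonneg_nonneg add_nonneg_nonneg divide_nonneg_nonneg; simp)+
 ultimately show ?thesis by linarith
qed

lemma form_le_energy:
 assumes u: "u : H10 T"
 shows "a u u + L2_inner T u u <= (ta^2 + 1) * energy T u"
proof -
 note n = L2_grad_le_energy[OF H10_in_H1[OF u]]
 have "(ta^2 + 1) * energy T u - (a u u + L2_inner T u u) = ta^2 * L2_inner T u u + grad_inner T u u + pi^2 / ta * L2_inner T u u"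
  unfolding energy_def a_alt by (simp add: algebra_simps)
 moreover have "0 <= ta^2 * L2_inner T u u" "0 <= pi^2 / ta * L2_inner T u u"
  using n ta_pos by (intro mult_nonneg_nonneg divide_nonneg_nonneg; simp)+
 ultimately show ?thesis using n by linarith
qed

text \<open>The triangle lies in the square \<open>(-M, M)^2\<close> because
  \<open>\<bar>x\<bar> < 1\<close> and \<open>0 < y < t\<close>. Test functions extend to it by
  zero, and \<open>Poincare_plane\<close> provides \<open>N * N\<close> functionals.\<close>

lemma Ehrling:
 assumes ep: "ep > 0"
 shows "EX N w. (ALL j<N. w j : L2 T) & (ALL u:H10 T. L2_inner T u u <= ep * energy T u + (\<Sum>j<(N::nat). (L2_inner T (w j) u)^2))"
proof -
 define M where "M = 1 + t"
 define N where "N = nat \<lceil>2 * M / sqrt ep\<rceil> + 1"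
 define de where "de = 2 * M / real N"
 have M: "M > 1" "M > t" using t_pos by (auto simp: M_def)
 have N: "real N > 0" "real N >= 2 * M / sqrt ep" unfolding N_def by linarith+
 have de: "de > 0" using M N by (simp add: de_def)
 have deep: "de^2 <= ep"
 proof -
  have "2 * M <= real N * sqrt ep" using N(2) ep by (simp add: field_simps)
  then have "de <= sqrt ep" using N(1) by (simp add: de_def field_simps)
  then have "de^2 <= (sqrt ep)^2" using de by (intro power_mono) auto
  then show ?thesis using ep by simp
 qed
 have AN: "- M + real N * de = M" using N by (simp add: de_def)
 define w where "w k p = (indicator (cell (-M) de (k div N)) (fst p) * indicator (cell (-M) de (k mod N)) (snd p) / de :: real)" for k and p :: "real \<times> real"
 have wm [measurable]: "w k : borel_measurable borel" for k
 proof -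
  have "cell (-M) de (k div N) \<times> cell (-M) de (k mod N) : sets borel" by (intro borel_open open_Times) (auto simp: cell_def)
  moreover have "w k = (%p. indicator (cell (-M) de (k div N) \<times> cell (-M) de (k mod N)) p / de)"
   by (auto simp: fun_eq_iff w_def indicator_times)
  ultimately show ?thesis by simp
 qed
 have wL: "w k : L2 T" for k
 proof -
  let ?R = "cell (-M) de (k div N) \<times> cell (-M) de (k mod N)"
  have "emeasure lborel ?R < \<infinity>" by (intro emeasure_bounded_finite bounded_Times) (simp_all add: cell_def)
  moreover have "?R : sets lborel" unfolding sets_lborel by (intro borel_open open_Times) (auto simp: cell_def)
  ultimately have "integrable lborel (%p. indicator ?R p / de^2 :: real)"
   by (intro integrable_divide integrable_real_indicator) auto
  moreover have "(%p. (w k p)^2) = (%p. indicator ?R p / de^2 :: real)"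
   by (auto simp: fun_eq_iff w_def power_divide indicator_times split: split_indicator)
  ultimately have "integrable lborel (%p. (w k p)^2)" by simp
  then show ?thesis using L2_subset(1)[OF borel_L2(1)[OF wm]] open_triangle by simp
 qed
 have tst: "L2_inner T ph ph <= ep * energy T ph + (\<Sum>k<N * N. (L2_inner T (w k) ph)^2)" if ph: "test_function T ph" for ph
 proof -
  have phU: "test_function UNIV ph" by (rule test_function_mono[OF ph]) simp
  have in_sq: "-M < x & x < M & -M < y & y < M" if "(x, y) : T" for x y
   using triangle_bounds[OF s_range t_pos that] M t_pos by linarith
  have z: "ph (x, y) = 0" if "x ~: {-M<..<-M + real N * de} | y ~: {-M<..<-M + real N * de}" for x y
   using that in_sq[of x y] unfolding AN by (intro test_zero[OF ph]) auto
  have Lw: "L2_inner T (w k) ph = (LBINT p. w k p * ph p)" for k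
  proof -
   have "L2_inner T (w k) ph = (LINT p|lebesgue. w k p * ph p)"
    unfolding L2_inner_def by (rule lebesgue_on_support(2)) (auto simp: open_sets_lebesgue open_triangle test_zero[OF ph])
   also have "... = (LBINT p. w k p * ph p)" using test_function_cont(2)[OF ph] by (intro lebesgue_lborel) measurable
   finally show ?thesis .
  qed
  have W: "(LBINT p. indicator (cell (-M) de (k div N)) (fst p) * indicator (cell (-M) de (k mod N)) (snd p) * ph p)^2 / de^2
    = (L2_inner T (w k) ph)^2" for k
  proof -
   have "(LBINT p. w k p * ph p) = (LBINT p. indicator (cell (-M) de (k div N)) (fst p) * indicator (cell (-M) de (k mod N)) (snd p) * ph p / de)"
    by (intro lebesgue_cong) (auto simp: w_def)
   then show ?thesis unfolding Lw by (simp add: power_divide)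
  qed
  have "L2_inner T ph ph <= de^2 * grad_inner T ph ph + (\<Sum>k<N * N. (L2_inner T (w k) ph)^2)"
   using Poincare_plane[where A = "-M" and N = N, OF phU de z] unfolding form_test[OF ph] sum_divmod W .
  moreover have "de^2 * grad_inner T ph ph <= ep * energy T ph"
   using deep ep L2_grad_le_energy[OF test_function_H1(1)[OF ph open_triangle]] by (intro mult_mono) (auto simp: energy_def)
  ultimately show ?thesis by linarith
 qed
 have "L2_inner T u u <= ep * energy T u + (\<Sum>k<N * N. (L2_inner T (w k) u)^2)" if "u : H10 T" for u
  by (rule Ehrling_extend[OF open_triangle wL tst that])
 then show ?thesis using wL by blast
qed

text \<open>On \<open>H10\<close> the quantities \<open>energy\<close> and
  \<open>a + L2_inner\<close> bound each other, so completeness and compactness are inherited from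
  the Sobolev norm.\<close>

lemma spectral_a: "spectral T (H10 T) a"
proof (intro spectral.intro spectral_axioms.intro semi_inner_a semi_inner_L2_H10)
 interpret A: semi_inner "H10 T" a by (rule semi_inner_a)
 interpret b: semi_inner "H10 T" "L2_inner T" by (rule semi_inner_L2_H10)
 have Q: "semi_inner (H10 T) (%u v. a u v + L2_inner T u v)"
 proof
  show "a (%x. c * u x + d * v x) w + L2_inner T (%x. c * u x + d * v x) w = c * (a u w + L2_inner T u w) + d * (a v w + L2_inner T v w)"
   if "u : H10 T" "v : H10 T" "w : H10 T" for u v w c d
   unfolding A.bilin[OF that] b.bilin[OF that] by (simp add: algebra_simps)
  show "a u v + L2_inner T u v = a v u + L2_inner T v u" if "u : H10 T" "v : H10 T" for u v
   using A.sym[OF that] b.sym[OF that] by simp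
 qed (simp_all add: A.zero A.lin A.nonneg b.nonneg)
 show "L2_inner T u u = 0 \<longleftrightarrow> (AE x in lebesgue_on T. u x = 0)" if "u : H10 T" for u
  by (rule L2_null_iff[OF H10_in_L2[OF that]])
 show "a u u > 0" if u: "u : H10 T" "L2_inner T u u > 0" for u
 proof -
  have "0 < ta^2 / 16 * L2_inner T u u" using u ta_pos by simp
  then show ?thesis using a_lower[OF u(1)] by linarith
 qed
 show "EX u:H10 T. (%n. quad a (%x. v n x - u x) + L2_sq T (%x. v n x - u x)) ----> 0"
  if v: "!!n. v n : H10 T" and cau: "!!ep. ep > 0 ==> EX N. ALL m>=N. ALL n>=N.
     quad a (%x. v m x - v n x) + L2_sq T (%x. v m x - v n x) < ep" for v
 proof -
  have "EX N. ALL m>=N. ALL n>=N. energy T (%x. v m x - v n x) < ep" if ep: "ep > 0" for ep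
  proof -
   have "ep / energy_const > 0" using ep energy_const_pos by simp
   from cau[OF this] obtain N where N: "!!m n. m >= N ==> n >= N ==>
     quad a (%x. v m x - v n x) + L2_sq T (%x. v m x - v n x) < ep / energy_const" by blast
   have "energy T (%x. v m x - v n x) < ep" if mn: "m >= N" "n >= N" for m n
   proof -
    have "energy_const * (quad a (%x. v m x - v n x) + L2_sq T (%x. v m x - v n x)) < energy_const * (ep / energy_const)"
     using N[OF mn] energy_const_pos by (intro mult_strict_left_mono)
    then show ?thesis using energy_le[OF A.diff[OF v v], of m n] energy_const_pos by simp
   qed
   then show ?thesis by blast
  qed
  from H1_complete[OF open_triangle H10_in_H1[OF v] this] obtain u where u: "u : H1 T"
   and lim: "(%n. energy T (%x. v n x - u x)) ----> 0" by blast
  have uH: "u : H10 T" by (rule H10_closed[OF open_triangle u v lim])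
  have "(%n. (ta^2 + 1) * energy T (%x. v n x - u x)) ----> 0"
   using tendsto_mult[OF tendsto_const lim, of "ta^2 + 1"] by simp
  then have "(%n. quad a (%x. v n x - u x) + L2_sq T (%x. v n x - u x)) ----> 0"
   by (rule tendsto_sandwich[OF _ _ tendsto_const, rotated 2])
     (use A.nonneg[OF A.diff[OF v uH]] b.nonneg[OF A.diff[OF v uH]] form_le_energy[OF A.diff[OF v uH]] in auto)
  then show ?thesis using uH by blast
 qed
 show "EX r::nat => nat. strict_mono r & (ALL ep>0. EX N. ALL m>=N. ALL n>=N.
     L2_sq T (%x. v (r m) x - v (r n) x) < ep)"
  if v: "!!n. v n : H10 T" "!!n. quad a (v n) + L2_sq T (v n) <= M" for v M
 proof (rule compact_from_Ehrling[where D = "H10 T" and Q = "%u v. a u v + L2_inner T u v" and U = T and v = v and M = M])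
  show "semi_inner (H10 T) (%u v. a u v + L2_inner T u v)" by (rule Q)
  show "v n : H10 T" "quad a (v n) + L2_sq T (v n) <= M" for n by (rule v)+
  show "H10 T <= L2 T" using H10_in_L2 by blast
  show "L2_inner T u u <= a u u + L2_inner T u u" if "u : H10 T" for u using A.nonneg[OF that] by simp
  fix ep :: real assume ep: "ep > 0"
  then have "ep / energy_const > 0" using energy_const_pos by simp
  from Ehrling[OF this] obtain N w where w: "ALL j<N. w j : L2 T"
   and le: "!!u. u : H10 T ==> L2_inner T u u <= ep / energy_const * energy T u + (\<Sum>j<(N::nat). (L2_inner T (w j) u)^2)" by blast
  have "L2_inner T u u <= ep * (a u u + L2_inner T u u) + (\<Sum>j<N. (L2_inner T (w j) u)^2)" if u: "u : H10 T" for u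
  proof -
   have "ep / energy_const * energy T u <= ep / energy_const * (energy_const * (a u u + L2_inner T u u))"
    using energy_le[OF u] ep energy_const_pos by (intro mult_left_mono) auto
   also have "... = ep * (a u u + L2_inner T u u)" using energy_const_pos by simp
   finally show ?thesis using le[OF u] by linarith
  qed
  then show "EX N w. (ALL j<N. w j : L2 T) & (ALL u:H10 T. L2_inner T u u <= ep * (a u u + L2_inner T u u) + (\<Sum>j<(N::nat). (L2_inner T (w j) u)^2))"
   using w by blast
 qed
 show "EX v. (ALL i<n. v i : H10 T) & (ALL c. L2_sq T (lincomb n c v) = 0 --> (ALL i<n. c i = 0))" for n
  using infinite_dim_test[OF open_triangle, of s t n] triangle_nonempty[OF s_range t_pos] test_function_H10[OF _ open_triangle] by blast
qed

sublocale spectral T "H10 T" a by (rule spectral_a)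

lemma mu_eq: "mu s t k = kth_eigenvalue T (H10 T) a k"
 by (simp add: mu_def a_def[abs_def])

lemma dense:
 assumes u: "u : H10 T" and ep: "ep > 0"
 shows "EX ph:{ph. test_function T ph}. quad a (%x. ph x - u x) + L2_sq T (%x. ph x - u x) < ep"
proof -
 obtain ph where ph: "!!n. test_function T (ph n)" and lim: "(%n. energy T (%x. ph n x - u x)) ----> 0"
  using test_approx[OF u] by blast
 have c: "ta^2 + 1 > 0" by (simp add: add_nonneg_pos)
 then have "ep / (ta^2 + 1) > 0" using ep by simp
 then obtain n where n: "energy T (%x. ph n x - u x) < ep / (ta^2 + 1)"
  using order_tendstoD(2)[OF lim] by (force simp: eventually_sequentially)
 have "(ta^2 + 1) * energy T (%x. ph n x - u x) < ep" using n c by (simp add: pos_less_divide_eq mult.commute)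
 moreover have "(%x. ph n x - u x) : H10 T" by (rule A.diff[OF test_function_H10[OF ph open_triangle] u])
 ultimately show ?thesis using form_le_energy ph[of n] by (intro bexI[of _ "ph n"]) force+
qed

end

subsection \<open>The lower bound\<close>

lemma test_function_lincomb:
 assumes "!!i. i < k ==> test_function U (v i)"
 shows "test_function U (lincomb k c v)"
 using assms
proof (induction k)
 case 0
 then show ?case by (simp add: test_function_0)
next
 case (Suc k)
 have "test_function U (%x. 1 * (\<Sum>i<k. c i * v i x) + c k * v k x)"
  using Suc by (intro test_function_lin) auto
 then show ?case by simp
qed

context tri_form begin

interpretation bar: bar_form s by unfold_locales (rule s_range)

text \<open>The first Dirichlet mode of \<open>(0, t)\<close>, normalised in \<open>L2\<close> and
  extended by zero.\<close>

definition "mode y = sqrt (2 / t) * sin (pi / t * y) * indicator {0..t} y"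

lemma mode: "mode : borel_measurable borel" "integrable lborel (%y. (mode y)^2)" "(LBINT y. (mode y)^2) = 1"
proof -
 show "mode : borel_measurable borel" unfolding mode_def[abs_def] by measurable
 have e: "(%y. (mode y)^2) = (%y. 2 / t * ((sin (pi / t * y))^2 * indicator {0..t} y))"
  using t_pos by (auto simp: fun_eq_iff mode_def power_mult_distrib split: split_indicator)
 show "integrable lborel (%y. (mode y)^2)" "(LBINT y. (mode y)^2) = 1"
  unfolding e using integral_sin_sq[OF t_pos] t_pos by (simp_all add: has_bochner_integral_iff)
qed

definition "strip ph p = ph (s + ta * fst p, snd p)"

lemma strip_test:
 assumes ph: "test_function T ph"
 shows "test_function UNIV (strip ph)"
proof -
 obtain K where K: "compact K" "K <= T" "!!p. p ~: K ==> ph p = 0" using test_functionD[OF ph] by blast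
 have L: "bounded_linear (%p::real \<times> real. (ta * fst p, snd p))"
  by (intro bounded_linear_Pair bounded_linear_const_mult bounded_linear_fst bounded_linear_snd)
 have e: "strip ph = (%p. ph ((ta * fst p, snd p) + (s, 0)))" by (simp add: fun_eq_iff strip_def add.commute)
 have C: "C_k n (strip ph)" for n unfolding e by (rule C_k_compose_affine[OF L test_function_C_k[OF ph]])
 have cK: "compact ((%p. ((fst p - s) / ta, snd p)) ` K)"
  using ta_pos by (intro compact_continuous_image[OF _ K(1)] continuous_intros) auto
 have "strip ph p = 0" if "p ~: (%p. ((fst p - s) / ta, snd p)) ` K" for p
 proof -
  have "p = (%p. ((fst p - s) / ta, snd p)) (s + ta * fst p, snd p)" using ta_pos by simp
  then have "(s + ta * fst p, snd p) ~: K" using that imageI[of "(s + ta * fst p, snd p)" K "%p. ((fst p - s) / ta, snd p)"] by auto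
  then show ?thesis by (simp add: strip_def K(3))
 qed
 then show ?thesis by (rule test_functionI[OF C cK subset_UNIV])
qed

lemma strip_deriv:
 assumes ph: "test_function T ph"
 shows "pd (strip ph) (1, 0) (X, y) = ta * pd ph (1, 0) (s + ta * X, y)"
proof -
 have phU: "test_function UNIV ph" by (rule test_function_mono[OF ph]) simp
 have d: "((%x. ph (x, y)) has_real_derivative pd ph (1, 0) (s + ta * X, y)) (at (s + ta * X))"
  using test_function_real_derivative[OF test_function_slice(1)[OF phU], of y "s + ta * X"] by (simp add: test_function_slice(2)[OF phU])
 have l: "((%X. s + ta * X) has_real_derivative ta) (at X)" by (auto intro!: derivative_eq_intros)
 have "((%X. ph (s + ta * X, y)) has_real_derivative pd ph (1, 0) (s + ta * X, y) * ta) (at X)"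
  using DERIV_chain2[OF d l] .
 then have "pd (%X. strip ph (X, y)) 1 X = pd ph (1, 0) (s + ta * X, y) * ta"
  by (intro partial_deriv_real) (simp add: strip_def)
 then show ?thesis by (simp add: test_function_slice(2)[OF strip_test[OF ph]] mult.commute)
qed

lemma lborel_affine:
 fixes f :: "real => real"
 shows "(LBINT X. f (s + ta * X)) = (LBINT x. f x) / ta" "integrable lborel f ==> integrable lborel (%X. f (s + ta * X))"
 using lborel_integral_real_affine[of ta f s] lborel_integrable_real_affine[of f ta s] ta_pos by simp_all

text \<open>The component of each fibre along \<open>mode\<close>, in the scaled horizontal
  variable; \<open>sqrt ta\<close> compensates the Jacobian, so that masses on the line and on the
  triangle are comparable.\<close>

definition "proj ph X = sqrt ta * (LBINT y. ph (s + ta * X, y) * mode y)"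

lemma mode_integrable:
 assumes ph: "test_function T ph"
 shows "integrable lborel (%y. ph (x, y) * mode y)"
proof (rule lebesgue_bound)
 have phU: "test_function UNIV ph" by (rule test_function_mono[OF ph]) simp
 show "integrable lborel (%y. (ph (x, y))^2 + (mode y)^2)" using test_function_sq_slices(1)[OF ph] mode(2) by simp
 show "(%y. ph (x, y) * mode y) : borel_measurable lborel"
  using test_function_cont(2)[OF test_function_slice(3)[OF phU]] mode(1) by (intro borel_measurable_times) auto
 have "\<bar>p * q\<bar> <= p^2 + q^2" for p q :: real
 proof -
  have "0 <= (\<bar>p\<bar> - \<bar>q\<bar>)^2" by simp
  then have "2 * (\<bar>p\<bar> * \<bar>q\<bar>) <= p^2 + q^2" by (simp add: power2_diff)
  moreover have "0 <= \<bar>p\<bar> * \<bar>q\<bar>" by simp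
  ultimately show ?thesis unfolding abs_mult by linarith
 qed
 then show "AE y in lborel. norm (ph (x, y) * mode y) <= norm ((ph (x, y))^2 + (mode y)^2)"
  by (intro always_eventually allI) simp
qed

lemma proj_lincomb:
 assumes v: "!!i. i < k ==> test_function T (v i)"
 shows "proj (lincomb k c v) = lincomb k c (%i. proj (v i))"
proof
 fix X
 have "(LBINT y. (\<Sum>i<k. c i * v i (s + ta * X, y)) * mode y) = (LBINT y. (\<Sum>i<k. c i * (v i (s + ta * X, y) * mode y)))"
  by (simp add: sum_distrib_right mult.assoc)
 also have "... = (\<Sum>i<k. c i * (LBINT y. v i (s + ta * X, y) * mode y))"
  by (subst Bochner_Integration.integral_sum) (use mode_integrable[OF v] in auto)
 finally show "proj (lincomb k c v) X = lincomb k c (%i. proj (v i)) X"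
  by (simp add: proj_def sum_distrib_left mult_ac)
qed

text \<open>Cauchy-Schwarz against the normalised \<open>mode\<close> bounds the average and its
  derivative by fibre integrals, which \<open>form_test_lower(1)\<close> compares with
  \<open>a\<close>. The mass missing after projection is what the gap in
  \<open>form_test_lower(2)\<close> controls.\<close>

lemma proj_bounds:
 assumes ph: "test_function T ph"
 shows "proj ph : bar.fdom" "quad bar.form (proj ph) <= a ph ph"
  "L2_inner T ph ph - ta / (3 * pi^2) * a ph ph <= L2_sq UNIV (proj ph)"
proof -
 have phU: "test_function UNIV ph" by (rule test_function_mono[OF ph]) simp
 note Sph = test_function_sq_slices[OF ph] and Sx = test_function_sq_slices[OF test_partials(1)[OF ph]]
 define m where "m X = (LBINT y. ph (s + ta * X, y) * mode y)" for X
 define m' where "m' X = (LBINT y. pd (strip ph) (1, 0) (X, y) * mode y)" for X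
 define f where "f x = (LBINT y. (ph (x, y))^2)" for x
 define g where "g x = (LBINT y. (pd ph (1, 0) (x, y))^2)" for x
 have fi: "integrable lborel f" and gi: "integrable lborel g" unfolding f_def[abs_def] g_def[abs_def] by (rule Sph(3) Sx(3))+
 have st: "strip ph (X, y) = ph (s + ta * X, y)" for X y by (simp add: strip_def)
 note W = weighted_slice[OF strip_test[OF ph] mode(1,2), unfolded st mode(3), folded m_def[abs_def] m'_def[abs_def], unfolded m_def[symmetric] m'_def[symmetric]]
 have mf: "(m X)^2 <= f (s + ta * X)" for X using W(3)[of X] by (simp add: f_def)
 have mg: "(m' X)^2 <= ta^2 * g (s + ta * X)" for X
  using W(6)[of X] by (simp add: g_def strip_deriv[OF ph] power_mult_distrib)
 have mL: "m : L2 UNIV" "L2_inner UNIV m m = (LBINT X. (m X)^2)" by (rule borel_L2[OF W(1,2)])+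
 have m'L: "m' : L2 UNIV" "L2_inner UNIV m' m' = (LBINT X. (m' X)^2)" by (rule borel_L2[OF W(4,5)])+
 have mH: "m : H1 UNIV" using mL m'L W(7) by (auto simp: H1_def)
 obtain K where K: "compact K" "!!x. x ~: K ==> m x = 0" using W(8) by blast
 have mf': "m : bar.fdom" by (rule bar.continuous_compact_fdom[OF mH K])
 have Pm: "proj ph = (%X. sqrt ta * m X + 0 * m X)" by (simp add: fun_eq_iff proj_def m_def)
 show Pf: "proj ph : bar.fdom" unfolding Pm by (rule bar.A.lin[OF mf' mf'])
 have "quad bar.form (proj ph) = sqrt ta * bar.form m (proj ph)"
  using bar.A.bilin[OF mf' mf' Pf, of "sqrt ta" 0] unfolding Pm[symmetric] by simp
 also have "bar.form m (proj ph) = sqrt ta * bar.form m m"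
  using bar.A.bilin2[OF mf' mf' mf', of "sqrt ta" 0] unfolding Pm[symmetric] by simp
 finally have PP: "quad bar.form (proj ph) = ta * bar.form m m" using ta_pos by (simp flip: mult.assoc)
 have Vm [measurable]: "V_bar s : borel_measurable borel" by (rule borel_measurable_continuous_onI[OF V_bar_continuous[OF s_range]])
 have potV: "pot (s + ta * X) = V_bar s X" for X using ta_pos by (simp add: pot_def)
 have gr: "grad_inner UNIV m m = (LBINT X. (m' X)^2)"
  using grad_inner_eq[OF mH mH open_UNIV, of "%_. m'" "%_. m'"] W(7) m'L(2) by simp
 have ipf: "integrable lborel (%x. pot x * f x)" unfolding f_def by (rule form_test_lower(3)[OF ph])
 have "(LINT X|lebesgue. V_bar s X * m X * m X) = (LBINT X. V_bar s X * m X * m X)"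
  using W(1) by (intro lebesgue_lborel) measurable
 also have "... <= (LBINT X. pot (s + ta * X) * f (s + ta * X))"
 proof -
  have le: "V_bar s X * m X * m X <= pot (s + ta * X) * f (s + ta * X)" for X
   using mult_left_mono[OF mf V_bar_nonneg[OF s_range], of X X] by (simp add: potV power2_eq_square mult.assoc)
  have i2: "integrable lborel (%X. pot (s + ta * X) * f (s + ta * X))" by (rule lborel_affine(2)[OF ipf])
  have "integrable lborel (%X. V_bar s X * m X * m X)"
  proof (rule lebesgue_bound[OF i2])
   show "(%X. V_bar s X * m X * m X) : borel_measurable lborel" using W(1) by measurable
   have "0 <= V_bar s X * m X * m X" for X
    using V_bar_nonneg[OF s_range, of X] by (simp add: mult.assoc)
   then show "AE X in lborel. norm (V_bar s X * m X * m X) <= norm (pot (s + ta * X) * f (s + ta * X))"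
    using le by (intro always_eventually allI) (metis abs_ge_self abs_of_nonneg order_trans real_norm_def)
  qed
  then show ?thesis by (intro integral_mono i2 le)
 qed
 also have "... = (LBINT x. pot x * f x) / ta" by (rule lborel_affine(1)[of "%x. pot x * f x"])
 finally have V: "(LINT X|lebesgue. V_bar s X * m X * m X) <= (LBINT x. pot x * f x) / ta" .
 have "(LBINT X. (m' X)^2) <= (LBINT X. ta^2 * g (s + ta * X))"
  using lborel_affine(2)[OF gi] by (intro integral_mono W(5) mg) simp
 also have "... = ta^2 * integral\<^sup>L lborel g / ta" by (simp add: lborel_affine(1)[of g])
 finally have "bar.form m m <= ta^2 * integral\<^sup>L lborel g / ta + (LBINT x. pot x * f x) / ta"
  using V unfolding bar.form_eq bar.bform_def gr by linarith
 then have "ta * bar.form m m <= ta * (ta^2 * integral\<^sup>L lborel g / ta + (LBINT x. pot x * f x) / ta)"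
  using ta_pos by (intro mult_left_mono) auto
 also have "... = ta^2 * integral\<^sup>L lborel g + (LBINT x. pot x * f x)" using ta_pos by (simp add: distrib_left)
 also have "... <= a ph ph" using form_test_lower(1)[OF ph] unfolding Sx(5) f_def g_def .
 finally show "quad bar.form (proj ph) <= a ph ph" unfolding PP .
 define F2 where "F2 x = 2 / t * (LBINT y. ph (x, y) * sin (pi / t * y))^2" for x
 have m2: "(m X)^2 = F2 (s + ta * X)" for X
 proof -
  have "m X = (LBINT y. sqrt (2 / t) * (ph (s + ta * X, y) * sin (pi / t * y)))"
   unfolding m_def
  proof (rule lebesgue_cong[OF refl])
   fix y
   obtain K where K: "compact K" "K <= {0<..<t}" "!!y. y ~: K ==> ph (s + ta * X, y) = 0" using test_functionD[OF slice_test(1)[OF ph]] by blast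
   show "ph (s + ta * X, y) * mode y = sqrt (2 / t) * (ph (s + ta * X, y) * sin (pi / t * y))"
   proof (cases "y : K")
    case True
    then have "y : {0..t}" using K(2) by auto
    then show ?thesis by (simp add: mode_def)
   qed (simp add: K(3))
  qed
  also have "... = sqrt (2 / t) * (LBINT y. ph (s + ta * X, y) * sin (pi / t * y))" by simp
  finally show ?thesis using t_pos by (simp add: F2_def power_mult_distrib)
 qed
 have "L2_sq UNIV (proj ph) = (LINT X|lebesgue. ta * (m X)^2)"
  unfolding L2_inner_def lebesgue_on_UNIV_eq
  by (intro lebesgue_cong) (use ta_pos in "auto simp: proj_def m_def power2_eq_square")
 also have "... = (LBINT X. ta * (m X)^2)" using W(1) by (intro lebesgue_lborel) measurable
 also have "... = integral\<^sup>L lborel F2" using ta_pos by (simp add: m2 lborel_affine(1)[of F2])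
 finally have L: "L2_sq UNIV (proj ph) = integral\<^sup>L lborel F2" .
 have "3 * pi^2 / ta * (L2_inner T ph ph - integral\<^sup>L lborel F2) <= a ph ph"
  using form_test_lower(2)[OF ph] unfolding form_test(1)[OF ph] F2_def .
 then have "ta / (3 * pi^2) * (3 * pi^2 / ta * (L2_inner T ph ph - integral\<^sup>L lborel F2)) <= ta / (3 * pi^2) * a ph ph"
  using ta_pos by (intro mult_left_mono) auto
 then show "L2_inner T ph ph - ta / (3 * pi^2) * a ph ph <= L2_sq UNIV (proj ph)"
  using ta_pos unfolding L by simp
qed

end

subsection \<open>The upper bound\<close>

text \<open>A smooth substitute for the positive part.\<close>

definition ramp :: "real => real" where
 "ramp = (SOME F. F 1 = 0 & (ALL x. (F has_real_derivative smoothstep x) (at x)))"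

lemma ramp_deriv: "ramp 1 = 0" "(ramp has_real_derivative smoothstep x) (at x)"
proof -
 have "continuous_on UNIV smoothstep" by (rule C_k_continuous[OF C_k_smoothstep])
 then obtain F where F: "!!x. (F has_real_derivative smoothstep x) (at x)" using continuous_antiderivative by blast
 have "((%x. F x - F 1) has_real_derivative smoothstep x) (at x)" for x
  using DERIV_diff[OF F[of x] DERIV_const[of "F 1"]] by simp
 then have "EX F. F 1 = 0 & (ALL x. (F has_real_derivative smoothstep x) (at x))" by (intro exI[of _ "%x. F x - F 1"]) simp
 from someI_ex[OF this] show "ramp 1 = 0" "(ramp has_real_derivative smoothstep x) (at x)" by (simp_all add: ramp_def)
qed

text \<open>Everything follows from the derivative lying in \<open>[0, 1]\<close>, equal to
  \<open>0\<close> before \<open>1\<close> and to \<open>1\<close> after \<open>2\<close>: both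
  \<open>ramp\<close> and \<open>x - ramp x\<close> are nondecreasing.\<close>

lemma ramp_bounds:
 shows "C_k n ramp" "x <= 1 ==> ramp x = 0" "0 <= ramp x" "x - 2 <= ramp x" "ramp x <= max 0 (x - 1)"
  "x >= 2 ==> ramp x = ramp 2 + (x - 2)"
proof -
 note d = ramp_deriv(2) and t1 = ramp_deriv(1)
 have C: "C_k n ramp" for n using C_k_SucD[OF C_k_SucI_real[OF d C_k_smoothstep]] .
 have up: "ramp x <= ramp y" if "x <= y" for x y
  by (rule DERIV_nonneg_imp_nondecreasing[OF that]) (use d smoothstep_range in blast)
 have lip: "ramp y - y <= ramp x - x" if "x <= y" for x y
 proof -
  have "- (ramp x - x) <= - (ramp y - y)"
  proof (rule DERIV_nonneg_imp_nondecreasing[OF that])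
   fix z
   have "((%z. - (ramp z - z)) has_real_derivative - (smoothstep z - 1)) (at z)" by (intro DERIV_minus DERIV_diff d DERIV_ident)
   then show "EX D. ((%z. - (ramp z - z)) has_real_derivative D) (at z) & 0 <= D" using smoothstep_range(2)[of z] by (intro exI conjI) auto
  qed
  then show ?thesis by simp
 qed
 have z: "ramp x = 0" if "x <= 1" for x
 proof -
  have "- ramp x <= - ramp 1"
  proof (rule DERIV_nonneg_imp_nondecreasing[OF that])
   fix z assume "x <= z" "z <= 1"
   then show "EX D. ((%z. - ramp z) has_real_derivative D) (at z) & 0 <= D" using DERIV_minus[OF d, of z] smoothstep_0[of z] by auto
  qed
  then show ?thesis using up[OF that] t1 by simp
 qed
 have nn: "0 <= ramp x" for x using z[of x] up[of 1 x] t1 by (cases "x <= 1") auto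
 have big: "ramp x = ramp 2 + (x - 2)" if "x >= 2" for x
 proof -
  have "ramp 2 - 2 <= ramp x - x"
  proof (rule DERIV_nonneg_imp_nondecreasing[OF that])
   fix z assume z: "2 <= z" "z <= x"
   have "((%z. ramp z - z) has_real_derivative smoothstep z - 1) (at z)" by (intro DERIV_diff d DERIV_ident)
   then show "EX D. ((%z. ramp z - z) has_real_derivative D) (at z) & 0 <= D" using smoothstep_1[OF z(1)] by auto
  qed
  then show ?thesis using lip[OF that] by simp
 qed
 have lo: "x - 2 <= ramp x" for x using nn[of x] nn[of 2] big[of x] by (cases "x >= 2") auto
 have hi: "ramp x <= max 0 (x - 1)" for x using z[of x] lip[of 1 x] t1 by (cases "x <= 1") auto
 show "C_k n ramp" by (rule C)
 show "x <= 1 ==> ramp x = 0" by (rule z)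
 show "0 <= ramp x" by (rule nn)
 show "x - 2 <= ramp x" by (rule lo)
 show "ramp x <= max 0 (x - 1)" by (rule hi)
 show "x >= 2 ==> ramp x = ramp 2 + (x - 2)" by (rule big)
qed

text \<open>The height is \<open>p * (x + 1) - (p + q) * max 0 (x - s)\<close>. A smooth majorant of
  the positive part gives a smooth minorant of the height with slope between \<open>- q\<close> and
  \<open>p\<close>. The corner is rounded on the steeper side of \<open>s\<close> only, so that the
  slope never exceeds that of the height in absolute value.\<close>

lemma smooth_height:
 assumes s: "s : {-1<..<1}" and t: "t > 0" and c0: "c0 > 0" and r: "0 < r" "r <= 1/2"
 shows "EX H. (ALL n. C_k n H) & (ALL x. 0 < H x) & (ALL x. c0 <= height s t x --> (1 - r) * height s t x <= H x & H x <= height s t x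
   & (x ~= s --> (pd H 1 x)^2 <= (slope s t x)^2))"
proof -
 note dth = ramp_deriv(2) and Cth = ramp_bounds(1) and thz = ramp_bounds(2) and th0 = ramp_bounds(3) and lo = ramp_bounds(4) and hi = ramp_bounds(5) and big = ramp_bounds(6)
 define p where "p = t / (1 + s)"
 define q where "q = t / (1 - s)"
 have pq: "p > 0" "q > 0" "p * (1 + s) = t" "q * (1 - s) = t" using s t by (auto simp: p_def q_def)
 \<comment> \<open>Sharpness of the rounding: the total error \<open>(p + q) * (2 / n)\<close>
   becomes \<open>r * c0\<close>, at most the fraction \<open>r\<close> of any height above
   \<open>c0\<close>.\<close>
 define n where "n = 2 * (p + q) / (r * c0)"
 have n0: "n > 0" using pq r c0 by (simp add: n_def)
 have n: "n > 0" "(p + q) * (2 / n) = r * c0"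
 proof -
  have e: "2 * (p + q) = n * (r * c0)" using r c0 by (simp add: n_def)
  have "(p + q) * (2 / n) = 2 * (p + q) / n" by (simp only: times_divide_eq_right mult.commute[of 2])
  then show "(p + q) * (2 / n) = r * c0" unfolding e using n0 by simp
 qed (rule n0)
 \<comment> \<open>Places the transition of \<open>z\<close> from \<open>1\<close> to
   \<open>2\<close> on the steeper side: left of \<open>s\<close> if \<open>q <= p\<close>, right of
   it otherwise.\<close>
 define ka :: real where "ka = (if q <= p then 2 else 1)"
 have ka: "1 <= ka" "ka <= 2" by (auto simp: ka_def)
 define z where "z x = n * x + (ka - n * s)" for x
 have z_eq: "z x = n * (x - s) + ka" for x by (simp add: z_def algebra_simps)
 define hn where "hn x = p * (x + 1) - (p + q) / n * (ramp (z x) + 1)" for x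
 define c where "c = c0 / 4"
 have c: "c > 0" using c0 by (simp add: c_def)
 \<comment> \<open>\<open>hn\<close> becomes negative far out. Passing it through a scaled
   \<open>ramp\<close> leaves it unchanged where \<open>hn x >= 2 * c\<close> and makes
   \<open>H\<close> positive everywhere, as the powers of \<open>H\<close> in the trial functions
   require.\<close>
 define H where "H x = c * ramp (1 / c * hn x) + c * (2 - ramp 2)" for x
 have Cid: "C_k j (%x::real. x)" for j by (rule C_k_bounded_linear[OF bounded_linear_ident])
 have Chn: "C_k j hn" for j
  unfolding hn_def[abs_def] z_def by (intro C_k_diff C_k_cmult C_k_add C_k_const Cid C_k_shift Cth)
 have CH: "C_k j H" for j
  unfolding H_def[abs_def] by (intro C_k_add C_k_cmult C_k_const C_k_compose[OF Cth] Chn)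
 have Hpos: "0 < H x" for x
 proof -
  have "ramp 2 <= 1" using hi[of 2] by simp
  then have "0 < c * (2 - ramp 2)" using c by simp
  moreover have "0 <= c * ramp (1 / c * hn x)" using c th0 by simp
  ultimately show ?thesis unfolding H_def by linarith
 qed
 have hgt: "height s t x = p * (x + 1) - (p + q) * max 0 (x - s)" for x
 proof (cases "x <= s")
  case False
  have "p * (x + 1) - (p + q) * (x - s) = p * (1 + s) - q * (x - s)" "q * (1 - x) = q * (1 - s) - q * (x - s)" by (simp_all add: algebra_simps)
  moreover have "height s t x = q * (1 - x)" using False by (simp add: height_def q_def right_diff_distrib diff_divide_distrib)
  ultimately show ?thesis using False pq by simp
 qed (simp add: height_def p_def)
 have close: "height s t x - r * c0 <= hn x" "hn x <= height s t x" for x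
 proof -
  have 1: "n * max 0 (x - s) <= ramp (z x) + 1"
  proof (cases "x <= s")
   case True
   then show ?thesis using th0[of "z x"] by simp
  next
   case False
   then show ?thesis using lo[of "z x"] ka unfolding z_eq by simp
  qed
  have 2: "ramp (z x) + 1 <= n * max 0 (x - s) + 2"
  proof -
   have "n * (x - s) <= n * max 0 (x - s)" "0 <= n * max 0 (x - s)" using n by (auto intro: mult_left_mono)
   then show ?thesis using hi[of "z x"] ka unfolding z_eq max_def by (simp split: if_splits)
  qed
  have k: "(p + q) / n >= 0" using pq n by simp
  define Z where "Z = (p + q) * max 0 (x - s)"
  define Y where "Y = (p + q) / n * (ramp (z x) + 1)"
  define E where "E = r * c0"
  define L where "L = p * (x + 1)"
  have e: "(p + q) / n * (n * max 0 (x - s)) = Z" "(p + q) / n * 2 = E" using n by (simp_all add: Z_def E_def)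
  have Y1: "Z <= Y" using mult_left_mono[OF 1 k] unfolding e(1) Y_def[symmetric] .
  have Y2: "Y <= Z + E" using mult_left_mono[OF 2 k] unfolding distrib_left[of _ _ 2] e Y_def[symmetric] .
  have "L - Z - E <= L - Y" "L - Y <= L - Z" using Y1 Y2 by simp_all
  then show "height s t x - r * c0 <= hn x" "hn x <= height s t x"
   unfolding hn_def hgt Z_def[symmetric] Y_def[symmetric] E_def[symmetric] L_def[symmetric] .
 qed
 have main: "(1 - r) * height s t x <= H x & H x <= height s t x & (x ~= s --> (pd H 1 x)^2 <= (slope s t x)^2)"
  if x: "c0 <= height s t x" for x
 proof -
  have "r * c0 <= r * height s t x" using r x by (intro mult_left_mono) auto
  then have h1: "(1 - r) * height s t x <= hn x" using close(1)[of x] by (simp add: left_diff_distrib)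
  moreover have "1/2 * c0 <= (1 - r) * height s t x" using r x c0 by (intro mult_mono) auto
  ultimately have h2: "2 <= 1 / c * hn x" using c by (simp add: c_def field_simps)
  have He: "H x = hn x" unfolding H_def big[OF h2] using c by (simp add: algebra_simps)
  define sg where "sg = smoothstep (z x)"
  have dz: "(z has_real_derivative n) (at x)" unfolding z_def[abs_def] by (auto intro!: derivative_eq_intros)
  have dhn: "(hn has_real_derivative p - (p + q) * sg) (at x)"
  proof -
   have "(hn has_real_derivative p * (1 + 0) - (p + q) / n * (smoothstep (z x) * n + 0)) (at x)"
    unfolding hn_def[abs_def] by (intro DERIV_diff DERIV_cmult DERIV_add DERIV_ident DERIV_const DERIV_chain2[OF dth dz])
   then show ?thesis using n by (simp add: sg_def)
  qed
  have "(H has_real_derivative c * (smoothstep (1 / c * hn x) * (1 / c * (p - (p + q) * sg))) + 0) (at x)"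
   unfolding H_def[abs_def] by (intro DERIV_add DERIV_cmult DERIV_const DERIV_chain2[OF dth] dhn)
  then have dH: "pd H 1 x = p - (p + q) * sg" using c smoothstep_1[OF h2] by (intro partial_deriv_real) simp
  have sg: "0 <= sg" "sg <= 1" using smoothstep_range by (auto simp: sg_def)
  have "0 <= (p + q) * sg" "(p + q) * sg <= (p + q) * 1" using sg pq by (auto intro!: mult_nonneg_nonneg mult_left_mono)
  then have rng: "- q <= p - (p + q) * sg" "p - (p + q) * sg <= p" by auto
  have "\<bar>p - (p + q) * sg\<bar> <= \<bar>slope s t x\<bar>" if "x ~= s"
  proof (cases "x < s")
   case True
   have sl: "slope s t x = p" using True by (simp add: slope_def p_def)
   show ?thesis
   proof (cases "q <= p")
    case False
    have "n * (x - s) <= 0" using True n by (simp add: mult_nonneg_nonpos)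
    then have "sg = 0" using False by (simp add: sg_def z_eq ka_def smoothstep_0)
    then show ?thesis using sl by simp
   qed (use rng sl pq in auto)
  next
   case False
   then have sl: "slope s t x = - q" using that by (simp add: slope_def q_def)
   show ?thesis
   proof (cases "q <= p")
    case True
    have "n * (x - s) >= 0" using False n by simp
    then have "sg = 1" using True by (simp add: sg_def z_eq ka_def smoothstep_1)
    then show ?thesis using sl by simp
   qed (use rng sl pq in auto)
  qed
  then show ?thesis unfolding He dH using h1 close(2) by (simp only: abs_le_square_iff) blast
 qed
 show ?thesis using CH Hpos main by blast
qed

text \<open>Energy and second moment of the derivative of the sine mode. They are half of
  \<open>pi^2\<close> and of \<open>pi^2 / 3 + 1 / 2\<close>, the other factor \<open>2\<close>
  being the normalisation; \<open>?F\<close> and \<open>?G\<close> are explicit primitives.\<close>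

lemma integral_cos_sq:
 "has_bochner_integral lborel (%x. (pi * cos (pi * x))^2 * indicator {0..1} x) (pi^2 / 2)"
 "has_bochner_integral lborel (%x. x^2 * (pi * cos (pi * x))^2 * indicator {0..1} x) (pi^2 / 6 + 1 / 4)"
proof -
 have c2: "cos (2 * pi * x) = 2 * (cos (pi * x))^2 - 1" for x using cos_double_cos[of "pi * x"] by (simp add: mult.assoc)
 let ?F = "%x. pi^2 * x / 2 + pi * sin (2 * pi * x) / 4"
 let ?G = "%x. pi^2 * x ^ 3 / 6 + pi * x^2 * sin (2 * pi * x) / 4 + x * cos (2 * pi * x) / 4 - sin (2 * pi * x) / (8 * pi)"
 have ds: "((%x. sin (2 * pi * x)) has_real_derivative 2 * pi * cos (2 * pi * x)) (at x)"
  and dc: "((%x. cos (2 * pi * x)) has_real_derivative - (2 * pi * sin (2 * pi * x))) (at x)" for x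
  by (auto intro!: derivative_eq_intros)
 have "has_bochner_integral lborel (%x. (pi * cos (pi * x))^2 * indicator {0..1} x) (?F 1 - ?F 0)"
 proof (rule has_bochner_integral_FTC_Icc_real)
  fix x :: real
  have "(?F has_real_derivative pi^2 * 1 / 2 + pi * (2 * pi * cos (2 * pi * x)) / 4) (at x)"
   by (intro DERIV_add DERIV_cdivide DERIV_cmult DERIV_ident ds)
  moreover have "pi^2 * 1 / 2 + pi * (2 * pi * cos (2 * pi * x)) / 4 = (pi * cos (pi * x))^2"
   unfolding c2 by (simp add: power2_eq_square field_simps)
  ultimately show "(?F has_real_derivative (pi * cos (pi * x))^2) (at x)" by simp
 qed (auto intro!: continuous_intros)
 then show "has_bochner_integral lborel (%x. (pi * cos (pi * x))^2 * indicator {0..1} x) (pi^2 / 2)" by simp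
 have "has_bochner_integral lborel (%x. x^2 * (pi * cos (pi * x))^2 * indicator {0..1} x) (?G 1 - ?G 0)"
 proof (rule has_bochner_integral_FTC_Icc_real)
  fix x :: real
  have d3: "((%x::real. x ^ 3) has_real_derivative 3 * x^2) (at x)" "((%x::real. x^2) has_real_derivative 2 * x) (at x)"
   by (auto intro!: derivative_eq_intros)
  have D: "(?G has_real_derivative pi^2 * (3 * x^2) / 6 + (pi * (2 * x) * sin (2 * pi * x) + (2 * pi * cos (2 * pi * x)) * (pi * x^2)) / 4
    + (1 * cos (2 * pi * x) + (- (2 * pi * sin (2 * pi * x))) * x) / 4 - (2 * pi * cos (2 * pi * x)) / (8 * pi)) (at x)"
   by (intro DERIV_add DERIV_diff DERIV_cdivide DERIV_mult DERIV_cmult DERIV_ident ds dc d3)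
  have g: "pi^2 * (3 * x^2) / 6 + (pi * (2 * x) * S + (2 * pi * C) * (pi * x^2)) / 4
    + (1 * C + (- (2 * pi * S)) * x) / 4 - (2 * pi * C) / (8 * pi) = pi^2 * x^2 * (1 + C) / 2" for S C
   by (simp add: field_simps power2_eq_square)
  have e: "pi^2 * x^2 * (1 + cos (2 * pi * x)) / 2 = x^2 * (pi * cos (pi * x))^2"
   unfolding c2 by (simp add: power_mult_distrib)
  show "(?G has_real_derivative x^2 * (pi * cos (pi * x))^2) (at x)" using D unfolding g e .
 qed (auto intro!: continuous_intros)
 then show "has_bochner_integral lborel (%x. x^2 * (pi * cos (pi * x))^2 * indicator {0..1} x) (pi^2 / 6 + 1 / 4)" by simp
qed

text \<open>The sine is positive up to the endpoints. Replacing it by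
  \<open>ramp (n * sin) / n\<close> gives compact support, does not increase the absolute value of
  the derivative, and reduces the mass \<open>1/2\<close> by at most \<open>4 / n\<close> before
  normalisation.\<close>

lemma fiber_profile:
 assumes de: "de > 0"
 shows "EX S. test_function {0<..<1} S & (LBINT y. (S y)^2) = 1 & (LBINT y. (pd S 1 y)^2) <= (1 + de) * pi^2
   & (LBINT y. y^2 * (pd S 1 y)^2) <= (1 + de) * (pi^2 / 3 + 1 / 2)"
proof -
 note dth = ramp_deriv(2) and Cth = ramp_bounds(1) and thz = ramp_bounds(2) and th0 = ramp_bounds(3) and lo = ramp_bounds(4) and hi = ramp_bounds(5) and big = ramp_bounds(6)
 \<comment> \<open>Solves \<open>1/2 - 4 / n = 1 / (2 * (1 + de))\<close>, so that normalising
   multiplies integrals by at most \<open>2 * (1 + de)\<close>.\<close>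
 define n where "n = 8 * (1 + de) / de"
 have n: "n > 0" "1 / 2 - 4 / n = 1 / (2 * (1 + de))" using de by (auto simp: n_def field_simps)
 \<comment> \<open>Both \<open>smoothstep\<close> factors are \<open>1\<close> on
   \<open>{0..1}\<close>; their product vanishes for \<open>y <= -1\<close> and
   \<open>y >= 2\<close>, which removes the other positive arcs of the sine.\<close>
 define R where "R y = smoothstep (1 * y + 2) * smoothstep ((-1) * y + 3) * (1 / n * ramp (n * sin (pi * y + 0)))" for y :: real
 define K where "K = {0..1} \<inter> {y. 1 / n <= sin (pi * y)}"
 have K: "compact K" unfolding K_def by (intro compact_Int_closed closed_Collect_le) (auto intro!: continuous_intros)
 have K01: "K <= {0<..<1}"
 proof
  fix y assume y: "y : K"
  then have "sin (pi * y) > 0" using n by (auto simp: K_def intro: less_le_trans[of 0 "1/n"])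
  then have "y ~= 0" "y ~= 1" by auto
  then show "y : {0<..<1}" using y by (auto simp: K_def)
 qed
 have Rz: "R y = 0" if y: "y ~: K" for y
 proof (cases "y <= -1 | y >= 2")
  case True
  then show ?thesis by (auto simp: R_def smoothstep_0)
 next
  case False
  have "n * sin (pi * y) <= 1"
  proof (cases "y : {0..1}")
   case True
   then have "sin (pi * y) <= 1 / n" using y by (auto simp: K_def)
   then show ?thesis using n by (simp add: field_simps)
  next
   case out: False
   have "sin (pi * y) <= 0"
   proof (cases "y < 0")
    case True
    have "0 <= sin (pi * (- y))"
    proof (rule sin_ge_zero)
     show "0 <= pi * - y" using True by (intro mult_nonneg_nonneg) auto
     have "pi * - y <= pi * 1" using False by (intro mult_left_mono) auto
     then show "pi * - y <= pi" by simp
    qed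
    then show ?thesis by simp
   next
    case y1: False
    show ?thesis
    proof (rule sin_le_zero)
     have "pi * 1 <= pi * y" using y1 out by (intro mult_left_mono) auto
     then show "pi <= pi * y" by simp
     have "pi * y < pi * 2" using False by (intro mult_strict_left_mono) auto
     then show "pi * y < 2 * pi" by simp
    qed
   qed
   then have "n * sin (pi * y) <= 0" using n by (simp add: mult_nonneg_nonpos)
   then show ?thesis by simp
  qed
  then show ?thesis by (simp add: R_def thz)
 qed
 have sin_deriv: "((%y. sin (pi * y + b)) has_real_derivative pi * sin (pi * y + (b + pi / 2))) (at y)" for b y :: real
  by (auto intro!: derivative_eq_intros simp: sin_add cos_add algebra_simps)
 have Csin: "C_k j (%y. sin (pi * y + b))" for j and b :: real
 proof (induction j arbitrary: b)
  case 0
  show ?case by (auto intro!: continuous_intros)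
 next
  case (Suc j)
  show ?case by (rule C_k_SucI_real[OF sin_deriv]) (intro C_k_cmult Suc.IH)
 qed
 have CR: "C_k j R" for j
  unfolding R_def[abs_def]
  by (rule C_k_mult[OF C_k_mult[OF C_k_shift[OF C_k_smoothstep] C_k_shift[OF C_k_smoothstep]] C_k_cmult[OF C_k_compose[OF Cth C_k_cmult[OF Csin]]]])
 have tR: "test_function {0<..<1} R" by (rule test_functionI[OF CR K K01 Rz])
 have Rin: "R y = 1 / n * ramp (n * sin (pi * y))" if "y : {0<..<1}" for y
  using that by (simp add: R_def smoothstep_1)
 let ?d = "pd R 1"
 have dR: "?d y = smoothstep (n * sin (pi * y)) * (pi * cos (pi * y))" if y: "y : {0<..<1}" for y
 proof -
  have "((%y. 1 / n * ramp (n * sin (pi * y))) has_real_derivative 1 / n * (smoothstep (n * sin (pi * y)) * (n * (cos (pi * y) * pi)))) (at y)"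
   by (intro DERIV_cmult DERIV_chain2[OF dth]) (auto intro!: derivative_eq_intros)
  then have "(R has_real_derivative 1 / n * (smoothstep (n * sin (pi * y)) * (n * (cos (pi * y) * pi)))) (at y)"
   by (rule has_field_derivative_transform_within_open[where S = "{0<..<1}"]) (use y Rin in auto)
  then show ?thesis using n by (intro partial_deriv_real) (simp add: mult_ac)
 qed
 have dz: "?d y = 0" if "y ~: {0<..<1}" for y
  by (rule partial_deriv_eq_0[of K]) (use that K01 K Rz in "auto simp: compact_imp_closed")
 have dle: "(?d y)^2 <= (pi * cos (pi * y))^2 * indicator {0..1} y" for y
 proof (cases "y : {0<..<1}")
  case True
  have "(smoothstep (n * sin (pi * y)))^2 <= 1" using smoothstep_range by (simp add: power_le_one)
  then have "(smoothstep (n * sin (pi * y)))^2 * (pi * cos (pi * y))^2 <= 1 * (pi * cos (pi * y))^2" by (intro mult_right_mono) auto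
  then show ?thesis using True by (simp add: dR[OF True] power_mult_distrib)
 qed (simp add: dz)
 have dt: "test_function {0<..<1} ?d" by (rule test_function_partial_deriv[OF tR]) simp
 obtain K' where K': "compact K'" "K' <= {0<..<1}" "!!y. y ~: K' ==> ?d y = 0" using test_functionD[OF dt] by blast
 have di: "integrable lborel (%y. (?d y)^2)" "integrable lborel (%y. y^2 * (?d y)^2)"
  by (rule continuous_compact_support[OF _ K'(1)]; use K'(3) in "auto intro!: continuous_intros test_function_cont[OF dt]")+
 have I1: "(LBINT y. (?d y)^2) <= pi^2 / 2"
  using integral_mono[OF di(1) _ dle] integral_cos_sq(1) by (simp add: has_bochner_integral_iff)
 have dle2: "y^2 * (?d y)^2 <= y^2 * (pi * cos (pi * y))^2 * indicator {0..1} y" for y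
  using mult_left_mono[OF dle, of "y^2" y] by (simp add: mult.assoc)
 have I2: "(LBINT y. y^2 * (?d y)^2) <= pi^2 / 6 + 1 / 4"
  using integral_mono[OF di(2) _ dle2] integral_cos_sq(2) by (simp add: has_bochner_integral_iff)
 define N where "N = (LBINT y. (R y)^2)"
 have Ri: "integrable lborel (%y. (R y)^2)"
  by (rule continuous_compact_support[OF _ K]; use Rz in "auto intro!: continuous_intros test_function_cont[OF tR]")
 have NL: "1 / (2 * (1 + de)) <= N"
 proof -
  have ss: "has_bochner_integral lborel (%y. (sin (pi * y))^2 * indicator {0..1} y) (1 / 2)" using integral_sin_sq[of 1] by simp
  have i1: "integrable lborel (%y::real. indicator {0..1} y :: real)" by (rule integrable_real_indicator) auto
  have "(LBINT y. (sin (pi * y))^2 * indicator {0..1} y - 4 / n * indicator {0..1} y) <= N"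
   unfolding N_def
  proof (rule integral_mono[OF _ Ri])
   show "integrable lborel (%y. (sin (pi * y))^2 * indicator {0..1} y - 4 / n * indicator {0..1} y)"
    using ss i1 by (simp add: has_bochner_integral_iff)
   fix y :: real
   show "(sin (pi * y))^2 * indicator {0..1} y - 4 / n * indicator {0..1} y <= (R y)^2"
   proof (cases "y : {0<..<1}")
    case True
    define S where "S = sin (pi * y)"
    have "0 < S" unfolding S_def by (rule sin_gt_zero) (use True in auto)
    moreover have "S <= 1" by (simp add: S_def)
    ultimately have S: "0 <= S" "S <= 1" by auto
    have "1 / n * (n * S - 2) <= R y" unfolding Rin[OF True] S_def using lo n by (intro mult_left_mono) auto
    then have l: "S - 2 / n <= R y" using n by (simp add: right_diff_distrib)
    have "4 / n * S <= 4 / n * 1" using S n by (intro mult_left_mono) auto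
    then have "S^2 - 4 / n <= S^2 - 4 / n * S" by simp
    also have "... <= (R y)^2"
    proof (cases "S >= 2 / n")
     case True
     then have "(S - 2 / n)^2 <= (R y)^2" using l by (intro power_mono) auto
     moreover have "(S - 2 / n)^2 = S^2 - 4 / n * S + (2 / n)^2" by (simp add: power2_diff)
     moreover have "0 <= (2 / n)^2" by simp
     ultimately show ?thesis by linarith
    next
     case False
     have "2 / n <= 4 / n" using n by (intro divide_right_mono) auto
     then have "S - 4 / n <= 0" using False by linarith
     then have "S * (S - 4 / n) <= 0" using S by (simp add: mult_nonneg_nonpos)
     then have "S^2 - 4 / n * S <= 0" by (simp add: power2_eq_square right_diff_distrib mult.commute)
     then show ?thesis using zero_le_power2[of "R y"] by linarith
    qed
    finally show ?thesis using True by (simp add: S_def)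
   next
    case False
    then have "(sin (pi * y))^2 * indicator {0..1} y = (0::real)" by (cases "y = 0 | y = 1") (auto split: split_indicator)
    moreover have "0 <= 4 / n * (indicator {0..1} y :: real)" using n by simp
    ultimately show ?thesis using zero_le_power2[of "R y"] by linarith
   qed
  qed
  moreover have "(LBINT y. (sin (pi * y))^2 * indicator {0..1} y - 4 / n * indicator {0..1} y) = 1 / 2 - 4 / n"
   using ss i1 by (simp add: has_bochner_integral_iff)
  ultimately show ?thesis using n(2) by simp
 qed
 have Npos: "N > 0" using NL de by (auto intro: less_le_trans[of 0 "1 / (2 * (1 + de))"])
 define S where "S = (%y. (1 / sqrt N) * R y + 0 * R y)"
 have tS: "test_function {0<..<1} S" unfolding S_def by (rule test_function_lin[OF tR tR])
 have dS: "pd S 1 y = (1 / sqrt N) * ?d y" for y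
  unfolding S_def using partial_deriv_lin[OF CR CR, of "1 / sqrt N" 0 1 y] by simp
 have S2: "(S y)^2 = 1 / N * (R y)^2" "(pd S 1 y)^2 = 1 / N * (?d y)^2" for y
  using Npos unfolding dS by (simp_all add: S_def power_divide)
 have sc: "1 / N * A <= (1 + de) * B" if "A <= B / 2" "B >= 0" for A B
 proof -
  have "B / 2 = (1 + de) * B * (1 / (2 * (1 + de)))" using de by (simp add: field_simps)
  also have "... <= (1 + de) * B * N" using NL de that by (intro mult_left_mono) auto
  finally have "A <= (1 + de) * B * N" using that by linarith
  then show ?thesis using Npos by (simp add: field_simps)
 qed
 have "(LBINT y. (S y)^2) = 1" unfolding S2 using Npos by (simp add: N_def)
 moreover have "(LBINT y. (pd S 1 y)^2) <= (1 + de) * pi^2"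
  using sc[OF I1] by (simp add: S2)
 moreover have "(LBINT y. y^2 * (pd S 1 y)^2) <= (1 + de) * (pi^2 / 3 + 1 / 2)"
 proof -
  have "(LBINT y. y^2 * (pd S 1 y)^2) = 1 / N * (LBINT y. y^2 * (?d y)^2)"
   by (subst integral_mult_right_zero[symmetric]) (simp add: S2)
  also have "... <= (1 + de) * (pi^2 / 3 + 1 / 2)" by (rule sc) (use I2 in auto)
  finally show ?thesis .
 qed
 ultimately show ?thesis using tS by blast
qed

lemma C_k_real_derivative:
 fixes H :: "real => real"
 assumes "C_k 1 H"
 shows "(H has_real_derivative pd H 1 x) (at x)"
proof -
 have "H differentiable at x" using assms by (simp add: differentiable_on_def)
 then obtain D where D: "(H has_real_derivative D) (at x)" by (auto simp: real_differentiable_def)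
 then show ?thesis using partial_deriv_real[OF D] by simp
qed

text \<open>The mixed moment comes from integrating the derivative of \<open>et * (S et)^2\<close>,
  whose integral over the line is \<open>0\<close>.\<close>

lemma profile_moment:
 assumes S: "test_function U S"
 shows "integrable lborel (%et. S et * (et * pd S 1 et))"
  "(LBINT et. S et * (et * pd S 1 et)) = - (LBINT et. (S et)^2) / 2"
  "integrable lborel (%et. (S et)^2)" "integrable lborel (%et. et^2 * (pd S 1 et)^2)"
proof -
 obtain K where K: "compact K" "K <= U" "!!x. x ~: K ==> S x = 0" using test_functionD[OF S] by blast
 have dt: "test_function U (pd S 1)" by (rule test_function_partial_deriv[OF S]) simp
 obtain K' where K': "compact K'" "K' <= U" "!!x. x ~: K' ==> pd S 1 x = 0" using test_functionD[OF dt] by blast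
 note c = test_function_cont(1)[OF S] test_function_cont(1)[OF dt]
 show i1: "integrable lborel (%et. S et * (et * pd S 1 et))"
  by (rule continuous_compact_support[OF _ K(1)]) (auto intro!: continuous_intros c simp: K(3))
 show i2: "integrable lborel (%et. (S et)^2)"
  by (rule continuous_compact_support[OF _ K(1)]) (auto intro!: continuous_intros c simp: K(3))
 show "integrable lborel (%et. et^2 * (pd S 1 et)^2)"
  by (rule continuous_compact_support[OF _ K'(1)]) (auto intro!: continuous_intros c simp: K'(3))
 define W where "W et = et * (S et * S et)" for et
 have CW: "C_k 1 W" unfolding W_def[abs_def]
  by (intro C_k_mult C_k_bounded_linear[OF bounded_linear_ident] test_function_C_k[OF S])
 have "pd W 1 et = (S et)^2 + 2 * (S et * (et * pd S 1 et))" for et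
 proof (rule partial_deriv_real)
  note dS = test_function_real_derivative[OF S, of et]
  have "(W has_real_derivative 1 * (S et * S et) + (pd S 1 et * S et + pd S 1 et * S et) * et) (at et)"
   unfolding W_def[abs_def] by (intro DERIV_mult DERIV_ident dS)
  then show "(W has_real_derivative (S et)^2 + 2 * (S et * (et * pd S 1 et))) (at et)"
   by (simp add: power2_eq_square algebra_simps)
 qed
 then have "pd W 1 = (%et. (S et)^2 + 2 * (S et * (et * pd S 1 et)))" by (rule ext)
 moreover have "integral\<^sup>L lborel (pd W 1) = 0"
  by (rule integral_partial_deriv_eq_0(2)[OF CW K(1)]) (simp_all add: W_def K(3))
 ultimately show "(LBINT et. S et * (et * pd S 1 et)) = - (LBINT et. (S et)^2) / 2"
  using i1 i2 by simp
qed

section \<open>Trial functions on the triangle\<close>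

context tri_form begin

text \<open>In the fibre coordinate \<open>et = y / H x\<close> this is a multiple of
  \<open>S et\<close>, and the power \<open>-1/2\<close> gives the fibre the mass
  \<open>ps^2\<close> whatever \<open>H\<close> is. All powers are written with \<open>powr\<close>,
  for \<open>C_k_powr\<close>.\<close>

definition "trial H S ps p = ps (1 / ta * fst p + (- s / ta)) * (H (fst p) powr (-1/2) * S (snd p * H (fst p) powr (-1)))"

text \<open>In the coordinates \<open>(X, et)\<close> the support is contained in a product of
  compact sets; its image under \<open>g\<close> lies in the open triangle since
  \<open>0 < et < 1\<close> and \<open>H\<close> stays below the height over
  \<open>K\<close>.\<close>

lemma trial_test:
 assumes S: "test_function {0<..<1} S" and H: "!!n. C_k n H" "!!x. H x > 0"
  and ps: "!!n. C_k n ps" "compact K" "!!X. X ~: K ==> ps X = 0"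
  and below: "!!X. X : K ==> H (s + ta * X) <= height s t (s + ta * X)"
 shows "test_function T (trial H S ps)"
proof -
 obtain KS where KS: "compact KS" "KS <= {0<..<1}" "!!x. x ~: KS ==> S x = 0" using test_functionD[OF S] by blast
 have Cf: "C_k n (%p::real \<times> real. fst p)" "C_k n (%p::real \<times> real. snd p)" for n
  by (rule C_k_bounded_linear, rule bounded_linear_fst bounded_linear_snd)+
 have CH: "C_k n (%p::real \<times> real. H (fst p))" for n by (rule C_k_compose[OF H(1) Cf(1)])
 have CP: "C_k n (%p::real \<times> real. H (fst p) powr b)" for n b by (rule C_k_powr[OF CH H(2)])
 have C: "C_k n (trial H S ps)" for n
  unfolding trial_def[abs_def]
  by (rule C_k_mult[OF C_k_compose[OF ps(1) C_k_add[OF C_k_cmult[OF Cf(1)] C_k_const]]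
     C_k_mult[OF CP C_k_compose[OF test_function_C_k[OF S] C_k_mult[OF Cf(2) CP]]]])
 define g where "g = (%q::real \<times> real. (s + ta * fst q, snd q * H (s + ta * fst q)))"
 have Hc: "continuous_on UNIV H" by (rule C_k_continuous[OF H(1)[of 0]])
 have "continuous_on (K \<times> KS) g" unfolding g_def
  by (intro continuous_intros continuous_on_compose2[OF Hc]) auto
 then have cK: "compact (g ` (K \<times> KS))" by (intro compact_continuous_image compact_Times ps(2) KS(1))
 have sub: "g ` (K \<times> KS) <= T"
 proof
  fix p assume "p : g ` (K \<times> KS)"
  then obtain X et where X: "X : K" and et: "et : KS" and p: "p = (s + ta * X, et * H (s + ta * X))" by (auto simp: g_def)
  have e: "0 < et" "et < 1" using KS(2) et by auto
  have "et * H (s + ta * X) < 1 * H (s + ta * X)" using e H(2) by (intro mult_strict_right_mono) auto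
  then have "et * H (s + ta * X) < height s t (s + ta * X)" using below[OF X] by simp
  moreover have "0 < et * H (s + ta * X)" using e H(2) by simp
  ultimately show "p : T" unfolding triangle_eq[OF s_range t_pos] height_eq_min[OF s_range t_pos] p by simp
 qed
 have "trial H S ps p = 0" if p: "p ~: g ` (K \<times> KS)" for p
 proof -
  define X where "X = 1 / ta * fst p + (- s / ta)"
  define et where "et = snd p * H (fst p) powr (-1)"
  have x: "s + ta * X = fst p" using ta_pos by (simp add: X_def field_simps)
  have "H (fst p) powr (-1) = 1 / H (fst p)" using powr_minus_divide[of "H (fst p)" 1] H(2)[of "fst p"] by simp
  then have "et * H (fst p) = snd p" using H(2)[of "fst p"] by (simp add: et_def)
  then have "p = g (X, et)" by (simp add: g_def x)
  then have "X ~: K | et ~: KS" using p by blast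
  then show ?thesis unfolding trial_def X_def[symmetric] et_def[symmetric] using ps(3) KS(3) by auto
 qed
 then show ?thesis by (rule test_functionI[OF C cK sub])
qed

text \<open>After substituting \<open>et = y / H x\<close>, the horizontal derivative is
  \<open>A * S - B * et * S'\<close> up to the factor \<open>H powr (-1/2)\<close>, with
  \<open>A = ps' / ta - B / 2\<close>. The mixed moment \<open>-1/2\<close> of \<open>S\<close> and
  \<open>et * S'\<close> cancels the cross terms between \<open>ps'\<close> and \<open>B\<close>,
  leaving the correction \<open>- B^2 / 4\<close>.\<close>

lemma trial_slices:
 assumes S: "test_function {0<..<1} S" and S1: "(LBINT et. (S et)^2) = 1" and H: "!!n. C_k n H" "!!x. H x > 0"
  and ps: "test_function U ps" and u: "test_function T (trial H S ps)"
 defines "X == %x. 1 / ta * x + (- s / ta)"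
 shows "(LBINT y. (trial H S ps (x, y))^2) = (ps (X x))^2"
  "(LBINT y. (pd (trial H S ps) (0, 1) (x, y))^2) = (ps (X x) / H x)^2 * (LBINT et. (pd S 1 et)^2)"
  "(LBINT y. (pd (trial H S ps) (1, 0) (x, y))^2) = (pd ps 1 (X x) / ta)^2
    + ((LBINT et. et^2 * (pd S 1 et)^2) - 1 / 4) * (ps (X x) * pd H 1 x / H x)^2"
proof -
 let ?u = "trial H S ps" and ?S' = "pd S 1"
 have uU: "test_function UNIV ?u" by (rule test_function_mono[OF u]) simp
 define h where "h = H x"
 define h' where "h' = pd H 1 x"
 define P where "P = ps (X x)"
 define P' where "P' = pd ps 1 (X x)"
 define rh where "rh = h powr (-1/2)"
 have h: "h > 0" using H(2) by (simp add: h_def)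
 have r1: "h powr (-1) = 1 / h" using powr_minus_divide[of h 1] h by simp
 have rh2: "rh^2 = 1 / h"
 proof -
  have "rh^2 = h powr (-1/2 + -1/2)" unfolding rh_def power2_eq_square powr_add ..
  then show ?thesis using r1 by simp
 qed
 have r3: "h powr (-1/2 - 1) = rh / h" "h powr (-1 - 1) = (1 / h) / h"
 proof -
  have p1: "h powr 1 = h" using h by simp
  show "h powr (-1/2 - 1) = rh / h" unfolding powr_diff p1 rh_def ..
  show "h powr (-1 - 1) = (1 / h) / h" unfolding powr_diff p1 r1 ..
 qed
 have sub: "(LBINT y. F (y * (1 / h))) = h * (LBINT et. F et)" for F :: "real => real"
  using lborel_integral_real_affine[of "1 / h" F 0] h by (simp add: mult.commute)
 note dS = test_function_real_derivative[OF S]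
 have ueq: "?u (x, y) = P * (rh * S (y * (1 / h)))" for y
  unfolding trial_def fst_conv snd_conv P_def X_def rh_def h_def[symmetric] r1 ..
 have "(LBINT y. (?u (x, y))^2) = (LBINT y. P^2 * (1 / h) * (S (y * (1 / h)))^2)"
  unfolding ueq power_mult_distrib rh2 by (simp only: mult.assoc)
 also have "... = h * (LBINT et. P^2 * (1 / h) * (S et)^2)" by (rule sub)
 also have "... = P^2" using less_imp_neq[OF h] S1 by simp
 finally show "(LBINT y. (?u (x, y))^2) = (ps (X x))^2" by (simp add: P_def)
 have uy: "pd ?u (0, 1) (x, y) = P * (rh * (?S' (y * (1 / h)) * (1 / h)))" for y
 proof -
  have l: "((%y. y * (1 / h)) has_real_derivative 1 / h) (at y)" using h by (auto intro!: derivative_eq_intros)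
  have "((%y. P * (rh * S (y * (1 / h)))) has_real_derivative P * (rh * (?S' (y * (1 / h)) * (1 / h)))) (at y)"
   by (intro DERIV_cmult DERIV_chain2[OF dS l])
  then have "((%y. ?u (x, y)) has_real_derivative P * (rh * (?S' (y * (1 / h)) * (1 / h)))) (at y)" unfolding ueq .
  then show ?thesis unfolding test_function_slice(4)[OF uU, symmetric] by (rule partial_deriv_real)
 qed
 have "(LBINT y. (pd ?u (0, 1) (x, y))^2) = (LBINT y. P^2 * (1 / h) * (1 / h)^2 * (?S' (y * (1 / h)))^2)"
  unfolding uy power_mult_distrib rh2 by (simp only: mult_ac)
 also have "... = h * (LBINT et. P^2 * (1 / h) * (1 / h)^2 * (?S' et)^2)" by (rule sub)
 also have "... = (P / h)^2 * (LBINT et. (?S' et)^2)" using h by (simp add: power_divide)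
 finally show "(LBINT y. (pd ?u (0, 1) (x, y))^2) = (ps (X x) / H x)^2 * (LBINT et. (?S' et)^2)"
  by (simp add: P_def h_def)
 define B where "B = P * h' / h"
 define A where "A = P' / ta - B / 2"
 have ux: "pd ?u (1, 0) (x, y) = rh * (A * S (y * (1 / h)) - B * ((y * (1 / h)) * ?S' (y * (1 / h))))" for y
 proof -
  have l: "((%x. 1 / ta * x + (- s / ta)) has_real_derivative 1 / ta) (at x)" using t_pos by (auto intro!: derivative_eq_intros)
  have d1: "((%x. ps (1 / ta * x + (- s / ta))) has_real_derivative P' * (1 / ta)) (at x)"
   using DERIV_chain2[OF test_function_real_derivative[OF ps] l] by (simp only: P'_def X_def)
  have dH: "(H has_real_derivative h') (at x)" unfolding h'_def by (rule C_k_real_derivative[OF H(1)])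
  have d2: "((%x. H x powr b) has_real_derivative b * h powr (b - 1) * h') (at x)" for b
   using DERIV_chain2[OF has_real_derivative_powr[OF H(2)] dH, of b] by (simp only: h_def)
  have d3: "((%x. S (y * H x powr (-1))) has_real_derivative ?S' (y * h powr (-1)) * (y * (-1 * h powr (-1 - 1) * h'))) (at x)"
   using DERIV_chain2[OF dS DERIV_cmult[OF d2[of "-1"]]] by (simp only: h_def)
  have "((%x. ?u (x, y)) has_real_derivative P' * (1 / ta) * (H x powr (-1/2) * S (y * H x powr (-1)))
    + ((-1/2 * h powr (-1/2 - 1) * h') * S (y * H x powr (-1)) + (?S' (y * h powr (-1)) * (y * (-1 * h powr (-1 - 1) * h'))) * H x powr (-1/2)) * ps (1 / ta * x + (- s / ta))) (at x)"
   unfolding trial_def fst_conv snd_conv by (intro DERIV_mult d1 d2 d3)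
  then have D: "((%x. ?u (x, y)) has_real_derivative P' * (1 / ta) * (rh * S (y * (1 / h)))
    + ((-1/2 * (rh / h) * h') * S (y * (1 / h)) + (?S' (y * (1 / h)) * (y * (-1 * ((1 / h) / h) * h'))) * rh) * P) (at x)"
   unfolding h_def[symmetric] r3 r1 rh_def[symmetric] P_def X_def .
  have gen: "P' * (1 / ta) * (rh * Sv) + ((-1/2 * (rh / h) * h') * Sv + (Sd * (y * (-1 * ((1 / h) / h) * h'))) * rh) * P
    = rh * (A * Sv - B * ((y * (1 / h)) * Sd))" for Sv Sd
   unfolding A_def B_def using h ta_pos by (simp add: field_simps)
  show ?thesis unfolding test_function_slice(2)[OF uU, symmetric] using D unfolding gen by (rule partial_deriv_real)
 qed
 note M = profile_moment[OF S]
 have "(LBINT y. (pd ?u (1, 0) (x, y))^2) = (LBINT y. (1 / h) * (A * S (y * (1 / h)) - B * ((y * (1 / h)) * ?S' (y * (1 / h))))^2)"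
  unfolding ux power_mult_distrib rh2 ..
 also have "... = h * (LBINT et. (1 / h) * (A * S et - B * (et * ?S' et))^2)"
  by (rule sub[of "%et. (1 / h) * (A * S et - B * (et * ?S' et))^2"])
 also have "... = (LBINT et. (A * S et - B * (et * ?S' et))^2)" using h by simp
 also have "... = (LBINT et. A^2 * (S et)^2 - 2 * A * B * (S et * (et * ?S' et)) + B^2 * (et^2 * (?S' et)^2))"
 proof (rule lebesgue_cong[OF refl])
  fix et :: real
  have gen: "(A * p - B * (e * q))^2 = A^2 * p^2 - 2 * A * B * (p * (e * q)) + B^2 * (e^2 * q^2)" for p q e :: real
   by (simp add: power2_eq_square algebra_simps)
  show "(A * S et - B * (et * ?S' et))^2 = A^2 * (S et)^2 - 2 * A * B * (S et * (et * ?S' et)) + B^2 * (et^2 * (?S' et)^2)" by (rule gen)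
 qed
 also have "... = A^2 * 1 - 2 * A * B * (- 1 / 2) + B^2 * (LBINT et. et^2 * (?S' et)^2)"
  using M(1,3,4) by (simp add: M(2) S1)
 also have "... = (P' / ta)^2 + ((LBINT et. et^2 * (?S' et)^2) - 1 / 4) * B^2"
 proof -
  have gen: "(Q - B / 2)^2 * 1 - 2 * (Q - B / 2) * B * (- 1 / 2) + B^2 * c = Q^2 + (c - 1 / 4) * B^2" for Q c
   by (simp add: power2_eq_square algebra_simps)
  show ?thesis unfolding A_def by (rule gen)
 qed
 finally show "(LBINT y. (pd ?u (1, 0) (x, y))^2) = (pd ps 1 (X x) / ta)^2
    + ((LBINT et. et^2 * (?S' et)^2) - 1 / 4) * (ps (X x) * pd H 1 x / H x)^2"
  by (simp add: B_def P_def P'_def h_def h'_def)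
qed

lemma trial_lincomb: "trial H S (lincomb k c v) = lincomb k c (%i. trial H S (v i))"
 by (simp add: fun_eq_iff trial_def sum_distrib_right mult.assoc)

text \<open>With \<open>pi^2 / ta\<close> added back, \<open>hat_pot\<close> is exactly what the
  trial functions would produce from the exact height and the exact sine mode.\<close>

lemma height_slope:
 assumes g: "hat_gap s ta X > 0"
 shows "height s t (s + ta * X) > 0"
  "hat_pot s ta X + pi^2 / ta = ta^2 * (pi^2 + (3 + 4 * pi^2) / 12 * (slope s t (s + ta * X))^2) / (height s t (s + ta * X))^2"
proof -
 define D where "D = side s X"
 define G where "G = hat_gap s ta X"
 have D: "D > 0" using s_range by (auto simp: D_def side_def)
 have c: "s + ta * X <= s \<longleftrightarrow> X <= 0" using ta_pos by (simp add: mult_le_0_iff)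
 have he: "height s t (s + ta * X) = t * G / D"
 proof (cases "X <= 0")
  case True
  then have "height s t (s + ta * X) = t / (1 + s) * (s + ta * X + 1)" unfolding height_def c by simp
  moreover have "G = s + ta * X + 1" "D = 1 + s" using True by (simp_all add: G_def D_def hat_gap_def side_def)
  ultimately show ?thesis by simp
 next
  case False
  then have "height s t (s + ta * X) = - t / (1 - s) * (s + ta * X - 1)" unfolding height_def c by simp
  moreover have "s + ta * X - 1 = - G" "D = 1 - s" using False by (simp_all add: G_def D_def hat_gap_def side_def)
  ultimately show ?thesis by simp
 qed
 then show "height s t (s + ta * X) > 0" using g D t_pos by (simp add: G_def)
 have sl: "(slope s t (s + ta * X))^2 = (t / D)^2"
  unfolding slope_def c D_def side_def by (simp add: power_divide)
 have G: "G > 0" using g by (simp add: G_def)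
 have gen: "pi^2 / ta * (D^2 / G^2) + bet * ta^2 / G^2 = ta^2 * (pi^2 + bet * (u / D^2)) / (u * G^2 / D^2)" if "u = ta * ta * ta" for bet u :: real
  unfolding that using D G ta_pos by (simp add: field_simps power2_eq_square)
 have "hat_pot s ta X + pi^2 / ta = pi^2 / ta * (D^2 / G^2) + (3 + 4 * pi^2) / 12 * ta^2 / G^2"
  unfolding hat_pot_def D_def G_def by (simp add: right_diff_distrib)
 also have "... = ta^2 * (pi^2 + (3 + 4 * pi^2) / 12 * (t^2 / D^2)) / (t^2 * G^2 / D^2)" by (rule gen) (simp add: ta_cube)
 finally show "hat_pot s ta X + pi^2 / ta = ta^2 * (pi^2 + (3 + 4 * pi^2) / 12 * (slope s t (s + ta * X))^2) / (height s t (s + ta * X))^2"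
  unfolding sl he by (simp only: power_divide power_mult_distrib)
qed

end

text \<open>Collects the errors of relative size \<open>de\<close>. The height enters through
  \<open>(1 - de / (2 * (1 + de)))^2 >= 1 / (1 + de)\<close>; removing \<open>1 / 4\<close> from the
  moment enlarges its relative error to at most \<open>4 * de\<close>, as
  \<open>bet >= 1 / 4\<close>; finally \<open>(1 + 4 * de) * (1 + de) <= 1 + 9 * de\<close>.\<close>

lemma potential_perturbation:
 fixes ta Ht h h' sl b1 b2 de P W ep :: real
 assumes de: "0 < de" "de <= 1" and Ht: "Ht > 0" and h: "(1 - de / (2 * (1 + de))) * Ht <= h" and h': "h'^2 <= sl^2"
  and b1: "b1 <= (1 + de) * pi^2" and b2: "b2 <= (1 + de) * (pi^2 / 3 + 1 / 2)"
  and W: "W = ta^2 * (pi^2 + (3 + 4 * pi^2) / 12 * sl^2) / Ht^2" and ep: "9 * de * W <= ep"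
 shows "ta^2 * ((b2 - 1 / 4) * (P * h' / h)^2) + ta^2 * ((P / h)^2 * b1) <= (W + ep) * P^2"
proof -
 define r where "r = de / (2 * (1 + de))"
 define bet where "bet = (3 + 4 * pi^2) / 12"
 define X where "X = 1 / h^2"
 define Y where "Y = (1 + de) / Ht^2"
 have r: "1 - 2 * r = 1 / (1 + de)" "r < 1" using de by (simp_all add: r_def field_simps)
 have hr: "0 < (1 - r) * Ht" "(1 - r) * Ht <= h" using r Ht h by (simp_all add: r_def)
 have XY: "X <= Y"
 proof -
  have "1 - 2 * r <= (1 - r)^2" by (simp add: power2_diff)
  then have "1 / (1 + de) * Ht^2 <= (1 - r)^2 * Ht^2" unfolding r(1) by (intro mult_right_mono) auto
  also have "... = ((1 - r) * Ht)^2" by (simp add: power_mult_distrib)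
  also have "... <= h^2" using hr by (intro power_mono) auto
  finally have "1 / h^2 <= 1 / (1 / (1 + de) * Ht^2)" using de Ht hr by (intro divide_left_mono mult_pos_pos zero_less_power) auto
  then show ?thesis unfolding X_def Y_def using de by simp
 qed
 have X0: "0 <= X" and Y0: "0 <= Y" using de by (auto simp: X_def Y_def)
 have bet: "bet >= 1 / 4" by (simp add: bet_def)
 have b2': "b2 - 1 / 4 <= (1 + 4 * de) * bet"
 proof -
  have "(1 + de) * (bet + 1 / 4) - 1 / 4 = bet + de * (bet + 1 / 4)" by (simp add: algebra_simps)
  also have "... <= bet + de * (4 * bet)" using de bet by (intro add_left_mono mult_left_mono) auto
  finally have "(1 + de) * (bet + 1 / 4) - 1 / 4 <= (1 + 4 * de) * bet" by (simp add: algebra_simps)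
  moreover have "bet + 1 / 4 = pi^2 / 3 + 1 / 2" by (simp add: bet_def field_simps)
  ultimately show ?thesis using b2 by simp
 qed
 have "(b2 - 1 / 4) * (h'^2 * X) <= (1 + 4 * de) * bet * (h'^2 * X)" using b2' X0 by (intro mult_right_mono) auto
 also have "... <= (1 + 4 * de) * bet * (sl^2 * Y)" using h' XY X0 de bet by (intro mult_left_mono mult_mono) auto
 finally have 1: "(b2 - 1 / 4) * (h'^2 * X) <= (1 + 4 * de) * bet * (sl^2 * Y)" .
 have "X * b1 <= X * ((1 + de) * pi^2)" using b1 X0 by (intro mult_left_mono)
 also have "... <= Y * ((1 + 4 * de) * pi^2)" using XY Y0 de by (intro mult_mono mult_right_mono) auto
 finally have 2: "X * b1 <= Y * ((1 + 4 * de) * pi^2)" .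
 have W': "W = ta^2 * (pi^2 + bet * sl^2) / Ht^2" by (simp add: W bet_def)
 have W0: "0 <= W" unfolding W' using bet by (intro divide_nonneg_nonneg mult_nonneg_nonneg add_nonneg_nonneg) auto
 have "ta^2 * ((b2 - 1 / 4) * (P * h' / h)^2) + ta^2 * ((P / h)^2 * b1) = (ta^2 * P^2) * ((b2 - 1 / 4) * (h'^2 * X) + X * b1)"
  by (simp add: X_def power_mult_distrib power_divide algebra_simps)
 also have "... <= (ta^2 * P^2) * ((1 + 4 * de) * bet * (sl^2 * Y) + Y * ((1 + 4 * de) * pi^2))"
  using 1 2 by (intro mult_left_mono add_mono) auto
 also have "... = ((1 + 4 * de) * (1 + de) * W) * P^2"
 proof -
  have gen: "(q * p) * (f * bet * (S * (g / K)) + (g / K) * (f * z)) = (f * g * (q * (z + bet * S) / K)) * p" for q p f S g K z :: real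
   by (simp add: algebra_simps add_divide_distrib)
  show ?thesis unfolding Y_def W' by (rule gen)
 qed
 also have "... <= (W + ep) * P^2"
 proof (rule mult_right_mono)
  have "de * de <= de * 1" using de by (intro mult_left_mono) auto
  then have "(1 + 4 * de) * (1 + de) <= 1 + 9 * de" by (simp add: algebra_simps)
  then have "(1 + 4 * de) * (1 + de) * W <= (1 + 9 * de) * W" using W0 by (intro mult_right_mono)
  also have "... = W + 9 * de * W" by (simp add: distrib_right)
  finally show "(1 + 4 * de) * (1 + de) * W <= W + ep" using ep by linarith
 qed simp
 finally show ?thesis .
qed

context tri_form begin

interpretation bar: bar_form s by unfold_locales (rule s_range)

text \<open>Stated for every larger \<open>C\<close>, so that the constant belonging to
  \<open>t\<^sub>0\<close> can be used uniformly in \<open>t\<close>.\<close>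

lemma lower_bound:
 assumes k: "k >= 1" and C: "ta / (3 * pi^2) <= C"
 shows "mu_bar s k / (1 + C * mu_bar s k) <= mu s t k"
proof (rule field_le_epsilon)
 fix ep :: real assume ep: "ep > 0"
 define M where "M = mu s t k + ep"
 have M: "M > 0" using kth_pos[of k] ep by (simp add: M_def mu_eq)
 have "0 <= ta / (3 * pi^2)" using ta_pos by (intro divide_nonneg_nonneg) auto
 then have C0: "C >= 0" using C by linarith
 have mp: "mu_bar s k > 0" unfolding bar.mu_bar_eq by (rule bar.kth_pos)
 have dp: "1 + C * mu_bar s k > 0" using C0 mp by (intro add_pos_nonneg mult_nonneg_nonneg) auto
 have "mu_bar s k <= M * (1 + C * mu_bar s k)"
 \<comment> \<open>For \<open>C * M >= 1\<close> the projection might lose all mass, but then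
   \<open>mu_bar / (1 + C * mu_bar) < 1 / C <= M\<close> holds anyway.\<close>
 proof (cases "C * M < 1")
  case False
  then have "1 * mu_bar s k <= (C * M) * mu_bar s k" using mp by (intro mult_right_mono) auto
  also have "... <= M * (1 + C * mu_bar s k)" using M by (simp add: algebra_simps)
  finally show ?thesis by simp
 next
  case True
  have "{ph. test_function T ph} <= H10 T" using test_function_H10[OF _ open_triangle] by blast
  from core_approx[OF dense this ep, of k] obtain v where v: "!!i. i < k ==> test_function T (v i)"
   and le: "!!c. quad a (lincomb k c v) <= M * L2_sq T (lincomb k c v)"
   and ge: "!!c. L2_sq T (lincomb k c v) >= (\<Sum>i<k. (c i)^2) / 2"
   unfolding M_def mu_eq by blast
  have pl: "proj (lincomb k c v) = lincomb k c (%i. proj (v i))" for c by (rule proj_lincomb) (rule v)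
  have t: "test_function T (lincomb k c v)" for c by (rule test_function_lincomb[OF v])
  have mass: "(1 - C * M) * L2_sq T (lincomb k c v) <= L2_sq UNIV (proj (lincomb k c v))" for c
  proof -
   have a0: "0 <= quad a (lincomb k c v)" by (rule A.nonneg[OF test_function_H10[OF t open_triangle]])
   have "ta / (3 * pi^2) * quad a (lincomb k c v) <= C * quad a (lincomb k c v)" by (rule mult_right_mono[OF C a0])
   also have "... <= C * (M * L2_sq T (lincomb k c v))" by (rule mult_left_mono[OF le C0])
   finally show ?thesis using proj_bounds(3)[OF t[of c]] by (simp add: left_diff_distrib mult.assoc)
  qed
  have "kth_eigenvalue UNIV bar.fdom bar.form k <= M / (1 - C * M)"
  proof (rule bar.minmax_le[where v = "%i. proj (v i)"])
   show "proj (v i) : bar.fdom" if "i < k" for i by (rule proj_bounds(1)[OF v[OF that]])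
   show "ALL i<k. c i = 0" if z: "L2_sq UNIV (lincomb k c (%i. proj (v i))) = 0" for c
   proof -
    have "(1 - C * M) * L2_sq T (lincomb k c v) <= 0" using mass[of c] unfolding pl z .
    then have "L2_sq T (lincomb k c v) <= 0" using True by (simp add: mult_le_0_iff)
    then have "(\<Sum>i<k. (c i)^2) <= 0" using ge[of c] by linarith
    moreover have "(\<Sum>i<k. (c i)^2) >= 0" by (intro sum_nonneg) auto
    ultimately have "(\<Sum>i<k. (c i)^2) = 0" by linarith
    then show ?thesis by (simp add: sum_nonneg_eq_0_iff)
   qed
   fix c
   have "quad bar.form (proj (lincomb k c v)) <= M * L2_sq T (lincomb k c v)"
    using proj_bounds(2)[OF t] le by (rule order_trans)
   also have "... = M / (1 - C * M) * ((1 - C * M) * L2_sq T (lincomb k c v))" using True by simp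
   also have "... <= M / (1 - C * M) * L2_sq UNIV (proj (lincomb k c v))"
    using M True by (intro mult_left_mono mass) auto
   finally show "quad bar.form (lincomb k c (%i. proj (v i))) <= M / (1 - C * M) * L2_sq UNIV (lincomb k c (%i. proj (v i)))"
    unfolding pl .
  qed (rule k)
  then have "mu_bar s k * (1 - C * M) <= M" using True by (simp add: bar.mu_bar_eq pos_le_divide_eq)
  then show ?thesis by (simp add: algebra_simps)
 qed
 then show "mu_bar s k / (1 + C * mu_bar s k) <= mu s t k + ep" using dp by (simp add: pos_divide_le_eq M_def)
qed

text \<open>The fibre integrals reduce \<open>a\<close> to a one-dimensional form in
  \<open>X\<close>. \<open>V\<close> is any majorant of the potential at \<open>ta\<close> over
  \<open>K\<close>, later the potential belonging to \<open>t\<^sub>0\<close>.\<close>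

lemma trial_form:
 assumes ps: "!!n. C_k n ps" "test_function U ps" "compact K" "!!X. X ~: K ==> ps X = 0"
  and S: "test_function {0<..<1} S" "(LBINT et. (S et)^2) = 1"
   "(LBINT et. (pd S 1 et)^2) <= (1 + de) * pi^2"
   "(LBINT et. et^2 * (pd S 1 et)^2) <= (1 + de) * (pi^2 / 3 + 1 / 2)"
  and de: "0 < de" "de <= 1"
  and H: "!!n. C_k n H" "!!x. H x > 0"
  and HK: "!!X. X : K ==> (1 - de / (2 * (1 + de))) * height s t (s + ta * X) <= H (s + ta * X) & H (s + ta * X) <= height s t (s + ta * X)
   & (s + ta * X ~= s --> (pd H 1 (s + ta * X))^2 <= (slope s t (s + ta * X))^2)"
  and gap: "!!X. X : K ==> hat_gap s ta X > 0"
  and pot: "!!X. X : K ==> 9 * de * (hat_pot s ta X + pi^2 / ta) <= ep" and V: "!!X. X : K ==> hat_pot s ta X <= V X"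
  and iV: "integrable lborel (%X. V X * (ps X)^2)"
 shows "test_function T (trial H S ps)"
  "L2_sq T (trial H S ps) = ta * (LBINT X. (ps X)^2)"
  "quad a (trial H S ps) <= ta * ((LBINT X. (pd ps 1 X)^2) + (LBINT X. V X * (ps X)^2) + ep * (LBINT X. (ps X)^2))"
proof -
 let ?u = "trial H S ps" and ?b1 = "LBINT et. (pd S 1 et)^2" and ?b2 = "LBINT et. et^2 * (pd S 1 et)^2"
 show u: "test_function T ?u" by (rule trial_test[OF S(1) H ps(1,3,4)]) (assumption | rule HK[THEN conjunct2, THEN conjunct1])+
 define X where "X x = 1 / ta * x + (- s / ta)" for x
 have Xs: "X (s + ta * x) = x" "s + ta * X x = x" for x using ta_pos by (simp_all add: X_def field_simps)
 note sl = trial_slices[OF S(1,2) H ps(2) u, folded X_def]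
 note Su = test_function_sq_slices[OF u] and Sx = test_function_sq_slices[OF test_partials(1)[OF u]] and Sy = test_function_sq_slices[OF test_partials(2)[OF u]]
 have aff: "(LBINT x. f (X x)) = ta * (LBINT x. f x)" for f :: "real => real"
  using lborel_affine(1)[of "%x. f (X x)"] ta_pos by (simp add: Xs)
 have affi: "integrable lborel (%x. f (X x))" if "integrable lborel f" for f :: "real => real"
  using lborel_integrable_real_affine[OF that, of "1 / ta" "- s / ta"] ta_pos by (simp add: X_def add.commute)
 have dps: "test_function U (pd ps 1)" by (rule test_function_partial_deriv[OF ps(2)]) simp
 have ips: "integrable lborel (%X. (ps X)^2)"
  by (rule continuous_compact_support[OF _ ps(3)]) (auto intro!: continuous_intros test_function_cont[OF ps(2)] simp: ps(4))
 obtain K' where K': "compact K'" "K' <= U" "!!x. x ~: K' ==> pd ps 1 x = 0" using test_functionD[OF dps] by blast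
 have ips': "integrable lborel (%X. (pd ps 1 X)^2)"
  by (rule continuous_compact_support[OF _ K'(1)]) (auto intro!: continuous_intros test_function_cont[OF dps] simp: K'(3))
 show "L2_inner T ?u ?u = ta * (LBINT X. (ps X)^2)"
  unfolding form_test(1)[OF u] Su(5) sl(1) by (rule aff)
 let ?Q = "%x. ta^2 * (LBINT y. (pd ?u (1, 0) (x, y))^2) + ta^2 * (LBINT y. (pd ?u (0, 1) (x, y))^2) - pi^2 / ta * (LBINT y. (?u (x, y))^2)"
 let ?G = "%X. (pd ps 1 X)^2 + V X * (ps X)^2 + ep * (ps X)^2"
 have iG: "integrable lborel ?G" using ips ips' iV by simp
 have iQ: "integrable lborel ?Q" using Su(3) Sx(3) Sy(3) by simp
 have "a ?u ?u = integral\<^sup>L lborel ?Q"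
  unfolding a_alt form_test[OF u] Su(5) Sx(5) Sy(5) using Su(3) Sx(3) Sy(3) by (simp add: distrib_left)
 also have "... <= (LBINT x. ?G (X x))"
 proof (rule integral_mono_AE[OF iQ affi[OF iG]])
  \<comment> \<open>At \<open>s\<close> itself the slope of \<open>H\<close> is not controlled, so
    the pointwise comparison holds off a null set.\<close>
  have "AE x in lborel. x ~= s" by (rule AE_lborel_singleton)
  then show "AE x in lborel. ?Q x <= ?G (X x)"
  proof eventually_elim
   case (elim x)
   have t1: "ta^2 * (pd ps 1 (X x) / ta)^2 = (pd ps 1 (X x))^2" using ta_pos by (simp add: power_divide)
   have Qe: "?Q x = (pd ps 1 (X x))^2 + (ta^2 * ((?b2 - 1 / 4) * (ps (X x) * pd H 1 x / H x)^2)
     + ta^2 * ((ps (X x) / H x)^2 * ?b1)) - pi^2 / ta * (ps (X x))^2"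
    unfolding sl by (simp only: distrib_left t1 add.assoc)
   show ?case
   proof (cases "X x : K")
    case False
    then have "ps (X x) = 0" by (rule ps(4))
    then show ?thesis unfolding Qe by simp
   next
    case True
    note hs = height_slope[OF gap[OF True], unfolded Xs(2)]
    have HKx: "(1 - de / (2 * (1 + de))) * height s t x <= H x" "(pd H 1 x)^2 <= (slope s t x)^2"
     using HK[OF True] elim unfolding Xs(2) by blast+
    have "ta^2 * ((?b2 - 1 / 4) * (ps (X x) * pd H 1 x / H x)^2) + ta^2 * ((ps (X x) / H x)^2 * ?b1)
      <= (hat_pot s ta (X x) + pi^2 / ta + ep) * (ps (X x))^2"
     by (rule potential_perturbation[OF de hs(1) HKx S(3,4) hs(2) pot[OF True]])
    moreover have "(hat_pot s ta (X x) + pi^2 / ta + ep) * (ps (X x))^2 <= (V (X x) + pi^2 / ta + ep) * (ps (X x))^2"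
     using V[OF True] by (intro mult_right_mono) auto
    moreover have "(V (X x) + pi^2 / ta + ep) * (ps (X x))^2 = V (X x) * (ps (X x))^2 + pi^2 / ta * (ps (X x))^2 + ep * (ps (X x))^2"
     by (simp only: distrib_right)
    ultimately show ?thesis unfolding Qe by linarith
   qed
  qed
 qed
 also have "... = ta * integral\<^sup>L lborel ?G" by (rule aff)
 also have "integral\<^sup>L lborel ?G = (LBINT X. (pd ps 1 X)^2) + (LBINT X. V X * (ps X)^2) + ep * (LBINT X. (ps X)^2)"
  using ips ips' iV by simp
 finally show "a ?u ?u <= ta * ((LBINT X. (pd ps 1 X)^2) + (LBINT X. V X * (ps X)^2) + ep * (LBINT X. (ps X)^2))" .
qed

end

context hat_form begin

lemma form_test:
 assumes ps: "test_function I ps"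
 shows "L2_inner I ps ps = (LBINT X. (ps X)^2)" "integrable lborel (%X. hat_pot s ta X * (ps X)^2)"
  "form ps ps = (LBINT X. (pd ps 1 X)^2) + (LBINT X. hat_pot s ta X * (ps X)^2)"
proof -
 obtain K where K: "compact K" "K <= I" "!!x. x ~: K ==> ps x = 0" using test_functionD[OF ps] by blast
 note T = test_function_inner[OF open_I ps ps]
 show "L2_inner I ps ps = (LBINT X. (ps X)^2)" using T(1) by (simp add: power2_eq_square)
 have [measurable]: "ps : borel_measurable borel" by (rule test_function_cont(2)[OF ps])
 have e: "rtW X * ps X * (rtW X * ps X) = hat_pot s ta X * (ps X)^2" for X
 proof (cases "X : K")
  case True
  then have "rtW X * rtW X = hat_pot s ta X" using K(2) by (intro rtW_sq) auto
  moreover have "rtW X * ps X * (rtW X * ps X) = (rtW X * rtW X) * (ps X * ps X)" by (simp only: mult_ac)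
  ultimately show ?thesis by (simp only: power2_eq_square)
 qed (simp add: K(3))
 have z: "hat_pot s ta X * (ps X)^2 = 0" if "X ~: I" for X using K(2) K(3)[of X] that by auto
 have R: "integrable (lebesgue_on I) (%X. hat_pot s ta X * (ps X)^2) \<longleftrightarrow> integrable lebesgue (%X. hat_pot s ta X * (ps X)^2)"
  "(LINT X|lebesgue_on I. hat_pot s ta X * (ps X)^2) = (LINT X|lebesgue. hat_pot s ta X * (ps X)^2)"
  using lebesgue_on_support[of I "%X. hat_pot s ta X * (ps X)^2"] open_sets_lebesgue[OF open_I] z by blast+
 have m: "(%X. hat_pot s ta X * (ps X)^2) : borel_measurable borel" by measurable
 have "integrable (lebesgue_on I) (%x. (rtW x * ps x)^2)" by (rule L2_D(2)) (use weighted_test[OF ps] in blast)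
 then show "integrable lborel (%X. hat_pot s ta X * (ps X)^2)"
  unfolding power2_eq_square[of "rtW _ * ps _"] e R(1) lebesgue_lborel(1)[OF m] .
 have "L2_sq I (%x. rtW x * ps x) = (LBINT X. hat_pot s ta X * (ps X)^2)"
  unfolding L2_inner_def e R(2) lebesgue_lborel(2)[OF m] ..
 then show "form ps ps = (LBINT X. (pd ps 1 X)^2) + (LBINT X. hat_pot s ta X * (ps X)^2)"
  unfolding form_def T(2) by (simp add: power2_eq_square)
qed

end

text \<open>The approximate eigenfunctions belong to the interval of \<open>t\<^sub>0\<close>, which
  is contained in that of \<open>t\<close>. Their compact support keeps the height over it above
  some \<open>c0\<close>, which makes the smoothing possible; monotonicity of \<open>hat_pot\<close>
  replaces the potential at \<open>t\<close> by that at \<open>t\<^sub>0\<close>.\<close>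

lemma upper_bound:
 fixes s t t\<^sub>0 :: real
 assumes s: "s : {-1<..<1}" and t: "0 < t" "t <= t\<^sub>0" and k: "k >= 1"
 shows "mu s t k <= mu_hat s t\<^sub>0 k"
proof (rule field_le_epsilon)
 fix e :: real assume e: "e > 0"
 interpret tri_form s t by unfold_locales (use s t in auto)
 define sg where "sg = t\<^sub>0 powr (2/3)"
 have sg: "ta <= sg" unfolding sg_def by (rule powr_mono2) (use t in auto)
 interpret hat: hat_form s sg by unfold_locales (rule s, rule less_le_trans[OF ta_pos sg])
 define ep where "ep = e / 2"
 have ep: "ep > 0" using e by (simp add: ep_def)
 define M where "M = kth_eigenvalue hat.I hat.fdom hat.form k + ep"
 have sub: "{ph. test_function hat.I ph} <= hat.fdom" unfolding hat.fdom_eq using test_function_H10[OF _ hat.open_I] by blast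
 from hat.core_approx[OF hat.dense sub ep, of k] obtain v where v: "!!i. i < k ==> test_function hat.I (v i)"
  and le: "!!c. quad hat.form (lincomb k c v) <= M * L2_sq hat.I (lincomb k c v)"
  and ge: "!!c. L2_sq hat.I (lincomb k c v) >= (\<Sum>i<k. (c i)^2) / 2"
  unfolding M_def by blast
 \<comment> \<open>One compact set carries the whole span, so a single choice of \<open>de\<close>,
   \<open>S\<close> and \<open>H\<close> serves all linear combinations and \<open>trial\<close>
   stays linear.\<close>
 define K where "K = (\<Union>i<k. closure {x. v i x ~= 0})"
 have Kc: "compact K" unfolding K_def using v by (intro compact_UN) (auto simp: test_function_def)
 have KI: "K <= hat.I" unfolding K_def using v by (force simp: test_function_def)
 have Kz: "lincomb k c v X = 0" if "X ~: K" for c X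
 proof -
  have "v i X = 0" if "i < k" for i
   using \<open>X ~: K\<close> that closure_subset[of "{x. v i x ~= 0}"] by (auto simp: K_def)
  then show ?thesis by simp
 qed
 have gap: "hat_gap s ta X > 0" if X: "X : K" for X
 proof -
  have "hat_gap s sg X > 0" using hat_gap_pos(1)[OF hat.ta_pos] X KI by blast
  moreover have "ta * \<bar>X\<bar> <= sg * \<bar>X\<bar>" using sg by (intro mult_right_mono) auto
  ultimately show ?thesis by (simp add: hat_gap_def)
 qed
 have hc: "continuous_on UNIV (%X. height s t (s + ta * X))"
  unfolding height_eq_min[OF s t(1)] using s by (auto intro!: continuous_intros)
 have "EX c0>0. ALL X:K. c0 <= height s t (s + ta * X)"
 proof (cases "K = {}")
  case False
  obtain X0 where X0: "X0 : K" "ALL X:K. height s t (s + ta * X0) <= height s t (s + ta * X)"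
   using continuous_attains_inf[OF Kc False continuous_on_subset[OF hc subset_UNIV]] by blast
  then show ?thesis using height_slope(1)[OF gap[OF X0(1)]] by blast
 qed (auto intro: exI[of _ 1])
 then obtain c0 where c0: "c0 > 0" "!!X. X : K ==> c0 <= height s t (s + ta * X)" by blast
 define bet where "bet = (3 + 4 * pi^2) / 12"
 \<comment> \<open>A uniform bound for the shifted potential over \<open>K\<close>, by which
   \<open>de\<close> turns the relative error \<open>9 * de\<close> into the absolute error
   \<open>ep\<close>.\<close>
 define W where "W = ta^2 * (pi^2 + bet * ((t / (1 + s))^2 + (t / (1 - s))^2)) / c0^2"
 have bet: "bet >= 0" by (simp add: bet_def)
 have W0: "W >= 0" unfolding W_def using bet by (intro divide_nonneg_nonneg mult_nonneg_nonneg add_nonneg_nonneg) auto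
 have potW: "hat_pot s ta X + pi^2 / ta <= W" if X: "X : K" for X
  unfolding height_slope(2)[OF gap[OF X]] W_def bet_def[symmetric]
 proof (intro frac_le mult_left_mono add_left_mono power_mono)
  show "(slope s t (s + ta * X))^2 <= (t / (1 + s))^2 + (t / (1 - s))^2" by (auto simp: slope_def power_divide)
  show "c0 <= height s t (s + ta * X)" by (rule c0(2)[OF X])
 qed (use bet c0(1) in "auto intro!: add_nonneg_nonneg mult_nonneg_nonneg")
 define de where "de = min 1 (ep / (9 * (W + 1)))"
 have de: "0 < de" "de <= 1" using ep W0 by (auto simp: de_def)
 have deW: "9 * de * (hat_pot s ta X + pi^2 / ta) <= ep" if X: "X : K" for X
 proof -
  have "9 * de * (hat_pot s ta X + pi^2 / ta) <= 9 * de * (W + 1)" using potW[OF X] de by (intro mult_left_mono) auto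
  also have "... = de * (9 * (W + 1))" by simp
  also have "... <= ep / (9 * (W + 1)) * (9 * (W + 1))" using W0 by (intro mult_right_mono) (auto simp: de_def)
  also have "... = ep" using W0 by simp
  finally show ?thesis .
 qed
 obtain S where S: "test_function {0<..<1} S" "(LBINT y. (S y)^2) = 1" "(LBINT y. (pd S 1 y)^2) <= (1 + de) * pi^2"
   "(LBINT y. y^2 * (pd S 1 y)^2) <= (1 + de) * (pi^2 / 3 + 1 / 2)"
  using fiber_profile[OF de(1)] by blast
 have r: "0 < de / (2 * (1 + de))" "de / (2 * (1 + de)) <= 1 / 2" using de by (auto simp: field_simps)
 obtain H where H: "!!n. C_k n H" "!!x. 0 < H x" and HK: "!!x. c0 <= height s t x ==> (1 - de / (2 * (1 + de))) * height s t x <= H x & H x <= height s t x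
   & (x ~= s --> (pd H 1 x)^2 <= (slope s t x)^2)"
  using smooth_height[OF s t(1) c0(1) r] by blast
 have tv: "test_function hat.I (lincomb k c v)" for c by (rule test_function_lincomb[OF v])
 have V: "hat_pot s ta X <= hat_pot s sg X" if "X : K" for X
  by (rule hat_pot_mono[OF ta_pos sg]) (use that KI in blast)
 note F = trial_form[OF test_function_C_k[OF tv] tv Kc Kz S de H HK[OF c0(2)] gap deW V hat.form_test(2)[OF tv]]
 have F2: "L2_sq T (trial H S (lincomb k c v)) = ta * L2_sq hat.I (lincomb k c v)" for c
  unfolding hat.form_test(1)[OF tv] by (rule F(2))
 have F3: "quad a (trial H S (lincomb k c v)) <= ta * (quad hat.form (lincomb k c v) + ep * L2_sq hat.I (lincomb k c v))" for c
  unfolding hat.form_test(1,3)[OF tv] by (rule F(3))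
 have "kth_eigenvalue T (H10 T) a k <= M + ep"
 proof (rule minmax_le[where v = "%i. trial H S (v i)"])
  show "trial H S (v i) : H10 T" if i: "i < k" for i
  proof -
   \<comment> \<open>The facts about trial functions are stated for combinations; Kronecker
     coefficients recover the single \<open>v i\<close>.\<close>
   have "lincomb k (%j. if j = i then 1 else 0) v = v i" using i by (simp add: fun_eq_iff if_distrib[of "%x. x * _"] sum.delta cong: if_cong)
   then show ?thesis using test_function_H10[OF F(1)[of "%j. if j = i then 1 else 0"] open_triangle] by simp
  qed
  show "ALL i<k. c i = 0" if z: "L2_sq T (lincomb k c (%i. trial H S (v i))) = 0" for c
  proof -
   have "ta * L2_sq hat.I (lincomb k c v) = 0" using z unfolding trial_lincomb[symmetric] F2 .
   then have "L2_sq hat.I (lincomb k c v) = 0" using ta_pos by simp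
   then have "(\<Sum>i<k. (c i)^2) <= 0" using ge[of c] by linarith
   moreover have "(\<Sum>i<k. (c i)^2) >= 0" by (intro sum_nonneg) auto
   ultimately have "(\<Sum>i<k. (c i)^2) = 0" by linarith
   then show ?thesis by (simp add: sum_nonneg_eq_0_iff)
  qed
  fix c
  have "ta * (quad hat.form (lincomb k c v) + ep * L2_sq hat.I (lincomb k c v))
    <= ta * (M * L2_sq hat.I (lincomb k c v) + ep * L2_sq hat.I (lincomb k c v))"
   using ta_pos le[of c] by (intro mult_left_mono add_right_mono) auto
  also have "... = (M + ep) * (ta * L2_sq hat.I (lincomb k c v))" by (simp add: algebra_simps)
  finally show "quad a (lincomb k c (%i. trial H S (v i))) <= (M + ep) * L2_sq T (lincomb k c (%i. trial H S (v i)))"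
   unfolding trial_lincomb[symmetric] F2 using F3[of c] by linarith
 qed (rule k)
 moreover have "mu_hat s t\<^sub>0 k = kth_eigenvalue hat.I hat.fdom hat.form k"
  unfolding sg_def using t by (intro mu_hat_eq[OF s]) auto
 ultimately show "mu s t k <= mu_hat s t\<^sub>0 k + e" unfolding mu_eq M_def ep_def by simp
qed

theorem theorem3p5:
  fixes s t\<^sub>0 t :: real and k :: nat
  assumes "s \<in> {-1<..<1}" and "t\<^sub>0 > 0" and "k \<ge> 1" and "t \<in> {0<..t\<^sub>0}"
  shows "mu_bar s k / (1 + t\<^sub>0 powr (2/3) / (3 * pi\<^sup>2) * mu_bar s k) \<le> mu s t k
       \<and> mu s t k \<le> mu_hat s t\<^sub>0 k"
proof
 have t: "0 < t" "t <= t\<^sub>0" using assms by auto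
 interpret tri_form s t by unfold_locales (use assms t in auto)
 have "t powr (2/3) <= t\<^sub>0 powr (2/3)" by (rule powr_mono2) (use t in auto)
 then have "t powr (2/3) / (3 * pi^2) <= t\<^sub>0 powr (2/3) / (3 * pi^2)" by (intro divide_right_mono) auto
 then show "mu_bar s k / (1 + t\<^sub>0 powr (2/3) / (3 * pi^2) * mu_bar s k) <= mu s t k" by (rule lower_bound[OF assms(3)])
 show "mu s t k <= mu_hat s t\<^sub>0 k" by (rule upper_bound[OF assms(1) t assms(3)])
qed

end
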